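(* Let $\rho\in(0,\infty)$ and let \[U_\rho:=\Big\{R_{\rho+\frac12}g:\ g\in L^2([0,1],dt),\ \int_0^1 g(t)^2\,dt\le\Gamma(\rho+1/2)^2\Big\}\subset L^2([0,1],dt),\] where $R_\beta g(t):=\frac{1}{\Gamma(\beta)}\int_0^t(t-s)^{\beta-1}g(s)\,ds$. Let $X^\rho_t:=\int_0^t(t-s)^{\rho-\frac12}dW_s$, $t\in[0,1]$, be the Riemann-Liouville process driven by a standard Brownian motion $W$, regarded as a random vector in $L^2([0,1],dt)$. Then \[e_n(U_\rho)\sim\Big(\frac{\rho+\frac12}{\pi}\Big)^{\rho+\frac12}\Gamma(\rho+1/2)(\log n)^{-(\rho+\frac12)}\sim\Big(\frac{\rho}{\log n}\Big)^{1/2}e_n(X^\rho)\quad\text{as }n\to\infty.\]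
   Context: Let $H=L^2([0,1],dt)$ with norm $\|\cdot\|$. For a compact set $U\subset H$, the $n$th entropy number is $e_n(U):=\inf\{\max_{x\in U}\min_{a\in\alpha}\|x-a\|:\alpha\subset H,\ \mathrm{card}(\alpha)\le n\}$. For a random vector $X$ in $H$ with ${\mathbb E}\|X\|^2<\infty$, the minimal $n$th $L^2$-quantization error is $e_n(X):=\inf\{({\mathbb E}\min_{a\in\alpha}\|X-a\|^2)^{1/2}:\alpha\subset H,\ \mathrm{card}(\alpha)\le n\}$. The notation $a_n\sim b_n$ means $a_n/b_n\to1$. *)

theory Defs
  imports "HOL-Probability.Probability" "HOL-Library.Landau_Symbols"
begin

text \<open>The Hilbert space H = L2([0,1]) represented by Borel functions on the reals that are
  square integrable on [0,1]; the norm only depends on values on [0,1].\<close>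
definition L2_01 :: "(real \<Rightarrow> real) set" where
  "L2_01 = {f. f \<in> borel_measurable lborel \<and> set_integrable lborel {0..1} (\<lambda>t. (f t)^2)}"

definition L2norm :: "(real \<Rightarrow> real) \<Rightarrow> real" where
  "L2norm f = sqrt (LBINT t:{0..1}. (f t)^2)"

definition RL_op :: "real \<Rightarrow> (real \<Rightarrow> real) \<Rightarrow> real \<Rightarrow> real" where
  "RL_op \<beta> g t = (1 / Gamma \<beta>) * (LBINT s:{0..t}. (t - s) powr (\<beta> - 1) * g s)"

definition U_rho :: "real \<Rightarrow> (real \<Rightarrow> real) set" where
  "U_rho \<rho> = {RL_op (\<rho> + 1/2) g | g. g \<in> L2_01 \<and>
               (LBINT t:{0..1}. (g t)^2) \<le> (Gamma (\<rho> + 1/2))^2}"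

definition codebooks :: "nat \<Rightarrow> (real \<Rightarrow> real) set set" where
  "codebooks n = {\<alpha>. \<alpha> \<subseteq> L2_01 \<and> finite \<alpha> \<and> \<alpha> \<noteq> {} \<and> card \<alpha> \<le> n}"

definition dist_to :: "(real \<Rightarrow> real) set \<Rightarrow> (real \<Rightarrow> real) \<Rightarrow> real" where
  "dist_to \<alpha> x = Min ((\<lambda>a. L2norm (\<lambda>t. x t - a t)) ` \<alpha>)"

definition entropy_number :: "(real \<Rightarrow> real) set \<Rightarrow> nat \<Rightarrow> real" where
  "entropy_number U n = (INF \<alpha>\<in>codebooks n. SUP x\<in>U. dist_to \<alpha> x)"

definition quant_error :: "'a measure \<Rightarrow> ('a \<Rightarrow> real \<Rightarrow> real) \<Rightarrow> nat \<Rightarrow> real" where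
  "quant_error M X n = (INF \<alpha>\<in>codebooks n. sqrt (LINT \<omega>|M. (dist_to \<alpha> (X \<omega>))^2))"

definition std_BM :: "'a measure \<Rightarrow> (real \<Rightarrow> 'a \<Rightarrow> real) \<Rightarrow> bool" where
  "std_BM M W \<longleftrightarrow> prob_space M \<and>
     (\<forall>t\<in>{0..1}. W t \<in> borel_measurable M) \<and>
     (\<forall>\<omega>\<in>space M. W 0 \<omega> = 0 \<and> continuous_on {0..1} (\<lambda>t. W t \<omega>)) \<and>
     (\<forall>s t. 0 \<le> s \<and> s < t \<and> t \<le> 1 \<longrightarrow>
        distributed M lborel (\<lambda>\<omega>. W t \<omega> - W s \<omega>) (normal_density 0 (sqrt (t - s)))) \<and>
     (\<forall>ts::real list. sorted_wrt (<) ts \<and> set ts \<subseteq> {0..1} \<longrightarrow>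
        prob_space.indep_vars M (\<lambda>_. borel) (\<lambda>i \<omega>. W (ts ! Suc i) \<omega> - W (ts ! i) \<omega>)
          {i. Suc i < length ts})"

definition is_partition :: "(nat \<Rightarrow> real) \<Rightarrow> nat \<Rightarrow> real \<Rightarrow> bool" where
  "is_partition p m t \<longleftrightarrow> p 0 = 0 \<and> p m = t \<and> (\<forall>j<m. p j < p (Suc j))"

definition step_fun :: "(nat \<Rightarrow> real) \<Rightarrow> (nat \<Rightarrow> real) \<Rightarrow> nat \<Rightarrow> real \<Rightarrow> real" where
  "step_fun p c m s = (\<Sum>j<m. c j * indicator {p j..<p (Suc j)} s)"

definition step_int :: "(real \<Rightarrow> 'a \<Rightarrow> real) \<Rightarrow> (nat \<Rightarrow> real) \<Rightarrow> (nat \<Rightarrow> real) \<Rightarrow> nat \<Rightarrow> 'a \<Rightarrow> real" where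
  "step_int W p c m \<omega> = (\<Sum>j<m. c j * (W (p (Suc j)) \<omega> - W (p j) \<omega>))"

text \<open>Y is (a version of) the Wiener integral of the deterministic f over [0,t] w.r.t. W:
  the L2(P)-limit of the integrals of step functions converging to f in L2([0,t]).\<close>
definition wiener_integral ::
  "'a measure \<Rightarrow> (real \<Rightarrow> 'a \<Rightarrow> real) \<Rightarrow> (real \<Rightarrow> real) \<Rightarrow> real \<Rightarrow> ('a \<Rightarrow> real) \<Rightarrow> bool" where
  "wiener_integral M W f t Y \<longleftrightarrow> Y \<in> borel_measurable M \<and>
     (\<exists>p c m. (\<forall>k. is_partition (p k) (m k) t) \<and>
        ((\<lambda>k. \<integral>\<^sup>+ s\<in>{0..t}. ennreal ((step_fun (p k) (c k) (m k) s - f s)^2) \<partial>lborel)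
            \<longlonglongrightarrow> 0) \<and>
        ((\<lambda>k. \<integral>\<^sup>+ \<omega>. ennreal ((Y \<omega> - step_int W (p k) (c k) (m k) \<omega>)^2) \<partial>M)
            \<longlonglongrightarrow> 0))"

definition RL_process :: "real \<Rightarrow> 'a measure \<Rightarrow> (real \<Rightarrow> 'a \<Rightarrow> real) \<Rightarrow> ('a \<Rightarrow> real \<Rightarrow> real) \<Rightarrow> bool" where
  "RL_process \<rho> M W X \<longleftrightarrow> (\<lambda>(\<omega>, t). X \<omega> t) \<in> borel_measurable (M \<Otimes>\<^sub>M lborel) \<and>
     (\<forall>t\<in>{0..1}. wiener_integral M W (\<lambda>s. (t - s) powr (\<rho> - 1/2)) t (\<lambda>\<omega>. X \<omega> t))"

end

theory Submission
 imports Defs "HOL-Real_Asymp.Real_Asymp"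
begin

text \<open>
 Put \<open>\<beta> = \<rho> + 1/2\<close>. Damping the kernel \<open>(t - s)\<^sup>\<beta>\<^sup>-\<^sup>1\<close> slightly and periodizing it gives a convolution kernel that is
 diagonal in the trigonometric system with coefficients asymptotic to \<open>\<Gamma>(\<beta>) (\<pi> j) powr (- \<beta>)\<close>. The periodization
 differs from the kernel by a function of \<open>1 + t - s\<close> that is singular only at a corner of the square, and
 dyadic binomial expansions approximate it up to an error \<open>2\<^sup>-\<^sup>n\<close> by a kernel of rank \<open>O(n\<^sup>2)\<close>. Such a low-rank part
 costs only polylogarithmically many bits, so both problems reduce to an explicit diagonal operator.

 Upper bounds: blocks of coordinates are coded by random Gaussian code words covering spheres, with relative
 accuracy \<open>(k/B) powr \<beta>\<close> in block k. Lower bounds: by Jensen's inequality and an exact Gaussian integral, a finite codebook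
 cannot be close to a Gaussian vector; restricted to the shell where the Gaussian norm concentrates, the same
 integral bounds the entropy numbers.
\<close>


section \<open>Square-integrable functions\<close>

text \<open>The constants come from a diagonal model. Let the modes be about
  \<open>c*j powr (- \<beta>)\<close> with \<open>c = Gamma \<beta>/pi powr \<beta>\<close>.
  Bringing the first D of them down to the level \<open>E = c*D powr (- \<beta>)\<close> costs the
  sum of \<open>ln (\<mu> j/E)\<close>, about \<beta> D. Hence D is about ln n / \<beta>, and the
  worst-case error is E. For the process, the D coded modes contribute D E^2 and the others their
  full variances, together \<open>c^2*D powr (1 - 2*\<beta>)*(1 + 1/(2*\<beta> - 1))\<close>; the
  last factor is \<beta>/\<rho>. The obstacle is that the Volterra kernel is not a function of t - s
  on the circle, so it is not diagonal in any explicit basis. The plain sum of its shifts diverges,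
  hence the damping. The function that periodization adds has to be removed with an error below
  every power of D, yet by a kernel whose coefficients cost only o(D) to code. Of the Fourier
  coefficients only the moduli are computed: the arguments merely rotate each cosine-sine pair, so
  the t-modes and the s-modes are two different orthonormal systems.\<close>

definition sqi :: "'a measure => ('a => real) set" where
 "sqi M = {f. f : borel_measurable M & integrable M (%x. (f x)^2)}"

definition nm :: "'a measure => ('a => real) => real" where
 "nm M f = sqrt (LINT x|M. (f x)^2)"

definition ip :: "'a measure => ('a => real) => ('a => real) => real" where
 "ip M f g = (LINT x|M. f x*g x)"

text \<open>\<open>L2norm\<close> sees a function of a real variable only on [0,1]. Restricting the
  measure turns it into the norm \<open>nm\<close> of a probability space, where bounded measurable
  functions are square integrable.\<close>

definition I01 :: "real measure" where "I01 = restrict_space lborel {0..1}"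

lemma sqiI: "f : borel_measurable M ==> integrable M (%x. (f x)^2) ==> f : sqi M"
 by (simp add: sqi_def)

lemma sqi_measurable: "f : sqi M ==> f : borel_measurable M"
 by (simp add: sqi_def)

lemma sqi_integrable: "f : sqi M ==> integrable M (%x. (f x)^2)"
 by (simp add: sqi_def)

lemma sqi_mult_integrable:
 assumes "f : sqi M" "g : sqi M" shows "integrable M (%x. f x*g x)"
proof (rule Bochner_Integration.integrable_bound)
 show "integrable M (%x. (f x)^2 + (g x)^2)"
  using assms by (auto simp: sqi_def)
 show "(%x. f x*g x) : borel_measurable M"
  using assms by (auto simp: sqi_def)
 show "AE x in M. norm (f x*g x) <= norm ((f x)^2 + (g x)^2)"
 proof (rule AE_I2)
  fix x
  have "0 <= (\<bar>f x\<bar> - \<bar>g x\<bar>)^2" "0 <= \<bar>f x*g x\<bar>" by auto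
  moreover have "(\<bar>f x\<bar> - \<bar>g x\<bar>)^2 = (f x)^2 + (g x)^2 - 2*\<bar>f x*g x\<bar>"
   by (simp add: power2_diff abs_mult)
  ultimately show "norm (f x*g x) <= norm ((f x)^2 + (g x)^2)"
   unfolding real_norm_def by linarith
 qed
qed

lemma sqi_cmult: "f : sqi M ==> (%x. c * f x) : sqi M"
 by (auto simp: sqi_def power_mult_distrib)

lemma sqi_add:
 assumes "f : sqi M" "g : sqi M" shows "(%x. f x + g x) : sqi M"
proof -
 have "integrable M (%x. (f x)^2 + (g x)^2 + 2*(f x*g x))"
  using assms sqi_mult_integrable[OF assms] by (auto simp: sqi_def)
 then show ?thesis using assms by (auto simp: sqi_def power2_sum mult.assoc)
qed

lemma sqi_uminus: "f : sqi M ==> (%x. - f x) : sqi M"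
 by (auto simp: sqi_def)

lemma sqi_diff: "f : sqi M ==> g : sqi M ==> (%x. f x - g x) : sqi M"
 using sqi_add[OF _ sqi_uminus, of f M g] by simp

lemma sqi_zero: "(%x. 0) : sqi M"
 by (simp add: sqi_def)

lemma sqi_sum: "(\<And>i. i : I ==> f i : sqi M) ==> (%x. \<Sum>i\<in>I. f i x) : sqi M"
 by (induction I rule: infinite_finite_induct) (auto simp: sqi_zero sqi_add)

lemma sqi_bounded:
 assumes "finite_measure M" "f : borel_measurable M" "\<And>x. x : space M ==> \<bar>f x\<bar> <= C"
 shows "f : sqi M"
proof (rule sqiI)
 interpret finite_measure M by fact
 have "\<And>x. x : space M ==> (f x)^2 <= C^2"
  using assms(3) by (metis abs_ge_zero power2_abs power_mono)
 then show "integrable M (%x. (f x)^2)"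
  using assms(2) by (intro integrable_const_bound[of _ "C^2"]) auto
qed fact

lemma nm_nonneg: "0 <= nm M f"
 by (simp add: nm_def)

lemma nm_sq: "(nm M f)^2 = (LINT x|M. (f x)^2)"
 by (simp add: nm_def)

lemma nm_uminus: "nm M (%x. - f x) = nm M f"
 by (simp add: nm_def)

lemma nm_cmult: "nm M (%x. c * f x) = \<bar>c\<bar>*nm M f"
 by (simp add: nm_def power_mult_distrib real_sqrt_mult)

lemma ip_le:
 assumes f: "f : sqi M" and g: "g : sqi M" shows "\<bar>ip M f g\<bar> <= nm M f*nm M g"
proof -
 define A B C where "A = (LINT x|M. (f x)^2)" and "B = ip M f g" and "C = (LINT x|M. (g x)^2)"
 have quad: "0 <= s^2*A + 2 * s*t*B + t^2*C" for s t
 proof -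
  have "0 <= (LINT x|M. (s * f x + t*g x)^2)" by simp
  also have "... = (LINT x|M. s^2*(f x)^2 + 2 * s*t*(f x*g x) + t^2*(g x)^2)"
   by (rule Bochner_Integration.integral_cong) (auto simp: power2_eq_square algebra_simps)
  also have "... = s^2*A + 2 * s*t*B + t^2*C"
   using sqi_integrable[OF f] sqi_integrable[OF g] sqi_mult_integrable[OF f g]
   by (simp add: A_def B_def C_def ip_def)
  finally show ?thesis .
 qed
 have "0 <= A" "0 <= C" by (auto simp: A_def C_def)
 have "B^2 <= A*C"
 proof (cases "C = 0")
  case True
  have "0 <= A - 2*n*B^2" for n
   using quad[of 1 "- n*B"] True by (simp add: power2_eq_square algebra_simps)
  \<comment> \<open>With C = 0 the form is affine in \<open>n\<close>; if B were nonzero, its value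
    at this \<open>n\<close> would be -1.\<close>
  from this[of "(A + 1)/(2*B^2)"] have "B = 0"
   by (cases "B = 0") (auto simp: field_simps)
  then show ?thesis using True by simp
 next
  case False
  then have "C > 0" using \<open>0 \<le> C\<close> by simp
  have "0 <= C*(A*C - B^2)"
   using quad[of C "- B"] by (simp add: power2_eq_square algebra_simps)
  then show ?thesis using \<open>C > 0\<close> by (simp add: zero_le_mult_iff)
 qed
 then have "sqrt (B^2) <= sqrt (A*C)" by (rule real_sqrt_le_mono)
 then show ?thesis by (simp add: A_def B_def C_def nm_def real_sqrt_mult)
qed

lemma nm_triangle:
 assumes f: "f : sqi M" and g: "g : sqi M" shows "nm M (%x. f x + g x) <= nm M f + nm M g"
proof -
 have "(nm M (%x. f x + g x))^2 = (LINT x|M. (f x)^2 + 2*(f x*g x) + (g x)^2)"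
  unfolding nm_sq by (rule Bochner_Integration.integral_cong) (auto simp: power2_eq_square algebra_simps)
 also have "... = (nm M f)^2 + 2*ip M f g + (nm M g)^2"
  using sqi_integrable[OF f] sqi_integrable[OF g] sqi_mult_integrable[OF f g]
  by (simp add: nm_sq ip_def)
 also have "... <= (nm M f)^2 + 2*(nm M f*nm M g) + (nm M g)^2"
  using ip_le[OF f g] by auto
 also have "... = (nm M f + nm M g)^2" by (simp add: power2_eq_square algebra_simps)
 finally show ?thesis by (rule power2_le_imp_le) (simp add: nm_nonneg)
qed

lemma nm_triangle_diff:
 assumes f: "f : sqi M" and g: "g : sqi M" shows "nm M (%x. f x - g x) <= nm M f + nm M g"
 using nm_triangle[OF f sqi_uminus[OF g]] by (simp add: nm_uminus)

lemma nm_sum_le: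
 "finite I ==> (\<And>i. i : I ==> f i : sqi M) ==> nm M (%x. \<Sum>i\<in>I. f i x) <= (\<Sum>i\<in>I. nm M (f i))"
proof (induction I rule: finite_induct)
 case empty show ?case by (simp add: nm_def)
next
 case (insert i I)
 then have "nm M (%x. f i x + (\<Sum>i\<in>I. f i x)) <= nm M (f i) + nm M (%x. \<Sum>i\<in>I. f i x)"
  by (intro nm_triangle sqi_sum) auto
 then show ?case using insert by (auto intro: order_trans)
qed

lemma nm_mono:
 assumes "g : sqi M" "AE x in M. \<bar>f x\<bar> <= g x"
 shows "nm M f <= nm M g"
proof -
 have "(LINT x|M. (f x)^2) <= (LINT x|M. (g x)^2)"
 proof (cases "integrable M (%x. (f x)^2)")
  case True
  show ?thesis
  proof (rule integral_mono_AE[OF True sqi_integrable[OF assms(1)]])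
   show "AE x in M. (f x)^2 <= (g x)^2"
    using assms(2) by eventually_elim (metis abs_ge_zero power2_abs power_mono)
  qed
 next
  \<comment> \<open>A square that is not integrable has Bochner integral 0, so the bound survives
    this default value.\<close>
  case False
  then show ?thesis by (simp add: not_integrable_integral_eq)
 qed
 then show ?thesis by (simp add: nm_def)
qed

lemma nm_cong_AE:
 assumes "f : borel_measurable M" "g : borel_measurable M" "AE x in M. f x = g x"
 shows "nm M f = nm M g"
 unfolding nm_def by (intro arg_cong[where f = sqrt] integral_cong_AE) (use assms in auto)

lemma sqi_bound:
 assumes "g : sqi M" "f : borel_measurable M" "AE x in M. \<bar>f x\<bar> <= g x"
 shows "f : sqi M"
proof (rule sqiI)
 show "integrable M (%x. (f x)^2)"
 proof (rule Bochner_Integration.integrable_bound[OF sqi_integrable[OF assms(1)]])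
  show "AE x in M. norm ((f x)^2) <= norm ((g x)^2)"
   using assms(3) by eventually_elim (simp, metis abs_ge_zero power2_abs power_mono)
 qed (use assms(2) in measurable)
qed fact

section \<open>Orthonormal systems and orthogonal projection\<close>

definition orthonormal :: "'a measure => nat set => (nat => 'a => real) => bool" where
 "orthonormal M J e \<longleftrightarrow> (\<forall>j\<in>J. e j : sqi M) &
   (\<forall>i\<in>J. \<forall>j\<in>J. ip M (e i) (e j) = (if i = j then 1 else 0))"

lemma ip_sum_left:
 assumes "\<And>j. j : J ==> e j : sqi M" "g : sqi M"
 shows "ip M (%x. \<Sum>j\<in>J. a j*e j x) g = (\<Sum>j\<in>J. a j*ip M (e j) g)"
proof -
 have "ip M (%x. \<Sum>j\<in>J. a j*e j x) g = (LINT x|M. (\<Sum>j\<in>J. a j*(e j x*g x)))"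
  by (simp add: ip_def sum_distrib_right mult.assoc)
 also have "... = (\<Sum>j\<in>J. (LINT x|M. a j*(e j x*g x)))"
  by (intro Bochner_Integration.integral_sum integrable_mult_right sqi_mult_integrable assms)
 finally show ?thesis by (simp add: ip_def)
qed

lemma ip_commute: "ip M f g = ip M g f"
 by (simp add: ip_def mult.commute)

lemma ip_self: "ip M f f = (nm M f)^2"
 unfolding nm_sq by (simp add: ip_def power2_eq_square)

lemma nm_orthonormal_sum:
 assumes "orthonormal M J e" "finite J"
 shows "(nm M (%x. \<Sum>j\<in>J. a j*e j x))^2 = (\<Sum>j\<in>J. (a j)^2)"
proof -
 have s: "\<And>j. j : J ==> e j : sqi M" using assms(1) by (auto simp: orthonormal_def)
 have S: "(%x. \<Sum>j\<in>J. a j*e j x) : sqi M" by (intro sqi_sum sqi_cmult s)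
 have "(nm M (%x. \<Sum>j\<in>J. a j*e j x))^2 = (\<Sum>j\<in>J. a j*ip M (e j) (%x. \<Sum>j\<in>J. a j*e j x))"
  using ip_sum_left[OF s S] by (simp add: ip_self[symmetric])
 also have "... = (\<Sum>j\<in>J. a j*(\<Sum>i\<in>J. a i*ip M (e i) (e j)))"
  using s by (simp add: ip_commute[of _ "e _" "%x. \<Sum>j\<in>J. a j*e j x"] ip_sum_left)
 also have "... = (\<Sum>j\<in>J. a j*(\<Sum>i\<in>J. a i*(if i = j then 1 else 0)))"
  using assms(1) by (intro sum.cong refl arg_cong2[where f = "(*)"]) (auto simp: orthonormal_def)
 also have "... = (\<Sum>j\<in>J. (a j)^2)"
  using assms(2) by (intro sum.cong refl) (simp add: power2_eq_square if_distrib[of "%x. _*x"] sum.delta cong: if_cong)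
 finally show ?thesis .
qed

lemma nm_diff_sq:
 assumes f: "f : sqi M" and g: "g : sqi M"
 shows "(nm M (%x. f x - g x))^2 = (nm M f)^2 - 2*ip M f g + (nm M g)^2"
proof -
 have "(nm M (%x. f x - g x))^2 = (LINT x|M. (f x)^2 - 2*(f x*g x) + (g x)^2)"
  unfolding nm_sq by (rule Bochner_Integration.integral_cong) (auto simp: power2_eq_square algebra_simps)
 also have "... = (nm M f)^2 - 2*ip M f g + (nm M g)^2"
  using sqi_integrable[OF f] sqi_integrable[OF g] sqi_mult_integrable[OF f g]
  by (simp add: nm_sq ip_def)
 finally show ?thesis .
qed

text \<open>Pythagoras for arbitrary coefficients \<open>a\<close>. With the inner products as
  coefficients the last sum vanishes, and nonnegativity of the left side is Bessel's inequality;
  comparison with any other choice of \<open>a\<close> is best approximation.\<close>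

lemma nm_diff_orthonormal_sum:
 assumes o: "orthonormal M J e" "finite J" and f: "f : sqi M"
 shows "(nm M (%x. f x - (\<Sum>j\<in>J. a j*e j x)))^2 =
  (nm M f)\<^sup>2 - (\<Sum>j\<in>J. (ip M f (e j))^2) + (\<Sum>j\<in>J. (a j - ip M f (e j))^2)"
proof -
 have s: "\<And>j. j : J ==> e j : sqi M" using o(1) by (auto simp: orthonormal_def)
 have S: "(%x. \<Sum>j\<in>J. a j*e j x) : sqi M" by (intro sqi_sum sqi_cmult s)
 have "ip M f (%x. \<Sum>j\<in>J. a j*e j x) = (\<Sum>j\<in>J. a j*ip M f (e j))"
  using ip_sum_left[OF s f] by (simp add: ip_commute[of M f])
 then show ?thesis
  unfolding nm_diff_sq[OF f S] nm_orthonormal_sum[OF o]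
  by (simp add: power2_eq_square algebra_simps sum.distrib sum_subtractf sum_distrib_left)
qed

lemma Bessel:
 assumes o: "orthonormal M J e" "finite J" and f: "f : sqi M"
 shows "(\<Sum>j\<in>J. (ip M f (e j))^2) <= (nm M f)^2"
proof -
 have "0 <= (nm M (%x. f x - (\<Sum>j\<in>J. ip M f (e j)*e j x)))^2" by simp
 then show ?thesis unfolding nm_diff_orthonormal_sum[OF assms] by simp
qed

lemma best_approximation:
 assumes o: "orthonormal M J e" "finite J" and f: "f : sqi M"
 shows "nm M (%x. f x - (\<Sum>j\<in>J. ip M f (e j)*e j x)) <= nm M (%x. f x - (\<Sum>j\<in>J. a j*e j x))"
proof -
 have "(nm M (%x. f x - (\<Sum>j\<in>J. ip M f (e j)*e j x)))^2 <= (nm M (%x. f x - (\<Sum>j\<in>J. a j*e j x)))^2"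
  unfolding nm_diff_orthonormal_sum[OF assms] by (simp add: sum_nonneg)
 then show ?thesis by (rule power2_le_imp_le) (simp add: nm_nonneg)
qed

section \<open>The Hilbert space of the theorem as L2 of the uniform law on [0,1]\<close>

lemma L2norm_eq_nm: "L2norm f = nm I01 f"
 by (simp add: L2norm_def nm_def I01_def integral_restrict_space set_lebesgue_integral_def)

lemma L2_01_iff: "f : L2_01 \<longleftrightarrow> f : borel_measurable borel & f : sqi I01"
 by (auto simp: L2_01_def sqi_def I01_def integrable_restrict_space set_integrable_def
   intro: measurable_restrict_space1)

lemma space_I01: "space I01 = {0..1}" by (simp add: I01_def space_restrict_space)

lemma borel_measurable_I01: "f : borel_measurable borel ==> f : borel_measurable I01"
 by (simp add: I01_def measurable_restrict_space1)

lemma prob_space_I01: "prob_space I01"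
 by (rule prob_spaceI) (simp add: I01_def emeasure_restrict_space space_restrict_space)

interpretation I01: prob_space I01 by (rule prob_space_I01)

lemma nm_const: "prob_space M ==> nm M (%x. c) = \<bar>c\<bar>"
 by (simp add: nm_def prob_space.prob_space)

section \<open>Random coding of spheres\<close>

text \<open>Two product laws can then be compared pointwise, through their densities against one and
  the same product of \<open>N\<close>.\<close>

lemma PiM_density:
 fixes f :: "'i => 'a => ennreal"
 assumes I: "finite I" and f: "\<And>i. f i : borel_measurable N"
  and N: "sigma_finite_measure N" and D: "\<And>i. sigma_finite_measure (density N (f i))"
 shows "PiM I (%i. density N (f i)) = density (PiM I (%_. N)) (%x. \<Prod>i\<in>I. f i (x i))"
proof -
 interpret N: product_sigma_finite "%_. N" by (intro product_sigma_finite.intro N)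
 interpret D: product_sigma_finite "%i. density N (f i)" by (intro product_sigma_finite.intro D)
 note f[measurable]
 have "density (PiM I (%_. N)) (%x. \<Prod>i\<in>I. f i (x i)) = PiM I (%i. density N (f i))"
 proof (rule D.PiM_eqI[OF I])
  show "sets (density (PiM I (%_. N)) (%x. \<Prod>i\<in>I. f i (x i))) = sets (PiM I (%i. density N (f i)))"
   by (simp, intro sets_PiM_cong) auto
  fix A assume A: "\<And>i. i : I ==> A i : sets (density N (f i))"
  then have A': "\<And>i. i : I ==> A i : sets N" by simp
  have [measurable]: "Pi\<^sub>E I A : sets (PiM I (%_. N))" by (intro sets_PiM_I_finite I A')
  have "emeasure (density (PiM I (%_. N)) (%x. \<Prod>i\<in>I. f i (x i))) (Pi\<^sub>E I A) =
   (\<integral>\<^sup>+ x. (\<Prod>i\<in>I. f i (x i))*indicator (Pi\<^sub>E I A) x \<partial>PiM I (%_. N))"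
   by (rule emeasure_density) measurable
  also have "... = (\<integral>\<^sup>+ x. (\<Prod>i\<in>I. f i (x i)*indicator (A i) (x i)) \<partial>PiM I (%_. N))"
  proof (rule nn_integral_cong)
   fix x assume "x : space (PiM I (%_. N))"
   \<comment> \<open>Membership in the box also fixes the value of \<open>x\<close> outside
     \<open>I\<close>. Every point of the product space has that value, so the indicator
     factorizes.\<close>
   then have "x : extensional I" by (auto simp: space_PiM PiE_def)
   then have "indicator (Pi\<^sub>E I A) x = (\<Prod>i\<in>I. indicator (A i) (x i) :: ennreal)"
    using I by (auto simp: indicator_def PiE_iff)
   then show "(\<Prod>i\<in>I. f i (x i))*indicator (Pi\<^sub>E I A) x = (\<Prod>i\<in>I. f i (x i)*indicator (A i) (x i))"
    by (simp add: prod.distrib)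
  qed
  also have "... = (\<Prod>i\<in>I. \<integral>\<^sup>+ x. f i x*indicator (A i) x \<partial>N)"
   by (rule N.product_nn_integral_prod[OF I]) (use A' in measurable)
  also have "... = (\<Prod>i\<in>I. emeasure (density N (f i)) (A i))"
   by (intro prod.cong refl) (simp add: emeasure_density A')
  finally show "emeasure (density (PiM I (%_. N)) (%x. \<Prod>i\<in>I. f i (x i))) (Pi\<^sub>E I A) =
   (\<Prod>i\<in>I. emeasure (density N (f i)) (A i))" .
 qed
 then show ?thesis by simp
qed

text \<open>Independence in the form of a product measure: mixed terms factorize and vanish with the
  means, so variances add. Integrands that depend on one or two coordinates are padded with factors
  1 to fit the product formula for integrals.\<close>

lemma PiM_second_moment_sum:
 fixes f :: "nat => 'a => real"
 assumes I: "finite I" and N: "\<And>i. prob_space (N i)"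
  and f: "\<And>i. i : I ==> f i : sqi (N i)" and mean: "\<And>i. i : I ==> (\<integral>y. f i y \<partial>N i) = 0"
 shows "(%x. \<Sum>i\<in>I. f i (x i)) : sqi (PiM I N)"
  and "(\<integral>x. (\<Sum>i\<in>I. f i (x i))^2 \<partial>PiM I N) = (\<Sum>i\<in>I. \<integral>y. (f i y)^2 \<partial>N i)"
proof -
 interpret prob_space "N i" for i by fact
 interpret product_sigma_finite N
  by (intro product_sigma_finite.intro) unfold_locales
 have int: "integrable (N i) (f i)" if "i : I" for i
  by (rule finite_measure.square_integrable_imp_integrable[OF prob_space.axioms(1)[OF N]
    sqi_measurable[OF f[OF that]] sqi_integrable[OF f[OF that]]])
 have F: "(%x. f i (x i)) : sqi (PiM I N)" and F2: "(\<integral>x. (f i (x i))^2 \<partial>PiM I N) = (\<integral>y. (f i y)^2 \<partial>N i)"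
  if i: "i : I" for i
 proof -
  let ?g = "%k y. if k = i then (f i y)\<^sup>2 else 1"
  have eq: "(\<Prod>k\<in>I. ?g k (x k)) = (f i (x i))^2" for x
   using I i by (subst prod.remove[OF I i]) auto
  have g: "\<And>k. k : I ==> integrable (N k) (?g k)"
   using f by (case_tac "k = i") (auto simp: sqi_def)
  have "(%x. f i (x i)) : borel_measurable (PiM I N)"
   by (rule measurable_compose[OF _ sqi_measurable[OF f[OF i]]]) (rule measurable_component_singleton[OF i])
  then show "(%x. f i (x i)) : sqi (PiM I N)"
   using product_integrable_prod[OF I g] unfolding eq by (rule sqiI)
  have "(\<integral>x. (f i (x i))^2 \<partial>PiM I N) = (\<Prod>k\<in>I. integral\<^sup>L (N k) (?g k))"
   using product_integral_prod[OF I g] unfolding eq .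
  also have "... = (\<integral>y. (f i y)^2 \<partial>N i)"
   by (subst prod.remove[OF I i]) (auto simp: prob_space intro!: prod.neutral)
  finally show "(\<integral>x. (f i (x i))^2 \<partial>PiM I N) = (\<integral>y. (f i y)^2 \<partial>N i)" .
 qed
 have cross: "(\<integral>x. f i (x i) * f j (x j) \<partial>PiM I N) = 0" if i: "i : I" and j: "j : I" and ij: "i ~= j" for i j
 proof -
  let ?g = "%k y. if k = i then f i y else if k = j then f j y else 1"
  have eq: "(\<Prod>k\<in>I. ?g k (x k)) = f i (x i) * f j (x j)" for x
   using I i j ij by (subst prod.remove[OF I i], subst prod.remove[of _ j]) auto
  have g: "\<And>k. k : I ==> integrable (N k) (?g k)"
   using int by (case_tac "k = i"; case_tac "k = j") auto
  have "(\<integral>x. f i (x i) * f j (x j) \<partial>PiM I N) = (\<Prod>k\<in>I. integral\<^sup>L (N k) (?g k))"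
   using product_integral_prod[OF I g] unfolding eq .
  also have "... = 0"
   using mean[OF i] i I by (auto intro!: bexI[of _ i])
  finally show ?thesis .
 qed
 show "(%x. \<Sum>i\<in>I. f i (x i)) : sqi (PiM I N)" by (rule sqi_sum) (rule F)
 have "(\<integral>x. (\<Sum>i\<in>I. f i (x i))^2 \<partial>PiM I N) = (\<integral>x. (\<Sum>i\<in>I. \<Sum>j\<in>I. f i (x i) * f j (x j)) \<partial>PiM I N)"
  by (simp add: power2_eq_square sum_product)
 also have "... = (\<Sum>i\<in>I. \<Sum>j\<in>I. \<integral>x. f i (x i) * f j (x j) \<partial>PiM I N)"
  by (subst Bochner_Integration.integral_sum, (intro Bochner_Integration.integrable_sum sqi_mult_integrable F; assumption),
    intro sum.cong refl Bochner_Integration.integral_sum sqi_mult_integrable F)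
 also have "... = (\<Sum>i\<in>I. \<Sum>j\<in>I. if i = j then (\<integral>y. (f i y)^2 \<partial>N i) else 0)"
  using F2 by (intro sum.cong refl) (auto simp: cross power2_eq_square)
 also have "... = (\<Sum>i\<in>I. \<integral>y. (f i y)^2 \<partial>N i)"
  using I by (simp add: sum.delta)
 finally show "(\<integral>x. (\<Sum>i\<in>I. f i (x i))^2 \<partial>PiM I N) = (\<Sum>i\<in>I. \<integral>y. (f i y)^2 \<partial>N i)" .
qed

lemma normal_integrable_power:
 "0 < s ==> integrable (density lborel (normal_density m s)) (%x. (x - m)^k)"
 by (simp add: integrable_density normal_density_nonneg integrable_normal_moment)

lemma normal_integral_power_even:
 "0 < s ==> (\<integral>x. (x - m)^(2*k) \<partial>density lborel (normal_density m s)) = fact (2*k)/((2/s^2)^k * fact k)"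
 by (simp add: integral_density normal_density_nonneg integral_normal_moment_even)

lemma normal_integral_centered:
 "0 < s ==> (\<integral>x. (x - m) \<partial>density lborel (normal_density m s)) = 0"
 using integral_normal_moment_odd[of s m 0] by (simp add: integral_density normal_density_nonneg)

lemma normal_integral_square:
 "0 < s ==> (\<integral>x. (x - m)^2 \<partial>density lborel (normal_density m s)) = s^2"
 using normal_integral_power_even[of s m 1] by simp

lemma normal_integral_fourth:
 "0 < s ==> (\<integral>x. (x - m)^4 \<partial>density lborel (normal_density m s)) = 3 * s^4"
 using normal_integral_power_even[of s m 2] by (simp add: fact_numeral field_simps)

text \<open>Chebyshev's inequality for two centred sums. The squared distance to \<open>m\<close>
  has variance \<open>2*n*s^4\<close>, the projection to the unit vector \<open>x\<close> has
  variance \<open>s^2\<close>; these give the two subtracted terms.\<close>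

lemma gaussian_concentration:
 fixes m x :: "nat => real" and s \<delta> \<epsilon> :: real
 assumes s: "s > 0" and \<delta>: "\<delta> > 0" and \<eta>: "\<eta> > 0" and n: "n > 0" and x: "(\<Sum>i<n. (x i)^2) = 1"
 defines "P \<equiv> PiM {..<n} (%i. density lborel (normal_density (m i) s))"
 shows "measure P {a : space P. \<bar>(\<Sum>i<n. (a i - m i)^2) - n * s^2\<bar> < \<delta>*n * s^2 & \<bar>\<Sum>i<n. x i*(a i - m i)\<bar> < \<eta>}
   >= 1 - 2/(n*\<delta>^2) - s^2/\<eta>^2"
proof -
 let ?N = "%i. density lborel (normal_density (m i) s)"
 have N: "prob_space (?N i)" for i using s by (rule prob_space_normal_density)
 interpret P: prob_space P unfolding P_def by (intro prob_space_PiM N)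
 interpret N: prob_space "?N i" for i by (rule N)
 have N1: "measure (?N i) UNIV = 1" for i using N.prob_space[of i] by simp
 let ?f = "%i y. (y - m i)^2 - s^2" and ?g = "%i y. x i*(y - m i)"
 have i2: "integrable (?N i) (%y. (y - m i)^k)" for i k by (rule normal_integrable_power[OF s])
 have fsq: "(?f i y)^2 = (y - m i)^4 - 2 * s^2*(y - m i)^2 + s^4" for i y
  by (simp add: power2_eq_square power4_eq_xxxx algebra_simps)
 have f: "?f i : sqi (?N i)" for i
  using i2 by (intro sqiI, measurable) (simp only: fsq, auto)
 have f0: "(\<integral>y. ?f i y \<partial>?N i) = 0" for i
  using i2 s by (simp add: normal_integral_square N1)
 have f2: "(\<integral>y. (?f i y)^2 \<partial>?N i) = 2 * s^4" for i
  unfolding fsq using i2 s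
  by (simp add: normal_integral_square normal_integral_fourth N1)
 have "(%y. y - m i) : sqi (?N i)" for i
  using i2[of i 2] by (rule sqiI[rotated]) measurable
 then have g: "?g i : sqi (?N i)" for i by (rule sqi_cmult)
 have g0: "(\<integral>y. ?g i y \<partial>?N i) = 0" for i
  using s by (simp add: normal_integral_centered)
 have g2: "(\<integral>y. (?g i y)^2 \<partial>?N i) = (x i)^2 * s^2" for i
  using s by (simp add: power_mult_distrib normal_integral_square)
 let ?F = "%a. \<Sum>i<n. ?f i (a i)" and ?G = "%a. \<Sum>i<n. ?g i (a i)"
 have F: "?F : sqi P" "(LINT a|P. (?F a)^2) = n*(2 * s^4)"
  using PiM_second_moment_sum[of "{..<n}" ?N ?f, OF finite_lessThan N f f0] unfolding P_def f2 by (blast, simp)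
 have G: "?G : sqi P" "(LINT a|P. (?G a)^2) = s^2"
  using PiM_second_moment_sum[of "{..<n}" ?N ?g, OF finite_lessThan N g g0] x
  unfolding P_def g2 by (blast, simp add: sum_distrib_right[symmetric])
 have [measurable]: "?F : borel_measurable P" "?G : borel_measurable P"
  using F G by (auto simp: sqi_def)
 have pos: "\<delta>*n * s^2 > 0" using s \<delta> n by simp
 have A: "measure P {a : space P. \<bar>?F a\<bar> >= \<delta>*n * s^2} <= n*(2 * s^4)/(\<delta>*n * s^2)^2"
  using P.second_moment_method[of ?F, OF _ sqi_integrable[OF F(1)] pos] F(2) by simp
 have "n*(2 * s^4)/(\<delta>*n * s^2)^2 = 2/(n*\<delta>^2)"
  using s n by (simp add: field_simps power2_eq_square power4_eq_xxxx)
 note A = A[unfolded this]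
 have B: "measure P {a : space P. \<bar>?G a\<bar> >= \<eta>} <= s^2/\<eta>^2"
  using P.second_moment_method[of ?G, OF _ sqi_integrable[OF G(1)] \<eta>] G(2) by simp
 have "space P - {a : space P. \<bar>?F a\<bar> < \<delta>*n * s^2 & \<bar>?G a\<bar> < \<eta>} \<subseteq>
   {a : space P. \<bar>?F a\<bar> >= \<delta>*n * s^2} \<union> {a : space P. \<bar>?G a\<bar> >= \<eta>}" by auto
 then have "measure P (space P - {a : space P. \<bar>?F a\<bar> < \<delta>*n * s^2 & \<bar>?G a\<bar> < \<eta>}) <=
   measure P ({a : space P. \<bar>?F a\<bar> >= \<delta>*n * s^2} \<union> {a : space P. \<bar>?G a\<bar> >= \<eta>})"
  by (rule P.finite_measure_mono) measurable
 also have "... <= measure P {a : space P. \<bar>?F a\<bar> >= \<delta>*n * s^2} + measure P {a : space P. \<bar>?G a\<bar> >= \<eta>}"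
  by (rule measure_Un_le) measurable
 finally have "1 - measure P {a : space P. \<bar>?F a\<bar> < \<delta>*n * s^2 & \<bar>?G a\<bar> < \<eta>} <= 2/(n*\<delta>^2) + s^2/\<eta>^2"
 proof -
  assume "measure P (space P - {a : space P. \<bar>?F a\<bar> < \<delta>*n * s^2 & \<bar>?G a\<bar> < \<eta>}) <=
   measure P {a : space P. \<bar>?F a\<bar> >= \<delta>*n * s^2} + measure P {a : space P. \<bar>?G a\<bar> >= \<eta>}"
  moreover have "measure P (space P - {a : space P. \<bar>?F a\<bar> < \<delta>*n * s^2 & \<bar>?G a\<bar> < \<eta>}) =
   1 - measure P {a : space P. \<bar>?F a\<bar> < \<delta>*n * s^2 & \<bar>?G a\<bar> < \<eta>}"
   by (rule P.prob_compl) measurable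
  ultimately show ?thesis using A B by linarith
 qed
 moreover have "?F a = (\<Sum>i<n. (a i - m i)^2) - n * s^2" for a
  by (simp add: sum_subtractf)
 ultimately show ?thesis by simp
qed

text \<open>The density of the code distribution is compared pointwise, on the typical set, with the
 density of the optimal test channel, which is concentrated on the ball to be hit.\<close>

lemma random_codeword_hits_ball:
 fixes x :: "nat => real" and \<epsilon> \<delta> :: real
 assumes e: "0 < \<epsilon>" "\<epsilon> < 1" and d: "0 < \<delta>" "\<delta> <= 1" and n: "n*\<delta>^2 >= 6"
  and x: "(\<Sum>i<n. (x i)^2) = 1"
 defines "Q \<equiv> PiM {..<n} (%_. density lborel (normal_density 0 (sqrt ((1 - \<epsilon>^2)/n))))"
 shows "measure Q {a : space Q. (\<Sum>i<n. (x i - a i)^2) <= \<epsilon>^2*(1 + 3*\<delta>)} >= 1/2*\<epsilon>^n*exp (- 2*\<delta>*n)"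
proof -
 have n0: "n > 0" using n d by (cases n) auto
 \<comment> \<open>The Gaussian test channel: a source with variance 1/n per coordinate is a
   reproduction of variance \<open>\<tau>^2\<close> plus independent noise of variance
   \<open>\<epsilon>^2/n\<close>. Given the source \<open>x\<close>, the reproduction has mean
   \<open>m\<close> and coordinate deviation \<open>s\<close>.\<close>
 define \<tau> where "\<tau> = sqrt ((1 - \<epsilon>^2)/n)"
 define s where "s = \<epsilon>*\<tau>"
 define m where "m i = (1 - \<epsilon>^2)*x i" for i
 have e2: "\<epsilon>^2 < 1" using e by (simp add: power_less_one_iff abs_square_less_1)
 have t0: "\<tau> > 0" using e2 n0 by (simp add: \<tau>_def)
 have s0: "s > 0" using t0 e by (simp add: s_def)
 have t2: "n*\<tau>^2 = 1 - \<epsilon>^2" using e2 n0 by (simp add: \<tau>_def)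
 have s2: "n * s^2 = \<epsilon>^2*(1 - \<epsilon>^2)" unfolding t2[symmetric] by (simp add: s_def power_mult_distrib)
 define P where "P = PiM {..<n} (%i. density lborel (normal_density (m i) s))"
 define G where "G = {a : space P. \<bar>(\<Sum>i<n. (a i - m i)^2) - n * s^2\<bar> < \<delta>*n * s^2 & \<bar>\<Sum>i<n. x i*(a i - m i)\<bar> < \<delta>*\<epsilon>}"
 define A where "A = {a : space Q. (\<Sum>i<n. (x i - a i)^2) <= \<epsilon>^2*(1 + 3*\<delta>)}"
 define c where "c = \<epsilon>^n*exp (- 2*\<delta>*n)"
 interpret P: prob_space P unfolding P_def by (intro prob_space_PiM prob_space_normal_density s0)
 interpret Q: prob_space Q unfolding Q_def \<tau>_def[symmetric] by (intro prob_space_PiM prob_space_normal_density t0)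
 let ?L = "PiM {..<n} (%_. lborel :: real measure)"
 have sP: "sets P = sets ?L" and sQ: "sets Q = sets ?L"
  unfolding P_def Q_def by (auto intro!: sets_PiM_cong)
 have spP: "space P = space ?L" and spQ: "space Q = space ?L"
  using sP sQ by (auto dest: sets_eq_imp_space_eq)
 have Pd: "P = density ?L (%a. \<Prod>i<n. ennreal (normal_density (m i) s (a i)))"
  unfolding P_def by (rule PiM_density) (auto intro: lborel.sigma_finite_measure_axioms
    prob_space_imp_sigma_finite prob_space_normal_density s0)
 have Qd: "Q = density ?L (%a. \<Prod>i<n. ennreal (normal_density 0 \<tau> (a i)))"
  unfolding Q_def \<tau>_def[symmetric] by (rule PiM_density[where f = "%_ x. ennreal (normal_density 0 \<tau> x)"])
   (auto intro: lborel.sigma_finite_measure_axioms prob_space_imp_sigma_finite prob_space_normal_density t0)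
 have Gs: "G : sets ?L" unfolding G_def spP by measurable
 have As: "A : sets ?L" unfolding A_def spQ by measurable
 have xz: "\<bar>\<Sum>i<n. x i*(a i - m i)\<bar> < \<delta>*\<epsilon>" and zz: "(\<Sum>i<n. (a i - m i)^2) < (1 + \<delta>)*(n * s^2)"
  and zz': "(\<Sum>i<n. (a i - m i)^2) > (1 - \<delta>)*(n * s^2)" if "a : G" for a
  using that by (auto simp: G_def algebra_simps abs_less_iff)
 have GA: "G \<subseteq> A"
 proof
  fix a assume a: "a : G"
  have "(\<Sum>i<n. (x i - a i)^2) = (\<Sum>i<n. \<epsilon>^4*(x i)^2 - 2*\<epsilon>^2*(x i*(a i - m i)) + (a i - m i)^2)"
   by (intro sum.cong refl) (simp add: m_def power2_eq_square power4_eq_xxxx algebra_simps)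
  also have "... = \<epsilon>^4 - 2*\<epsilon>^2*(\<Sum>i<n. x i*(a i - m i)) + (\<Sum>i<n. (a i - m i)^2)"
   using x by (simp add: sum.distrib sum_subtractf sum_distrib_left[symmetric])
  also have "... <= \<epsilon>^4 + 2*\<epsilon>^2*(\<delta>*\<epsilon>) + (1 + \<delta>)*(n * s^2)"
  proof -
   have "2*\<epsilon>^2*(- (\<Sum>i<n. x i*(a i - m i))) <= 2*\<epsilon>^2*(\<delta>*\<epsilon>)"
    using xz[OF a] by (intro mult_left_mono) (auto simp: abs_less_iff)
   then show ?thesis using zz[OF a] by linarith
  qed
  also have "... = \<epsilon>^2*(\<epsilon>^2 + 2*\<delta>*\<epsilon> + (1 + \<delta>)*(1 - \<epsilon>^2))"
   unfolding s2 by (simp add: power2_eq_square power4_eq_xxxx algebra_simps)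
  also have "... <= \<epsilon>^2*(1 + 3*\<delta>)"
  proof (rule mult_left_mono)
   have "\<delta>*\<epsilon> <= \<delta>" "0 <= \<delta>*\<epsilon>^2" using e d by (auto simp: mult_le_cancel_left1)
   then show "\<epsilon>^2 + 2*\<delta>*\<epsilon> + (1 + \<delta>)*(1 - \<epsilon>^2) <= 1 + 3*\<delta>" by (simp add: algebra_simps)
  qed simp
  finally show "a : A" using a by (simp add: A_def G_def spP spQ)
 qed
 \<comment> \<open>The normalizing factors differ by \<open>(s/\<tau>)^n\<close>, that is
   \<epsilon>^n. On \<open>G\<close> the exponent of the first density is at most -n(1 -
   \<delta>)/2, that of the second at least -n(1 + 3\<delta>)/2, and the difference is
   2\<delta>n.\<close>
 have dens: "c*(\<Prod>i<n. normal_density (m i) s (a i)) <= (\<Prod>i<n. normal_density 0 \<tau> (a i))" if a: "a : G" for a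
 proof -
  have nd: "normal_density m' s' y = (1/(sqrt (2*pi) * s'))*exp (- (y - m')\<^sup>2/(2 * s'^2))" if "s' > 0" for m' s' y
   using that by (simp add: normal_density_def real_sqrt_mult)
  define Z where "Z = (\<Sum>i<n. (a i - m i)^2)"
  have 1: "(\<Prod>i<n. normal_density (m i) s (a i)) = (1/(sqrt (2*pi) * s))^n*exp (- Z/(2 * s^2))"
   unfolding nd[OF s0] prod.distrib by (simp add: exp_sum[symmetric] Z_def sum_divide_distrib[symmetric] sum_negf)
  have 2: "(\<Prod>i<n. normal_density 0 \<tau> (a i)) = (1/(sqrt (2*pi)*\<tau>))^n*exp (- (\<Sum>i<n. (a i)^2)/(2*\<tau>^2))"
   unfolding nd[OF t0] prod.distrib by (simp add: exp_sum[symmetric] sum_divide_distrib[symmetric] sum_negf)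
  have 3: "(1/(sqrt (2*pi)*\<tau>))^n = \<epsilon>^n*(1/(sqrt (2*pi) * s))^n"
   unfolding power_mult_distrib[symmetric] s_def using e by simp
  have "(\<Sum>i<n. (a i)^2) = (\<Sum>i<n. (1 - \<epsilon>^2)^2*(x i)^2 + 2*(1 - \<epsilon>^2)*(x i*(a i - m i)) + (a i - m i)^2)"
   by (intro sum.cong refl) (simp add: m_def power2_eq_square algebra_simps)
  also have "... = (1 - \<epsilon>^2)^2 + 2*(1 - \<epsilon>^2)*(\<Sum>i<n. x i*(a i - m i)) + Z"
   using x by (simp add: sum.distrib sum_distrib_left[symmetric] Z_def)
  also have "... <= (1 - \<epsilon>^2)^2 + 2*(1 - \<epsilon>^2)*(\<delta>*\<epsilon>) + (1 + \<delta>)*(\<epsilon>^2*(1 - \<epsilon>^2))"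
   using xz[OF a] zz[OF a] e2 unfolding s2 Z_def[symmetric]
   by (intro add_mono order_refl mult_left_mono) (auto simp: abs_less_iff)
  also have "... = (1 - \<epsilon>^2)*(1 + 2*\<delta>*\<epsilon> + \<delta>*\<epsilon>^2)"
   by (simp add: power2_eq_square algebra_simps)
  finally have "(\<Sum>i<n. (a i)^2)/(2*\<tau>^2) <= (1 - \<epsilon>^2)*(1 + 2*\<delta>*\<epsilon> + \<delta>*\<epsilon>^2)/(2*\<tau>^2)"
   by (rule divide_right_mono) simp
  also have "... = n/2*(1 + 2*\<delta>*\<epsilon> + \<delta>*\<epsilon>^2)"
   using t0 by (simp add: t2[symmetric] field_simps)
  also have "... <= n/2*(1 + 3*\<delta>)"
  proof (intro mult_left_mono)
   have "\<delta>*\<epsilon> <= \<delta>" "\<delta>*\<epsilon>^2 <= \<delta>" using e e2 d by (auto simp: mult_le_cancel_left1)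
   then show "1 + 2*\<delta>*\<epsilon> + \<delta>*\<epsilon>^2 <= 1 + 3*\<delta>" by linarith
  qed simp
  finally have S: "(\<Sum>i<n. (a i)^2)/(2*\<tau>^2) <= n/2*(1 + 3*\<delta>)" .
  have "Z/(2 * s^2) >= (1 - \<delta>)*(n * s^2)/(2 * s^2)"
   using zz'[OF a] by (intro divide_right_mono) (auto simp: Z_def)
  moreover have "(1 - \<delta>)*(n * s^2)/(2 * s^2) = n/2*(1 - \<delta>)" using s0 by simp
  ultimately have "Z/(2 * s^2) >= n/2*(1 - \<delta>)" by simp
  then have "- 2*\<delta>*n + - Z/(2 * s^2) <= - (\<Sum>i<n. (a i)^2)/(2*\<tau>^2)"
   using S by (simp add: algebra_simps)
  then have "exp (- 2*\<delta>*n)*exp (- Z/(2 * s^2)) <= exp (- (\<Sum>i<n. (a i)^2)/(2*\<tau>^2))"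
   by (simp add: exp_add[symmetric])
  then have "\<epsilon>^n*(1/(sqrt (2*pi) * s))^n*(exp (- 2*\<delta>*n)*exp (- Z/(2 * s^2)))
    <= \<epsilon>^n*(1/(sqrt (2*pi) * s))^n*exp (- (\<Sum>i<n. (a i)^2)/(2*\<tau>^2))"
   using e s0 by (intro mult_left_mono) auto
  then show ?thesis unfolding 1 2 3 c_def by (simp add: mult_ac)
 qed
 have c0: "c >= 0" using e by (simp add: c_def)
 have "ennreal c*emeasure P G = (\<integral>\<^sup>+ a. ennreal c*((\<Prod>i<n. ennreal (normal_density (m i) s (a i)))*indicator G a) \<partial>?L)"
  unfolding Pd using Gs by (subst emeasure_density) (auto intro!: nn_integral_cmult[symmetric])
 also have "... <= (\<integral>\<^sup>+ a. (\<Prod>i<n. ennreal (normal_density 0 \<tau> (a i)))*indicator A a \<partial>?L)"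
 proof (rule nn_integral_mono)
  fix a
  show "ennreal c*((\<Prod>i<n. ennreal (normal_density (m i) s (a i)))*indicator G a)
   <= (\<Prod>i<n. ennreal (normal_density 0 \<tau> (a i)))*indicator A a"
   using dens[of a] GA c0
   by (cases "a : G") (auto simp: prod_ennreal normal_density_nonneg prod_nonneg ennreal_mult[symmetric] intro!: ennreal_leI)
 qed
 also have "... = emeasure Q A" unfolding Qd using As by (subst emeasure_density) auto
 finally have "c * measure P G <= measure Q A"
  using c0 by (simp add: P.emeasure_eq_measure Q.emeasure_eq_measure ennreal_mult[symmetric])
 \<comment> \<open>The hypothesis \<open>n*\<delta>^2 >= 6\<close> makes the two Chebyshev terms at
   most 1/3 and 1/6.\<close>
 moreover have "measure P G >= 1/2"
 proof -
  have "measure P G >= 1 - 2/(n*\<delta>^2) - s^2/(\<delta>*\<epsilon>)^2"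
   unfolding P_def G_def by (rule gaussian_concentration) (use s0 d e n0 x in auto)
  moreover have "s^2/(\<delta>*\<epsilon>)^2 <= 1/(n*\<delta>^2)"
  proof -
   have "s^2/(\<delta>*\<epsilon>)^2 = \<tau>^2/\<delta>^2" using e d by (simp add: s_def power_mult_distrib)
   also have "... = (n*\<tau>^2)/(n*\<delta>^2)" using n0 by simp
   also have "... <= 1/(n*\<delta>^2)" unfolding t2 using e by (intro divide_right_mono) auto
   finally show ?thesis .
  qed
  moreover have "1/(n*\<delta>^2) <= 1/6" "2/(n*\<delta>^2) <= 2/6" using n by (auto intro!: divide_left_mono)
  moreover have "1 - u - v <= p ==> v <= w ==> w <= 1/6 ==> u <= 2/6 ==> 1/2 <= p" for u v w p :: real
   by linarith
  ultimately show ?thesis by blast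
 qed
 then have "c*(1/2) <= c * measure P G" by (rule mult_left_mono) (rule c0)
 ultimately show ?thesis unfolding A_def c_def by simp
qed

section \<open>Finite codes for spheres, balls and the real line\<close>

lemma greedy_cover:
 assumes Q: "prob_space Q" and S: "finite S" and p: "p <= 1"
  and m: "\<And>x. x : S ==> {a : space Q. P x a} : sets Q"
  and hit: "\<And>x. x : S ==> measure Q {a : space Q. P x a} >= p"
 shows "\<exists>C. finite C & card C <= k & real (card {x : S. \<forall>a\<in>C. \<not> P x a}) <= real (card S)*(1 - p)^k"
proof (induction k)
 case 0
 show ?case by (rule exI[of _ "{}"]) simp
next
 case (Suc k)
 interpret Q: prob_space Q by fact
 from Suc obtain C where C: "finite C" "card C <= k" "real (card {x : S. \<forall>a\<in>C. \<not> P x a}) <= real (card S)*(1 - p)^k"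
  by blast
 define T where "T = {x : S. \<forall>a\<in>C. \<not> P x a}"
 have T: "finite T" "T \<subseteq> S" using S by (auto simp: T_def)
 let ?f = "%a. \<Sum>x\<in>T. indicator {a : space Q. P x a} a :: real"
 have ind: "integrable Q (indicator {a : space Q. P x a} :: _ => real)" if "x : T" for x
  using m T that by (intro integrable_real_indicator) (auto simp: less_top[symmetric])
 then have int: "integrable Q ?f" by (intro Bochner_Integration.integrable_sum) auto
 \<comment> \<open>Averaged over the random word, the number of uncovered points that it hits is at
   least \<open>card T*p\<close>, so some word hits that many. Each round thus leaves at most the
   fraction 1 - p.\<close>
 have "(LINT a|Q. ?f a) = (\<Sum>x\<in>T. measure Q {a : space Q. P x a})"
  using m T ind by (subst Bochner_Integration.integral_sum) (auto intro!: sum.cong)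
 also have "... >= (\<Sum>x\<in>T. p)" using hit T by (intro sum_mono) auto
 finally have "(LINT a|Q. ?f a) >= card T*p" by simp
 then have "\<not> (AE a in Q. ?f a < card T*p)"
  using Q.expectation_less[OF int, of "card T*p"] by (meson not_less)
 then obtain a where a: "a : space Q" "?f a >= card T*p"
  by (meson AE_I2 not_less)
 have "?f a = card {x : T. P x a}"
  using a T by (simp add: indicator_def sum.If_cases Int_def)
 then have hit_a: "card {x : T. P x a} >= card T*p" using a by simp
 have "{x : S. \<forall>a\<in>insert a C. \<not> P x a} = T - {x : T. P x a}" by (auto simp: T_def)
 moreover have "card (T - {x : T. P x a}) = card T - card {x : T. P x a}"
  using T by (intro card_Diff_subset) auto
 moreover have "card {x : T. P x a} <= card T" using T by (intro card_mono) auto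
 ultimately have "real (card {x : S. \<forall>a\<in>insert a C. \<not> P x a}) <= card T*(1 - p)"
  using hit_a by (simp add: algebra_simps of_nat_diff)
 also have "... <= (real (card S)*(1 - p)^k)*(1 - p)"
  using C p by (intro mult_right_mono) (auto simp: T_def)
 finally have "real (card {x : S. \<forall>a\<in>insert a C. \<not> P x a}) <= real (card S)*(1 - p)^Suc k" by (simp add: mult_ac)
 then show ?case
  using C by (intro exI[of _ "insert a C"]) (auto intro: order_trans[OF card_insert_le_m1] simp: card_insert_if)
qed

text \<open>The sphere is cut by cubes of side \<open>h\<close>, and one of its own points is kept
  from each cube that it meets. Points on the sphere are wanted, rather than cube centres, because
  the hitting probability is known only for balls about unit vectors.\<close>

lemma sphere_net:
 fixes h :: real
 assumes h: "h > 0"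
 shows "\<exists>S. finite S & S \<subseteq> {x. (\<Sum>i<n. (x i)^2) = 1} & real (card S) <= (2/h + 3)^n &
  (\<forall>x. (\<Sum>i<n. (x i)^2) = 1 --> (\<exists>y\<in>S. \<forall>i<n. \<bar>x i - y i\<bar> <= h))"
proof -
 define Sph where "Sph = {x::nat => real. (\<Sum>i<n. (x i)^2) = 1}"
 define K where "K = \<lceil>1/h\<rceil>"
 define g where "g x = restrict (%i. \<lfloor>x i/h\<rfloor>) {..<n}" for x :: "nat => real"
 have "0 < 1/h" using h by simp
 then have K0: "K >= 0" unfolding K_def by linarith
 have sub: "g ` Sph \<subseteq> PiE {..<n} (%_. {-K..K})"
 proof
  fix y assume "y : g ` Sph"
  then obtain x where x: "x : Sph" "y = g x" by auto
  have "\<lfloor>x i/h\<rfloor> : {-K..K}" if "i < n" for i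
  proof -
   have "(x i)^2 <= (\<Sum>i<n. (x i)^2)" using that by (intro member_le_sum) auto
   then have "\<bar>x i\<bar> <= 1" using x by (simp add: Sph_def abs_square_le_1)
   then have "x i/h <= 1/h" "- (1/h) <= x i/h" using h by (auto simp: field_simps)
   then show ?thesis using h unfolding K_def by (simp; linarith)
  qed
  then show "y : PiE {..<n} (%_. {-K..K})" using x by (auto simp: g_def PiE_iff)
 qed
 have fin: "finite (g ` Sph)" by (rule finite_subset[OF sub]) (auto intro: finite_PiE)
 have "card (g ` Sph) <= card (PiE {..<n} (%_. {-K..K}))"
  by (rule card_mono[OF _ sub]) (auto intro: finite_PiE)
 also have "... = nat (2*K + 1)^n" by (simp add: card_PiE)
 finally have "real (card (g ` Sph)) <= real (nat (2*K + 1))^n" by (metis of_nat_le_iff of_nat_power)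
 also have "... <= (2/h + 3)^n"
 proof (rule power_mono)
  have "real_of_int K <= 1/h + 1" unfolding K_def by linarith
  then show "real (nat (2*K + 1)) <= 2/h + 3" using K0 by simp
 qed simp
 finally have card: "real (card (g ` Sph)) <= (2/h + 3)^n" .
 define S where "S = inv_into Sph g ` (g ` Sph)"
 have inv: "inv_into Sph g (g x) : Sph" "g (inv_into Sph g (g x)) = g x" if "x : Sph" for x
  using inv_into_into[of "g x" g Sph] f_inv_into_f[of "g x" g Sph] that by auto
 have "finite S" using fin by (simp add: S_def)
 moreover have "S \<subseteq> Sph" using inv by (auto simp: S_def)
 moreover have "card S <= card (g ` Sph)" unfolding S_def by (rule card_image_le[OF fin])
 moreover have "\<exists>y\<in>S. \<forall>i<n. \<bar>x i - y i\<bar> <= h" if x: "x : Sph" for x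
 proof (rule bexI[of _ "inv_into Sph g (g x)"], intro allI impI)
  fix i assume i: "i < n"
  have "\<lfloor>x i/h\<rfloor> = \<lfloor>inv_into Sph g (g x) i/h\<rfloor>"
   using inv(2)[OF x] i by (auto simp: g_def restrict_def fun_eq_iff split: if_splits)
  then have "\<bar>x i/h - inv_into Sph g (g x) i/h\<bar> < 1" by linarith
  then have "\<bar>(x i - inv_into Sph g (g x) i)/h\<bar> < 1" by (simp add: diff_divide_distrib)
  then show "\<bar>x i - inv_into Sph g (g x) i\<bar> <= h" using h by (simp add: abs_divide field_simps)
 qed (use x in \<open>simp add: S_def\<close>)
 ultimately show ?thesis using card unfolding Sph_def by (intro exI[of _ S]) auto
qed

lemma L2_set_triangle_diff:
 "L2_set (%i. f i - h i) A <= L2_set (%i. f i - g i) A + L2_set (%i. g i - h i) A"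
 using L2_set_triangle_ineq[of "%i. f i - g i" "%i. g i - h i" A] by simp

text \<open>About 1/p words suffice, where p, essentially \<epsilon>^n, is the hitting probability
  of one random word. The net has exponentially many points, but its size enters only through a
  logarithm and so leaves a polynomial factor. The mesh is chosen so that moving from a net point to
  any point of its cell costs at most \<delta>\<epsilon>.\<close>

lemma sphere_code:
 fixes \<epsilon> \<delta> :: real
 assumes e: "0 < \<epsilon>" "\<epsilon> < 1" and d: "0 < \<delta>" "\<delta> <= 1" and n: "n*\<delta>^2 >= 6"
 shows "\<exists>C. finite C & real (card C) <= 20*(real n)^2/(\<delta>*\<epsilon>)*exp (2*\<delta>*n)/\<epsilon>^n &
  (\<forall>x. L2_set x {..<n} = 1 --> (\<exists>a\<in>C. L2_set (%i. x i - a i) {..<n} <= \<epsilon>*(1 + 3*\<delta>)))"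
proof -
 have n1: "n > 0" using n d by (cases n) auto
 define h where "h = \<delta>*\<epsilon>/sqrt n"
 have h: "h > 0" using e d n1 by (simp add: h_def)
 from sphere_net[OF h, of n] obtain S where S: "finite S" "S \<subseteq> {x. (\<Sum>i<n. (x i)^2) = 1}"
  "real (card S) <= (2/h + 3)^n" "\<And>x. (\<Sum>i<n. (x i)^2) = 1 ==> \<exists>y\<in>S. \<forall>i<n. \<bar>x i - y i\<bar> <= h" by blast
 define Q where "Q = PiM {..<n} (%_. density lborel (normal_density 0 (sqrt ((1 - \<epsilon>^2)/n))))"
 define p where "p = 1/2*\<epsilon>^n*exp (- 2*\<delta>*n)"
 have e2: "\<epsilon>^2 < 1" using e by (simp add: power_less_one_iff abs_square_less_1)
 have t0: "sqrt ((1 - \<epsilon>^2)/n) > 0" using e2 n1 by simp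
 have Q: "prob_space Q" unfolding Q_def by (intro prob_space_PiM prob_space_normal_density t0)
 have p0: "p > 0" using e by (simp add: p_def)
 have "\<epsilon>^n*exp (- 2*\<delta>*n) <= 1*1"
  using e d by (intro mult_mono) (auto simp: power_le_one)
 then have p1: "p <= 1" by (simp add: p_def)
 let ?P = "%x a. (\<Sum>i<n. (x i - a i)^2) <= \<epsilon>^2*(1 + 3*\<delta>)"
 have hit: "measure Q {a : space Q. ?P x a} >= p" if "x : S" for x
  unfolding Q_def p_def using S(2) that by (intro random_codeword_hits_ball e d n) auto
 have sQ: "sets Q = sets (PiM {..<n} (%_. borel :: real measure))"
  unfolding Q_def by (auto intro!: sets_PiM_cong)
 have spQ: "space Q = space (PiM {..<n} (%_. borel :: real measure))"
  using sQ by (auto dest: sets_eq_imp_space_eq)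
 have ms: "{a : space Q. ?P x a} : sets Q" if "x : S" for x
  unfolding sQ spQ by measurable
 \<comment> \<open>Makes \<open>exp (- (p*k))\<close> at most \<open>1/(card S + 1)\<close>, so
   fewer than one net point, hence none, stays uncovered.\<close>
 define k where "k = nat \<lceil>ln (card S + 1)/p\<rceil>"
 have "\<exists>C. finite C & card C <= k & real (card {x : S. \<forall>a\<in>C. \<not> ?P x a}) <= real (card S)*(1 - p)^k"
  by (rule greedy_cover[OF Q S(1) p1 ms hit])
 then obtain C where C: "finite C" "card C <= k" "real (card {x : S. \<forall>a\<in>C. \<not> ?P x a}) <= real (card S)*(1 - p)^k"
  by (elim exE conjE)
 have "real (card S)*(1 - p)^k < 1"
 proof -
  have "(1 - p)^k <= exp (- p)^k" using p1 exp_ge_add_one_self[of "- p"] by (intro power_mono) auto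
  also have "... = exp (- (p*k))" by (simp add: exp_of_nat_mult[symmetric] mult.commute)
  also have "... <= exp (- ln (card S + 1))"
  proof -
   have "ln (card S + 1)/p <= k" unfolding k_def by linarith
   then show ?thesis using p0 by (simp add: field_simps)
  qed
  also have "... = 1/(card S + 1)" by (simp add: exp_minus divide_inverse)
  finally have "real (card S)*(1 - p)^k <= real (card S)*(1/(card S + 1))" by (rule mult_left_mono) simp
  also have "... < 1" by simp
  finally show ?thesis .
 qed
 then have "card {x : S. \<forall>a\<in>C. \<not> ?P x a} = 0" using C(3) by linarith
 then have cov: "\<exists>a\<in>C. ?P x a" if "x : S" for x using S(1) that by auto
 have "\<exists>a\<in>C. L2_set (%i. x i - a i) {..<n} <= \<epsilon>*(1 + 3*\<delta>)" if x: "L2_set x {..<n} = 1" for x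
 proof -
  from x have "(\<Sum>i<n. (x i)^2) = 1" by (simp add: L2_set_def)
  then obtain y where y: "y : S" "\<forall>i<n. \<bar>x i - y i\<bar> <= h" using S(4) by blast
  obtain a where a: "a : C" "?P y a" using cov[OF y(1)] by blast
  have "L2_set (%i. x i - y i) {..<n} <= sqrt (\<Sum>i<n. h^2)"
   unfolding L2_set_def using y(2) h
   by (intro real_sqrt_le_mono sum_mono) (metis abs_ge_zero lessThan_iff power2_abs power_mono)
  also have "... = \<delta>*\<epsilon>" using h n1 e d by (simp add: real_sqrt_mult h_def)
  finally have 1: "L2_set (%i. x i - y i) {..<n} <= \<delta>*\<epsilon>" .
  have "L2_set (%i. y i - a i) {..<n} <= sqrt ((\<epsilon>*(1 + 2*\<delta>))^2)"
   unfolding L2_set_def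
  proof (rule real_sqrt_le_mono)
   have "1 + 3*\<delta> <= (1 + 2*\<delta>)^2" using d by (simp add: power2_eq_square algebra_simps)
   then have "\<epsilon>^2*(1 + 3*\<delta>) <= (\<epsilon>*(1 + 2*\<delta>))^2" unfolding power_mult_distrib by (rule mult_left_mono) simp
   with a show "(\<Sum>i<n. (y i - a i)^2) <= (\<epsilon>*(1 + 2*\<delta>))^2" by simp
  qed
  then have 2: "L2_set (%i. y i - a i) {..<n} <= \<epsilon>*(1 + 2*\<delta>)" using e d by simp
  have "L2_set (%i. x i - a i) {..<n} <= \<delta>*\<epsilon> + \<epsilon>*(1 + 2*\<delta>)"
   using 1 2 L2_set_triangle_diff[of x a "{..<n}" y] by linarith
  then show ?thesis using a(1) by (auto simp: algebra_simps)
 qed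
 moreover have "real (card C) <= 20*(real n)^2/(\<delta>*\<epsilon>)*exp (2*\<delta>*n)/\<epsilon>^n"
 proof -
  have de: "0 < \<delta>*\<epsilon>" "\<delta>*\<epsilon> <= 1" using e d mult_mono[of \<delta> 1 \<epsilon> 1] by auto
  define q where "q = n/(\<delta>*\<epsilon>)"
  have q1: "n <= q" using de n1 by (simp add: q_def field_simps)
  then have q1': "1 <= q" using n1 by linarith
  have "sqrt n <= n" using n1 by (intro real_le_lsqrt) (auto simp: power2_eq_square)
  then have "2/h <= 2*q" using de by (simp add: h_def q_def divide_right_mono)
  then have "2/h + 3 <= 5*q" using q1' by linarith
  then have "(2/h + 3)^n <= (5*q)^n" using h by (intro power_mono) auto
  then have "real (card S) <= (5*q)^n" using S(3) by linarith
  moreover have "1 <= (5*q)^n" using q1' by (intro one_le_power) auto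
  ultimately have "card S + 1 <= 2*(5*q)^n" by linarith
  then have "ln (card S + 1) <= ln (2*(5*q)^n)" by (intro ln_mono) auto
  also have "... = ln 2 + n*ln (5*q)" using q1' by (simp add: ln_mult ln_realpow distrib_left)
  also have "... <= 1 + n*(5*q - 1)"
   using q1' ln_le_minus_one[of "5*q"] ln_2_less_1 by (intro add_mono mult_left_mono) auto
  also have "... <= 5*n*q" using n1 by (simp add: algebra_simps)
  finally have L: "ln (card S + 1) <= 5*n*q" .
  have "real (card C) <= real k" using C(2) by simp
  also have "... <= ln (card S + 1)/p + 1"
  proof -
   have "0 <= ln (card S + 1)/p" using p0 by simp
   then show ?thesis unfolding k_def by linarith
  qed
  also have "... <= (5*n*q + 1)/p"
  proof -
   have "ln (card S + 1)/p <= 5*n*q/p" "1 <= 1/p" using L p0 p1 by (auto intro: divide_right_mono)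
   then show ?thesis by (simp add: add_divide_distrib)
  qed
  also have "... <= 10*(n*q)/p"
  proof -
   have "1*1 <= n*q" using n1 q1' by (intro mult_mono) auto
   moreover have "5*n*q = 5*(n*q)" by simp
   ultimately have "5*n*q + 1 <= 10*(n*q)" by linarith
   then show ?thesis using p0 by (intro divide_right_mono) auto
  qed
  also have "... = 20*(real n)^2/(\<delta>*\<epsilon>)*exp (2*\<delta>*n)/\<epsilon>^n"
   unfolding p_def q_def by (simp add: exp_minus power2_eq_square field_simps)
  finally show ?thesis .
 qed
 ultimately show ?thesis using C(1) by blast
qed

text \<open>Direction and length are coded separately: a sphere code for the direction, multiples of
  1/H up to H for the length. A vector longer than H is sent to 0, where its length is at most its
  square over H. This quadratic excess is the price of a finite code that is valid on the whole
  space.\<close>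

lemma ball_code:
 fixes \<epsilon> \<delta> H :: real
 assumes e: "0 < \<epsilon>" "\<epsilon> < 1" and d: "0 < \<delta>" "\<delta> <= 1" and n: "n*\<delta>^2 >= 6" and H: "H >= 1"
 shows "\<exists>V. finite V & V ~= {} & real (card V) <= (H^2 + 1)*(20*(real n)^2/(\<delta>*\<epsilon>)*exp (2*\<delta>*n)/\<epsilon>^n) &
  (\<forall>y. \<exists>v\<in>V. L2_set (%i. y i - v i) {..<n} <=
    \<epsilon>*(1 + 3*\<delta>)*L2_set y {..<n} + 5/H + (L2_set y {..<n})^2/H)"
proof -
 have n1: "n > 0" using n d by (cases n) auto
 obtain C where C: "finite C" "real (card C) <= 20*(real n)^2/(\<delta>*\<epsilon>)*exp (2*\<delta>*n)/\<epsilon>^n"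
  "\<And>x. L2_set x {..<n} = 1 ==> \<exists>a\<in>C. L2_set (%i. x i - a i) {..<n} <= \<epsilon>*(1 + 3*\<delta>)"
  using sphere_code[OF e d n] by blast
 have "L2_set (%i. if i = 0 then 1 else 0) {..<n} = 1"
  using n1 by (simp add: L2_set_def if_distrib[of "%x. x^2"] sum.delta cong: if_cong)
 then have Cne: "C ~= {}" using C(3) by blast
 define V where "V = (%(k, a) i. (real k/H)*a i) ` ({..nat \<lfloor>H\<^sup>2\<rfloor>} \<times> C)"
 have "finite V" "V ~= {}" using C(1) Cne by (auto simp: V_def)
 moreover have "real (card V) <= (H^2 + 1)*card C"
 proof -
  have "card V <= card ({..nat \<lfloor>H\<^sup>2\<rfloor>} \<times> C)" unfolding V_def by (rule card_image_le) (use C in auto)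
  also have "... = (nat \<lfloor>H\<^sup>2\<rfloor> + 1)*card C" by (simp add: card_cartesian_product)
  finally have "real (card V) <= real (nat \<lfloor>H\<^sup>2\<rfloor> + 1)*card C" by (metis of_nat_le_iff of_nat_mult)
  also have "... <= (H^2 + 1)*card C" using H by (intro mult_right_mono) auto
  finally show ?thesis .
 qed
 then have "real (card V) <= (H^2 + 1)*(20*(real n)^2/(\<delta>*\<epsilon>)*exp (2*\<delta>*n)/\<epsilon>^n)"
  by (rule order_trans) (intro mult_left_mono C(2), simp)
 moreover have "\<exists>v\<in>V. L2_set (%i. y i - v i) {..<n} <=
    \<epsilon>*(1 + 3*\<delta>)*L2_set y {..<n} + 5/H + (L2_set y {..<n})^2/H" for y
 proof -
  define \<rho> where "\<rho> = L2_set y {..<n}"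
  have \<rho>0: "\<rho> >= 0" by (simp add: \<rho>_def)
  have t1: "0 <= \<epsilon>*(1 + 3*\<delta>)*\<rho>" "0 <= 5/H" "0 <= \<rho>^2/H" using e d H \<rho>0 by auto
  consider "\<rho> = 0 \<or> \<rho> > H" | "0 < \<rho>" "\<rho> <= H" using \<rho>0 by linarith
  then show ?thesis
  proof cases
   case 1
   obtain a where a: "a : C" using Cne by blast
   have v: "(%i. 0) : V" unfolding V_def using a by (intro image_eqI[of _ _ "(0, a)"]) auto
   have "\<rho> <= \<rho>^2/H" using 1 H by (auto simp: field_simps power2_eq_square)
   moreover have "L2_set (%i. y i - 0) {..<n} = \<rho>" by (simp add: \<rho>_def)
   ultimately have "L2_set (%i. y i - 0) {..<n} <= \<epsilon>*(1 + 3*\<delta>)*\<rho> + 5/H + \<rho>^2/H"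
    using t1 by linarith
   then show ?thesis using v unfolding \<rho>_def by (intro bexI[of _ "%i. 0"])
  next
   case 2
   define u where "u i = y i/\<rho>" for i
   have "L2_set u {..<n} = \<rho>/\<rho>"
    using 2 by (simp add: u_def L2_set_def power_divide sum_divide_distrib[symmetric] real_sqrt_divide \<rho>_def)
   then have "L2_set u {..<n} = 1" using 2 by simp
   then obtain a where a: "a : C" "L2_set (%i. u i - a i) {..<n} <= \<epsilon>*(1 + 3*\<delta>)" using C(3) by blast
   define k where "k = nat \<lfloor>H*\<rho>\<rfloor>"
   have "H*\<rho> <= H^2" using 2 H by (simp add: power2_eq_square)
   then have kH: "k <= nat \<lfloor>H\<^sup>2\<rfloor>" unfolding k_def by (intro nat_mono floor_mono)
   have v: "(%i. real k/H*a i) : V" unfolding V_def using a kH by (intro image_eqI[of _ _ "(k, a)"]) auto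
   have "H*\<rho> >= 0" using H 2 by simp
   then have "\<bar>H*\<rho> - k\<bar> <= 1" unfolding k_def by linarith
   then have "\<bar>H*\<rho> - k\<bar>/H <= 1/H" using H by (intro divide_right_mono) auto
   moreover have "\<rho> - k/H = (H*\<rho> - k)/H" using H by (simp add: field_simps)
   ultimately have kr: "\<bar>\<rho> - k/H\<bar> <= 1/H" using H by (simp add: abs_divide)
   have "L2_set a {..<n} <= L2_set u {..<n} + L2_set (%i. a i - u i) {..<n}"
    using L2_set_triangle_ineq[of u "%i. a i - u i" "{..<n}"] by simp
   also have "L2_set (%i. a i - u i) {..<n} = L2_set (%i. u i - a i) {..<n}"
    by (simp add: L2_set_def power2_commute)
   finally have "L2_set a {..<n} <= 1 + \<epsilon>*(1 + 3*\<delta>)"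
    using a(2) \<open>L2_set u {..<n} = 1\<close> by linarith
   also have "\<epsilon>*(1 + 3*\<delta>) <= 1*4" using e d by (intro mult_mono) auto
   \<comment> \<open>A code word need not be a unit vector, but its norm is at most 1 + 1*4: the
     origin of the 5 in \<open>5/H\<close>.\<close>
   finally have a5: "L2_set a {..<n} <= 5" by simp
   have "L2_set (%i. y i - real k/H*a i) {..<n} = L2_set (%i. \<rho>*(u i - a i) + (\<rho> - k/H)*a i) {..<n}"
    using 2 by (intro L2_set_cong refl) (simp add: u_def algebra_simps)
   also have "... <= L2_set (%i. \<rho>*(u i - a i)) {..<n} + L2_set (%i. (\<rho> - k/H)*a i) {..<n}"
    by (rule L2_set_triangle_ineq)
   also have "... = \<rho>*L2_set (%i. u i - a i) {..<n} + \<bar>\<rho> - k/H\<bar>*L2_set a {..<n}"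
    using 2 by (simp add: L2_set_def power_mult_distrib sum_distrib_left[symmetric] real_sqrt_mult)
   also have "... <= \<rho>*(\<epsilon>*(1 + 3*\<delta>)) + 1/H*5"
    using 2 a(2) kr a5 H by (intro add_mono mult_mono) auto
   also have "... = \<epsilon>*(1 + 3*\<delta>)*\<rho> + 5/H" by (simp add: mult_ac)
   finally have "L2_set (%i. y i - real k/H*a i) {..<n} <= \<epsilon>*(1 + 3*\<delta>)*\<rho> + 5/H + \<rho>^2/H"
    using t1 by linarith
   then show ?thesis using v unfolding \<rho>_def by (intro bexI[of _ "%i. real k/H*a i"])
  qed
 qed
 ultimately show ?thesis by blast
qed

text \<open>The scalar analogue of \<open>ball_code\<close>: rounding with step 1/H on [-H,H], and 0
  beyond, where \<bar>z\<bar> is at most z^2/H.\<close>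

lemma grid_code:
 fixes H :: real
 assumes H: "H >= 1"
 shows "\<exists>G. finite G & G ~= {} & real (card G) <= 5*H^2 & (\<forall>z. \<exists>g\<in>G. \<bar>z - g\<bar> <= 1/H + z^2/H)"
proof -
 define K where "K = \<lceil>H^2\<rceil>"
 have K: "H^2 <= K" "K < H^2 + 1" unfolding K_def by linarith+
 have H2: "1 <= H^2" using H by simp
 define G where "G = (%k. real_of_int k/H) ` {-K..K}"
 have "card G <= card {-K..K}" unfolding G_def by (rule card_image_le) simp
 then have "real (card G) <= real (nat (2*K + 1))" by simp
 also have "... <= 5*H^2" using K H2 by simp
 finally have "real (card G) <= 5*H^2" .
 moreover have "0 : G" using K H2 by (auto simp: G_def intro!: image_eqI[of _ _ 0])
 moreover have "\<exists>g\<in>G. \<bar>z - g\<bar> <= 1/H + z^2/H" for z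
 proof (cases "\<bar>z\<bar> <= H")
  case True
  have "\<bar>z*H\<bar> <= H^2" using True H by (simp add: abs_mult power2_eq_square mult_mono)
  then have "z*H <= K" "- K <= z*H" using K by linarith+
  then have "\<lfloor>z*H\<rfloor> : {-K..K}" by (simp add: le_floor_iff floor_le_iff)
  then have g: "\<lfloor>z*H\<rfloor>/H : G" by (auto simp: G_def)
  have "z - \<lfloor>z*H\<rfloor>/H = (z*H - \<lfloor>z*H\<rfloor>)/H" using H by (simp add: field_simps)
  moreover have "\<bar>z*H - \<lfloor>z*H\<rfloor>\<bar>/H <= 1/H" using H by (intro divide_right_mono; linarith)
  ultimately have "\<bar>z - \<lfloor>z*H\<rfloor>/H\<bar> <= 1/H" using H by (simp add: abs_divide)
  moreover have "0 <= z^2/H" using H by simp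
  ultimately show ?thesis using g by (intro bexI[of _ "\<lfloor>z*H\<rfloor>/H"]) auto
 next
  case False
  then have "\<bar>z\<bar>*H <= \<bar>z\<bar>*\<bar>z\<bar>" by (intro mult_left_mono) auto
  then have "\<bar>z\<bar> <= z^2/H" using H by (simp add: field_simps power2_eq_square)
  moreover have "0 <= 1/H" using H by simp
  ultimately have "\<bar>z - 0\<bar> <= 1/H + z^2/H" unfolding diff_0_right by linarith
  then show ?thesis using \<open>0 \<in> G\<close> by blast
 qed
 ultimately show ?thesis by (intro exI[of _ G]) (auto simp: G_def)
qed

section \<open>Coding coordinates in blocks of equal length\<close>

lemma sum_blocks:
 fixes f :: "nat => real"
 shows "sum f {..<B*l} = (\<Sum>k<B. \<Sum>i<l. f (k*l + i))"
proof -
 have "sum f {..<B*l} = (\<Sum>k<B. sum f {k*l..<k*l + l})" by (rule sum.nat_group[symmetric])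
 also have "... = (\<Sum>k<B. \<Sum>i<l. f (k*l + i))"
 proof (rule sum.cong[OF refl])
  fix k
  show "sum f {k*l..<k*l + l} = (\<Sum>i<l. f (k*l + i))"
   using sum.shift_bounds_nat_ivl[of f 0 "k*l" l] by (simp add: add.commute lessThan_atLeast0)
 qed
 finally show ?thesis .
qed

text \<open>One codebook serves both the deterministic and the random problem: the bound holds for
 every coefficient vector, the quadratic terms absorbing large coefficients.\<close>

lemma block_codebook:
 fixes e b :: "nat => 'a => real" and \<mu> \<epsilon> D :: "nat => real" and V :: "nat => (nat => real) set"
 assumes on: "orthonormal S {..<m} e"
  and b: "\<And>i. i < r ==> b i : sqi S" "\<And>i. i < r ==> nm S (b i) <= K"
  and \<mu>: "\<And>j. j < m ==> 0 <= \<mu> j" "\<And>j. j < m ==> \<mu> j <= K"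
  and B: "0 < B" "0 < l" "B*l <= m"
  and V: "\<And>k. 1 <= k ==> k < B ==> finite (V k)" "\<And>k. 1 <= k ==> k < B ==> V k ~= {}"
   "\<And>k y. 1 <= k ==> k < B ==> \<exists>v\<in>V k. L2_set (%i. y i - v i) {..<l} <=
     \<epsilon> k*L2_set y {..<l} + 5/H + (L2_set y {..<l})^2/H"
  and D: "\<And>k j. 1 <= k ==> k < B ==> k*l <= j ==> j < k*l + l ==> \<mu> j <= D k"
   "\<And>k. 1 <= k ==> k < B ==> 0 <= D k" "\<And>k. 1 <= k ==> k < B ==> D k <= K"
   "\<And>k. 1 <= k ==> k < B ==> D k*\<epsilon> k <= E"
  and H: "H >= 1" and K: "K >= 0" and E: "E >= 0"
 shows "\<exists>\<alpha>. finite \<alpha> & \<alpha> ~= {} & (\<forall>a\<in>\<alpha>. \<exists>p q. a = (%t. (\<Sum>j<m. p j*e j t) + (\<Sum>i<r. q i*b i t))) &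
   real (card \<alpha>) <= (\<Prod>k\<in>{1..<B}. real (card (V k)))*(5*H^2)^(r + l) &
   (\<forall>y z. \<exists>a\<in>\<alpha>. nm S (%t. (\<Sum>j<m. \<mu> j*y j*e j t) + (\<Sum>i<r. z i*b i t) - a t) <=
    sqrt (E^2*(\<Sum>j<B*l. (y j)^2) + (\<Sum>j\<in>{B*l..<m}. (\<mu> j*y j)^2)) +
    6*K*(B + r + l)/H*(1 + (\<Sum>j<B*l. (y j)^2) + (\<Sum>i<r. (z i)^2)))"
proof -
 obtain G where G: "finite G" "G ~= {}" "real (card G) <= 5*H^2" "\<And>z. \<exists>g\<in>G. \<bar>z - g\<bar> <= 1/H + z^2/H"
  using grid_code[OF H] by blast
 \<comment> \<open>Block 0 is coded on the scalar grid: the accuracy (k/B) powr \<beta> of the later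
   blocks would be 0 there. The first \<open>r\<close> grid values belong to the low-rank
   coefficients, hence the index \<open>r + j\<close>. From \<open>B*l\<close> on nothing is
   coded.\<close>
 define Y where "Y f g j = (if j < l then g (r + j) else if j < B*l then f (j div l) (j mod l) else 0)"
  for f :: "nat => nat => real" and g :: "nat => real" and j
 define A where "A f g t = (\<Sum>j<m. \<mu> j*Y f g j*e j t) + (\<Sum>i<r. g i*b i t)" for f g t
 define F where "F = PiE {1..<B} V"
 define P where "P = PiE {..<r + l} (%_. G)"
 define \<alpha> where "\<alpha> = (%(f, g). A f g) ` (F \<times> P)"
 have F: "finite F" "F ~= {}" "card F = (\<Prod>k\<in>{1..<B}. card (V k))"
  using V by (auto simp: F_def card_PiE PiE_eq_empty_iff intro: finite_PiE)
 have P: "finite P" "P ~= {}" "card P = card G^(r + l)"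
  using G by (auto simp: P_def card_PiE PiE_eq_empty_iff intro: finite_PiE)
 have "finite \<alpha>" "\<alpha> ~= {}" using F P by (auto simp: \<alpha>_def)
 moreover have "\<exists>p q. a = (%t. (\<Sum>j<m. p j*e j t) + (\<Sum>i<r. q i*b i t))" if "a : \<alpha>" for a
 proof -
  from that obtain f g where "a = A f g" by (auto simp: \<alpha>_def)
  then show ?thesis by (intro exI[of _ "%j. \<mu> j*Y f g j"] exI[of _ g]) (simp add: A_def fun_eq_iff)
 qed
 moreover have "real (card \<alpha>) <= (\<Prod>k\<in>{1..<B}. real (card (V k)))*(5*H^2)^(r + l)"
 proof -
  have "card \<alpha> <= card (F \<times> P)" unfolding \<alpha>_def by (rule card_image_le) (use F P in auto)
  then have "card \<alpha> <= card F*card P" by (simp add: card_cartesian_product)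
  then have "real (card \<alpha>) <= real (card F)*real (card P)" by (metis of_nat_le_iff of_nat_mult)
  also have "... = (\<Prod>k\<in>{1..<B}. real (card (V k)))*real (card G)^(r + l)" by (simp add: F P)
  also have "... <= (\<Prod>k\<in>{1..<B}. real (card (V k)))*(5*H^2)^(r + l)"
   using G by (intro mult_left_mono power_mono) (auto intro: prod_nonneg)
  finally show ?thesis .
 qed
 moreover have "\<exists>a\<in>\<alpha>. nm S (%t. (\<Sum>j<m. \<mu> j*y j*e j t) + (\<Sum>i<r. z i*b i t) - a t) <=
    sqrt (E^2*(\<Sum>j<B*l. (y j)^2) + (\<Sum>j\<in>{B*l..<m}. (\<mu> j*y j)^2)) +
    6*K*(B + r + l)/H*(1 + (\<Sum>j<B*l. (y j)^2) + (\<Sum>i<r. (z i)^2))" for y z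
 proof -
  define R where "R k = L2_set (%i. y (k*l + i)) {..<l}" for k
  define f where "f = restrict (%k. SOME v. v : V k & L2_set (%i. y (k*l + i) - v i) {..<l} <=
     \<epsilon> k * R k + 5/H + (R k)^2/H) {1..<B}"
  define x where "x k = (if k < r then z k else y (k - r))" for k
  define g where "g = restrict (%k. SOME g. g : G & \<bar>x k - g\<bar> <= 1/H + (x k)^2/H) {..<r + l}"
  have f: "f k : V k" "L2_set (%i. y (k*l + i) - f k i) {..<l} <= \<epsilon> k * R k + 5/H + (R k)^2/H"
   if "1 <= k" "k < B" for k
   using someI_ex[of "%v. v : V k & L2_set (%i. y (k*l + i) - v i) {..<l} <= \<epsilon> k * R k + 5/H + (R k)^2/H"]
    V(3)[OF that, of "%i. y (k*l + i)"] that by (auto simp: f_def R_def)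
  have g: "g k : G" "\<bar>x k - g k\<bar> <= 1/H + (x k)^2/H" if "k < r + l" for k
   using someI_ex[of "%g. g : G & \<bar>x k - g\<bar> <= 1/H + (x k)^2/H"] G(4)[of "x k"] that by (auto simp: g_def)
  have fF: "f : F" unfolding F_def by (rule PiE_I) (use f in \<open>auto simp: f_def\<close>)
  have gP: "g : P" unfolding P_def by (rule PiE_I) (use g in \<open>auto simp: g_def\<close>)
  define d where "d j = y j - Y f g j" for j
  have es: "\<And>j. j < m ==> e j : sqi S" using on by (auto simp: orthonormal_def)
  let ?E = "%t. \<Sum>j<m. (\<mu> j*d j)*e j t" and ?Z = "%t. \<Sum>i<r. (z i - g i)*b i t"
  have "nm S (%t. (\<Sum>j<m. \<mu> j*y j*e j t) + (\<Sum>i<r. z i*b i t) - A f g t) = nm S (%t. ?E t + ?Z t)"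
   by (simp add: A_def d_def left_diff_distrib right_diff_distrib sum_subtractf add_diff_add)
  also have "... <= nm S ?E + nm S ?Z"
   by (intro nm_triangle sqi_sum sqi_cmult) (use es b in auto)
  also have "nm S ?Z <= (\<Sum>i<r. nm S (%t. (z i - g i)*b i t))"
   by (intro nm_sum_le sqi_cmult) (use b in auto)
  also have "... <= (\<Sum>i<r. (1/H + (z i)^2/H)*K)"
  proof (rule sum_mono)
   fix i assume "i : {..<r}"
   then show "nm S (%t. (z i - g i)*b i t) <= (1/H + (z i)^2/H)*K"
    unfolding nm_cmult using g(2)[of i] b(2)[of i] H by (intro mult_mono) (auto simp: x_def nm_nonneg)
  qed
  finally have T1: "nm S (%t. (\<Sum>j<m. \<mu> j*y j*e j t) + (\<Sum>i<r. z i*b i t) - A f g t) <=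
    nm S ?E + (\<Sum>i<r. (1/H + (z i)^2/H)*K)" by simp
  have "(nm S ?E)^2 = (\<Sum>j<m. (\<mu> j*d j)^2)" by (rule nm_orthonormal_sum[OF on]) simp
  then have "nm S ?E = L2_set (%j. \<mu> j*d j) {..<m}"
   using real_sqrt_unique[of "nm S ?E"] nm_nonneg[of S ?E] by (simp add: L2_set_def)
  \<comment> \<open>The error of block k is split into a main part \<open>M k\<close> and a rounding
    part \<open>s k\<close>, which Minkowski's inequality over the blocks will separate. Block 0 has
    only a rounding part, so its slot in \<open>M\<close> holds the uncoded tail
    \<open>T\<close>.\<close>
  define T where "T = L2_set (%j. \<mu> j*y j) {B*l..<m}"
  define s where "s k = (if k = 0 then (\<Sum>j<l. (1/H + (y j)^2/H)*K) else K*(5/H + (R k)^2/H))" for k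
  define M where "M k = (if k = 0 then T else E * R k)" for k
  have R2: "(R k)^2 = (\<Sum>i<l. (y (k*l + i))^2)" for k by (simp add: R_def L2_set_def sum_nonneg)
  have R0: "R k >= 0" for k by (simp add: R_def)
  have s0: "s k >= 0" for k using H K by (auto simp: s_def intro!: sum_nonneg)
  have block: "(\<Sum>i<l. (\<mu> (k*l + i)*d (k*l + i))^2) <= (M k + s k)^2" if k: "1 <= k" "k < B" for k
  proof -
   have km: "k*l + i < m" "k*l + i < B*l" "\<not> k*l + i < l" if "i < l" for i
   proof -
    have "k*l + l <= B*l" using k mult_le_mono1[of "Suc k" B l] by simp
    then show "k*l + i < m" "k*l + i < B*l" using B that by linarith+
    have "l <= k*l" using k by simp
    then show "\<not> k*l + i < l" by linarith
   qed
   have "(\<Sum>i<l. (\<mu> (k*l + i)*d (k*l + i))^2) <= (\<Sum>i<l. (D k*(y (k*l + i) - f k i))^2)"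
   proof (rule sum_mono)
    fix i assume "i : {..<l}"
    then have i: "i < l" by simp
    have dd: "d (k*l + i) = y (k*l + i) - f k i" using km[OF i] i by (simp add: d_def Y_def)
    have "(\<mu> (k*l + i))^2 <= (D k)^2" using \<mu>(1)[OF km(1)[OF i]] D(1)[OF k, of "k*l + i"] i by (intro power_mono) auto
    then show "(\<mu> (k*l + i)*d (k*l + i))^2 <= (D k*(y (k*l + i) - f k i))^2"
     unfolding dd power_mult_distrib by (rule mult_right_mono) simp
   qed
   also have "... = (D k*L2_set (%i. y (k*l + i) - f k i) {..<l})^2"
    by (simp add: L2_set_def power_mult_distrib sum_distrib_left[symmetric] sum_nonneg)
   also have "... <= (M k + s k)^2"
   proof (rule power_mono)
    have "D k*L2_set (%i. y (k*l + i) - f k i) {..<l} <= D k*(\<epsilon> k * R k + 5/H + (R k)^2/H)"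
     using f(2)[OF k] D(2)[OF k] by (rule mult_left_mono)
    also have "... = D k*\<epsilon> k * R k + D k*(5/H + (R k)^2/H)" by (simp add: algebra_simps)
    also have "... <= E * R k + K*(5/H + (R k)^2/H)"
     using D(3,4)[OF k] R0 H by (intro add_mono mult_right_mono) auto
    finally show "D k*L2_set (%i. y (k*l + i) - f k i) {..<l} <= M k + s k"
     using k by (simp add: M_def s_def)
   qed (use D(2)[OF k] in simp)
   finally show ?thesis .
  qed
  have first: "L2_set (%j. \<mu> j*d j) {..<l} <= s 0"
  proof -
   have "L2_set (%j. \<mu> j*d j) {..<l} <= (\<Sum>j<l. \<bar>\<mu> j*d j\<bar>)" by (rule L2_set_le_sum_abs)
   also have "... <= (\<Sum>j<l. (1/H + (y j)^2/H)*K)"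
   proof (rule sum_mono)
    fix j assume "j : {..<l}"
    then have j: "j < l" by simp
    have "1*l <= B*l" using B by (intro mult_le_mono1) simp
    then have "l <= m" using B by linarith
    then have "0 <= \<mu> j" "\<mu> j <= K" using j \<mu> by auto
    moreover have "\<bar>d j\<bar> <= 1/H + (y j)^2/H" using g(2)[of "r + j"] j by (simp add: d_def Y_def x_def)
    ultimately have "\<bar>d j\<bar>*\<mu> j <= (1/H + (y j)^2/H)*K" using H by (intro mult_mono) auto
    then show "\<bar>\<mu> j*d j\<bar> <= (1/H + (y j)^2/H)*K" using \<open>0 \<le> \<mu> j\<close> by (simp add: abs_mult mult.commute)
   qed
   finally show ?thesis by (simp add: s_def)
  qed
  have "(\<Sum>j<m. (\<mu> j*d j)^2) = (\<Sum>j<B*l. (\<mu> j*d j)^2) + (\<Sum>j\<in>{B*l..<m}. (\<mu> j*d j)^2)"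
   using B(3) by (metis (lifting) lessThan_atLeast0 sum.atLeastLessThan_concat zero_le)
  also have "(\<Sum>j\<in>{B*l..<m}. (\<mu> j*d j)^2) = T^2"
  proof -
   have lB: "1*l <= B*l" using B by (intro mult_le_mono1) simp
   have "d j = y j" if "j >= B*l" for j
   proof -
    have "\<not> j < l" "\<not> j < B*l" using that lB by linarith+
    then show ?thesis by (simp add: d_def Y_def)
   qed
   then show ?thesis by (simp add: T_def L2_set_def sum_nonneg)
  qed
  also have "(\<Sum>j<B*l. (\<mu> j*d j)^2) = (\<Sum>k<B. \<Sum>i<l. (\<mu> (k*l + i)*d (k*l + i))^2)" by (rule sum_blocks)
  also have "... = (\<Sum>i<l. (\<mu> i*d i)^2) + (\<Sum>k\<in>{1..<B}. \<Sum>i<l. (\<mu> (k*l + i)*d (k*l + i))^2)"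
   using B(1) by (simp add: lessThan_atLeast0 sum.atLeast_Suc_lessThan)
  also have "... <= (s 0)^2 + (\<Sum>k\<in>{1..<B}. (M k + s k)^2)"
  proof (intro add_mono sum_mono)
   have "(L2_set (%j. \<mu> j*d j) {..<l})^2 <= (s 0)^2" using first by (intro power_mono) auto
   then show "(\<Sum>i<l. (\<mu> i*d i)^2) <= (s 0)^2" by (simp add: L2_set_def sum_nonneg)
  qed (use block in auto)
  finally have "(\<Sum>j<m. (\<mu> j*d j)^2) <= (s 0)^2 + (\<Sum>k\<in>{1..<B}. (M k + s k)^2) + T^2" by simp
  also have "... <= (M 0 + s 0)^2 + (\<Sum>k\<in>{1..<B}. (M k + s k)^2)"
  proof -
   have "T >= 0" by (simp add: T_def)
   then have "(s 0)^2 + T^2 <= (M 0 + s 0)^2" using s0[of 0] by (simp add: M_def power2_sum)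
   then show ?thesis by simp
  qed
  also have "... = (\<Sum>k<B. (M k + s k)^2)"
   using B(1) by (simp add: lessThan_atLeast0 sum.atLeast_Suc_lessThan)
  finally have "L2_set (%j. \<mu> j*d j) {..<m} <= L2_set (%k. M k + s k) {..<B}"
   unfolding L2_set_def by (rule real_sqrt_le_mono)
  also have "... <= L2_set M {..<B} + L2_set s {..<B}" by (rule L2_set_triangle_ineq)
  also have "L2_set s {..<B} <= (\<Sum>k<B. s k)" using L2_set_le_sum[of "{..<B}" s] s0 by auto
  also have "L2_set M {..<B} <= sqrt (E^2*(\<Sum>j<B*l. (y j)^2) + (\<Sum>j\<in>{B*l..<m}. (\<mu> j*y j)^2))"
   unfolding L2_set_def
  proof (rule real_sqrt_le_mono)
   have "(\<Sum>k<B. (M k)^2) = T^2 + (\<Sum>k\<in>{1..<B}. E^2*(R k)^2)"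
    using B(1) by (simp add: lessThan_atLeast0 sum.atLeast_Suc_lessThan M_def power_mult_distrib)
   also have "... <= T^2 + (\<Sum>k<B. E^2*(R k)^2)"
    by (intro add_left_mono sum_mono2) auto
   also have "(\<Sum>k<B. E^2*(R k)^2) = E^2*(\<Sum>j<B*l. (y j)^2)"
    by (simp add: R2 sum_blocks sum_distrib_left)
   finally show "(\<Sum>k<B. (M k)^2) <= E^2*(\<Sum>j<B*l. (y j)^2) + (\<Sum>j\<in>{B*l..<m}. (\<mu> j*y j)^2)"
    by (simp add: T_def L2_set_def sum_nonneg)
  qed
  finally have T2: "nm S ?E <= sqrt (E^2*(\<Sum>j<B*l. (y j)^2) + (\<Sum>j\<in>{B*l..<m}. (\<mu> j*y j)^2)) + (\<Sum>k<B. s k)"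
   using \<open>nm S ?E = _\<close> by simp
  define yy zz where "yy = (\<Sum>j<B*l. (y j)^2)" and "zz = (\<Sum>i<r. (z i)^2)"
  have yz0: "yy >= 0" "zz >= 0" by (auto simp: yy_def zz_def intro: sum_nonneg)
  have "(\<Sum>k<B. s k) = K/H*(l + (R 0)^2) + (\<Sum>k\<in>{1..<B}. K/H*(5 + (R k)^2))"
   using B(1) by (simp add: lessThan_atLeast0 sum.atLeast_Suc_lessThan s_def R2 sum.distrib sum_distrib_left
     sum_divide_distrib add_divide_distrib algebra_simps)
  also have "... = K/H*(l + 5*(real B - 1) + (\<Sum>k<B. (R k)^2))"
  proof -
   have 1: "(\<Sum>k\<in>{1..<B}. K/H*(5 + (R k)^2)) = K/H*(5*(real B - 1) + (\<Sum>k\<in>{1..<B}. (R k)^2))"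
    using B(1) by (subst sum_distrib_left[symmetric]) (simp add: sum.distrib of_nat_diff)
   have 2: "(\<Sum>k<B. (R k)^2) = (R 0)^2 + (\<Sum>k\<in>{1..<B}. (R k)^2)"
    using B(1) by (simp add: lessThan_atLeast0 sum.atLeast_Suc_lessThan)
   show ?thesis unfolding 1 2 by (simp only: distrib_left[symmetric] add.assoc add.left_commute)
  qed
  also have "(\<Sum>k<B. (R k)^2) = yy" by (simp add: R2 sum_blocks yy_def)
  finally have sB: "(\<Sum>k<B. s k) = K/H*(l + 5*(real B - 1) + yy)" .
  have sz: "(\<Sum>i<r. (1/H + (z i)^2/H)*K) = K/H*(r + zz)"
   by (simp add: zz_def sum.distrib sum_distrib_left sum_divide_distrib add_divide_distrib algebra_simps)
  have "(\<Sum>k<B. s k) + (\<Sum>i<r. (1/H + (z i)^2/H)*K) = K/H*(l + 5*(real B - 1) + yy + r + zz)"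
   unfolding sB sz by (simp add: algebra_simps)
  also have "... <= K/H*(6*(B + r + l)*(1 + yy + zz))"
  proof (rule mult_left_mono)
   have "1*(yy + zz) <= (6*(real B + r + l))*(yy + zz)" using B(1) yz0 by (intro mult_right_mono) auto
   then show "l + 5*(real B - 1) + yy + r + zz <= 6*(B + r + l)*(1 + yy + zz)"
    by (simp add: algebra_simps)
  qed (use K H in auto)
  finally have "(\<Sum>k<B. s k) + (\<Sum>i<r. (1/H + (z i)^2/H)*K) <= 6*K*(B + r + l)/H*(1 + yy + zz)"
   by (simp add: mult_ac)
  then have "nm S (%t. (\<Sum>j<m. \<mu> j*y j*e j t) + (\<Sum>i<r. z i*b i t) - A f g t) <=
    sqrt (E^2*(\<Sum>j<B*l. (y j)^2) + (\<Sum>j\<in>{B*l..<m}. (\<mu> j*y j)^2)) +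
    6*K*(B + r + l)/H*(1 + (\<Sum>j<B*l. (y j)^2) + (\<Sum>i<r. (z i)^2))"
   using T1 T2 unfolding yy_def zz_def by linarith
  then show ?thesis using fF gP unfolding \<alpha>_def by (intro bexI[of _ "A f g"]) auto
 qed
 ultimately show ?thesis by (intro exI[of _ \<alpha>]) blast
qed

section \<open>Gaussian lower bounds\<close>

lemma integral_iexp_normal:
 assumes s: "\<sigma> > 0"
 shows "(LINT x|lborel. iexp (u*x)*complex_of_real (normal_density 0 \<sigma> x)) = complex_of_real (exp (- (u*\<sigma>)\<^sup>2/2))"
proof -
 have "complex_of_real (exp (- (u*\<sigma>)\<^sup>2/2)) = char std_normal_distribution (u*\<sigma>)"
  by (simp add: char_std_normal_distribution)
 also have "... = (LINT x|lborel. std_normal_density x *\<^sub>R iexp (u*\<sigma>*x))"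
  unfolding char_def by (subst integral_density) (auto simp: normal_density_nonneg)
 also have "... = (LINT x|lborel. \<sigma> *\<^sub>R (iexp (u*(0 + \<sigma>*x))*complex_of_real (normal_density 0 \<sigma> (0 + \<sigma>*x))))"
  using s by (intro Bochner_Integration.integral_cong refl)
   (simp add: normal_density_def real_sqrt_mult power_mult_distrib scaleR_conv_of_real mult_ac)
 also have "... = (LINT x|lborel. iexp (u*x)*complex_of_real (normal_density 0 \<sigma> x))"
  using s by (subst lborel_integral_real_affine[where c = \<sigma> and t = 0]) (auto simp: )
 finally show ?thesis by simp
qed

text \<open>The weight \<open>exp (- \<alpha>*x^2)\<close> turns the standard normal density into
  \<sigma> times the centred normal density of variance \<open>1/(1 + 2*\<alpha>)\<close>.\<close>

lemma integral_iexp_gauss: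
 assumes a: "\<alpha> > 0"
 shows "(LINT x|std_normal_distribution. iexp (u*x)*complex_of_real (exp (- \<alpha>*x^2))) =
  complex_of_real (exp (- u\<^sup>2/(2*(1 + 2*\<alpha>)))/sqrt (1 + 2*\<alpha>))"
proof -
 define \<sigma> where "\<sigma> = 1/sqrt (1 + 2*\<alpha>)"
 have s: "\<sigma> > 0" using a by (simp add: \<sigma>_def)
 have s2: "\<sigma>^2 = 1/(1 + 2*\<alpha>)" using a by (simp add: \<sigma>_def power_divide)
 have dens: "std_normal_density x*exp (- \<alpha>*x^2) = \<sigma>*normal_density 0 \<sigma> x" for x
 proof -
  have "- x\<^sup>2/2 + - \<alpha>*x^2 = - x\<^sup>2/(2*\<sigma>^2)" using a unfolding s2 by (simp add: field_simps)
  then show ?thesis using s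
   by (simp add: normal_density_def real_sqrt_mult exp_add[symmetric] field_simps)
 qed
 have "(LINT x|std_normal_distribution. iexp (u*x)*complex_of_real (exp (- \<alpha>*x^2))) =
  (LINT x|lborel. std_normal_density x *\<^sub>R (iexp (u*x)*complex_of_real (exp (- \<alpha>*x^2))))"
  by (subst integral_density) (auto simp: normal_density_nonneg)
 also have "... = (LINT x|lborel. complex_of_real \<sigma>*(iexp (u*x)*complex_of_real (normal_density 0 \<sigma> x)))"
 proof (intro Bochner_Integration.integral_cong refl)
  fix x
  have "complex_of_real (std_normal_density x)*complex_of_real (exp (- \<alpha>*x^2)) = complex_of_real \<sigma>*complex_of_real (normal_density 0 \<sigma> x)"
   unfolding of_real_mult[symmetric] dens ..
  then show "std_normal_density x *\<^sub>R (iexp (u*x)*complex_of_real (exp (- \<alpha>*x^2))) =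
   complex_of_real \<sigma>*(iexp (u*x)*complex_of_real (normal_density 0 \<sigma> x))"
   unfolding scaleR_conv_of_real by (metis (no_types) mult.left_commute)
 qed
 also have "... = complex_of_real \<sigma>*complex_of_real (exp (- (u*\<sigma>)\<^sup>2/2))"
  unfolding integral_mult_right_zero integral_iexp_normal[OF s] ..
 also have "... = complex_of_real (exp (- u\<^sup>2/(2*(1 + 2*\<alpha>)))/sqrt (1 + 2*\<alpha>))"
 proof -
  have "- (u*\<sigma>)\<^sup>2/2 = - u\<^sup>2/(2*(1 + 2*\<alpha>))" by (simp add: power_mult_distrib s2)
  then show ?thesis unfolding of_real_mult[symmetric] by (simp only: \<sigma>_def) simp
 qed
 finally show ?thesis .
qed

text \<open>The last clause is the value of these integrals for d independent standard normal
  variables. It is taken as the definition since the lower bounds draw on the law through exactly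
  such integrals and the second moments.\<close>

definition gauss_system :: "'a measure => nat => (nat => 'a => real) => bool" where
 "gauss_system M d \<eta> \<longleftrightarrow> prob_space M & (\<forall>j<d. \<eta> j : sqi M & (LINT \<omega>|M. (\<eta> j \<omega>)^2) = 1) &
   (\<forall>\<alpha> b. (\<forall>j<d. 0 < \<alpha> j) --> (LINT \<omega>|M. exp (- (\<Sum>j<d. \<alpha> j*(\<eta> j \<omega> - b j)^2))) =
    (\<Prod>j<d. exp (- (\<alpha> j*(b j)^2)/(1 + 2*\<alpha> j))/sqrt (1 + 2*\<alpha> j)))"

text \<open>Each Gaussian factor is replaced by the Fourier integral of a Gaussian, one coordinate at a
 time, so that only the joint characteristic function is needed.\<close>

lemma gauss_formula_from_char:
 fixes \<eta> :: "nat => 'a => real"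
 assumes M: "prob_space M" and \<eta>: "\<And>j. j < d ==> \<eta> j : borel_measurable M"
  and char: "\<And>s. (LINT \<omega>|M. iexp (\<Sum>j<d. s j*\<eta> j \<omega>)) = complex_of_real (exp (- (\<Sum>j<d. (s j)^2)/2))"
  and \<alpha>: "\<And>j. j < d ==> 0 < \<alpha> j"
 shows "(LINT \<omega>|M. exp (- (\<Sum>j<d. \<alpha> j*(\<eta> j \<omega> - b j)^2))) =
    (\<Prod>j<d. exp (- (\<alpha> j*(b j)^2)/(1 + 2*\<alpha> j))/sqrt (1 + 2*\<alpha> j))"
proof -
 interpret M: prob_space M by fact
 interpret S: prob_space std_normal_distribution by (rule prob_space_normal_density) simp
 interpret P: pair_prob_space M std_normal_distribution ..
 note \<eta>[measurable]
 define G where "G k \<omega> = (\<Prod>j<k. exp (- \<alpha> j*(\<eta> j \<omega> - b j)^2))" for k \<omega>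
 define c where "c j = exp (- (\<alpha> j*(b j)^2)/(1 + 2*\<alpha> j))/sqrt (1 + 2*\<alpha> j)" for j
 have Gm: "G k : borel_measurable M" if "k <= d" for k
 proof -
  have [measurable]: "\<eta> j : borel_measurable M" if "j < k" for j using \<eta>[of j] that \<open>k \<le> d\<close> by simp
  show ?thesis unfolding G_def by measurable
 qed
 have G1: "0 <= G k \<omega>" "G k \<omega> <= 1" if "k <= d" for k \<omega>
  unfolding G_def using that \<alpha> by (auto intro!: prod_nonneg prod_le_1 simp: less_imp_le)
 \<comment> \<open>Induction on the number k of converted coordinates: the first k carry their
   Gaussian factor, the others still a character. The assertion is the case k = d.\<close>
 have claim: "(LINT \<omega>|M. complex_of_real (G k \<omega>)*iexp (\<Sum>j\<in>{k..<d}. s j*\<eta> j \<omega>)) =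
   complex_of_real ((\<Prod>j<k. c j)*exp (- (\<Sum>j\<in>{k..<d}. (s j)^2)/2))" if "k <= d" for k s
  using that
 proof (induction k arbitrary: s)
  case 0
  show ?case using char[of s] by (simp add: G_def lessThan_atLeast0)
 next
  case (Suc k)
  then have k: "k < d" "k <= d" by auto
  have [measurable]: "G k : borel_measurable M" by (rule Gm[OF k(2)])
  have [measurable]: "\<eta> k : borel_measurable M" by (rule \<eta>[OF k(1)])
  define S where "S \<omega> = (\<Sum>j\<in>{Suc k..<d}. s j*\<eta> j \<omega>)" for \<omega>
  have [measurable]: "S : borel_measurable M" unfolding S_def
   by (intro borel_measurable_sum borel_measurable_times borel_measurable_const \<eta>) auto
  define a where "a = sqrt (2*\<alpha> k)"
  have a2: "a^2 = 2*\<alpha> k" using \<alpha>[OF k(1)] by (simp add: a_def)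
  \<comment> \<open>\<open>exp (- y^2/2)\<close> is the characteristic function of the standard
    normal law; \<open>a\<close> with \<open>a^2 = 2*\<alpha> k\<close> rescales it to the wanted
    factor.\<close>
  have four: "complex_of_real (exp (- \<alpha> k*(\<eta> k \<omega> - b k)^2)) =
    (LINT z|std_normal_distribution. iexp (a*(\<eta> k \<omega> - b k)*z))" for \<omega>
  proof -
   have "(LINT z|std_normal_distribution. iexp (a*(\<eta> k \<omega> - b k)*z)) =
    char std_normal_distribution (a*(\<eta> k \<omega> - b k))" by (simp add: char_def)
   then show ?thesis by (simp add: char_std_normal_distribution power_mult_distrib a2)
  qed
  let ?h = "%\<omega> z. complex_of_real (G k \<omega>)*iexp (a*(\<eta> k \<omega> - b k)*z + S \<omega>)"
  have hm: "(%(\<omega>, z). ?h \<omega> z) : borel_measurable (M \<Otimes>\<^sub>M std_normal_distribution)"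
   by measurable
  have int: "integrable (M \<Otimes>\<^sub>M std_normal_distribution) (%(\<omega>, z). ?h \<omega> z)"
   using G1[OF k(2)] hm by (intro P.integrable_const_bound[of _ 1]) (auto simp: norm_mult)
  have "(LINT \<omega>|M. complex_of_real (G (Suc k) \<omega>)*iexp (S \<omega>)) =
   (LINT \<omega>|M. (LINT z|std_normal_distribution. ?h \<omega> z))"
  proof (rule Bochner_Integration.integral_cong[OF refl])
   fix \<omega>
   have "(LINT z|std_normal_distribution. ?h \<omega> z) =
    (LINT z|std_normal_distribution. complex_of_real (G k \<omega>)*iexp (S \<omega>)*iexp (a*(\<eta> k \<omega> - b k)*z))"
    by (intro Bochner_Integration.integral_cong refl) (simp only: of_real_add distrib_left exp_add mult_ac)
   also have "... = complex_of_real (G k \<omega>)*iexp (S \<omega>)*complex_of_real (exp (- \<alpha> k*(\<eta> k \<omega> - b k)^2))"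
    unfolding four by (rule integral_mult_right_zero)
   also have "... = complex_of_real (G (Suc k) \<omega>)*iexp (S \<omega>)"
    by (simp add: G_def mult_ac)
   finally show "complex_of_real (G (Suc k) \<omega>)*iexp (S \<omega>) = (LINT z|std_normal_distribution. ?h \<omega> z)" ..
  qed
  also have "... = (LINT z|std_normal_distribution. (LINT \<omega>|M. ?h \<omega> z))"
   using P.Fubini_integral[OF int] by simp
  also have "... = (LINT z|std_normal_distribution. complex_of_real ((\<Prod>j<k. c j)*exp (- (\<Sum>j\<in>{Suc k..<d}. (s j)^2)/2)) *
    (iexp (- a*b k*z)*complex_of_real (exp (- \<alpha> k*z^2))))"
  proof (rule Bochner_Integration.integral_cong[OF refl])
   fix z
   \<comment> \<open>For fixed z the new factor is one more character, of frequency a*z in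
     coordinate k, so the induction hypothesis applies to the updated \<open>s\<close>.\<close>
   let ?s = "s(k := a*z)"
   have "?h \<omega> z = iexp (- a*b k*z)*(complex_of_real (G k \<omega>)*iexp (\<Sum>j\<in>{k..<d}. ?s j*\<eta> j \<omega>))" for \<omega>
   proof -
    have "(\<Sum>j\<in>{k..<d}. ?s j*\<eta> j \<omega>) = a*z*\<eta> k \<omega> + S \<omega>"
     using k by (simp add: sum.atLeast_Suc_lessThan S_def)
    then have "a*(\<eta> k \<omega> - b k)*z + S \<omega> = - a*b k*z + (\<Sum>j\<in>{k..<d}. ?s j*\<eta> j \<omega>)"
     by (simp add: algebra_simps)
    then show ?thesis by (simp only: of_real_add distrib_left exp_add mult_ac)
   qed
   then have "(LINT \<omega>|M. ?h \<omega> z) = iexp (- a*b k*z)*(LINT \<omega>|M. complex_of_real (G k \<omega>)*iexp (\<Sum>j\<in>{k..<d}. ?s j*\<eta> j \<omega>))"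
    by (simp only: integral_mult_right_zero)
   also have "... = iexp (- a*b k*z)*complex_of_real ((\<Prod>j<k. c j)*exp (- (\<Sum>j\<in>{k..<d}. (?s j)^2)/2))"
    unfolding Suc.IH[OF k(2)] ..
   also have "(\<Sum>j\<in>{k..<d}. (?s j)^2) = 2*\<alpha> k*z^2 + (\<Sum>j\<in>{Suc k..<d}. (s j)^2)"
    using k by (simp add: sum.atLeast_Suc_lessThan power_mult_distrib a2)
   also have "- (2*\<alpha> k*z^2 + (\<Sum>j\<in>{Suc k..<d}. (s j)^2))/2 = - \<alpha> k*z^2 + - (\<Sum>j\<in>{Suc k..<d}. (s j)^2)/2"
    by (simp add: field_simps)
   finally show "(LINT \<omega>|M. ?h \<omega> z) = complex_of_real ((\<Prod>j<k. c j)*exp (- (\<Sum>j\<in>{Suc k..<d}. (s j)^2)/2)) *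
    (iexp (- a*b k*z)*complex_of_real (exp (- \<alpha> k*z^2)))"
    by (simp only: exp_add of_real_mult mult_ac)
  qed
  also have "... = complex_of_real ((\<Prod>j<k. c j)*exp (- (\<Sum>j\<in>{Suc k..<d}. (s j)^2)/2)) *
    complex_of_real (exp (- (- a*b k)\<^sup>2/(2*(1 + 2*\<alpha> k)))/sqrt (1 + 2*\<alpha> k))"
   by (subst integral_mult_right_zero, subst integral_iexp_gauss[OF \<alpha>[OF k(1)]]) (rule refl)
  also have "exp (- (- a*b k)\<^sup>2/(2*(1 + 2*\<alpha> k)))/sqrt (1 + 2*\<alpha> k) = c k"
  proof -
   have "(- a*b k)^2/(2*(1 + 2*\<alpha> k)) = \<alpha> k*(b k)^2/(1 + 2*\<alpha> k)"
    using mult_divide_mult_cancel_left[of 2 "\<alpha> k*(b k)^2" "1 + 2*\<alpha> k"]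
    by (simp add: power_mult_distrib a2 mult.assoc del: distrib_left_numeral)
   then show ?thesis by (simp add: c_def)
  qed
  finally show ?case unfolding S_def by (simp add: mult_ac)
 qed
 have "complex_of_real (LINT \<omega>|M. exp (- (\<Sum>j<d. \<alpha> j*(\<eta> j \<omega> - b j)^2))) = (LINT \<omega>|M. complex_of_real (G d \<omega>))"
  by (simp add: G_def exp_sum[symmetric] sum_negf)
 also have "... = complex_of_real (\<Prod>j<d. c j)" using claim[of d "%_. 0"] by simp
 finally show ?thesis unfolding c_def of_real_eq_iff .
qed

text \<open>The point is a bound independent of the centre \<open>a\<close>. After completing the
  square, \<open>a j\<close> enters through the exponent \<open>\<Lambda>*(a
  j)^2*(2*\<Lambda>*(\<sigma> j)^2/(1 + 2*\<alpha> j) - 1)\<close>, which is nonpositive because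
  \<open>w j <= 1/2\<close>.\<close>

lemma gauss_exp_bound:
 fixes \<eta> :: "nat => 'a => real" and \<sigma> w a :: "nat => real"
 assumes g: "gauss_system M d \<eta>" and l: "\<Lambda> > 0"
  and w: "\<And>j. j < d ==> w j <= 1/2" "\<And>j. j < d ==> w j < \<Lambda>*(\<sigma> j)^2"
 shows "integrable M (%\<omega>. exp (- \<Lambda>*(\<Sum>j<d. (\<sigma> j*\<eta> j \<omega> - a j)^2) + (\<Sum>j<d. w j*(\<eta> j \<omega>)^2)))" (is ?I)
  and "(LINT \<omega>|M. exp (- \<Lambda>*(\<Sum>j<d. (\<sigma> j*\<eta> j \<omega> - a j)^2) + (\<Sum>j<d. w j*(\<eta> j \<omega>)^2))) <=
   (\<Prod>j<d. 1/sqrt (1 + 2*\<Lambda>*(\<sigma> j)^2 - 2*w j))" (is ?B)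
proof -
 interpret prob_space M using g by (simp add: gauss_system_def)
 define \<alpha> where "\<alpha> j = \<Lambda>*(\<sigma> j)^2 - w j" for j
 define b where "b j = \<Lambda>*\<sigma> j*a j/\<alpha> j" for j
 have \<alpha>: "\<alpha> j > 0" if "j < d" for j using w(2)[OF that] by (simp add: \<alpha>_def)
 have [measurable]: "\<eta> j : borel_measurable M" if "j < d" for j
  using g that by (auto simp: gauss_system_def sqi_def)
 define K where "K = (\<Sum>j<d. \<alpha> j*(b j)^2 - \<Lambda>*(a j)^2)"
 have eq: "- \<Lambda>*(\<Sum>j<d. (\<sigma> j*\<eta> j \<omega> - a j)^2) + (\<Sum>j<d. w j*(\<eta> j \<omega>)^2) =
   K + - (\<Sum>j<d. \<alpha> j*(\<eta> j \<omega> - b j)^2)" for \<omega>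
 proof -
  have "- \<Lambda>*(\<sigma> j*x - a j)^2 + w j*x^2 = (\<alpha> j*(b j)^2 - \<Lambda>*(a j)^2) - \<alpha> j*(x - b j)^2" if "j < d" for j x
  proof -
   have ab: "\<alpha> j*b j = \<Lambda>*\<sigma> j*a j" using \<alpha>[OF that] by (simp add: b_def)
   have "(\<alpha> j*(b j)^2 - \<Lambda>*(a j)^2) - \<alpha> j*(x - b j)^2 = 2*(\<alpha> j*b j)*x - \<Lambda>*(a j)^2 - \<alpha> j*x^2"
    by (simp add: power2_eq_square algebra_simps)
   then show ?thesis unfolding ab by (simp add: \<alpha>_def power2_eq_square algebra_simps)
  qed
  then have "(\<Sum>j<d. - \<Lambda>*(\<sigma> j*\<eta> j \<omega> - a j)^2 + w j*(\<eta> j \<omega>)^2) =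
   (\<Sum>j<d. (\<alpha> j*(b j)^2 - \<Lambda>*(a j)^2) - \<alpha> j*(\<eta> j \<omega> - b j)^2)"
   by (intro sum.cong) auto
  then show ?thesis by (simp add: K_def sum.distrib sum_subtractf sum_distrib_left sum_negf)
 qed
 have int: "integrable M (%\<omega>. exp (- (\<Sum>j<d. \<alpha> j*(\<eta> j \<omega> - b j)^2)))"
  using \<alpha> by (intro integrable_const_bound[of _ 1]) (auto intro!: sum_nonneg mult_nonneg_nonneg simp: less_imp_le)
 show ?I unfolding eq exp_add using int by simp
 have "(LINT \<omega>|M. exp (- \<Lambda>*(\<Sum>j<d. (\<sigma> j*\<eta> j \<omega> - a j)^2) + (\<Sum>j<d. w j*(\<eta> j \<omega>)^2))) =
  exp K*(\<Prod>j<d. exp (- (\<alpha> j*(b j)^2)/(1 + 2*\<alpha> j))/sqrt (1 + 2*\<alpha> j))"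
  unfolding eq exp_add using g \<alpha> by (simp add: gauss_system_def)
 also have "... = (\<Prod>j<d. exp (\<alpha> j*(b j)^2 - \<Lambda>*(a j)^2 - (\<alpha> j*(b j)^2)/(1 + 2*\<alpha> j))/sqrt (1 + 2*\<alpha> j))"
  unfolding K_def exp_sum[OF finite_lessThan] prod.distrib[symmetric]
  by (intro prod.cong refl) (simp add: exp_add[symmetric])
 also have "... <= (\<Prod>j<d. 1/sqrt (1 + 2*\<Lambda>*(\<sigma> j)^2 - 2*w j))"
 proof (rule prod_mono, intro conjI)
  fix j assume "j : {..<d}"
  then have j: "j < d" by simp
  have a1: "1 + 2*\<alpha> j = 1 + 2*\<Lambda>*(\<sigma> j)^2 - 2*w j" by (simp add: \<alpha>_def)
  have ab: "\<alpha> j*b j = \<Lambda>*\<sigma> j*a j" using \<alpha>[OF j] by (simp add: b_def)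
  have "\<alpha> j*(b j)^2 - (\<alpha> j*(b j)^2)/(1 + 2*\<alpha> j) = 2*(\<alpha> j*b j)^2/(1 + 2*\<alpha> j)"
   using \<alpha>[OF j] by (simp add: field_simps power2_eq_square)
  also have "... = \<Lambda>*(a j)^2*(2*\<Lambda>*(\<sigma> j)^2/(1 + 2*\<alpha> j))"
   unfolding ab by (simp add: power2_eq_square)
  also have "... <= \<Lambda>*(a j)^2*1"
  proof (rule mult_left_mono)
   have "2*\<Lambda>*(\<sigma> j)^2 <= 1 + 2*\<alpha> j" using w(1)[OF j] unfolding a1 by simp
   then show "2*\<Lambda>*(\<sigma> j)^2/(1 + 2*\<alpha> j) <= 1" using \<alpha>[OF j] by (subst divide_le_eq_1_pos) auto
  qed (use l in simp)
  finally have "\<alpha> j*(b j)^2 - \<Lambda>*(a j)^2 - (\<alpha> j*(b j)^2)/(1 + 2*\<alpha> j) <= 0" by simp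
  then show "exp (\<alpha> j*(b j)^2 - \<Lambda>*(a j)^2 - (\<alpha> j*(b j)^2)/(1 + 2*\<alpha> j))/sqrt (1 + 2*\<alpha> j) <=
   1/sqrt (1 + 2*\<Lambda>*(\<sigma> j)^2 - 2*w j)"
   unfolding a1[symmetric] using \<alpha>[OF j] by (intro divide_right_mono) auto
  show "0 <= exp (\<alpha> j*(b j)^2 - \<Lambda>*(a j)^2 - (\<alpha> j*(b j)^2)/(1 + 2*\<alpha> j))/sqrt (1 + 2*\<alpha> j)"
   using \<alpha>[OF j] by simp
 qed
 finally show ?B .
qed

text \<open>The best code word depends on \<omega>, but its exponential is at most the sum over all
  code words. This is the place where the cardinality of the code enters.\<close>

lemma gauss_sum_exp_bound:
 fixes \<eta> :: "nat => 'a => real" and \<sigma> w :: "nat => real" and A :: "(nat => real) set"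
 assumes g: "gauss_system M d \<eta>" and l: "\<Lambda> > 0"
  and w: "\<And>j. j < d ==> w j <= 1/2" "\<And>j. j < d ==> w j < \<Lambda>*(\<sigma> j)^2"
  and f: "integrable M f"
  and le: "AE \<omega> in M. \<exists>a\<in>A. f \<omega> <= exp (- \<Lambda>*(\<Sum>j<d. (\<sigma> j*\<eta> j \<omega> - a j)^2) + (\<Sum>j<d. w j*(\<eta> j \<omega>)^2))"
  and A: "finite A"
 shows "(LINT \<omega>|M. f \<omega>) <= card A*(\<Prod>j<d. 1/sqrt (1 + 2*\<Lambda>*(\<sigma> j)^2 - 2*w j))"
proof -
 let ?e = "%a \<omega>. exp (- \<Lambda>*(\<Sum>j<d. (\<sigma> j*\<eta> j \<omega> - a j)^2) + (\<Sum>j<d. w j*(\<eta> j \<omega>)^2))"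
 have int: "integrable M (?e a)" for a using gauss_exp_bound(1)[OF g l w] by simp
 have "(LINT \<omega>|M. f \<omega>) <= (LINT \<omega>|M. (\<Sum>a\<in>A. ?e a \<omega>))"
 proof (rule integral_mono_AE[OF f])
  show "integrable M (%\<omega>. \<Sum>a\<in>A. ?e a \<omega>)" by (intro Bochner_Integration.integrable_sum int)
  show "AE \<omega> in M. f \<omega> <= (\<Sum>a\<in>A. ?e a \<omega>)"
   using le
  proof eventually_elim
   case (elim \<omega>)
   then obtain a where a: "a : A" "f \<omega> <= ?e a \<omega>" by blast
   have "?e a \<omega> <= (\<Sum>a\<in>A. ?e a \<omega>)" by (rule member_le_sum[OF a(1)]) (use A in auto)
   with a(2) show ?case by linarith
  qed
 qed
 also have "... = (\<Sum>a\<in>A. \<integral>\<omega>. ?e a \<omega> \<partial>M)" by (intro Bochner_Integration.integral_sum int)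
 also have "... <= (\<Sum>a\<in>A. (\<Prod>j<d. 1/sqrt (1 + 2*\<Lambda>*(\<sigma> j)^2 - 2*w j)))"
  by (intro sum_mono gauss_exp_bound(2)[OF g l w])
 finally show ?thesis by simp
qed

text \<open>Shannon's lower bound: Jensen's inequality for the tilted exponential of the distortion.\<close>

lemma gauss_quantization_lower:
 fixes \<eta> :: "nat => 'a => real" and \<sigma> w :: "nat => real" and A :: "(nat => real) set"
 assumes g: "gauss_system M d \<eta>" and l: "\<Lambda> > 0"
  and w: "\<And>j. j < d ==> w j <= 1/2" "\<And>j. j < d ==> w j < \<Lambda>*(\<sigma> j)^2"
  and F: "integrable M F"
  and le: "AE \<omega> in M. \<exists>a\<in>A. (\<Sum>j<d. (\<sigma> j*\<eta> j \<omega> - a j)^2) <= F \<omega>"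
  and A: "finite A" "A ~= {}"
 shows "\<Lambda>*(LINT \<omega>|M. F \<omega>) >= (\<Sum>j<d. w j) - ln (card A) + (\<Sum>j<d. ln (1 + 2*\<Lambda>*(\<sigma> j)^2 - 2*w j))/2"
proof -
 interpret prob_space M using g by (simp add: gauss_system_def)
 have \<eta>i: "integrable M (%\<omega>. (\<eta> j \<omega>)^2)" "(LINT \<omega>|M. (\<eta> j \<omega>)^2) = 1" if "j < d" for j
  using g that by (auto simp: gauss_system_def sqi_def)
 define G where "G \<omega> = - \<Lambda>*F \<omega> + (\<Sum>j<d. w j*(\<eta> j \<omega>)^2)" for \<omega>
 have Gi: "integrable M G" unfolding G_def using F \<eta>i
  by (intro Bochner_Integration.integrable_add Bochner_Integration.integrable_sum integrable_mult_right) auto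
 define E where "E = (LINT \<omega>|M. G \<omega>)"
 have "E = - \<Lambda>*(LINT \<omega>|M. F \<omega>) + (\<Sum>j<d. \<integral>\<omega>. w j*(\<eta> j \<omega>)^2 \<partial>M)"
  unfolding E_def G_def using F \<eta>i
  by (subst Bochner_Integration.integral_add, (auto)[2], subst Bochner_Integration.integral_sum) auto
 also have "(\<Sum>j<d. \<integral>\<omega>. w j*(\<eta> j \<omega>)^2 \<partial>M) = (\<Sum>j<d. w j)" using \<eta>i by (intro sum.cong) auto
 finally have Eeq: "E = - \<Lambda>*(LINT \<omega>|M. F \<omega>) + (\<Sum>j<d. w j)" .
 define Q where "Q = (\<Prod>j<d. 1/sqrt (1 + 2*\<Lambda>*(\<sigma> j)^2 - 2*w j))"
 have pos: "1 + 2*\<Lambda>*(\<sigma> j)^2 - 2*w j > 0" if "j < d" for j using w[OF that] by simp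
 have Q0: "Q > 0" unfolding Q_def using pos by (intro prod_pos) auto
 \<comment> \<open>Jensen's inequality through the tangent of exp at the mean \<open>E\<close>: the
   affine minorant is integrable because \<open>G\<close> is, and its integral is
   \<open>exp E\<close>.\<close>
 have "(LINT \<omega>|M. exp E*(1 + (G \<omega> - E))) <= card A*Q"
  unfolding Q_def
 proof (rule gauss_sum_exp_bound[OF g l w _ _ A(1)])
  show "integrable M (%\<omega>. exp E*(1 + (G \<omega> - E)))" using Gi by auto
  show "AE \<omega> in M. \<exists>a\<in>A. exp E*(1 + (G \<omega> - E)) <= exp (- \<Lambda>*(\<Sum>j<d. (\<sigma> j*\<eta> j \<omega> - a j)^2) + (\<Sum>j<d. w j*(\<eta> j \<omega>)^2))"
   using le
  proof eventually_elim
   case (elim \<omega>)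
   then obtain a where a: "a : A" "(\<Sum>j<d. (\<sigma> j*\<eta> j \<omega> - a j)^2) <= F \<omega>" by blast
   have "exp E*(1 + (G \<omega> - E)) <= exp E*exp (G \<omega> - E)" by (intro mult_left_mono exp_ge_add_one_self) simp
   also have "... = exp (G \<omega>)" by (simp add: exp_add[symmetric])
   also have "... <= exp (- \<Lambda>*(\<Sum>j<d. (\<sigma> j*\<eta> j \<omega> - a j)^2) + (\<Sum>j<d. w j*(\<eta> j \<omega>)^2))"
    using a(2) l by (simp add: G_def)
   finally show ?case using a(1) by blast
  qed
 qed
 moreover have "(LINT \<omega>|M. exp E*(1 + (G \<omega> - E))) = exp E"
  using Gi by (simp add: prob_space E_def)
 ultimately have "exp E <= card A*Q" by simp
 then have "E <= ln (card A*Q)" using Q0 A by (simp add: ln_ge_iff card_gt_0_iff)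
 also have "... = ln (card A) + ln Q" using Q0 A by (intro ln_mult_pos) (auto simp: card_gt_0_iff)
 also have "ln Q = (\<Sum>j<d. - ln (1 + 2*\<Lambda>*(\<sigma> j)^2 - 2*w j)/2)"
  unfolding Q_def
 proof (subst ln_prod)
  show "(\<Sum>j<d. ln (1/sqrt (1 + 2*\<Lambda>*(\<sigma> j)^2 - 2*w j))) = (\<Sum>j<d. - ln (1 + 2*\<Lambda>*(\<sigma> j)^2 - 2*w j)/2)"
  proof (rule sum.cong[OF refl])
   fix j assume "j : {..<d}"
   then have "1 + 2*\<Lambda>*(\<sigma> j)^2 - 2*w j > 0" using pos by simp
   then show "ln (1/sqrt (1 + 2*\<Lambda>*(\<sigma> j)^2 - 2*w j)) = - ln (1 + 2*\<Lambda>*(\<sigma> j)^2 - 2*w j)/2"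
    by (subst ln_div) (auto simp: ln_sqrt)
  qed
 next
  fix j assume "j : {..<d}"
  then have "1 + 2*\<Lambda>*(\<sigma> j)^2 - 2*w j > 0" using pos by simp
  then have "1/sqrt (1 + 2*\<Lambda>*(\<sigma> j)^2 - 2*w j) > 0" by simp
  then show "1/sqrt (1 + 2*\<Lambda>*(\<sigma> j)^2 - 2*w j) ~= 0" by linarith
 qed simp
 also have "... = - (\<Sum>j<d. ln (1 + 2*\<Lambda>*(\<sigma> j)^2 - 2*w j))/2"
  by (simp add: sum_negf sum_divide_distrib)
 finally show ?thesis unfolding Eeq by simp
qed

text \<open>Chebyshev's inequality is applied to \<open>exp (- (N/d))\<close> instead of the squared
  norm N, since \<open>gauss_system\<close> provides exponential integrals. The mean tends to
  \<open>exp (- 1)\<close> and the second moment to \<open>exp (- 2)\<close>, so the variance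
  vanishes. The threshold depends on \<delta> alone and not on the system.\<close>

lemma gauss_norm_concentration:
 fixes \<delta> :: real
 assumes d: "\<delta> > 0"
 shows "\<exists>d0>0. \<forall>d\<ge>d0. \<forall>(M :: 'a measure) \<eta>. gauss_system M d \<eta> -->
  measure M {\<omega> : space M. (1 - \<delta>)*d <= (\<Sum>j<d. (\<eta> j \<omega>)^2) & (\<Sum>j<d. (\<eta> j \<omega>)^2) <= (1 + \<delta>)*d} >= 1/2"
proof -
 \<comment> \<open>Half of the smaller gap between \<open>exp (- 1)\<close> and the values at
   relative squared norm 1 - \<delta> and 1 + \<delta>: one \<kappa> is spent on the error of the
   mean, the other on the deviation.\<close>
 define \<kappa> where "\<kappa> = min (exp (- 1) - exp (- 1 - \<delta>)) (exp (- 1 + \<delta>) - exp (- 1))/2"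
 have k: "\<kappa> > 0" using d by (simp add: \<kappa>_def)
 let ?m = "%\<alpha> d. (1/sqrt (1 + 2*(\<alpha>/real d)))^d"
 have lim1: "(%d. ?m 1 d) \<longlonglongrightarrow> exp (- 1)" and lim2: "(%d. ?m 2 d - (?m 1 d)^2) \<longlonglongrightarrow> 0"
 proof -
  have eq: "eventually (%d. ?m \<alpha> d = (1 + 2*(\<alpha>/real d)) powr (- real d/2)) sequentially" if "\<alpha> > 0" for \<alpha> :: real
   using eventually_gt_at_top[of 0]
  proof eventually_elim
   case (elim d)
   have p: "1 + 2*(\<alpha>/real d) > 0" using that elim by (simp add: add_pos_pos)
   then have "1/sqrt (1 + 2*(\<alpha>/real d)) = (1 + 2*(\<alpha>/real d)) powr (- 1/2)"
    by (simp add: powr_half_sqrt[symmetric] powr_minus_divide)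
   then show ?case using p by (simp add: powr_realpow[symmetric] powr_powr mult.commute)
  qed
  have "(%d. (1 + 2*(1/real d)) powr (- real d/2)) \<longlonglongrightarrow> exp (- 1)" by real_asymp
  then show "(%d. ?m 1 d) \<longlonglongrightarrow> exp (- 1)" using eq[of 1] by (simp add: filterlim_cong)
  moreover have "(%d. (1 + 2*(2/real d)) powr (- real d/2)) \<longlonglongrightarrow> exp (- 2)" by real_asymp
  then have "(%d. ?m 2 d) \<longlonglongrightarrow> exp (- 2)" using eq[of 2] by (simp add: filterlim_cong)
  ultimately have "(%d. ?m 2 d - (?m 1 d)^2) \<longlonglongrightarrow> exp (- 2) - (exp (- 1))^2"
   by (intro tendsto_diff tendsto_power)
  then show "(%d. ?m 2 d - (?m 1 d)^2) \<longlonglongrightarrow> 0" by (simp add: exp_double[symmetric])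
 qed
 have "eventually (%d. \<bar>?m 1 d - exp (- 1)\<bar> < \<kappa>) sequentially"
  using lim1 k unfolding tendsto_iff dist_real_def by blast
 moreover have "eventually (%d. ?m 2 d - (?m 1 d)^2 < \<kappa>^2/2) sequentially"
  using lim2 k by (intro order_tendstoD(2)[of _ 0]) auto
 ultimately have "eventually (%d. \<bar>?m 1 d - exp (- 1)\<bar> < \<kappa> & ?m 2 d - (?m 1 d)^2 < \<kappa>^2/2) sequentially"
  by eventually_elim auto
 then obtain d0 where d0: "\<And>d. d >= d0 ==> \<bar>?m 1 d - exp (- 1)\<bar> < \<kappa> & ?m 2 d - (?m 1 d)^2 < \<kappa>^2/2"
  by (auto simp: eventually_sequentially)
 have "measure M {\<omega> : space M. (1 - \<delta>)*d <= (\<Sum>j<d. (\<eta> j \<omega>)^2) & (\<Sum>j<d. (\<eta> j \<omega>)^2) <= (1 + \<delta>)*d} >= 1/2"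
  if dd: "d >= Suc d0" and g: "gauss_system M d \<eta>" for d and M :: "'a measure" and \<eta>
 proof -
  interpret prob_space M using g by (simp add: gauss_system_def)
  have dp: "real d > 0" using dd by simp
  have \<eta>m: "\<eta> j : borel_measurable M" if "j < d" for j
   using g that by (auto simp: gauss_system_def sqi_def)
  define N where "N \<omega> = (\<Sum>j<d. (\<eta> j \<omega>)^2)" for \<omega>
  have [measurable]: "N : borel_measurable M" unfolding N_def by (intro borel_measurable_sum borel_measurable_power \<eta>m) auto
  define V where "V \<omega> = exp (- (N \<omega>/d))" for \<omega>
  have [measurable]: "V : borel_measurable M" unfolding V_def by measurable
  have EV: "(LINT \<omega>|M. exp (- (\<alpha>*(N \<omega>/d)))) = ?m \<alpha> d" if "\<alpha> > 0" for \<alpha>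
  proof -
   have "(LINT \<omega>|M. exp (- (\<Sum>j<d. \<alpha>/d*(\<eta> j \<omega> - 0)^2))) = (\<Prod>j<d. exp (- (\<alpha>/d*0^2)/(1 + 2*(\<alpha>/d)))/sqrt (1 + 2*(\<alpha>/d)))"
    using g that dp unfolding gauss_system_def by (elim conjE allE[of _ "%_. \<alpha>/d"] allE[of _ "%_. 0"]) auto
   moreover have "(\<Sum>j<d. \<alpha>/d*(\<eta> j \<omega> - 0)^2) = \<alpha>*(N \<omega>/d)" for \<omega>
    unfolding N_def by (simp add: sum_distrib_left sum_divide_distrib)
   ultimately show ?thesis by simp
  qed
  have V1: "(LINT \<omega>|M. V \<omega>) = ?m 1 d" using EV[of 1] by (simp add: V_def)
  have V2: "(LINT \<omega>|M. (V \<omega>)^2) = ?m 2 d" using EV[of 2] by (simp add: V_def exp_double[symmetric])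
  have Vb: "0 < V \<omega>" "V \<omega> <= 1" for \<omega> by (auto simp: V_def N_def intro!: divide_nonneg_nonneg sum_nonneg)
  have Vi: "integrable M V" "integrable M (%\<omega>. (V \<omega>)^2)"
   using Vb by (auto intro!: integrable_const_bound[of _ 1] simp: power_le_one less_imp_le)
  have "prob {\<omega> : space M. \<kappa> <= \<bar>V \<omega> - expectation V\<bar>} <= variance V/\<kappa>^2"
   by (rule Chebyshev_inequality) (use Vi k in auto)
  also have "variance V = ?m 2 d - (?m 1 d)^2"
   by (subst variance_eq) (use Vi V1 V2 in auto)
  also have "... / \<kappa>^2 <= (\<kappa>^2/2)/\<kappa>^2" using d0[of d] dd by (intro divide_right_mono) auto
  also have "... = 1/2" using k by simp
  finally have half: "prob {\<omega> : space M. \<kappa> <= \<bar>V \<omega> - expectation V\<bar>} <= 1/2" .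
  let ?G = "{\<omega> : space M. (1 - \<delta>)*d <= N \<omega> & N \<omega> <= (1 + \<delta>)*d}"
  have "space M - ?G \<subseteq> {\<omega> : space M. \<kappa> <= \<bar>V \<omega> - expectation V\<bar>}"
  proof
   fix \<omega> assume w: "\<omega> : space M - ?G"
   have m1: "\<bar>expectation V - exp (- 1)\<bar> < \<kappa>" using d0[of d] dd unfolding V1 by simp
   have k2: "2*\<kappa> <= exp (- 1) - exp (- 1 - \<delta>)" "2*\<kappa> <= exp (- 1 + \<delta>) - exp (- 1)" by (auto simp: \<kappa>_def)
   from w consider "N \<omega> < (1 - \<delta>)*d" | "N \<omega> > (1 + \<delta>)*d" by fastforce
   then have "\<kappa> <= \<bar>V \<omega> - expectation V\<bar>"
   proof cases
    case 1
    then have "N \<omega>/d < 1 - \<delta>" using dp by (simp add: field_simps)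
    then have "exp (- 1 + \<delta>) < V \<omega>" by (simp add: V_def)
    then show ?thesis using m1 k2 by linarith
   next
    case 2
    then have "N \<omega>/d > 1 + \<delta>" using dp by (simp add: field_simps)
    then have "V \<omega> < exp (- 1 - \<delta>)" by (simp add: V_def)
    then show ?thesis using m1 k2 by linarith
   qed
   then show "\<omega> : {\<omega> : space M. \<kappa> <= \<bar>V \<omega> - expectation V\<bar>}" using w by simp
  qed
  then have "prob (space M - ?G) <= prob {\<omega> : space M. \<kappa> <= \<bar>V \<omega> - expectation V\<bar>}"
   by (rule finite_measure_mono) measurable
  then have "prob (space M - ?G) <= 1/2" using half by linarith
  moreover have "prob (space M - ?G) = 1 - prob ?G" by (rule prob_compl) measurable
  ultimately show ?thesis unfolding N_def by linarith
 qed
 then show ?thesis by blast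
qed

text \<open>Divided by \<open>sqrt (d*(1 + \<delta>))\<close>, a Gaussian vector on the shell lies
  in the unit ball, where the covering applies. The tilted exponential is then at least
  \<open>exp (- \<delta>*d/2)\<close> with probability 1/2, while its mean is at most
  \<open>card A\<close> times the product of \<open>e * sqrt (1 + \<delta>)/\<mu> j\<close>.\<close>

lemma gauss_covering_lower:
 fixes \<eta> :: "nat => 'a => real" and \<mu> :: "nat => real" and A :: "(nat => real) set"
 assumes g: "gauss_system M d \<eta>" and d: "d > 0" "0 < \<delta>" "\<delta> <= 1"
  and G: "measure M {\<omega> : space M. (1 - \<delta>)*d <= (\<Sum>j<d. (\<eta> j \<omega>)^2) & (\<Sum>j<d. (\<eta> j \<omega>)^2) <= (1 + \<delta>)*d} >= 1/2"
  and cov: "\<And>y. (\<Sum>j<d. (y j)^2) <= 1 ==> \<exists>a\<in>A. (\<Sum>j<d. (\<mu> j*y j - a j)^2) <= e^2"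
  and A: "finite A" and e: "e > 0" and \<mu>: "\<And>j. j < d ==> \<mu> j > e * sqrt (1 + \<delta>)"
 shows "ln (card A) >= (\<Sum>j<d. ln (\<mu> j/e)) - ln 2 - \<delta>*d"
proof -
 interpret prob_space M using g by (simp add: gauss_system_def)
 have [measurable]: "\<eta> j : borel_measurable M" if "j < d" for j
  using g that by (auto simp: gauss_system_def sqi_def)
 let ?G = "{\<omega> : space M. (1 - \<delta>)*d <= (\<Sum>j<d. (\<eta> j \<omega>)^2) & (\<Sum>j<d. (\<eta> j \<omega>)^2) <= (1 + \<delta>)*d}"
 have Gs: "?G : sets M" by measurable
 define r where "r = sqrt (d*(1 + \<delta>))"
 have r: "r > 0" "r^2 = d*(1 + \<delta>)" using d by (auto simp: r_def)
 define \<sigma> where "\<sigma> j = \<mu> j/r" for j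
 \<comment> \<open>Gives \<open>\<Lambda>*e^2 = d/2\<close>, which balances the gain from the tilt
   1/2 on the shell up to \<delta>d/2.\<close>
 define \<Lambda> where "\<Lambda> = d/(2*e^2)"
 have l: "\<Lambda> > 0" using d e by (simp add: \<Lambda>_def)
 have mu2: "(\<mu> j)^2 > e^2*(1 + \<delta>)" if "j < d" for j
 proof -
  have "(e * sqrt (1 + \<delta>))^2 < (\<mu> j)^2" using \<mu>[OF that] e d by (intro power_strict_mono) auto
  then show ?thesis using d by (simp add: power_mult_distrib)
 qed
 have ls: "2*\<Lambda>*(\<sigma> j)^2 = (\<mu> j)^2/(e^2*(1 + \<delta>))" for j
  using d e by (simp add: \<Lambda>_def \<sigma>_def power_divide r(2))
 have ls1: "1/2 < \<Lambda>*(\<sigma> j)^2" if "j < d" for j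
 proof -
  have "1 < (\<mu> j)^2/(e^2*(1 + \<delta>))" using mu2[OF that] e d
   by (subst less_divide_eq_1_pos) (auto intro!: mult_pos_pos)
  then show ?thesis unfolding ls[symmetric] by simp
 qed
 define c where "c = exp (- \<Lambda>*e^2 + (1 - \<delta>)*d/2)"
 have "(LINT \<omega>|M. c*indicator ?G \<omega>) <= card A*(\<Prod>j<d. 1/sqrt (1 + 2*\<Lambda>*(\<sigma> j)^2 - 2*(1/2)))"
 proof (rule gauss_sum_exp_bound[OF g l, where w = "%_. 1/2"])
  show "integrable M (%\<omega>. c*indicator ?G \<omega>)"
   using Gs by (intro integrable_mult_right integrable_real_indicator) (auto simp: less_top[symmetric])
  obtain a0 where a0: "a0 : A" using cov[of "%_. 0"] by auto
  show "AE \<omega> in M. \<exists>a\<in>A. c*indicator ?G \<omega> <= exp (- \<Lambda>*(\<Sum>j<d. (\<sigma> j*\<eta> j \<omega> - a j)^2) + (\<Sum>j<d. 1/2*(\<eta> j \<omega>)^2))"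
  proof (rule AE_I2)
   fix \<omega>
   show "\<exists>a\<in>A. c*indicator ?G \<omega> <= exp (- \<Lambda>*(\<Sum>j<d. (\<sigma> j*\<eta> j \<omega> - a j)^2) + (\<Sum>j<d. 1/2*(\<eta> j \<omega>)^2))"
   proof (cases "\<omega> : ?G")
    case True
    have "(\<Sum>j<d. (\<eta> j \<omega>/r)^2) = (\<Sum>j<d. (\<eta> j \<omega>)^2)/(d*(1 + \<delta>))"
     by (simp add: power_divide r(2) sum_divide_distrib)
    also have "... <= 1" using True d by (simp add: mult.commute)
    finally obtain a where a: "a : A" "(\<Sum>j<d. (\<mu> j*(\<eta> j \<omega>/r) - a j)^2) <= e^2"
     using cov[of "%j. \<eta> j \<omega>/r"] by blast
    then have "\<Lambda>*(\<Sum>j<d. (\<sigma> j*\<eta> j \<omega> - a j)^2) <= \<Lambda>*e^2" using l by (intro mult_left_mono) (auto simp: \<sigma>_def)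
    moreover have "(1 - \<delta>)*d/2 <= (\<Sum>j<d. 1/2*(\<eta> j \<omega>)^2)"
     using True by (simp add: sum_divide_distrib[symmetric])
    ultimately have "c <= exp (- \<Lambda>*(\<Sum>j<d. (\<sigma> j*\<eta> j \<omega> - a j)^2) + (\<Sum>j<d. 1/2*(\<eta> j \<omega>)^2))"
     by (simp add: c_def)
    then show ?thesis using True a(1) by (intro bexI[of _ a]) auto
   next
    case False
    then show ?thesis using a0 by (intro bexI[of _ a0]) auto
   qed
  qed
 qed (use ls1 A in auto)
 moreover have "(LINT \<omega>|M. c*indicator ?G \<omega>) = c*prob ?G" using Gs by simp
 moreover have "c*(1/2) <= c*prob ?G" using G by (intro mult_left_mono) (auto simp: c_def)
 ultimately have main: "c/2 <= card A*(\<Prod>j<d. 1/sqrt (2*\<Lambda>*(\<sigma> j)^2))" by simp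
 have c0: "c > 0" by (simp add: c_def)
 have mu0: "\<mu> j > 0" if "j < d" for j using \<mu>[OF that] e d by (smt (verit) mult_pos_pos real_sqrt_gt_zero)
 define Q where "Q = (\<Prod>j<d. 1/sqrt (2*\<Lambda>*(\<sigma> j)^2))"
 have Qj: "1/sqrt (2*\<Lambda>*(\<sigma> j)^2) > 0" if "j < d" for j using ls1[OF that] by simp
 have Q0: "Q > 0" unfolding Q_def using Qj by (intro prod_pos) auto
 have "card A > 0"
 proof (rule ccontr)
  assume "\<not> 0 < card A"
  then have "c/2 <= 0" using main by simp
  then show False using c0 by simp
 qed
 have "ln (c/2) <= ln (card A*Q)" using main c0 unfolding Q_def by (intro ln_mono) auto
 also have "... = ln (card A) + ln Q" using Q0 \<open>card A > 0\<close> by (intro ln_mult_pos) auto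
 also have "ln Q = (\<Sum>j<d. - ln (\<mu> j/e) + ln (1 + \<delta>)/2)"
  unfolding Q_def
 proof (subst ln_prod)
  show "(\<Sum>j<d. ln (1/sqrt (2*\<Lambda>*(\<sigma> j)^2))) = (\<Sum>j<d. - ln (\<mu> j/e) + ln (1 + \<delta>)/2)"
  proof (rule sum.cong[OF refl])
   fix j assume "j : {..<d}"
   then have m0: "\<mu> j > 0" using mu0 by simp
   have "sqrt (2*\<Lambda>*(\<sigma> j)^2) = (\<mu> j/e)/sqrt (1 + \<delta>)"
    unfolding ls using m0 e by (simp add: real_sqrt_divide real_sqrt_mult)
   then show "ln (1/sqrt (2*\<Lambda>*(\<sigma> j)^2)) = - ln (\<mu> j/e) + ln (1 + \<delta>)/2"
    using m0 e d by (simp add: ln_div ln_mult ln_sqrt)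
  qed
 next
  fix j assume "j : {..<d}"
  then have "1/sqrt (2*\<Lambda>*(\<sigma> j)^2) > 0" using Qj by simp
  then show "1/sqrt (2*\<Lambda>*(\<sigma> j)^2) ~= 0" by linarith
 qed simp
 also have "... = - (\<Sum>j<d. ln (\<mu> j/e)) + d*(ln (1 + \<delta>)/2)" unfolding sum.distrib sum_negf by simp
 also have "... <= - (\<Sum>j<d. ln (\<mu> j/e)) + d*(\<delta>/2)"
  using d ln_add_one_self_le_self[of \<delta>] by (intro add_left_mono mult_left_mono divide_right_mono) auto
 finally have "ln (c/2) <= ln (card A) - (\<Sum>j<d. ln (\<mu> j/e)) + d*(\<delta>/2)" by simp
 moreover have "ln (c/2) = - \<delta>*d/2 - ln 2"
  using e by (simp add: c_def ln_div \<Lambda>_def field_simps)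
 ultimately show ?thesis by (simp add: algebra_simps)
qed

section \<open>Wiener integrals\<close>

lemma nm_sum_sq:
 assumes "\<And>i. i < n ==> f i : sqi M"
 shows "(nm M (%x. \<Sum>i<n. a i * f i x))^2 = (\<Sum>i<n. \<Sum>j<n. a i*a j*ip M (f i) (f j))"
proof -
 have S: "(%x. \<Sum>i<n. a i * f i x) : sqi M" using assms by (intro sqi_sum sqi_cmult) auto
 have "(nm M (%x. \<Sum>i<n. a i * f i x))^2 = (\<Sum>i<n. a i*ip M (f i) (%x. \<Sum>i<n. a i * f i x))"
  unfolding ip_self[symmetric] by (rule ip_sum_left) (use assms S in auto)
 also have "... = (\<Sum>i<n. a i*(\<Sum>j<n. a j*ip M (f i) (f j)))"
 proof (intro sum.cong[OF refl] arg_cong2[where f = "(*)", OF refl])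
  fix i assume i: "i : {..<n}"
  have "ip M (f i) (%x. \<Sum>i<n. a i * f i x) = ip M (%x. \<Sum>i<n. a i * f i x) (f i)" by (rule ip_commute)
  also have "... = (\<Sum>j<n. a j*ip M (f j) (f i))" by (rule ip_sum_left) (use assms i in auto)
  also have "... = (\<Sum>j<n. a j*ip M (f i) (f j))" by (rule sum.cong[OF refl], subst ip_commute, rule refl)
  finally show "ip M (f i) (%x. \<Sum>i<n. a i * f i x) = (\<Sum>j<n. a j*ip M (f i) (f j))" .
 qed
 finally show ?thesis by (simp add: sum_distrib_left mult_ac)
qed

lemma ip_diff_diff:
 assumes "f : sqi N" "g : sqi N" "h : sqi N" "k : sqi N"
 shows "ip N (%s. f s - g s) (%s. h s - k s) = ip N f h - ip N f k - ip N g h + ip N g k"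
 using assms by (simp add: ip_def left_diff_distrib right_diff_distrib sqi_mult_integrable)

context
 fixes M :: "'a measure" and W :: "real => 'a => real"
 assumes BM: "std_BM M W"
begin

lemma prob_space_M: "prob_space M" using BM by (simp add: std_BM_def)

lemma W_measurable: "0 <= t ==> t <= 1 ==> W t : borel_measurable M"
 using BM by (simp add: std_BM_def)

lemma W_increment:
 assumes "0 <= s" "s < t" "t <= 1"
 shows "(%\<omega>. W t \<omega> - W s \<omega>) : sqi M" "(LINT \<omega>|M. (W t \<omega> - W s \<omega>)^2) = t - s"
proof -
 have D: "distributed M lborel (%\<omega>. W t \<omega> - W s \<omega>) (normal_density 0 (sqrt (t - s)))"
  using BM assms by (simp add: std_BM_def)
 have ts: "0 < sqrt (t - s)" using assms by simp
 have i: "integrable lborel (%x. normal_density 0 (sqrt (t - s)) x*x^2)"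
  using integrable_normal_moment[OF ts, of 0 2] by simp
 have "integrable M (%\<omega>. (W t \<omega> - W s \<omega>)^2)"
  using distributed_integrable[OF D, of "%x. x^2"] i by (simp add: normal_density_nonneg)
 then show "(%\<omega>. W t \<omega> - W s \<omega>) : sqi M"
  using W_measurable assms by (intro sqiI) auto
 show "(LINT \<omega>|M. (W t \<omega> - W s \<omega>)^2) = t - s"
  using distributed_integral[OF D, of "%x. x^2"] integral_normal_moment_even[OF ts, of 0 1] assms
  by (simp add: normal_density_nonneg)
qed

lemma W_sqi: assumes "0 <= t" "t <= 1" shows "W t : sqi M" "(LINT \<omega>|M. (W t \<omega>)^2) = t"
proof -
 have W0: "W 0 \<omega> = 0" if "\<omega> : space M" for \<omega> using BM that by (simp add: std_BM_def)
 have "W t : sqi M & (LINT \<omega>|M. (W t \<omega>)^2) = t"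
 proof (cases "t = 0")
  case True
  have "integrable M (%\<omega>. (W 0 \<omega>)^2) \<longleftrightarrow> integrable M (%\<omega>. 0 :: real)"
   by (rule Bochner_Integration.integrable_cong) (auto simp: W0)
  moreover have "(LINT \<omega>|M. (W 0 \<omega>)^2) = (LINT \<omega>|M. 0)"
   by (rule Bochner_Integration.integral_cong) (auto simp: W0)
  ultimately show ?thesis using True W_measurable[of 0] by (auto simp: sqi_def)
 next
  case False
  then have t: "0 < t" using assms by simp
  have "integrable M (%\<omega>. (W t \<omega>)^2) \<longleftrightarrow> integrable M (%\<omega>. (W t \<omega> - W 0 \<omega>)^2)"
   by (rule Bochner_Integration.integrable_cong) (auto simp: W0)
  moreover have "(LINT \<omega>|M. (W t \<omega>)^2) = (LINT \<omega>|M. (W t \<omega> - W 0 \<omega>)^2)"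
   by (rule Bochner_Integration.integral_cong) (auto simp: W0)
  ultimately show ?thesis using W_increment[of 0 t] t assms W_measurable[of t] by (auto simp: sqi_def)
 qed
 then show "W t : sqi M" "(LINT \<omega>|M. (W t \<omega>)^2) = t" by auto
qed

lemma W_cov:
 assumes "0 <= s" "s <= 1" "0 <= t" "t <= 1" shows "ip M (W s) (W t) = min s t"
proof -
 have *: "ip M (W s) (W t) = s" if "0 <= s" "s <= t" "t <= 1" for s t
 proof (cases "s = t")
  case True
  then show ?thesis using W_sqi(2)[of t] that by (simp add: ip_def power2_eq_square)
 next
  case False
  then have st: "s < t" using that by simp
  have "(nm M (%\<omega>. W t \<omega> - W s \<omega>))^2 = (nm M (W t))^2 - 2*ip M (W t) (W s) + (nm M (W s))^2"
   using that st by (intro nm_diff_sq W_sqi) auto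
  then have "t - s = t - 2*ip M (W t) (W s) + s"
   unfolding nm_sq using W_increment(2)[OF that(1) st that(3)] W_sqi(2)[of t] W_sqi(2)[of s] that st by simp
  then show ?thesis by (simp add: ip_commute[of M "W s"])
 qed
 show ?thesis
 proof (cases "s <= t")
  case True then show ?thesis using *[of s t] assms by simp
 next
  case False then show ?thesis using *[of t s] assms by (simp add: ip_commute[of M "W s"])
 qed
qed

lemma ip_I01_indicator:
 assumes "0 <= s" "s <= 1" "0 <= t" "t <= 1"
 shows "ip I01 (indicator {0..<s}) (indicator {0..<t}) = min s t"
proof -
 have "ip I01 (indicator {0..<s}) (indicator {0..<t}) = (LINT x|lborel. indicator {0..<min s t} x)"
 proof -
  have "indicator {0..1} x *\<^sub>R (indicator {0..<s} x*indicator {0..<t} x) = (indicator {0..<min s t} x :: real)" for x :: real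
   using assms by (auto simp: indicator_def)
  then show ?thesis unfolding ip_def I01_def by (subst integral_restrict_space) simp_all
 qed
 also have "... = min s t" using assms by simp
 finally show ?thesis .
qed

lemma indicator_sqi: "(indicator {a..<b} :: real => real) : sqi I01"
 by (rule sqi_bounded[of _ _ 1])
  (auto simp: indicator_def intro!: borel_measurable_I01 I01.finite_measure_axioms)

text \<open>The covariance min s t of Brownian motion is also the inner product of the indicators of
  [0,s) and [0,t). The isometry therefore holds for arbitrary, even overlapping, intervals, and
  later for the difference of step functions on two unrelated partitions.\<close>

lemma increments_isometry:
 assumes ab: "\<And>i. i < n ==> 0 <= a i & a i <= b i & b i <= 1"
 shows "nm M (%\<omega>. \<Sum>i<n. x i*(W (b i) \<omega> - W (a i) \<omega>)) = nm I01 (%s. \<Sum>i<n. x i*indicator {a i..<b i} s)"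
proof -
 have ind: "ip I01 (indicator {a i..<b i}) (indicator {a j..<b j}) =
   ip I01 (%s. indicator {0..<b i} s - indicator {0..<a i} s) (%s. indicator {0..<b j} s - indicator {0..<a j} s)"
  if "i < n" "j < n" for i j
  unfolding ip_def using ab[of i] ab[of j] that
  by (intro Bochner_Integration.integral_cong refl) (auto simp: space_I01 indicator_def)
 have "(nm M (%\<omega>. \<Sum>i<n. x i*(W (b i) \<omega> - W (a i) \<omega>)))^2 =
   (\<Sum>i<n. \<Sum>j<n. x i*x j*ip M (%\<omega>. W (b i) \<omega> - W (a i) \<omega>) (%\<omega>. W (b j) \<omega> - W (a j) \<omega>))"
 proof (rule nm_sum_sq)
  fix i assume "i < n"
  then show "(%\<omega>. W (b i) \<omega> - W (a i) \<omega>) : sqi M" using ab[of i] by (intro sqi_diff W_sqi) auto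
 qed
 also have "... = (\<Sum>i<n. \<Sum>j<n. x i*x j*ip I01 (indicator {a i..<b i}) (indicator {a j..<b j}))"
 proof (intro sum.cong refl arg_cong2[where f = "(*)"])
  fix i j assume "i : {..<n}" "j : {..<n}"
  then have ij: "i < n" "j < n" by auto
  have bd: "0 <= a i" "a i <= 1" "0 <= b i" "b i <= 1" "0 <= a j" "a j <= 1" "0 <= b j" "b j <= 1"
   using ab[OF ij(1)] ab[OF ij(2)] by auto
  show "ip M (%\<omega>. W (b i) \<omega> - W (a i) \<omega>) (%\<omega>. W (b j) \<omega> - W (a j) \<omega>) = ip I01 (indicator {a i..<b i}) (indicator {a j..<b j})"
   unfolding ind[OF ij] ip_diff_diff[OF indicator_sqi indicator_sqi indicator_sqi indicator_sqi]
    ip_diff_diff[OF W_sqi(1)[OF bd(3,4)] W_sqi(1)[OF bd(1,2)] W_sqi(1)[OF bd(7,8)] W_sqi(1)[OF bd(5,6)]]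
   using bd by (simp add: W_cov ip_I01_indicator)
 qed
 also have "... = (nm I01 (%s. \<Sum>i<n. x i*indicator {a i..<b i} s))^2"
  by (rule nm_sum_sq[symmetric]) (rule indicator_sqi)
 finally show ?thesis by (rule power2_eq_imp_eq) (rule nm_nonneg)+
qed

section \<open>Wiener integrals of step functions on an equidistant grid\<close>

definition incr :: "nat => nat => 'a => real" where
 "incr N i \<omega> = W (real (Suc i)/N) \<omega> - W (real i/N) \<omega>"

lemma incr_normal:
 assumes "i < N" shows "distributed M lborel (incr N i) (normal_density 0 (sqrt (1/N)))"
proof -
 have "real i/N < real (Suc i)/N" "real (Suc i)/N <= 1" "0 <= real i/N"
  using assms by (auto simp: divide_simps)
 moreover have "real (Suc i)/N - real i/N = 1/N" by (simp add: diff_divide_distrib[symmetric])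
 ultimately show ?thesis using BM unfolding std_BM_def incr_def[abs_def] by metis
qed

lemma incr_indep: "prob_space.indep_vars M (%_. borel) (incr N) {..<N}"
proof -
 let ?ts = "map (%i. real i/N) [0..<Suc N]"
 have "sorted_wrt (<) ?ts"
  by (simp add: sorted_wrt_map sorted_wrt_iff_nth_less divide_strict_right_mono del: upt_Suc)
 moreover have "set ?ts \<subseteq> {0..1}" by (auto simp: divide_simps)
 ultimately have "prob_space.indep_vars M (%_. borel) (%i \<omega>. W (?ts ! Suc i) \<omega> - W (?ts ! i) \<omega>) {i. Suc i < length ?ts}"
  using BM unfolding std_BM_def by blast
 moreover have "{i. Suc i < length ?ts} = {..<N}" by auto
 ultimately have "prob_space.indep_vars M (%_. borel) (%i \<omega>. W (?ts ! Suc i) \<omega> - W (?ts ! i) \<omega>) {..<N}" by simp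
 then show ?thesis
  by (rule prob_space.indep_vars_cong[OF prob_space_M, THEN iffD1, rotated -1])
   (auto simp: incr_def fun_eq_iff simp del: upt_Suc)
qed

text \<open>The Wiener integral of the step function with value \<open>v i\<close> on the i-th of N
  equal cells.\<close>

definition wint :: "nat => (nat => real) => 'a => real" where
 "wint N v \<omega> = (\<Sum>i<N. v i*incr N i \<omega>)"

text \<open>The fourth moment is wanted because the errors of the codes contain squares of
  coefficients. Sums of independent normal variables are normal for positive deviations, hence the
  restriction to the nonzero coefficients \<open>J\<close> and the separate case of an empty
  \<open>J\<close>.\<close>

lemma wint_moments:
 assumes "N > 0"
 shows "wint N v : sqi M" "(%\<omega>. (wint N v \<omega>)^2) : sqi M"
  "(LINT \<omega>|M. (wint N v \<omega>)^2) = (\<Sum>i<N. (v i)^2)/N"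
  "nm M (%\<omega>. (wint N v \<omega>)^2) = sqrt 3*((\<Sum>i<N. (v i)^2)/N)"
proof -
 interpret prob_space M by (rule prob_space_M)
 define J where "J = {i. i < N & v i ~= 0}"
 have J: "finite J" "J \<subseteq> {..<N}" by (auto simp: J_def)
 have wJ: "wint N v \<omega> = (\<Sum>i\<in>J. v i*incr N i \<omega>)" for \<omega>
  unfolding wint_def by (rule sum.mono_neutral_right) (auto simp: J_def)
 have sJ: "(\<Sum>i<N. (v i)^2) = (\<Sum>i\<in>J. (v i)^2)"
  by (rule sum.mono_neutral_right) (auto simp: J_def)
 have "wint N v : sqi M & (%\<omega>. (wint N v \<omega>)^2) : sqi M &
  (LINT \<omega>|M. (wint N v \<omega>)^2) = (\<Sum>i<N. (v i)^2)/N &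
  (LINT \<omega>|M. ((wint N v \<omega>)^2)^2) = 3*((\<Sum>i<N. (v i)^2)/N)^2"
 proof (cases "J = {}")
  case True
  then have "wint N v = (%\<omega>. 0)" using wJ by auto
  then show ?thesis using True sJ by (simp add: sqi_zero)
 next
  case False
  have ind: "indep_vars (%_. borel) (%i \<omega>. v i*incr N i \<omega>) J"
   by (rule indep_vars_compose2[where Y = "%i x. v i*x", OF indep_vars_subset[OF incr_indep J(2)]]) auto
  have nor: "distributed M lborel (%\<omega>. v i*incr N i \<omega>) (normal_density 0 (\<bar>v i\<bar> * sqrt (1/N)))" if "i : J" for i
   using normal_density_affine[OF incr_normal[of i N], of "v i" 0] that assms by (auto simp: J_def)
  define \<sigma> where "\<sigma> = sqrt (\<Sum>i\<in>J. (\<bar>v i\<bar> * sqrt (1/N))^2)"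
  have D: "distributed M lborel (wint N v) (normal_density 0 \<sigma>)"
  proof -
   have "0 < \<bar>v i\<bar> * sqrt (1/N)" if "i : J" for i using that assms by (auto simp: J_def)
   moreover have "wint N v = (%\<omega>. \<Sum>i\<in>J. v i*incr N i \<omega>)" using wJ by auto
   ultimately show ?thesis using sum_indep_normal[OF J(1) False ind _ nor] unfolding \<sigma>_def by simp
  qed
  have s2: "\<sigma>^2 = (\<Sum>i<N. (v i)^2)/N"
   unfolding \<sigma>_def sJ using assms by (simp add: power_mult_distrib sum_nonneg sum_divide_distrib)
  have "\<sigma> > 0" unfolding \<sigma>_def using J False assms by (intro real_sqrt_gt_zero sum_pos) (auto simp: J_def)
  have i: "integrable M (%\<omega>. (wint N v \<omega>)^k)" for k
   using distributed_integrable[OF D, of "%x. x^k"] integrable_normal_moment[OF \<open>\<sigma> > 0\<close>, of 0 k] by (simp add: normal_density_nonneg)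
  have m: "wint N v : borel_measurable M" using D by (simp add: distributed_def)
  have I2: "(LINT \<omega>|M. (wint N v \<omega>)^(2*k)) = fact (2*k)/((2/\<sigma>^2)^k * fact k)" for k
   using distributed_integral[OF D, of "%x. x^(2*k)"] integral_normal_moment_even[OF \<open>\<sigma> > 0\<close>, of 0 k]
   by (simp add: normal_density_nonneg)
  have "(LINT \<omega>|M. ((wint N v \<omega>)^2)^2) = 3*(\<sigma>^2)^2"
   using I2[of 2] by (simp add: power_mult[symmetric] fact_numeral power_divide)
  moreover have "(LINT \<omega>|M. (wint N v \<omega>)^2) = \<sigma>^2" using I2[of 1] by simp
  ultimately show ?thesis unfolding s2 using i[of 2] i[of 4] m by (auto simp: sqi_def power_mult[symmetric])
 qed
 then show "wint N v : sqi M" "(%\<omega>. (wint N v \<omega>)^2) : sqi M"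
  "(LINT \<omega>|M. (wint N v \<omega>)^2) = (\<Sum>i<N. (v i)^2)/N"
  "nm M (%\<omega>. (wint N v \<omega>)^2) = sqrt 3*((\<Sum>i<N. (v i)^2)/N)"
  by (auto simp: nm_def real_sqrt_mult real_sqrt_divide sum_nonneg)
qed

lemma wint_char:
 assumes "N > 0"
 shows "(LINT \<omega>|M. iexp (wint N u \<omega>)) = complex_of_real (exp (- ((\<Sum>i<N. (u i)^2)/N)/2))"
proof -
 interpret prob_space M by (rule prob_space_M)
 have mi: "incr N i : borel_measurable M" if "i < N" for i
  using incr_normal[OF that] by (simp add: distributed_def)
 have ind: "indep_vars (%_. borel) (%i \<omega>. iexp (u i*incr N i \<omega>)) {..<N}"
  by (rule indep_vars_compose2[where Y = "%i x. iexp (u i*x)", OF incr_indep]) auto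
 have int: "integrable M (%\<omega>. iexp (u i*incr N i \<omega>))" if "i < N" for i
  using mi[OF that] by (intro integrable_const_bound[of _ 1]) auto
 have one: "(LINT \<omega>|M. iexp (u i*incr N i \<omega>)) = complex_of_real (exp (- ((u i)^2/N)/2))" if "i < N" for i
 proof -
  have "(LINT \<omega>|M. iexp (u i*incr N i \<omega>)) = (\<integral>x. iexp (u i*x) \<partial>distr M lborel (incr N i))"
   using mi[OF that] by (subst integral_distr) auto
  also have "... = (\<integral>x. iexp (u i*x) \<partial>density lborel (normal_density 0 (sqrt (1/N))))"
   using incr_normal[OF that] by (simp add: distributed_def)
  also have "... = (LINT x|lborel. normal_density 0 (sqrt (1/N)) x *\<^sub>R iexp (u i*x))"
   by (subst integral_density) (auto simp: normal_density_nonneg)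
  also have "... = (LINT x|lborel. iexp (u i*x)*complex_of_real (normal_density 0 (sqrt (1/N)) x))"
   by (simp add: scaleR_conv_of_real mult.commute)
  also have "... = complex_of_real (exp (- (u i * sqrt (1/N))\<^sup>2/2))"
   using assms by (intro integral_iexp_normal) simp
  finally show ?thesis using assms by (simp add: power_mult_distrib)
 qed
 have "(LINT \<omega>|M. iexp (wint N u \<omega>)) = (LINT \<omega>|M. (\<Prod>i<N. iexp (u i*incr N i \<omega>)))"
  by (simp add: wint_def exp_sum sum_distrib_left)
 also have "... = (\<Prod>i<N. \<integral>\<omega>. iexp (u i*incr N i \<omega>) \<partial>M)"
  by (rule indep_vars_lebesgue_integral[OF _ ind int]) auto
 also have "... = (\<Prod>i<N. complex_of_real (exp (- ((u i)^2/N)/2)))"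
  using one by (intro prod.cong refl) auto
 also have "... = complex_of_real (exp (\<Sum>i<N. - ((u i)^2/N)/2))"
  by (simp add: exp_sum)
 also have "(\<Sum>i<N. - ((u i)^2/N)/2) = - ((\<Sum>i<N. (u i)^2)/N)/2"
  by (simp add: sum_negf sum_divide_distrib)
 finally show ?thesis .
qed

text \<open>Orthogonality of the vectors \<open>\<psi> j\<close> in N-dimensional space turns the
  joint characteristic function of their integrals into that of independent standard normal
  variables.\<close>

lemma gauss_system_wint:
 assumes N: "N > 0"
  and on: "\<And>j k. j < d ==> k < d ==> (\<Sum>i<N. \<psi> j i*\<psi> k i) = (if j = k then real N else 0)"
 shows "gauss_system M d (%j. wint N (\<psi> j))"
 unfolding gauss_system_def
proof (intro conjI allI impI)
 show "prob_space M" by (rule prob_space_M)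
 fix j assume j: "j < d"
 show "wint N (\<psi> j) : sqi M" by (rule wint_moments(1)[OF N])
 show "(LINT \<omega>|M. (wint N (\<psi> j) \<omega>)^2) = 1"
  using on[OF j j] N unfolding wint_moments(3)[OF N] by (simp add: power2_eq_square)
next
 fix \<alpha> b :: "nat => real" assume \<alpha>: "\<forall>j<d. 0 < \<alpha> j"
 show "(LINT \<omega>|M. exp (- (\<Sum>j<d. \<alpha> j*(wint N (\<psi> j) \<omega> - b j)^2))) =
    (\<Prod>j<d. exp (- (\<alpha> j*(b j)^2)/(1 + 2*\<alpha> j))/sqrt (1 + 2*\<alpha> j))"
 proof (rule gauss_formula_from_char[OF prob_space_M])
  fix s :: "nat => real"
  define u where "u i = (\<Sum>j<d. s j*\<psi> j i)" for i
  have "(\<Sum>j<d. s j*wint N (\<psi> j) \<omega>) = wint N u \<omega>" for \<omega>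
  proof -
   have "(\<Sum>j<d. s j*wint N (\<psi> j) \<omega>) = (\<Sum>j<d. \<Sum>i<N. s j*\<psi> j i*incr N i \<omega>)"
    by (simp add: wint_def sum_distrib_left mult.assoc)
   also have "... = (\<Sum>i<N. \<Sum>j<d. s j*\<psi> j i*incr N i \<omega>)" by (rule sum.swap)
   finally show ?thesis by (simp add: wint_def u_def sum_distrib_right)
  qed
  moreover have "(\<Sum>i<N. (u i)^2)/N = (\<Sum>j<d. (s j)^2)"
  proof -
   have "(\<Sum>i<N. (u i)^2) = (\<Sum>i<N. \<Sum>j<d. \<Sum>k<d. s j * s k*(\<psi> j i*\<psi> k i))"
    by (simp add: u_def power2_eq_square sum_product mult_ac)
   also have "... = (\<Sum>j<d. \<Sum>i<N. \<Sum>k<d. s j * s k*(\<psi> j i*\<psi> k i))" by (rule sum.swap)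
   also have "... = (\<Sum>j<d. \<Sum>k<d. \<Sum>i<N. s j * s k*(\<psi> j i*\<psi> k i))"
    by (rule sum.cong[OF refl], rule sum.swap)
   also have "... = (\<Sum>j<d. \<Sum>k<d. s j * s k*(if j = k then real N else 0))"
    using on by (simp add: sum_distrib_left[symmetric])
   also have "... = (\<Sum>j<d. \<Sum>k<d. if j = k then s j * s k*real N else 0)"
    by (intro sum.cong refl) auto
   also have "... = (\<Sum>j<d. (s j)^2*N)" by (intro sum.cong refl) (simp add: power2_eq_square)
   finally show ?thesis using N by (simp add: sum_distrib_right[symmetric])
  qed
  ultimately show "(LINT \<omega>|M. iexp (\<Sum>j<d. s j*wint N (\<psi> j) \<omega>)) = complex_of_real (exp (- (\<Sum>j<d. (s j)^2)/2))"
   using wint_char[OF N, of u] by simp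
 qed (use \<alpha> wint_moments(1)[OF N] in \<open>auto simp: sqi_def\<close>)
qed

text \<open>The Wiener integral is only given through some approximating step functions; comparing it
 with a fixed step function costs nothing in the limit.\<close>

lemma wiener_integral_approx:
 assumes Y: "wiener_integral M W f t Y" and t: "0 <= t" "t <= 1" and N: "N > 0"
  and f: "(%s. if s < t then f s else 0) : sqi I01"
 shows "Y : sqi M" "nm M (%\<omega>. Y \<omega> - wint N v \<omega>) <= nm I01 (%s. (if s < t then f s else 0) - v (nat \<lfloor>N * s\<rfloor>))"
proof -
 interpret prob_space M by (rule prob_space_M)
 define g where "g s = (if s < t then f s else 0)" for s
 define vs where "vs s = (\<Sum>i<N. v i*indicator {real i/N..<real (Suc i)/N} s)" for s
 obtain p c m where part: "\<And>k. is_partition (p k) (m k) t"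
  and conv_f: "(%k. \<integral>\<^sup>+ s\<in>{0..t}. ennreal ((step_fun (p k) (c k) (m k) s - f s)^2) \<partial>lborel) \<longlonglongrightarrow> 0"
  and conv_Y: "(%k. \<integral>\<^sup>+ \<omega>. ennreal ((Y \<omega> - step_int W (p k) (c k) (m k) \<omega>)^2) \<partial>M) \<longlonglongrightarrow> 0"
  and Ym: "Y : borel_measurable M"
  using Y unfolding wiener_integral_def by blast
 define F where "F k = step_fun (p k) (c k) (m k)" for k
 define S where "S k = step_int W (p k) (c k) (m k)" for k
 have p01: "0 <= p k j & p k j <= t" if "j <= m k" for k j
 proof -
  have "p k 0 <= p k j" using that
  proof (induction j)
   case (Suc j)
   then have "p k j < p k (Suc j)" using part[of k] by (simp add: is_partition_def)
   then show ?case using Suc by simp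
  qed simp
  moreover have "p k j <= p k (m k)" using that
  proof (induction "m k - j" arbitrary: j)
   case (Suc n)
   then have "p k j < p k (Suc j)" using part[of k] by (simp add: is_partition_def)
   moreover have "p k (Suc j) <= p k (m k)" using Suc by (intro Suc) auto
   ultimately show ?case by simp
  qed simp
  ultimately show ?thesis using part[of k] by (simp add: is_partition_def)
 qed
 then have p1: "p k j <= 1" if "j <= m k" for k j using that t by fastforce
 have p_mono: "p k j <= p k (Suc j)" if "j < m k" for k j using part[of k] that by (simp add: is_partition_def less_imp_le)
 have S_sqi: "S k : sqi M" for k
  unfolding S_def step_int_def using p01[of _ k] p1[of _ k]
  by (intro sqi_sum sqi_cmult sqi_diff W_sqi) auto
 have F_sqi: "F k : sqi I01" for k
  unfolding F_def step_fun_def by (intro sqi_sum sqi_cmult indicator_sqi)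
 have vs_sqi: "vs : sqi I01"
  unfolding vs_def by (intro sqi_sum sqi_cmult indicator_sqi)
 have wint_sqi: "wint N v : sqi M" by (rule wint_moments(1)[OF N])
 have iso: "nm M (%\<omega>. S k \<omega> - wint N v \<omega>) = nm I01 (%s. F k s - vs s)" for k
 proof -
  \<comment> \<open>The given step function and the grid step function are joined into one family of
    \<open>m k + N\<close> intervals, the second with opposite signs, so that the isometry bears on
    their difference.\<close>
  define x where "x i = (if i < m k then c k i else - v (i - m k))" for i
  define a where "a i = (if i < m k then p k i else real (i - m k)/N)" for i
  define b where "b i = (if i < m k then p k (Suc i) else real (Suc (i - m k))/N)" for i
  have ab: "0 <= a i & a i <= b i & b i <= 1" if "i < m k + N" for i
  proof (cases "i < m k")
   case True
   then show ?thesis using p01[of i k] p01[of "Suc i" k] p_mono[of i k] t by (auto simp: a_def b_def)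
  next
   case False
   then have "i - m k < N" using that by simp
   then show ?thesis using False by (auto simp: a_def b_def divide_simps)
  qed
  have split: "(\<Sum>i<m k + N. h i) = (\<Sum>i<m k. h i) + (\<Sum>i<N. h (m k + i))" for h :: "nat => real"
   by (induction N) auto
  have 1: "(\<Sum>i<m k + N. x i*(W (b i) \<omega> - W (a i) \<omega>)) = S k \<omega> - wint N v \<omega>" for \<omega>
   unfolding split by (simp add: x_def a_def b_def S_def step_int_def wint_def incr_def sum_negf)
  have 2: "(\<Sum>i<m k + N. x i*indicator {a i..<b i} s) = F k s - vs s" for s
   unfolding split by (simp add: x_def a_def b_def F_def step_fun_def vs_def sum_negf)
  show ?thesis using increments_isometry[of "m k + N" a b x, OF ab] unfolding 1 2 by simp
 qed
 have nY: "(%\<omega>. Y \<omega> - S k \<omega>) : borel_measurable M" for k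
  by (rule borel_measurable_diff[OF Ym sqi_measurable[OF S_sqi]])
 \<comment> \<open>Convergence to 0 makes the possibly infinite integrals finite from some index on.
   Adding back the square integrable \<open>S k0\<close> then shows that \<open>Y\<close> is square
   integrable.\<close>
 have "eventually (%k. (\<integral>\<^sup>+ \<omega>. ennreal ((Y \<omega> - S k \<omega>)^2) \<partial>M) < 1) sequentially"
  using order_tendstoD(2)[OF conv_Y, of 1] unfolding S_def by simp
 then obtain k0 where k0: "\<And>k. k >= k0 ==> (\<integral>\<^sup>+ \<omega>. ennreal ((Y \<omega> - S k \<omega>)^2) \<partial>M) < 1"
  by (auto simp: eventually_sequentially)
 have YS: "(%\<omega>. Y \<omega> - S k \<omega>) : sqi M" if "k >= k0" for k
  using k0[OF that] nY[of k]
  by (intro sqiI integrableI_bounded) (auto intro: order_less_trans[OF _ ennreal_one_less_top])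
 have "(%\<omega>. (Y \<omega> - S k0 \<omega>) + S k0 \<omega>) : sqi M" by (intro sqi_add YS S_sqi) simp
 then show Ys: "Y : sqi M" by simp
 have nmY: "(%k. nm M (%\<omega>. Y \<omega> - S k \<omega>)) \<longlonglongrightarrow> 0"
 proof -
  have eq: "ennreal ((nm M (%\<omega>. Y \<omega> - S k \<omega>))^2) = (\<integral>\<^sup>+ \<omega>. ennreal ((Y \<omega> - S k \<omega>)^2) \<partial>M)" for k
   unfolding nm_sq by (rule nn_integral_eq_integral[symmetric]) (use sqi_diff[OF Ys S_sqi] in \<open>auto simp: sqi_def\<close>)
  have "(%k. ennreal ((nm M (%\<omega>. Y \<omega> - S k \<omega>))^2)) \<longlonglongrightarrow> ennreal 0"
   unfolding eq using conv_Y by (simp add: S_def)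
  then have "(%k. (nm M (%\<omega>. Y \<omega> - S k \<omega>))^2) \<longlonglongrightarrow> 0"
   by (subst (asm) tendsto_ennreal_iff) auto
  then have "(%k. sqrt ((nm M (%\<omega>. Y \<omega> - S k \<omega>))^2)) \<longlonglongrightarrow> sqrt 0" by (rule tendsto_real_sqrt)
  then show ?thesis by (simp add: nm_nonneg)
 qed
 have gs: "g : sqi I01" using f by (simp add: g_def[abs_def])
 have nmF: "(%k. nm I01 (%s. F k s - g s)) \<longlonglongrightarrow> 0"
 proof -
  have eq: "ennreal ((nm I01 (%s. F k s - g s))^2) = (\<integral>\<^sup>+ s\<in>{0..t}. ennreal ((F k s - f s)^2) \<partial>lborel)" for k
  proof -
   have "ennreal ((nm I01 (%s. F k s - g s))^2) = (\<integral>\<^sup>+ s. ennreal ((F k s - g s)^2) \<partial>I01)"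
    unfolding nm_sq by (rule nn_integral_eq_integral[symmetric]) (use sqi_diff[OF F_sqi gs] in \<open>auto simp: sqi_def\<close>)
   also have "... = (\<integral>\<^sup>+ s\<in>{0..1}. ennreal ((F k s - g s)^2) \<partial>lborel)"
    unfolding I01_def by (subst nn_integral_restrict_space) auto
   also have "... = (\<integral>\<^sup>+ s\<in>{0..t}. ennreal ((F k s - f s)^2) \<partial>lborel)"
   proof (rule nn_integral_cong_AE)
    have F0: "F k s = 0" if "s > t" for s
     unfolding F_def step_fun_def using p01[of "Suc _" k] that
     by (intro sum.neutral) (auto simp: indicator_def, (metis Suc_leI dual_order.trans leD less_le_not_le)?)
    show "AE s in lborel. ennreal ((F k s - g s)^2)*indicator {0..1} s = ennreal ((F k s - f s)^2)*indicator {0..t} s"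
     using AE_lborel_singleton[of t]
    proof eventually_elim
     case (elim s)
     then show ?case using t F0[of s] by (cases "s < t") (auto simp: g_def indicator_def)
    qed
   qed
   finally show ?thesis .
  qed
  have "(%k. ennreal ((nm I01 (%s. F k s - g s))^2)) \<longlonglongrightarrow> ennreal 0"
   unfolding eq using conv_f by (simp add: F_def)
  then have "(%k. (nm I01 (%s. F k s - g s))^2) \<longlonglongrightarrow> 0"
   by (subst (asm) tendsto_ennreal_iff) auto
  then have "(%k. sqrt ((nm I01 (%s. F k s - g s))^2)) \<longlonglongrightarrow> sqrt 0" by (rule tendsto_real_sqrt)
  then show ?thesis by (simp add: nm_nonneg)
 qed
 have bound: "nm M (%\<omega>. Y \<omega> - wint N v \<omega>) <= nm M (%\<omega>. Y \<omega> - S k \<omega>) + nm I01 (%s. F k s - g s) + nm I01 (%s. g s - vs s)" for k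
 proof -
  have "nm M (%\<omega>. (Y \<omega> - S k \<omega>) + (S k \<omega> - wint N v \<omega>)) <= nm M (%\<omega>. Y \<omega> - S k \<omega>) + nm M (%\<omega>. S k \<omega> - wint N v \<omega>)"
   by (intro nm_triangle sqi_diff Ys S_sqi wint_sqi)
  moreover have "nm I01 (%s. (F k s - g s) + (g s - vs s)) <= nm I01 (%s. F k s - g s) + nm I01 (%s. g s - vs s)"
   by (intro nm_triangle sqi_diff F_sqi gs vs_sqi)
  ultimately show ?thesis using iso[of k] by simp
 qed
 have "(%k. nm M (%\<omega>. Y \<omega> - S k \<omega>) + nm I01 (%s. F k s - g s) + nm I01 (%s. g s - vs s)) \<longlonglongrightarrow> 0 + 0 + nm I01 (%s. g s - vs s)"
  by (intro tendsto_add nmY nmF tendsto_const)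
 then have "nm M (%\<omega>. Y \<omega> - wint N v \<omega>) <= 0 + 0 + nm I01 (%s. g s - vs s)"
  by (rule LIMSEQ_le_const) (use bound in auto)
 also have "nm I01 (%s. g s - vs s) <= nm I01 (%s. g s - v (nat \<lfloor>N * s\<rfloor>))"
 proof -
  have "AE s in I01. vs s = v (nat \<lfloor>N * s\<rfloor>)"
  proof -
   have "AE s in I01. s ~= 1" unfolding I01_def
    by (subst AE_restrict_space_iff) (use AE_lborel_singleton[of 1] in \<open>auto elim: eventually_mono\<close>)
   then show ?thesis
    using AE_space
   proof eventually_elim
    case (elim s)
    then have s: "0 <= s" "s < 1" by (auto simp: space_I01)
    define i0 where "i0 = nat \<lfloor>N * s\<rfloor>"
    have Ns: "0 <= N * s" "N * s < N" using s N by auto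
    then have i0: "i0 < N" "real i0 <= N * s" "N * s < real i0 + 1" unfolding i0_def by linarith+
    have "indicator {real i/N..<real (Suc i)/N} s = (if i = i0 then 1 else 0 :: real)" for i
    proof -
     have "s : {real i/N..<real (Suc i)/N} \<longleftrightarrow> real i <= N * s & N * s < real i + 1"
      using N by (auto simp: divide_simps mult.commute)
     also have "... \<longleftrightarrow> i = i0" using i0 by linarith
     finally show ?thesis by (simp only: indicator_def of_bool_def)
    qed
    then have "vs s = (\<Sum>i<N. if i = i0 then v i else 0)"
     unfolding vs_def by (intro sum.cong) auto
    also have "... = v i0" using i0 by simp
    finally show ?case by (simp add: i0_def)
   qed
  qed
  note ae = this
  have "nm I01 (%s. g s - vs s) = nm I01 (%s. g s - v (nat \<lfloor>N * s\<rfloor>))"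
  proof (rule nm_cong_AE)
   show "AE s in I01. g s - vs s = g s - v (nat \<lfloor>real N * s\<rfloor>)" using ae by eventually_elim simp
   have "(%s. v (nat \<lfloor>real N * s\<rfloor>)) : borel_measurable I01" by (rule borel_measurable_I01) measurable
   then show "(%s. g s - v (nat \<lfloor>real N * s\<rfloor>)) : borel_measurable I01"
    by (rule borel_measurable_diff[OF sqi_measurable[OF gs]])
   show "(%s. g s - vs s) : borel_measurable I01"
    by (rule borel_measurable_diff[OF sqi_measurable[OF gs] sqi_measurable[OF vs_sqi]])
  qed
  then show ?thesis by simp
 qed
 finally show "nm M (%\<omega>. Y \<omega> - wint N v \<omega>) <= nm I01 (%s. (if s < t then f s else 0) - v (nat \<lfloor>N * s\<rfloor>))"
  by (simp add: g_def)
qed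

end

section \<open>The trigonometric system\<close>

text \<open>Index j carries the frequency j div 2 + 1; even and odd indices are cosine and sine,
  both shifted by the phase \<theta> of their frequency. Frequencies start at 1: the constant mode
  is treated with the low-rank part.\<close>

definition tmode :: "(nat => real) => nat => real => real" where
 "tmode \<theta> j x = sqrt 2*cos (2*pi*real (j div 2 + 1)*x - \<theta> (j div 2 + 1) - (if odd j then pi/2 else 0))"

lemma tmode_measurable [measurable]: "tmode \<theta> j : borel_measurable borel"
 unfolding tmode_def[abs_def] by measurable

lemma tmode_bound: "\<bar>tmode \<theta> j x\<bar> <= 2"
proof -
 have "\<bar>tmode \<theta> j x\<bar> <= sqrt 2*1" unfolding tmode_def abs_mult by (intro mult_mono) auto
 also have "sqrt 2 <= 2" by (simp add: real_le_lsqrt)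
 finally show ?thesis by simp
qed

lemma sqi_I01_bounded: "f : borel_measurable borel ==> (\<And>x. \<bar>f x\<bar> <= C) ==> f : sqi I01"
 by (rule sqi_bounded[OF I01.finite_measure_axioms borel_measurable_I01])

lemma tmode_sqi: "tmode \<theta> j : sqi I01"
 by (rule sqi_I01_bounded[OF tmode_measurable tmode_bound])

lemma integral_cos_period:
 assumes "n ~= (0::int)"
 shows "(LINT x|I01. cos (2*pi*real_of_int n*x + \<phi>)) = 0"
proof -
 let ?F = "%x. sin (2*pi*real_of_int n*x + \<phi>)/(2*pi*real_of_int n)"
 have "(LINT x|I01. cos (2*pi*real_of_int n*x + \<phi>)) =
  (LINT x|lborel. indicator {0..1} x *\<^sub>R cos (2*pi*real_of_int n*x + \<phi>))"
  by (simp add: I01_def integral_restrict_space)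
 also have "... = ?F 1 - ?F 0"
  by (rule integral_FTC_Icc) (use assms in \<open>auto intro!: derivative_eq_intros continuous_intros
    simp: has_real_derivative_iff_has_vector_derivative[symmetric]\<close>)
 also have "sin (2*pi*real_of_int n*1 + \<phi>) = sin (2*pi*real_of_int n*0 + \<phi>)"
  using sin_add[of "2*pi*real_of_int n" \<phi>] cos_int_2pin[of n] sin_int_2pin[of n] by (simp add: mult.commute)
 finally show ?thesis by simp
qed

lemma cos_mult_cos: "2*(cos a*cos b) = cos (a - b) + cos (a + b)" for a b :: real
 by (simp add: cos_diff cos_add)

lemma tmode_product:
 "tmode \<theta> i x*tmode \<theta>' j y =
  cos (2*pi*(real (i div 2 + 1)*x - real (j div 2 + 1)*y) +
    (\<theta>' (j div 2 + 1) + (if odd j then pi/2 else 0) - \<theta> (i div 2 + 1) - (if odd i then pi/2 else 0))) +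
  cos (2*pi*(real (i div 2 + 1)*x + real (j div 2 + 1)*y) +
    (- \<theta>' (j div 2 + 1) - (if odd j then pi/2 else 0) - \<theta> (i div 2 + 1) - (if odd i then pi/2 else 0)))"
proof -
 let ?a = "2*pi*real (i div 2 + 1)*x - \<theta> (i div 2 + 1) - (if odd i then pi/2 else 0)"
 let ?b = "2*pi*real (j div 2 + 1)*y - \<theta>' (j div 2 + 1) - (if odd j then pi/2 else 0)"
 have "tmode \<theta> i x*tmode \<theta>' j y = (sqrt 2 * sqrt 2)*(cos ?a*cos ?b)" unfolding tmode_def by (simp only: mult_ac)
 also have "... = cos (?a - ?b) + cos (?a + ?b)" using cos_mult_cos[of ?a ?b] by simp
 finally show ?thesis by (simp add: algebra_simps)
qed

lemma same_frequency_offset: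
 assumes "i div 2 = j div 2"
 shows "cos ((if odd j then pi/2 else 0) - (if odd i then pi/2 else 0)) = (if i = j then 1 else 0 :: real)"
proof (cases "i = j")
 case False
 then have "odd i ~= odd j" using assms by (metis div_mult_mod_eq parity_cases even_iff_mod_2_eq_zero odd_iff_mod_2_eq_one)
 then show ?thesis using False by auto
qed simp

lemma tmode_orthonormal: "orthonormal I01 J (tmode \<theta>)"
 unfolding orthonormal_def
proof (intro conjI ballI)
 fix i j :: nat
 define k l :: nat where "k = i div 2 + 1" and "l = j div 2 + 1"
 define \<phi> where "\<phi> = \<theta> l + (if odd j then pi/2 else 0) - \<theta> k - (if odd i then pi/2 else 0)"
 define \<phi>' where "\<phi>' = - \<theta> l - (if odd j then pi/2 else 0) - \<theta> k - (if odd i then pi/2 else 0)"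
 have "ip I01 (tmode \<theta> i) (tmode \<theta> j) =
   (LINT x|I01. cos (2*pi*real_of_int (int k - int l)*x + \<phi>) + cos (2*pi*real_of_int (int k + int l)*x + \<phi>'))"
  unfolding ip_def tmode_product k_def[symmetric] l_def[symmetric] \<phi>_def[symmetric] \<phi>'_def[symmetric]
  by (intro Bochner_Integration.integral_cong refl) (simp add: algebra_simps)
 also have "... = (LINT x|I01. cos (2*pi*real_of_int (int k - int l)*x + \<phi>)) + (LINT x|I01. cos (2*pi*real_of_int (int k + int l)*x + \<phi>'))"
  by (intro Bochner_Integration.integral_add I01.integrable_const_bound[of _ 1]) (auto intro!: borel_measurable_I01)
 also have "(LINT x|I01. cos (2*pi*real_of_int (int k + int l)*x + \<phi>')) = 0"
  by (rule integral_cos_period) (simp add: k_def l_def)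
 finally have eq: "ip I01 (tmode \<theta> i) (tmode \<theta> j) = (LINT x|I01. cos (2*pi*real_of_int (int k - int l)*x + \<phi>))" by simp
 show "ip I01 (tmode \<theta> i) (tmode \<theta> j) = (if i = j then 1 else 0)"
 proof (cases "k = l")
  case True
  then have "i div 2 = j div 2" by (simp add: k_def l_def)
  from same_frequency_offset[OF this] True show ?thesis
   unfolding eq by (simp add: \<phi>_def I01.prob_space)
 next
  case False
  then have "(LINT x|I01. cos (2*pi*real_of_int (int k - int l)*x + \<phi>)) = 0"
   by (intro integral_cos_period) auto
  then show ?thesis using False unfolding eq by (auto simp: k_def l_def)
 qed
qed (rule tmode_sqi)

text \<open>The terms are real parts of the powers of an N-th root of unity other than 1, rotated by
  the phase.\<close>

lemma sum_cos_grid: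
 assumes N: "N > 0" and n: "\<not> int N dvd n"
 shows "(\<Sum>i<N. cos (2*pi*real_of_int n*(real i/N) + \<phi>)) = 0"
proof -
 define z where "z = cis (2*pi*real_of_int n/N)"
 have zN: "z^N = 1" 
 proof -
  have "real N*(2*pi*real_of_int n/N) = 2*pi*real_of_int n" using N by simp
  then show ?thesis unfolding z_def Complex.DeMoivre by (simp only: cis_multiple_2pi[OF Ints_of_int])
 qed
 have z1: "z ~= 1"
 proof
  assume "z = 1"
  then have "cos (2*pi*real_of_int n/N) = 1" unfolding z_def by (metis cis.simps(1) one_complex.simps(1))
  then obtain m :: int where "2*pi*real_of_int n/N = of_int m*2*pi"
   by (auto simp: cos_one_2pi_int)
  then have "real_of_int n = real_of_int m*real N" using N by (simp add: field_simps)
  then have "n = m*int N" by (metis of_int_eq_iff of_int_mult of_int_of_nat_eq)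
  then show False using n by simp
 qed
 have "(\<Sum>i<N. z^i) = 0" using zN z1 by (simp add: geometric_sum)
 then have "0 = Re (cis \<phi>*(\<Sum>i<N. z^i))" by simp
 also have "... = (\<Sum>i<N. Re (cis \<phi>*z^i))" by (simp add: sum_distrib_left)
 also have "... = (\<Sum>i<N. cos (2*pi*real_of_int n*(real i/N) + \<phi>))"
  unfolding z_def Complex.DeMoivre cis_mult by (intro sum.cong refl) (simp add: algebra_simps)
 finally show ?thesis by simp
qed

text \<open>Sampling preserves orthonormality as long as the sum of any two frequencies stays below
  N, which excludes aliasing.\<close>

lemma tmode_grid_orthonormal:
 assumes i: "i < m" and j: "j < m" and N: "N > m + 2"
 shows "(\<Sum>n<N. tmode \<theta> i (real n/N)*tmode \<theta> j (real n/N)) = (if i = j then real N else 0)"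
proof -
 define k l :: nat where "k = i div 2 + 1" and "l = j div 2 + 1"
 define \<phi> where "\<phi> = \<theta> l + (if odd j then pi/2 else 0) - \<theta> k - (if odd i then pi/2 else 0)"
 define \<phi>' where "\<phi>' = - \<theta> l - (if odd j then pi/2 else 0) - \<theta> k - (if odd i then pi/2 else 0)"
 have kl: "0 < k + l" "k + l < N" using i j N by (auto simp: k_def l_def)
 have "(\<Sum>n<N. tmode \<theta> i (real n/N)*tmode \<theta> j (real n/N)) =
   (\<Sum>n<N. cos (2*pi*real_of_int (int k - int l)*(real n/N) + \<phi>) + cos (2*pi*real_of_int (int k + int l)*(real n/N) + \<phi>'))"
  unfolding tmode_product k_def[symmetric] l_def[symmetric] \<phi>_def[symmetric] \<phi>'_def[symmetric]
  by (intro sum.cong refl) (simp add: algebra_simps)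
 also have "... = (\<Sum>n<N. cos (2*pi*real_of_int (int k - int l)*(real n/N) + \<phi>)) + (\<Sum>n<N. cos (2*pi*real_of_int (int k + int l)*(real n/N) + \<phi>'))"
  by (rule sum.distrib)
 also have "(\<Sum>n<N. cos (2*pi*real_of_int (int k + int l)*(real n/N) + \<phi>')) = 0"
  using kl N by (intro sum_cos_grid) (auto dest: zdvd_imp_le)
 finally have eq: "(\<Sum>n<N. tmode \<theta> i (real n/N)*tmode \<theta> j (real n/N)) = (\<Sum>n<N. cos (2*pi*real_of_int (int k - int l)*(real n/N) + \<phi>))" by simp
 show ?thesis
 proof (cases "k = l")
  case True
  then have "i div 2 = j div 2" by (simp add: k_def l_def)
  from same_frequency_offset[OF this] True show ?thesis
   unfolding eq by (simp add: \<phi>_def)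
 next
  case False
  have "\<not> int N dvd (int k - int l)"
  proof
   assume "int N dvd (int k - int l)"
   moreover have "\<bar>int k - int l\<bar> < int N" using kl by linarith
   moreover have "int k - int l ~= 0" using False by simp
   ultimately show False using dvd_imp_le_int[of "int k - int l" "int N"] by linarith
  qed
  then have "(\<Sum>n<N. cos (2*pi*real_of_int (int k - int l)*(real n/N) + \<phi>)) = 0"
   using N by (intro sum_cos_grid) auto
  then show ?thesis using False unfolding eq by (auto simp: k_def l_def)
 qed
qed

text \<open>Completeness of the trigonometric system, via Weierstrass approximation of the even and the
 odd part about the midpoint as functions of the cosine.\<close>

inductive_set trigs :: "(real => real) set" where
 trigs_cos: "(%x. c*cos (2*pi*real k*x - \<phi>)) : trigs"
| trigs_add: "f : trigs ==> g : trigs ==> (%x. f x + g x) : trigs"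

lemma trigs_const: "(%x. c) : trigs"
 using trigs_cos[of c 0 0] by simp

lemma trigs_cmult: "f : trigs ==> (%x. c * f x) : trigs"
 by (induction rule: trigs.induct) (auto simp: distrib_left mult.assoc[symmetric] intro: trigs.intros)

lemma trigs_sum: "(\<And>i. i : I ==> f i : trigs) ==> (%x. \<Sum>i\<in>I. f i x) : trigs"
 by (induction I rule: infinite_finite_induct) (auto intro: trigs_const trigs_add)

lemma trigs_mult_cos: "f : trigs ==> (%x. cos (2*pi*x) * f x) : trigs"
proof (induction rule: trigs.induct)
 case (trigs_cos c k \<phi>)
 show ?case
 proof (cases k)
  case 0
  then show ?thesis using trigs.trigs_cos[of "c*cos \<phi>" 1 0] by (simp add: mult_ac)
 next
  case (Suc n)
  have "cos (2*pi*x)*(c*cos (2*pi*real k*x - \<phi>)) =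
   c/2*cos (2*pi*real n*x - \<phi>) + c/2*cos (2*pi*real (k + 1)*x - \<phi>)" for x
   using arg_cong[OF cos_mult_cos[of "2*pi*real k*x - \<phi>" "2*pi*x"], of "%z. c/2*z"] Suc
   by (simp add: algebra_simps)
  then show ?thesis using trigs_add[OF trigs.trigs_cos[of "c/2" n \<phi>] trigs.trigs_cos[of "c/2" "k + 1" \<phi>]] by simp
 qed
qed (auto simp: distrib_left intro: trigs_add)

lemma trigs_mult_cos_power: "f : trigs ==> (%x. cos (2*pi*x)^n * f x) : trigs"
 by (induction n) (auto simp: mult.assoc dest: trigs_mult_cos)

lemma trigs_expand:
 assumes "f : trigs"
 shows "\<exists>n p0 p. f = (%x. p0 + (\<Sum>j<2*n. p j*tmode (%_. 0) j x))"
 using assms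
proof (induction rule: trigs.induct)
 case (trigs_cos c k \<phi>)
 show ?case
 proof (cases k)
  case 0
  show ?thesis by (rule exI[of _ 0], rule exI[of _ "c*cos \<phi>"]) (use 0 in auto)
 next
  case (Suc n)
  define p where "p j = (if j = 2*n then c*cos \<phi>/sqrt 2 else if j = 2*n + 1 then c * sin \<phi>/sqrt 2 else 0)" for j :: nat
  have "(\<Sum>j<2*k. p j*tmode (%_. 0) j x) = c*cos (2*pi*real k*x - \<phi>)" for x
  proof -
   have "(\<Sum>j<2*k. p j*tmode (%_. 0) j x) = (\<Sum>j\<in>{2*n, 2*n + 1}. p j*tmode (%_. 0) j x)"
    by (rule sum.mono_neutral_right) (auto simp: p_def Suc)
   also have "... = c*(cos \<phi>*cos (2*pi*real k*x) + sin \<phi> * sin (2*pi*real k*x))"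
    by (simp add: p_def tmode_def Suc cos_diff algebra_simps)
   finally show ?thesis by (simp add: cos_diff algebra_simps)
  qed
  then show ?thesis by (intro exI[of _ k] exI[of _ 0] exI[of _ p]) auto
 qed
next
 case (trigs_add f g)
 then obtain n p0 p n' p0' p' where f: "f = (%x. p0 + (\<Sum>j<2*n. p j*tmode (%_. 0) j x))"
  and g: "g = (%x. p0' + (\<Sum>j<2*n'. p' j*tmode (%_. 0) j x))" by blast
 define q where "q j = (if j < 2*n then p j else 0) + (if j < 2*n' then p' j else 0)" for j
 have ext: "(\<Sum>j<2*n. p j*tmode (%_. 0) j x) = (\<Sum>j<2 * max n n'. (if j < 2*n then p j else 0)*tmode (%_. 0) j x)"
  "(\<Sum>j<2*n'. p' j*tmode (%_. 0) j x) = (\<Sum>j<2 * max n n'. (if j < 2*n' then p' j else 0)*tmode (%_. 0) j x)"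
  for x by (rule sum.mono_neutral_cong_left; auto)+
 have "f x + g x = (p0 + p0') + (\<Sum>j<2 * max n n'. q j*tmode (%_. 0) j x)" for x
  unfolding f g ext by (simp add: q_def distrib_right sum.distrib)
 then show ?case by (intro exI[of _ "max n n'"] exI[of _ "p0 + p0'"] exI[of _ q]) auto
qed

text \<open>\<open>cos (2*pi*x)\<close> maps [0,1/2] bijectively onto [-1,1], so F becomes a
  continuous function of it. Folding x to 1 - x leaves the cosine unchanged.\<close>

lemma cos_polynomial_approx:
 fixes F :: "real => real"
 assumes c: "continuous_on {0..1/2} F" and e: "e > 0"
 shows "\<exists>n (a :: nat => real). \<forall>x\<in>{0..1}. \<bar>F (if x <= 1/2 then x else 1 - x) - (\<Sum>i\<le>n. a i*cos (2*pi*x)^i)\<bar> < e"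
proof -
 define h where "h y = F (arccos y/(2*pi))" for y
 have "continuous_on {-1..1} h"
  unfolding h_def
 proof (rule continuous_on_compose2[OF c])
  show "continuous_on {-1..1} (%y. arccos y/(2*pi))" by (intro continuous_intros continuous_on_arccos') auto
  show "(%y. arccos y/(2*pi)) ` {-1..1} \<subseteq> {0..1/2}"
   using arccos_lbound arccos_ubound by (auto simp: divide_simps)
 qed
 then obtain g where g: "real_polynomial_function g" "\<And>y. y : {-1..1} ==> \<bar>h y - g y\<bar> < e"
  using Stone_Weierstrass_real_polynomial_function[of "{-1..1::real}" h e] e by auto
 obtain a n where gs: "g = (%x. \<Sum>i\<le>n. a i*x^i)" using real_polynomial_function_imp_sum[OF g(1)] by blast
 have "\<bar>F (if x <= 1/2 then x else 1 - x) - (\<Sum>i\<le>n. a i*cos (2*pi*x)^i)\<bar> < e" if x: "x : {0..1}" for x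
 proof -
  define u where "u = (if x <= 1/2 then x else 1 - x)"
  have u: "0 <= u" "u <= 1/2" using x by (auto simp: u_def)
  have c1: "cos (2*pi*x) = cos (2*pi*u)"
  proof (cases "x <= 1/2")
   case False
   have "cos (2*pi*(1 - x)) = cos (2*pi - 2*pi*x)" by (simp add: right_diff_distrib)
   then show ?thesis using False by (simp add: u_def)
  qed (simp add: u_def)
  have "2*pi*u <= pi" using u by simp
  then have "arccos (cos (2*pi*u)) = 2*pi*u" using u by (intro arccos_cos) auto
  then have h1: "h (cos (2*pi*u)) = F u" by (simp add: h_def)
  have b1: "\<bar>h (cos (2*pi*u)) - g (cos (2*pi*u))\<bar> < e" by (intro g) auto
  show ?thesis unfolding u_def[symmetric] c1 using b1[unfolded h1 gs] .
 qed
 then show ?thesis by blast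
qed

lemma continuous_on_vanishing_ends:
 fixes F :: "real => real"
 assumes d: "0 < \<delta>" "2*\<delta> < b" and c: "continuous_on {\<delta>..b - \<delta>} F"
  and z: "\<And>x. 0 <= x ==> x <= \<delta> ==> F x = 0" "\<And>x. b - \<delta> <= x ==> x <= b ==> F x = 0"
 shows "continuous_on {0..b} F"
proof -
 have z1: "continuous_on {0..\<delta>} F" and z2: "continuous_on {b - \<delta>..b} F"
  using z by (auto intro: continuous_on_eq[OF continuous_on_const[of _ 0]])
 have "continuous_on ({0..\<delta>} \<union> {\<delta>..b - \<delta>}) F" by (rule continuous_on_closed_Un[OF _ _ z1 c]) auto
 then have "continuous_on (({0..\<delta>} \<union> {\<delta>..b - \<delta>}) \<union> {b - \<delta>..b}) F"
  by (rule continuous_on_closed_Un[OF _ _ _ z2, rotated 2]) (auto intro: closed_Un)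
 moreover have "({0..\<delta>} \<union> {\<delta>..b - \<delta>}) \<union> {b - \<delta>..b} = {0..b}" using d by auto
 ultimately show ?thesis by simp
qed

text \<open>Vanishes near 0, 1/2 and 1, the zeros of \<open>sin (2*pi*x)\<close> in the unit
  interval, and tends to 1 at every other point of it. The end points are also where the function to
  be approximated may be singular.\<close>

definition cutoff :: "nat => real => real" where
 "cutoff n x = max 0 (min 1 (real n * min (min x (1 - x)) \<bar>x - 1/2\<bar> - 1))"

lemma trigs_L2_dense:
 fixes f :: "real => real"
 assumes f: "f : sqi I01" and c: "continuous_on {0<..<1} f" and e: "e > 0"
 shows "\<exists>g\<in>trigs. nm I01 (%x. f x - g x) < e"
proof -
 have cut01: "0 <= cutoff n x" "cutoff n x <= 1" for n x by (auto simp: cutoff_def)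
 have cutm: "cutoff n : borel_measurable I01" for n
  unfolding cutoff_def[abs_def] by (intro borel_measurable_I01) measurable
 note fm = sqi_measurable[OF f]
 have "(%n. \<integral>x. (f x - f x*cutoff n x)^2 \<partial>I01) \<longlonglongrightarrow> (LINT x|I01. 0)"
 proof (rule integral_dominated_convergence[where w = "%x. (f x)^2"])
  show "integrable I01 (%x. (f x)^2)" using f by (rule sqi_integrable)
  show "(%x. (f x - f x*cutoff n x)^2) : borel_measurable I01" for n using fm cutm by measurable
  have bd: "(f x - f x*cutoff n x)^2 <= (f x)^2" for n x
  proof -
   have "(f x - f x*cutoff n x)^2 = (f x)^2*(1 - cutoff n x)^2" by (simp add: power_mult_distrib[symmetric] algebra_simps)
   also have "... <= (f x)^2*1" using cut01[of n x] by (intro mult_left_mono) (auto simp: power_le_one)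
   finally show ?thesis by simp
  qed
  show "AE x in I01. norm ((f x - f x*cutoff n x)^2) <= (f x)^2" for n using bd by (auto intro!: AE_I2)
  have "AE x in I01. x ~= 0 & x ~= 1 & x ~= 1/2" unfolding I01_def
   using AE_lborel_singleton[of "0::real"] AE_lborel_singleton[of "1::real"] AE_lborel_singleton[of "1/2::real"]
   by (subst AE_restrict_space_iff) (auto elim!: eventually_elim2)
  then show "AE x in I01. (%n. (f x - f x*cutoff n x)^2) \<longlonglongrightarrow> 0"
   using AE_space
  proof eventually_elim
   case (elim x)
   define d where "d = min (min x (1 - x)) \<bar>x - 1/2\<bar>"
   have d: "d > 0" using elim by (auto simp: d_def space_I01)
   obtain n0 where n0: "2/d < real n0" using reals_Archimedean2 by blast
   have "cutoff n x = 1" if "n >= n0" for n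
   proof -
    have "2/d <= n" using n0 that by linarith
    then have "2 <= n*d" using d by (simp add: field_simps)
    then show ?thesis by (simp add: cutoff_def d_def[symmetric])
   qed
   then have "eventually (%n. (f x - f x*cutoff n x)^2 = 0) sequentially"
    by (auto simp: eventually_sequentially intro!: exI[of _ n0])
   then show ?case by (rule tendsto_eventually)
  qed
 qed auto
 then have "(%n. sqrt (LINT x|I01. (f x - f x*cutoff n x)^2)) \<longlonglongrightarrow> sqrt 0" by (intro tendsto_real_sqrt) simp
 then have "eventually (%n. sqrt (LINT x|I01. (f x - f x*cutoff n x)^2) < e/2) sequentially"
  using e by (intro order_tendstoD(2)) auto
 then have "eventually (%n. nm I01 (%x. f x - f x*cutoff n x) < e/2 & n >= 10) sequentially"
  using eventually_ge_at_top[of 10] unfolding nm_def by eventually_elim simp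
 then obtain n where n: "nm I01 (%x. f x - f x*cutoff n x) < e/2" "n >= 10"
  using eventually_happens'[OF sequentially_bot] by blast
 define g where "g x = f x*cutoff n x" for x
 define \<delta> where "\<delta> = 1/real n"
 have \<delta>: "0 < \<delta>" "\<delta> <= 1/10" using n by (auto simp: \<delta>_def divide_simps)
 have g0: "g x = 0" if "x <= \<delta> \<or> 1 - x <= \<delta> \<or> \<bar>x - 1/2\<bar> <= \<delta>" for x
 proof -
  have "min (min x (1 - x)) \<bar>x - 1/2\<bar> <= 1/n" using that by (auto simp: \<delta>_def)
  then have "n * min (min x (1 - x)) \<bar>x - 1/2\<bar> <= n*(1/n)" by (intro mult_left_mono) auto
  moreover have "real n*(1/n) = 1" using n by simp
  ultimately have "min 1 (real n * min (min x (1 - x)) \<bar>x - 1/2\<bar> - 1) <= 0" by (intro min.coboundedI2) linarith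
  then have "cutoff n x = 0" unfolding cutoff_def by (rule max_absorb1)
  then show ?thesis by (simp add: g_def)
 qed
 have gc: "continuous_on {0<..<1} g" unfolding g_def cutoff_def by (intro continuous_intros c)
 have gc2: "continuous_on {\<delta>..1/2 - \<delta>} g" "continuous_on {\<delta>..1/2 - \<delta>} (%x. g (1 - x))"
  using \<delta> by (auto intro!: continuous_on_subset[OF gc] continuous_on_compose2[OF gc] continuous_intros)
 \<comment> \<open>Reflection at 1/2 fixes \<open>cos (2*pi*x)\<close> and negates
   \<open>sin (2*pi*x)\<close>: the even part is a function of the cosine, the odd part the sine
   times such a function. The division is harmless because \<open>g\<close> vanishes near the zeros
   of the sine.\<close>
 define E where "E x = (g x + g (1 - x))/2" for x
 define O' where "O' x = (g x - g (1 - x))/2/sin (2*pi*x)" for x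
 have Ec: "continuous_on {0..1/2} E"
  by (rule continuous_on_vanishing_ends[of \<delta>]) (use \<delta> gc2 g0 in \<open>auto simp: E_def intro!: continuous_intros\<close>)
 have "sin (2*pi*x) ~= 0" if "\<delta> <= x" "x <= 1/2 - \<delta>" for x
 proof -
  have "2*pi*x < 2*pi*(1/2)" "0 < 2*pi*x" using that \<delta> by (auto intro: mult_strict_left_mono)
  then have "sin (2*pi*x) > 0" by (intro sin_gt_zero) auto
  then show ?thesis by simp
 qed
 then have Oc: "continuous_on {0..1/2} O'"
  by (intro continuous_on_vanishing_ends[of \<delta>]) (use \<delta> gc2 g0 in \<open>auto simp: O'_def intro!: continuous_intros\<close>)
 obtain n1 a1 where A1: "\<And>x. x : {0..1} ==> \<bar>E (if x <= 1/2 then x else 1 - x) - (\<Sum>i\<le>n1. a1 i*cos (2*pi*x)^i)\<bar> < e/4"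
  using cos_polynomial_approx[OF Ec divide_pos_pos[OF e zero_less_numeral], of "Num.Bit0 (Num.Bit0 Num.One)"] by blast
 obtain n2 a2 where A2: "\<And>x. x : {0..1} ==> \<bar>O' (if x <= 1/2 then x else 1 - x) - (\<Sum>i\<le>n2. a2 i*cos (2*pi*x)^i)\<bar> < e/4"
  using cos_polynomial_approx[OF Oc divide_pos_pos[OF e zero_less_numeral], of "Num.Bit0 (Num.Bit0 Num.One)"] by blast
 define h where "h x = (\<Sum>i\<le>n1. a1 i*cos (2*pi*x)^i) + (\<Sum>i\<le>n2. a2 i*(cos (2*pi*x)^i * sin (2*pi*x)))" for x
 have sin_trig: "(%x. sin (2*pi*x)) : trigs"
  using trigs_cos[of 1 1 "pi/2"] by (simp add: cos_diff)
 have h: "h : trigs" unfolding h_def[abs_def]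
  using trigs_mult_cos_power[OF trigs_const[of 1]] trigs_mult_cos_power[OF sin_trig]
  by (intro trigs_add trigs_sum trigs_cmult) auto
 have gh: "\<bar>g x - h x\<bar> <= e/2" if x: "x : {0..1}" for x
 proof -
  define u where "u = (if x <= 1/2 then x else 1 - x)"
  have dec: "g x = E u + sin (2*pi*x)*O' u"
  proof (cases "sin (2*pi*x) = 0")
   case True
   have "x = 0 \<or> x = 1/2 \<or> x = 1"
   proof (rule ccontr)
    assume "\<not> ?thesis"
    then consider "0 < x" "x < 1/2" | "1/2 < x" "x < 1" using x by fastforce
    then show False
    proof cases
     case 1
     then have "0 < 2*pi*x" "2*pi*x < 2*pi*(1/2)" by (auto intro: mult_strict_left_mono)
     then show False using sin_gt_zero[of "2*pi*x"] True by simp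
    next
     case 2
     then have "0 < 2*pi*(1 - x)" "2*pi*(1 - x) < 2*pi*(1/2)" by (auto intro: mult_strict_left_mono)
     then have "sin (2*pi*(1 - x)) > 0" by (intro sin_gt_zero) auto
     moreover have "sin (2*pi*(1 - x)) = - sin (2*pi*x)" by (simp add: right_diff_distrib sin_diff)
     ultimately show False using True by simp
    qed
   qed
   then have "g x = 0" "g u = 0" "g (1 - u) = 0" using g0 \<delta> by (auto simp: u_def)
   then show ?thesis using True by (simp add: E_def)
  next
   case False
   have "sin (2*pi*(1 - x)) = - sin (2*pi*x)" by (simp add: right_diff_distrib sin_diff)
   then show ?thesis using False by (auto simp: u_def E_def O'_def field_simps)
  qed
  have "g x - h x = (E u - (\<Sum>i\<le>n1. a1 i*cos (2*pi*x)^i)) + sin (2*pi*x)*(O' u - (\<Sum>i\<le>n2. a2 i*cos (2*pi*x)^i))"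
   unfolding dec h_def by (simp add: right_diff_distrib sum_distrib_left mult_ac)
  also have "\<bar>...\<bar> <= e/4 + 1*(e/4)"
  proof (rule order_trans[OF abs_triangle_ineq], rule add_mono)
   show "\<bar>E u - (\<Sum>i\<le>n1. a1 i*cos (2*pi*x)^i)\<bar> <= e/4" using A1[OF x] unfolding u_def by simp
   have "\<bar>O' u - (\<Sum>i\<le>n2. a2 i*cos (2*pi*x)^i)\<bar> <= e/4" using A2[OF x] unfolding u_def by simp
   then show "\<bar>sin (2*pi*x)*(O' u - (\<Sum>i\<le>n2. a2 i*cos (2*pi*x)^i))\<bar> <= 1*(e/4)"
    unfolding abs_mult by (intro mult_mono) auto
  qed
  finally show ?thesis by simp
 qed
 have hm: "h : borel_measurable borel" unfolding h_def[abs_def] by measurable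
 have gs: "g : sqi I01"
 proof (rule sqi_bound[where g = "%x. \<bar>f x\<bar>"])
  show "g : borel_measurable I01" unfolding g_def[abs_def] by (rule borel_measurable_times[OF fm cutm])
  show "AE x in I01. \<bar>g x\<bar> <= \<bar>f x\<bar>"
   using cut01[of n] by (auto simp: g_def abs_mult intro!: mult_left_le)
 qed (use f in \<open>auto simp: sqi_def\<close>)
 have hs: "h : sqi I01"
 proof -
  have cont: "continuous_on {0..1} h" unfolding h_def by (intro continuous_intros)
  have "bounded (h ` {0..1})" by (rule compact_imp_bounded[OF compact_continuous_image[OF cont]]) simp
  then obtain C where "\<forall>y\<in>h ` {0..1}. norm y <= C" unfolding bounded_iff by blast
  then show ?thesis
   by (intro sqi_bounded[OF I01.finite_measure_axioms borel_measurable_I01[OF hm]]) (auto simp: space_I01)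
 qed
 have "nm I01 (%x. g x - h x) <= nm I01 (%x. e/2)"
  using gh by (intro nm_mono AE_I2) (auto simp: space_I01 intro!: sqi_I01_bounded)
 then have gh2: "nm I01 (%x. g x - h x) <= e/2" using e by (simp add: nm_const[OF prob_space_I01])
 have "nm I01 (%x. (f x - g x) + (g x - h x)) <= nm I01 (%x. f x - g x) + nm I01 (%x. g x - h x)"
  by (intro nm_triangle sqi_diff f gs hs)
 then have "nm I01 (%x. f x - h x) < e" using n(1) gh2 unfolding g_def[symmetric] by simp
 then show ?thesis using h by blast
qed

lemma Fourier_L2:
 fixes f :: "real => real"
 assumes f: "f : sqi I01" and c: "continuous_on {0<..<1} f" and e: "e > 0"
 shows "\<exists>n0. \<forall>n\<ge>n0. nm I01 (%x. f x - ((LINT x|I01. f x) + (\<Sum>j<2*n. ip I01 f (tmode (%_. 0) j)*tmode (%_. 0) j x))) < e"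
proof -
 obtain g where g: "g : trigs" "nm I01 (%x. f x - g x) < e" using trigs_L2_dense[OF assms] by blast
 obtain n0 p0 p where gp: "g = (%x. p0 + (\<Sum>j<2*n0. p j*tmode (%_. 0) j x))" using trigs_expand[OF g(1)] by blast
 have "nm I01 (%x. f x - ((LINT x|I01. f x) + (\<Sum>j<2*n. ip I01 f (tmode (%_. 0) j)*tmode (%_. 0) j x))) < e"
  if n: "n >= n0" for n
 proof -
  \<comment> \<open>The modes start at frequency 1, so the constant function is put in front of
    them.\<close>
  define E where "E j = (case j of 0 => (%x. 1) | Suc i => tmode (%_. 0) i)" for j
  have E01: "ip I01 (%x. 1) (tmode (%_. 0) j) = 0" for j
   using integral_cos_period[of "int (j div 2 + 1)" "- (if odd j then pi/2 else 0)"] by (simp add: ip_def tmode_def[abs_def])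
  have on: "orthonormal I01 {..<Suc (2*n)} E"
   unfolding orthonormal_def
  proof (intro conjI ballI)
   fix i j
   show "E j : sqi I01" for j by (cases j) (auto simp: E_def tmode_sqi intro!: sqi_I01_bounded)
   show "ip I01 (E i) (E j) = (if i = j then 1 else 0)"
    using tmode_orthonormal[of UNIV "%_. 0"] E01 I01.prob_space
    by (cases i; cases j) (auto simp: E_def orthonormal_def ip_commute[of I01 "tmode _ _" "%x. 1"] ip_def[of I01 "%x. 1" "%x. 1"])
  qed
  define a where "a j = (case j of 0 => p0 | Suc i => if i < 2*n0 then p i else 0)" for j
  have sE: "(\<Sum>j<Suc (2*n). q j*E j x) = q 0 + (\<Sum>j<2*n. q (Suc j)*tmode (%_. 0) j x)" for q :: "nat => real" and x
   unfolding sum.lessThan_Suc_shift by (simp add: E_def)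
  have ga: "g x = (\<Sum>j<Suc (2*n). a j*E j x)" for x
  proof -
   have "(\<Sum>j<2*n0. p j*tmode (%_. 0) j x) = (\<Sum>j<2*n. (if j < 2*n0 then p j else 0)*tmode (%_. 0) j x)"
    using n by (intro sum.mono_neutral_cong_left) auto
   then show ?thesis unfolding gp sE by (simp add: a_def)
  qed
  have "nm I01 (%x. f x - (\<Sum>j<Suc (2*n). ip I01 f (E j)*E j x)) <= nm I01 (%x. f x - (\<Sum>j<Suc (2*n). a j*E j x))"
   by (rule best_approximation[OF on _ f]) simp
  then have "nm I01 (%x. f x - (\<Sum>j<Suc (2*n). ip I01 f (E j)*E j x)) < e" using g(2) unfolding ga by simp
  moreover have "ip I01 f (E 0) = (LINT x|I01. f x)" by (simp add: E_def ip_def)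
  moreover have "ip I01 f (E (Suc j)) = ip I01 f (tmode (%_. 0) j)" for j by (simp add: E_def)
  ultimately show ?thesis unfolding sE by simp
 qed
 then show ?thesis by blast
qed

section \<open>Periodized power kernels\<close>

text \<open>The periodization of the damped power \<open>x powr \<gamma>*exp (- a*x)\<close> on the
  positive half-line; the damping makes the series converge for every \<gamma>.\<close>

definition psi :: "real => real => real => real" where
 "psi \<gamma> a x = (\<Sum>l. (x + real l) powr \<gamma>*exp (- a*(x + real l)))"

text \<open>Dominates, uniformly for 0 < x <= 2, the part of \<open>psi\<close> without its first
  summand, the only one that can be singular at 0.\<close>

definition psi_tail :: "nat => real => real" where
 "psi_tail q a = (\<Sum>l. (real l + 3)^q*exp (- a*(real l + 1)))"

text \<open>Half of the damping absorbs the power, through y^q <= q! exp y, and the other half sums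
  geometrically. The bound is polynomial in 1/a, so an exponentially small damping costs only an
  exponential factor.\<close>

lemma psi_tail_bound:
 assumes a: "0 < a" "a <= 1"
 shows "summable (%l. (real l + 3)^q*exp (- a*(real l + 1)))"
  and "psi_tail q a <= 4*exp 1 * fact q*2^q/a^(q + 1)"
proof -
 define C where "C = exp 1 * fact q*(2/a)^q"
 have C0: "C >= 0" using a by (simp add: C_def)
 have tb: "(real l + 3)^q*exp (- a*(real l + 1)) <= C*exp (- a/2)^l" for l
 proof -
  define y where "y = a*(real l + 3)/2"
  have y: "y >= 0" using a by (simp add: y_def)
  have "y^q/fact q <= exp y"
  proof -
   have "(\<Sum>n\<in>{q}. y^n /\<^sub>R fact n) <= (\<Sum>n. y^n /\<^sub>R fact n)"
    using y by (intro sum_le_suminf summable_exp_generic) auto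
   then show ?thesis by (simp add: exp_def divide_inverse mult.commute)
  qed
  then have "y^q <= fact q*exp y" by (simp add: field_simps)
  moreover have "real l + 3 = 2/a*y" using a by (simp add: y_def)
  then have "(real l + 3)^q = (2/a)^q*y^q" by (simp only: power_mult_distrib)
  ultimately have "(real l + 3)^q <= (2/a)^q*(fact q*exp y)" using a by (simp add: mult_left_mono)
  then have "(real l + 3)^q*exp (- a*(real l + 1)) <= (2/a)^q*(fact q*exp y)*exp (- a*(real l + 1))"
   by (rule mult_right_mono) simp
  also have "... = (2/a)^q * fact q*exp (a/2 + - a/2*real l)"
   by (simp add: exp_add[symmetric] y_def) (simp add: algebra_simps)
  also have "... = (2/a)^q * fact q*exp (a/2)*exp (- a/2)^l"
  proof -
   have "exp (- a/2*real l) = exp (- a/2)^l" by (subst exp_of_nat_mult[symmetric]) (simp add: mult.commute)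
   then show ?thesis unfolding exp_add by simp
  qed
  also have "... <= C*exp (- a/2)^l"
   using a by (intro mult_right_mono) (auto simp: C_def mult_ac intro!: mult_left_mono)
  finally show ?thesis .
 qed
 have e1: "exp (- a/2) < 1" using a by simp
 have sg: "summable (%l. C*exp (- a/2)^l)" using e1 by (intro summable_mult summable_geometric) auto
 show s: "summable (%l. (real l + 3)^q*exp (- a*(real l + 1)))"
  by (rule summable_comparison_test'[OF sg, of 0]) (use tb in auto)
 have "psi_tail q a <= (\<Sum>l. C*exp (- a/2)^l)"
  unfolding psi_tail_def by (rule suminf_le[OF tb s sg])
 also have "... = C*(1/(1 - exp (- a/2)))"
  using e1 by (simp add: suminf_mult summable_geometric suminf_geometric)
 also have "... <= C*(4/a)"
 proof (rule mult_left_mono[OF _ C0])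
  have "1 + a/2 <= exp (a/2)" by (rule exp_ge_add_one_self)
  then have "exp (- a/2) <= 1/(1 + a/2)" using a by (simp add: exp_minus divide_simps)
  moreover have "1/(1 + a/2) <= 1 - a/4" using a by (simp add: divide_simps) (simp add: algebra_simps)
  ultimately have "a/4 <= 1 - exp (- a/2)" by linarith
  then show "1/(1 - exp (- a/2)) <= 4/a" using a e1 by (simp add: divide_simps)
 qed
 also have "... = 4*exp 1 * fact q*2^q/a^(q + 1)" using a by (simp add: C_def power_divide mult_ac)
 finally show "psi_tail q a <= 4*exp 1 * fact q*2^q/a^(q + 1)" .
qed

lemma psi_term_bound:
 assumes "0 < x" "x <= 2" "\<gamma> <= real q" "a > 0"
 shows "(x + real (Suc l)) powr \<gamma>*exp (- a*(x + real (Suc l))) <= (real l + 3)^q*exp (- a*(real l + 1))"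
proof (rule mult_mono)
 have "(x + real (Suc l)) powr \<gamma> <= (x + real (Suc l)) powr real q"
  using assms by (intro powr_mono) auto
 also have "... = (x + real (Suc l))^q" using assms by (subst powr_realpow) auto
 also have "... <= (real l + 3)^q" using assms by (intro power_mono) auto
 finally show "(x + real (Suc l)) powr \<gamma> <= (real l + 3)^q" .
 show "exp (- a*(x + real (Suc l))) <= exp (- a*(real l + 1))" using assms by simp
qed auto

lemma psi_summable:
 assumes x: "0 < x" "x <= 2" and a: "0 < a" "a <= 1"
 shows "summable (%l. (x + real l) powr \<gamma>*exp (- a*(x + real l)))"
proof -
 obtain q :: nat where q: "\<gamma> <= real q" using real_arch_simple by blast
 have "summable (%l. (x + real (Suc l)) powr \<gamma>*exp (- a*(x + real (Suc l))))"
  by (rule summable_comparison_test'[OF psi_tail_bound(1)[OF a, of q], of 0])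
   (use psi_term_bound[OF x q a(1)] in auto)
 then show ?thesis by (subst summable_Suc_iff[symmetric])
qed

text \<open>For x = t - s this isolates the damped kernel: it is the periodization minus a function
  of 1 + t - s, the correction left for the low-rank part.\<close>

lemma psi_split:
 assumes "0 < x" "x <= 2" "0 < a" "a <= 1"
 shows "psi \<gamma> a x = x powr \<gamma>*exp (- a*x) + psi \<gamma> a (x + 1)"
 unfolding psi_def using suminf_split_head[OF psi_summable[OF assms, of \<gamma>]] by (simp add: add_ac)

lemma psi_upper:
 assumes x: "0 < x" "x <= 2" and a: "0 < a" "a <= 1" and q: "\<gamma> <= real q"
 shows "0 <= psi \<gamma> a x" "psi \<gamma> a x <= x powr \<gamma> + psi_tail q a"
proof -
 show "0 <= psi \<gamma> a x" unfolding psi_def by (rule suminf_nonneg[OF psi_summable[OF x a]]) auto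
 have s: "summable (%l. (x + real (Suc l)) powr \<gamma>*exp (- a*(x + real (Suc l))))"
  using psi_summable[OF x a, of \<gamma>] by (subst summable_Suc_iff)
 have "(\<Sum>l. (x + real (Suc l)) powr \<gamma>*exp (- a*(x + real (Suc l)))) <= psi_tail q a"
  unfolding psi_tail_def by (intro suminf_le psi_term_bound s psi_tail_bound x q a)
 moreover have "x powr \<gamma>*exp (- a*x) <= x powr \<gamma>*1" using x a by (intro mult_left_mono) auto
 moreover have "psi \<gamma> a x = x powr \<gamma>*exp (- a*x) + (\<Sum>l. (x + real (Suc l)) powr \<gamma>*exp (- a*(x + real (Suc l))))"
  unfolding psi_def using suminf_split_head[OF psi_summable[OF x a, of \<gamma>]] by simp
 ultimately show "psi \<gamma> a x <= x powr \<gamma> + psi_tail q a" by simp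
qed

lemma psi_continuous:
 assumes a: "0 < a" "a <= 1"
 shows "continuous_on {0<..2} (psi \<gamma> a)"
proof -
 obtain q :: nat where q: "\<gamma> <= real q" using real_arch_simple by blast
 have "uniform_limit {0<..2} (%n x. \<Sum>l<n. (x + real (Suc l)) powr \<gamma>*exp (- a*(x + real (Suc l))))
   (%x. \<Sum>l. (x + real (Suc l)) powr \<gamma>*exp (- a*(x + real (Suc l)))) sequentially"
  by (rule Weierstrass_m_test[OF _ psi_tail_bound(1)[OF a, of q]]) (use psi_term_bound[OF _ _ q a(1)] in auto)
 then have "continuous_on {0<..2} (%x. \<Sum>l. (x + real (Suc l)) powr \<gamma>*exp (- a*(x + real (Suc l))))"
  by (rule uniform_limit_theorem[rotated]) (auto intro!: always_eventually continuous_intros)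
 then have "continuous_on {0<..2} (%x. x powr \<gamma>*exp (- a*x) + (\<Sum>l. (x + real (Suc l)) powr \<gamma>*exp (- a*(x + real (Suc l)))))"
  by (intro continuous_intros) auto
 moreover have "psi \<gamma> a x = x powr \<gamma>*exp (- a*x) + (\<Sum>l. (x + real (Suc l)) powr \<gamma>*exp (- a*(x + real (Suc l))))"
  if "x : {0<..2}" for x
  unfolding psi_def using suminf_split_head[OF psi_summable[of x a \<gamma>]] that a by simp
 ultimately show ?thesis by (subst continuous_on_cong[OF refl])
qed

lemma psi_measurable [measurable]: "psi \<gamma> a : borel_measurable borel"
 unfolding psi_def[abs_def] by measurable

lemma powr_sqi_I01:
 assumes "\<gamma> > - 1/2"
 shows "(%x. x powr \<gamma>) : sqi I01" "(LINT x|I01. (x powr \<gamma>)^2) = 1/(2*\<gamma> + 1)"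
  "0 <= \<delta> ==> \<delta> <= 1 ==> (LINT x|I01. (indicator {0..\<delta>} x*x powr \<gamma>)^2) = \<delta> powr (2*\<gamma> + 1)/(2*\<gamma> + 1)"
proof -
 have sq: "(x powr \<gamma>)^2 = x powr (2*\<gamma>)" for x :: real
  by (simp add: power2_eq_square powr_add[symmetric])
 have hb: "has_bochner_integral lborel (%x. indicator {0..c} x *\<^sub>R x powr (2*\<gamma>)) (c powr (2*\<gamma> + 1)/(2*\<gamma> + 1))" if "0 <= c" for c
 proof -
  have hi: "((%x. x powr (2*\<gamma>)) has_integral c powr (2*\<gamma> + 1)/(2*\<gamma> + 1)) {0..c}"
   using has_integral_powr_from_0[of "2*\<gamma>" c] assms that by simp
  have "integral\<^sup>N lborel (%x. ennreal (indicator {0..c} x*x powr (2*\<gamma>))) = ennreal (c powr (2*\<gamma> + 1)/(2*\<gamma> + 1))"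
   by (rule nn_integral_has_integral_lebesgue[OF _ hi]) auto
  then show ?thesis using assms
   by (intro has_bochner_integral_nn_integral) (auto simp: ennreal_mult'' )
 qed
 have e1: "(%x. indicator {0..1} x *\<^sub>R (x powr \<gamma>)\<^sup>2) = (%x. indicator {0..1} x *\<^sub>R x powr (2*\<gamma>))" by (simp add: sq)
 show "(%x. x powr \<gamma>) : sqi I01"
  using hb[of 1] unfolding has_bochner_integral_iff e1[symmetric]
  by (intro sqiI borel_measurable_I01) (auto simp: I01_def integrable_restrict_space)
 show "(LINT x|I01. (x powr \<gamma>)^2) = 1/(2*\<gamma> + 1)"
  using hb[of 1] unfolding has_bochner_integral_iff e1[symmetric] by (simp add: I01_def integral_restrict_space)
 assume d: "0 <= \<delta>" "\<delta> <= 1"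
 have "(%x. indicator {0..1} x *\<^sub>R (indicator {0..\<delta>} x*x powr \<gamma>)\<^sup>2) = (%x. indicator {0..\<delta>} x *\<^sub>R x powr (2*\<gamma>))"
  using d by (auto simp: fun_eq_iff indicator_def sq)
 then show "(LINT x|I01. (indicator {0..\<delta>} x*x powr \<gamma>)^2) = \<delta> powr (2*\<gamma> + 1)/(2*\<gamma> + 1)"
  using hb[OF d(1)] unfolding has_bochner_integral_iff by (simp add: I01_def integral_restrict_space)
qed

lemma AE_I01_pos: "AE x in I01. 0 < x & x < 1"
proof -
 have "AE x in I01. x ~= 0 & x ~= 1" unfolding I01_def
  using AE_lborel_singleton[of "0::real"] AE_lborel_singleton[of "1::real"]
  by (subst AE_restrict_space_iff) (auto elim!: eventually_elim2)
 then show ?thesis using AE_space by eventually_elim (auto simp: space_I01)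
qed

lemma psi_sqi:
 assumes g: "\<gamma> > - 1/2" and a: "0 < a" "a <= 1"
 shows "psi \<gamma> a : sqi I01"
proof -
 obtain q :: nat where q: "\<gamma> <= real q" using real_arch_simple by blast
 show ?thesis
 proof (rule sqi_bound)
  show "(%x. x powr \<gamma> + psi_tail q a) : sqi I01"
   by (intro sqi_add powr_sqi_I01 g sqi_I01_bounded[of "%_. psi_tail q a" "\<bar>psi_tail q a\<bar>"]) auto
  show "psi \<gamma> a : borel_measurable I01" by (intro borel_measurable_I01 psi_measurable)
  show "AE x in I01. \<bar>psi \<gamma> a x\<bar> <= x powr \<gamma> + psi_tail q a"
   using AE_I01_pos
  proof eventually_elim
   case (elim x)
   then show ?case using psi_upper[of x a \<gamma> q] a q by auto
  qed
 qed
qed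

section \<open>Laplace transform of a power and the Fourier coefficients of its
  periodization\<close>

lemma gamma_moment:
 fixes s w :: real
 assumes s: "s > 0" and w: "w > 0"
 shows "has_bochner_integral lborel (%x. indicator {0..} x*(x powr (s - 1)*exp (- w*x))) (Gamma s/w powr s)"
proof -
 have "ennreal (Gamma s) = (\<integral>\<^sup>+t. ennreal (indicator {0..} t*t powr (s - 1)/exp t) \<partial>lborel)"
  using Gamma_conv_nn_integral_real[OF s] by simp
 also have "... = \<bar>w\<bar>*(\<integral>\<^sup>+x. ennreal (indicator {0..} (0 + w*x)*(0 + w*x) powr (s - 1)/exp (0 + w*x)) \<partial>lborel)"
  using w by (subst nn_integral_real_affine[where c = w and t = 0]) auto
 also have "... = (\<integral>\<^sup>+x. ennreal (w powr s)*ennreal (indicator {0..} x*(x powr (s - 1)*exp (- w*x))) \<partial>lborel)"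
 proof -
  have eq: "w*(indicator {0..} (0 + w*x)*(0 + w*x) powr (s - 1)/exp (0 + w*x)) =
   w powr s*(indicator {0..} x*(x powr (s - 1)*exp (- w*x)))" for x
  proof (cases "x >= 0")
   case True
   have "w powr s = w*w powr (s - 1)" using w by (simp add: powr_diff)
   then show ?thesis using True w by (simp add: powr_mult exp_minus divide_inverse mult_ac)
  next
   case False
   then show ?thesis using w by (simp add: zero_le_mult_iff)
  qed
  have "(\<integral>\<^sup>+x. ennreal w*ennreal (indicator {0..} (0 + w*x)*(0 + w*x) powr (s - 1)/exp (0 + w*x)) \<partial>lborel) =
   (\<integral>\<^sup>+x. ennreal (w powr s)*ennreal (indicator {0..} x*(x powr (s - 1)*exp (- w*x))) \<partial>lborel)"
   using w by (intro nn_integral_cong, subst (1 2) ennreal_mult[symmetric]) (simp_all only: eq, auto)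
  moreover have "ennreal \<bar>w\<bar> = ennreal w" using w by simp
  ultimately show ?thesis by (subst nn_integral_cmult[symmetric]) auto
 qed
 also have "... = ennreal (w powr s)*(\<integral>\<^sup>+x. ennreal (indicator {0..} x*(x powr (s - 1)*exp (- w*x))) \<partial>lborel)"
  by (rule nn_integral_cmult) auto
 finally have eq: "ennreal (w powr s)*(\<integral>\<^sup>+x. ennreal (indicator {0..} x*(x powr (s - 1)*exp (- w*x))) \<partial>lborel) = ennreal (Gamma s)" ..
 have G: "Gamma s > 0" using s by (rule Gamma_real_pos)
 have "(\<integral>\<^sup>+x. ennreal (indicator {0..} x*(x powr (s - 1)*exp (- w*x))) \<partial>lborel) =
   ennreal (1/w powr s)*(ennreal (w powr s)*(\<integral>\<^sup>+x. ennreal (indicator {0..} x*(x powr (s - 1)*exp (- w*x))) \<partial>lborel))"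
  using w by (simp add: mult.assoc[symmetric] ennreal_mult[symmetric])
 also have "... = ennreal (Gamma s/w powr s)"
  unfolding eq using w G by (simp add: ennreal_mult[symmetric])
 finally show ?thesis using G w by (intro has_bochner_integral_nn_integral) auto
qed

text \<open>The complex parameter is reached from a real one by a power series: around a large real
  \<open>w0\<close> the exponential is expanded, the moments of the Gamma law turn it into the
  binomial series for \<open>(1 - z) powr (- s)\<close>, and absolute convergence justifies termwise
  integration.\<close>

lemma laplace_norm:
 fixes w :: complex
 assumes s: "s > 0" and w: "Re w > 0"
 shows "norm (LINT x|lborel. complex_of_real (indicator {0..} x*x powr (s - 1))*exp (- w * of_real x)) = Gamma s*norm w powr (- s)"
proof -
 \<comment> \<open>The condition norm (w - w0) < w0 amounts to (norm w)^2 < 2 w0 Re w; the summand 1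
   makes it strict.\<close>
 define w0 where "w0 = (norm w)^2/(2 * Re w) + 1"
 have w0: "w0 > 0" using w by (simp add: w0_def add_nonneg_pos)
 define z where "z = 1 - w/of_real w0"
 have wz: "w = of_real w0*(1 - z)" using w0 by (simp add: z_def)
 have z1: "norm z < 1"
 proof -
  have "(norm z)^2 = 1 - 2 * Re w/w0 + (norm w)^2/w0^2"
  proof -
   have zr: "Re z = 1 - Re w/w0" "Im z = - Im w/w0" by (simp_all add: z_def)
   show ?thesis unfolding cmod_power2 zr using w0 by (simp add: power2_eq_square field_simps)
  qed
  also have "... < 1"
  proof -
   have "(norm w)^2 < w0*(2 * Re w)" using w by (simp add: w0_def field_simps)
   then have "(norm w)^2/w0^2 < w0*(2 * Re w)/w0^2" using w0 by (intro divide_strict_right_mono) auto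
   also have "... = 2 * Re w/w0" using w0 by (simp add: power2_eq_square)
   finally show ?thesis by simp
  qed
  finally show ?thesis using abs_square_less_1[of "norm z"] by simp
 qed
 define f where "f n x = complex_of_real (indicator {0..} x*(x powr (s + real n - 1)*exp (- w0*x)))*(of_real w0*z)^n/fact n" for n x
 have poch: "Gamma (s + real n) = Gamma s*pochhammer s n" for n
 proof -
  have "s \<notin> \<int>\<^sub>\<le>\<^sub>0" using s by (auto elim!: nonpos_Ints_cases)
  then show ?thesis using pochhammer_Gamma[of s n] Gamma_real_pos[OF s] by simp
 qed
 have coef: "Gamma (s + real n)/w0 powr (s + real n)*w0^n/fact n = Gamma s*w0 powr (- s)*(pochhammer s n/fact n)" for n
  using w0 by (simp add: poch powr_add powr_realpow powr_minus field_simps)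
 have int: "has_bochner_integral lborel (f n) (of_real (Gamma s*w0 powr (- s))*(of_real (pochhammer s n/fact n)*z^n))" for n
 proof -
  have "has_bochner_integral lborel (%x. indicator {0..} x*(x powr (s + real n - 1)*exp (- w0*x))) (Gamma (s + real n)/w0 powr (s + real n))"
   using s w0 by (intro gamma_moment) auto
  then have "has_bochner_integral lborel (%x. complex_of_real (indicator {0..} x*(x powr (s + real n - 1)*exp (- w0*x)))) (of_real (Gamma (s + real n)/w0 powr (s + real n)))"
   by (rule has_bochner_integral_of_real)
  then have "has_bochner_integral lborel (f n) (of_real (Gamma (s + real n)/w0 powr (s + real n))*((of_real w0*z)^n/fact n))"
   unfolding f_def times_divide_eq_right[symmetric] by (rule has_bochner_integral_mult_left) 
  also have "complex_of_real (Gamma (s + real n)/w0 powr (s + real n))*((of_real w0*z)^n/fact n) =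
   of_real (Gamma (s + real n)/w0 powr (s + real n)*w0^n/fact n)*z^n"
   by (simp add: power_mult_distrib)
  also have "... = of_real (Gamma s*w0 powr (- s))*(of_real (pochhammer s n/fact n)*z^n)" unfolding coef by simp
  finally show ?thesis .
 qed
 \<comment> \<open>The moments carry rising factorials; two sign factors turn them into the binomial
   coefficients of exponent -s at the argument -z.\<close>
 have gb: "((- of_real s :: complex) gchoose n)*(- z)^n = of_real (pochhammer s n/fact n)*z^n" for n
 proof -
  have "((- of_real s :: complex) gchoose n) = (- 1)^n * of_real (pochhammer s n/fact n)"
   by (simp add: gbinomial_pochhammer pochhammer_of_real)
  moreover have "(- z)^n = (- 1)^n*z^n" by (rule power_minus)
  ultimately have "((- of_real s :: complex) gchoose n)*(- z)^n = ((- 1)^n*(- 1)^n)*(of_real (pochhammer s n/fact n)*z^n)"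
   by (simp only: mult_ac)
  also have "(- 1)^n*(- 1)^n = (1 :: complex)" by (simp add: power_mult_distrib[symmetric])
  finally show ?thesis by simp
 qed
 have sums1: "(%n. of_real (pochhammer s n/fact n)*z^n) sums (1 - z) powr (- of_real s)"
  using gen_binomial_complex[of "- z" "- of_real s"] z1 unfolding gb by simp
 have pos: "pochhammer s n >= 0" for n using s by (simp add: pochhammer_nonneg)
 have abs_sums: "summable (%n. pochhammer s n/fact n*norm z^n)"
 proof -
  have "(%n. ((- s) gchoose n)*(- norm z)^n) sums (1 + - norm z) powr (- s)"
   using z1 by (intro gen_binomial_real) simp
  moreover have "((- s) gchoose n)*(- norm z)^n = pochhammer s n/fact n*norm z^n" for n
   by (simp add: gbinomial_pochhammer power_minus[of "norm z"])
  ultimately show ?thesis by (simp add: sums_iff)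
 qed
 have nf: "norm (f n x) = indicator {0..} x*(x powr (s + real n - 1)*exp (- w0*x))*(w0*norm z)^n/fact n" for n x
  using w0 by (auto simp: f_def norm_mult norm_divide norm_power indicator_def)
 have nint: "(LINT x|lborel. norm (f n x)) = Gamma s*w0 powr (- s)*(pochhammer s n/fact n*norm z^n)" for n
 proof -
  have "has_bochner_integral lborel (%x. indicator {0..} x*(x powr (s + real n - 1)*exp (- w0*x))*((w0*norm z)^n/fact n))
    (Gamma (s + real n)/w0 powr (s + real n)*((w0*norm z)^n/fact n))"
   using s w0 by (intro has_bochner_integral_mult_left gamma_moment) auto
  then have "(LINT x|lborel. norm (f n x)) = Gamma (s + real n)/w0 powr (s + real n)*((w0*norm z)^n/fact n)"
   unfolding nf by (simp add: has_bochner_integral_iff)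
  also have "... = Gamma (s + real n)/w0 powr (s + real n)*w0^n/fact n*norm z^n" by (simp add: power_mult_distrib)
  finally show ?thesis unfolding coef by simp
 qed
 have xp: "x powr (s + real n - 1) = x powr (s - 1)*x^n" if "x > 0" for x n
 proof -
  have "s + real n - 1 = (s - 1) + real n" by simp
  then show ?thesis using that by (simp only: powr_add powr_realpow)
 qed
 have fsum: "(%n. f n x) sums (complex_of_real (indicator {0..} x*x powr (s - 1))*exp (- w * of_real x))"
  and nsum: "summable (%n. norm (f n x))" for x
 proof -
  have "(%n. f n x) sums (complex_of_real (indicator {0..} x*x powr (s - 1))*exp (- w * of_real x)) & summable (%n. norm (f n x))"
  proof (cases "x > 0")
   case True
   have fe: "f n x = complex_of_real (x powr (s - 1))*exp (of_real (- w0*x))*((of_real (w0*x)*z)^n /\<^sub>R fact n)" for n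
    unfolding exp_of_real[of "- w0*x"] using True by (simp add: f_def xp power_mult_distrib scaleR_conv_of_real divide_inverse mult_ac)
   have "exp (of_real (- w0*x))*exp (of_real (w0*x)*z) = exp (- w * of_real x)"
    by (simp add: exp_add[symmetric] wz algebra_simps)
   then have eq: "complex_of_real (x powr (s - 1))*exp (of_real (- w0*x))*exp (of_real (w0*x)*z) =
     complex_of_real (indicator {0..} x*x powr (s - 1))*exp (- w * of_real x)"
    using True by (simp add: mult.assoc)
   have "(%n. f n x) sums (complex_of_real (x powr (s - 1))*exp (of_real (- w0*x))*exp (of_real (w0*x)*z))"
    unfolding fe by (intro sums_mult exp_converges)
   moreover have "summable (%n. norm (f n x))"
    unfolding fe norm_mult by (intro summable_mult summable_norm_exp)
   ultimately show ?thesis unfolding eq by simp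
  next
   case False
   then have "f n x = 0" for n using s by (cases "x = 0") (auto simp: f_def)
   moreover have z0: "complex_of_real (indicator {0..} x*x powr (s - 1)) = 0" using False by (cases "x = 0") auto
   ultimately show ?thesis unfolding z0 by simp
  qed
  then show "(%n. f n x) sums (complex_of_real (indicator {0..} x*x powr (s - 1))*exp (- w * of_real x))"
   "summable (%n. norm (f n x))" by auto
 qed
 have "(%n. integral\<^sup>L lborel (f n)) sums (LINT x|lborel. (\<Sum>n. f n x))"
 proof (rule sums_integral)
  show "integrable lborel (f n)" for n using int[of n] by (simp add: has_bochner_integral_iff)
  show "AE x in lborel. summable (%n. norm (f n x))" using nsum by simp
  show "summable (%n. \<integral>x. norm (f n x) \<partial>lborel)" unfolding nint by (intro summable_mult abs_sums)
 qed
 moreover have "(%n. integral\<^sup>L lborel (f n)) sums (of_real (Gamma s*w0 powr (- s))*(1 - z) powr (- of_real s))"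
 proof -
  have e: "integral\<^sup>L lborel (f n) = of_real (Gamma s*w0 powr (- s))*(of_real (pochhammer s n/fact n)*z^n)" for n
   using int[of n] by (simp only: has_bochner_integral_iff)
  show ?thesis unfolding e by (rule sums_mult[OF sums1])
 qed
 moreover have "(\<Sum>n. f n x) = complex_of_real (indicator {0..} x*x powr (s - 1))*exp (- w * of_real x)" for x
  using fsum[of x] by (simp add: sums_iff)
 ultimately have "(LINT x|lborel. complex_of_real (indicator {0..} x*x powr (s - 1))*exp (- w * of_real x)) =
   of_real (Gamma s*w0 powr (- s))*(1 - z) powr (- of_real s)"
  using sums_unique2 by fastforce
 then have "norm (LINT x|lborel. complex_of_real (indicator {0..} x*x powr (s - 1))*exp (- w * of_real x)) =
   Gamma s*w0 powr (- s)*norm (1 - z) powr (- s)"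
  using Gamma_real_pos[OF s] by (simp add: norm_mult norm_powr_real_powr')
 also have "... = Gamma s*(w0*norm (1 - z)) powr (- s)" using w0 by (simp add: powr_mult)
 also have "w0*norm (1 - z) = norm w" unfolding wz norm_mult using w0 by simp
 finally show ?thesis .
qed


text \<open>Unfolding: \<open>cis (2*pi*k*l) = 1\<close>, so integrating the sum of shifts against a
  character over one period is the same as integrating the damped power over the half-line. The
  result is the Laplace transform at a + 2 pi i k.\<close>

lemma psi_fourier:
 fixes k :: nat
 assumes b: "\<beta> > 1/2" and a: "0 < a" "a <= 1"
 shows "norm (LINT x|I01. complex_of_real (psi (\<beta> - 1) a x)*cis (- (2*pi*k*x))) = Gamma \<beta>*(a^2 + (2*pi*k)^2) powr (- \<beta>/2)"
proof -
 define w where "w = Complex a (2*pi*k)"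
 have Rw: "Re w > 0" using a by (simp add: w_def)
 define F where "F x = complex_of_real (indicator {0..} x*x powr (\<beta> - 1))*exp (- w * of_real x)" for x
 have Fm [measurable]: "F : borel_measurable borel" unfolding F_def[abs_def] by measurable
 have ew: "exp (- w * of_real x) = of_real (exp (- a*x))*cis (- (2*pi*k*x))" for x
  by (simp add: exp_eq_polar w_def)
 have nF: "norm (F x) = indicator {0..} x*(x powr (\<beta> - 1)*exp (- a*x))" for x
  unfolding F_def ew by (simp add: norm_mult indicator_def)
 have hb: "has_bochner_integral lborel (%x. norm (F x)) (Gamma \<beta>/a powr \<beta>)"
  unfolding nF using b a by (intro gamma_moment) auto
 then have Fi: "integrable lborel F"
  using integrable_norm_iff[of F lborel] by (simp add: has_bochner_integral_iff)
 define G where "G l x = indicator {0..<1::real} x *\<^sub>R F (real l + x)" for l :: nat and x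
 have Gi: "integrable lborel (G l)" for l
  using lborel_integrable_real_affine[OF Fi, of 1 "real l"] unfolding G_def by (intro integrable_mult_indicator) auto
 define g where "g l x = indicator {real l..<real l + 1} x *\<^sub>R F x" for l :: nat and x
 have gi: "integrable lborel (g l)" for l unfolding g_def by (intro integrable_mult_indicator Fi) auto
 have gG: "integral\<^sup>L lborel (g l) = integral\<^sup>L lborel (G l)" "(LINT x|lborel. norm (g l x)) = (LINT x|lborel. norm (G l x))" for l
 proof -
  have "indicator {real l..<real l + 1} (real l + 1*x) = (indicator {0..<1} x :: real)" for x by (auto simp: indicator_def)
  then have e: "g l (real l + 1*x) = G l x" for x by (simp add: g_def G_def)
  show "integral\<^sup>L lborel (g l) = integral\<^sup>L lborel (G l)"
   by (subst lborel_integral_real_affine[where c = 1 and t = "real l"]) (simp_all add: e[simplified])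
  show "(LINT x|lborel. norm (g l x)) = (LINT x|lborel. norm (G l x))"
   by (subst lborel_integral_real_affine[where c = 1 and t = "real l"]) (simp_all add: e[simplified])
 qed
 have sums_ind: "(%l. g l x) sums F x & summable (%l. norm (g l x))" for x
 proof (cases "x >= 0")
  case True
  define l0 where "l0 = nat \<lfloor>x\<rfloor>"
  have "x : {real l..<real l + 1} \<longleftrightarrow> l = l0" for l using True unfolding l0_def by (auto; linarith)
  then have e: "g l x = (if l = l0 then F x else 0)" for l by (auto simp: g_def indicator_def simp del: atLeastLessThan_iff)
  then have "(%l. g l x) sums F x" using sums_single[of l0 "%_. F x"] by simp
  moreover have "(%l. norm (g l x)) = (%l. if l = l0 then norm (F x) else 0)" using e by auto
  ultimately show ?thesis using sums_single[of l0 "%_. norm (F x)"] by (auto simp: sums_iff)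
 next
  case False
  then have "F x = 0" by (simp add: F_def)
  then show ?thesis by (simp add: g_def)
 qed
 have sumn: "summable (%l. \<integral>x. norm (g l x) \<partial>lborel)"
 proof (rule summableI_nonneg_bounded)
  fix n
  have "(\<Sum>l<n. \<integral>x. norm (g l x) \<partial>lborel) = (LINT x|lborel. (\<Sum>l<n. norm (g l x)))"
   using gi by (intro Bochner_Integration.integral_sum[symmetric]) auto
  also have "... <= (LINT x|lborel. norm (F x))"
  proof (rule integral_mono)
   show "integrable lborel (%x. \<Sum>l<n. norm (g l x))" using gi by auto
   show "integrable lborel (%x. norm (F x))" using Fi by auto
   fix x
   show "(\<Sum>l<n. norm (g l x)) <= norm (F x)"
   proof -
    have "(\<Sum>l<n. norm (g l x)) <= (\<Sum>l. norm (g l x))" using sums_ind[of x] by (intro sum_le_suminf) auto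
    also have "... <= norm (F x)"
    proof (cases "x >= 0")
     case True
     define l0 where "l0 = nat \<lfloor>x\<rfloor>"
     have "x : {real l..<real l + 1} \<longleftrightarrow> l = l0" for l using True unfolding l0_def by (auto; linarith)
     then have "(%l. norm (g l x)) = (%l. if l = l0 then norm (F x) else 0)" by (auto simp: g_def indicator_def simp del: atLeastLessThan_iff)
     then show ?thesis using sums_single[of l0 "%_. norm (F x)"] by (auto simp: sums_iff)
    next
     case False
     then show ?thesis by (simp add: g_def F_def)
    qed
    finally show ?thesis .
   qed
  qed
  finally show "(\<Sum>l<n. \<integral>x. norm (g l x) \<partial>lborel) <= (LINT x|lborel. norm (F x))" .
 qed simp
 have "(%l. integral\<^sup>L lborel (g l)) sums (LINT x|lborel. (\<Sum>l. g l x))"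
  by (rule sums_integral[OF gi _ sumn]) (use sums_ind in auto)
 moreover have "(\<Sum>l. g l x) = F x" for x using sums_ind[of x] by (simp add: sums_iff)
 ultimately have S1: "(%l. integral\<^sup>L lborel (G l)) sums (LINT x|lborel. F x)" by (simp add: gG)
 have Gx: "(%l. G l x) sums (indicator {0..1} x *\<^sub>R (complex_of_real (psi (\<beta> - 1) a x)*cis (- (2*pi*k*x)))) & summable (%l. norm (G l x))"
  if "x ~= 0" "x ~= 1" for x
 proof (cases "0 < x & x < 1")
  case True
  have e: "G l x = complex_of_real ((x + real l) powr (\<beta> - 1)*exp (- a*(x + real l)))*cis (- (2*pi*k*x))" for l
  proof -
   have "cis (- (2*pi*k*(real l + x))) = cis (- (2*pi*k*x))*cis (2*pi*(- real k*real l))"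
    by (simp add: cis_mult algebra_simps)
   also have "cis (2*pi*(- real k*real l)) = 1" by (rule cis_multiple_2pi) auto
   finally have c: "cis (- (2*pi*k*(real l + x))) = cis (- (2*pi*k*x))" by simp
   have "F (real l + x) = of_real ((real l + x) powr (\<beta> - 1))*(of_real (exp (- a*(real l + x)))*cis (- (2*pi*k*(real l + x))))"
    using True unfolding F_def ew by simp
   then show ?thesis using True unfolding c by (simp add: G_def add.commute mult.assoc)
  qed
  have sm: "summable (%l. (x + real l) powr (\<beta> - 1)*exp (- a*(x + real l)))" using True a by (intro psi_summable) auto
  then have "(%l. complex_of_real ((x + real l) powr (\<beta> - 1)*exp (- a*(x + real l)))) sums complex_of_real (psi (\<beta> - 1) a x)"
   unfolding psi_def by (intro sums_of_real summable_sums)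
  then have "(%l. G l x) sums (complex_of_real (psi (\<beta> - 1) a x)*cis (- (2*pi*k*x)))" unfolding e by (rule sums_mult2)
  moreover have "norm (G l x) = (x + real l) powr (\<beta> - 1)*exp (- a*(x + real l))" for l
   unfolding e by (simp add: norm_mult)
  ultimately show ?thesis using True sm by simp
 next
  case False
  then have "x \<notin> {0..<1}" "x \<notin> {0..1}" using that by auto
  then show ?thesis by (simp add: G_def)
 qed
 have AE1: "AE x in lborel. x ~= (0::real) & x ~= 1"
  using AE_lborel_singleton[of "0::real"] AE_lborel_singleton[of "1::real"] by (auto elim!: eventually_elim2)
 have "(%l. integral\<^sup>L lborel (G l)) sums (LINT x|lborel. (\<Sum>l. G l x))"
 proof (rule sums_integral[OF Gi])
  show "AE x in lborel. summable (%l. norm (G l x))" using AE1 by eventually_elim (use Gx in auto)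
  show "summable (%l. \<integral>x. norm (G l x) \<partial>lborel)" using sumn by (simp add: gG)
 qed
 moreover have "(LINT x|lborel. (\<Sum>l. G l x)) = (LINT x|lborel. indicator {0..1} x *\<^sub>R (complex_of_real (psi (\<beta> - 1) a x)*cis (- (2*pi*k*x))))"
 proof (rule integral_cong_AE)
  show "AE x in lborel. (\<Sum>l. G l x) = indicator {0..1} x *\<^sub>R (complex_of_real (psi (\<beta> - 1) a x)*cis (- (2*pi*k*x)))"
   using AE1 by eventually_elim (use Gx in \<open>auto simp: sums_iff\<close>)
  show "(%x. \<Sum>l. G l x) : borel_measurable lborel" unfolding G_def by measurable
  show "(%x. indicator {0..1} x *\<^sub>R (complex_of_real (psi (\<beta> - 1) a x)*cis (- (2*pi*k*x)))) : borel_measurable lborel"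
   unfolding cis_conv_exp by measurable
 qed
 ultimately have "(LINT x|lborel. F x) = (LINT x|I01. complex_of_real (psi (\<beta> - 1) a x)*cis (- (2*pi*k*x)))"
  using sums_unique2[OF S1] by (simp add: I01_def integral_restrict_space)
 then have "norm (LINT x|I01. complex_of_real (psi (\<beta> - 1) a x)*cis (- (2*pi*k*x))) = Gamma \<beta>*norm w powr (- \<beta>)"
  using laplace_norm[of \<beta> w] b Rw unfolding F_def by simp
 also have "norm w = (a^2 + (2*pi*k)^2) powr (1/2)"
  by (simp add: w_def complex_norm powr_half_sqrt)
 also have "... powr (- \<beta>) = (a^2 + (2*pi*k)^2) powr (- \<beta>/2)" by (simp add: powr_powr)
 finally show ?thesis .
qed

text \<open>Separates t from s in one frequency of a convolution kernel. The phase stays entirely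
  with t, so the s-modes are the plain cosine and sine.\<close>

lemma tmode_pair:
 "tmode \<theta> (2*n) t*tmode (%_. 0) (2*n) s + tmode \<theta> (2*n + 1) t*tmode (%_. 0) (2*n + 1) s =
  2*cos (2*pi*real (n + 1)*(t - s) - \<theta> (n + 1))"
proof -
 let ?A = "2*pi*real (n + 1)*t - \<theta> (n + 1)" and ?B = "2*pi*real (n + 1) * s"
 have "tmode \<theta> (2*n) t*tmode (%_. 0) (2*n) s + tmode \<theta> (2*n + 1) t*tmode (%_. 0) (2*n + 1) s =
  (sqrt 2 * sqrt 2)*(cos ?A*cos ?B + cos (?A - pi/2)*cos (?B - pi/2))"
 proof -
  have e: "tmode \<theta> (2*n) t = sqrt 2*cos ?A" "tmode (%_. 0) (2*n) s = sqrt 2*cos ?B"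
   "tmode \<theta> (2*n + 1) t = sqrt 2*cos (?A - pi/2)" "tmode (%_. 0) (2*n + 1) s = sqrt 2*cos (?B - pi/2)"
   by (simp_all add: tmode_def)
  show ?thesis unfolding e by (simp only: distrib_left mult_ac)
 qed
 also have "cos (?A - pi/2)*cos (?B - pi/2) = sin ?A * sin ?B" by (simp add: cos_diff)
 also have "cos ?A*cos ?B + sin ?A * sin ?B = cos (?A - ?B)" by (simp add: cos_diff)
 finally show ?thesis by (simp add: algebra_simps)
qed

lemma sum_pairs: "(\<Sum>j<2*n. f j) = (\<Sum>k<n. f (2*k) + f (2*k + 1))" for f :: "nat => real"
 by (induction n) auto

text \<open>The arguments of the Fourier coefficients are not computed; with their sign reversed
  they become the phases \<theta>.\<close>

lemma psi_fourier_series: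
 assumes b: "\<beta> > 1/2" and a: "0 < a" "a <= 1"
 defines "\<mu> \<equiv> %k::nat. Gamma \<beta>*(a^2 + (2*pi*k)^2) powr (- \<beta>/2)"
 shows "\<exists>\<theta>. \<forall>e>0. \<exists>n0. \<forall>n\<ge>n0.
  nm I01 (%x. psi (\<beta> - 1) a x - (\<mu> 0 + (\<Sum>k<n. \<mu> (k + 1)*(2*cos (2*pi*real (k + 1)*x - \<theta> (k + 1)))))) < e"
proof -
 let ?f = "psi (\<beta> - 1) a"
 define c where "c k = (LINT x|I01. complex_of_real (?f x)*cis (- (2*pi*real k*x)))" for k :: nat
 have nc: "norm (c k) = \<mu> k" for k unfolding c_def \<mu>_def by (rule psi_fourier[OF b a])
 define \<theta> where "\<theta> k = - Arg (c k)" for k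
 have cp: "c k = of_real (\<mu> k)*cis (- \<theta> k)" for k
  using rcis_cmod_Arg[of "c k"] by (simp add: \<theta>_def nc rcis_def)
 have fs: "?f : sqi I01" using b a by (intro psi_sqi) auto
 have fi: "integrable I01 ?f" 
  by (rule I01.square_integrable_imp_integrable[OF sqi_measurable[OF fs] sqi_integrable[OF fs]])
 have ci: "integrable I01 (%x. complex_of_real (?f x)*cis (- (2*pi*real k*x)))" for k
 proof (rule Bochner_Integration.integrable_bound[OF fi])
  show "(%x. complex_of_real (?f x)*cis (- (2*pi*real k*x))) : borel_measurable I01"
   unfolding cis_conv_exp by (intro borel_measurable_I01) measurable
 qed (auto simp: norm_mult)
 have coef: "(LINT x|I01. ?f x*cos (2*pi*real k*x - \<phi>)) = \<mu> k*cos (\<phi> - \<theta> k)" for k \<phi>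
 proof -
  have "(LINT x|I01. ?f x*cos (2*pi*real k*x - \<phi>)) = (LINT x|I01. Re (cis \<phi>*(complex_of_real (?f x)*cis (- (2*pi*real k*x)))))"
   by (intro Bochner_Integration.integral_cong refl) (simp add: cos_diff algebra_simps)
  also have "... = Re (cis \<phi>*c k)"
   using ci[of k] by (subst integral_Re) (auto simp: c_def)
  also have "cis \<phi>*c k = of_real (\<mu> k)*cis (\<phi> - \<theta> k)" unfolding cp by (simp add: cis_mult mult_ac)
  finally show ?thesis by simp
 qed
 have c0: "(LINT x|I01. ?f x) = \<mu> 0"
 proof -
  have "c 0 = complex_of_real (LINT x|I01. ?f x)" unfolding c_def by simp
  moreover have "0 <= (LINT x|I01. ?f x)"
  proof (rule integral_nonneg_AE)
   show "AE x in I01. 0 <= ?f x" using AE_I01_pos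
    by eventually_elim (use psi_upper(1) a real_arch_simple in \<open>meson less_eq_real_def order_trans one_le_numeral\<close>)
  qed
  ultimately show ?thesis using nc[of 0] by simp
 qed
 have pair: "ip I01 ?f (tmode (%_. 0) (2*k))*tmode (%_. 0) (2*k) x + ip I01 ?f (tmode (%_. 0) (2*k + 1))*tmode (%_. 0) (2*k + 1) x =
   \<mu> (k + 1)*(2*cos (2*pi*real (k + 1)*x - \<theta> (k + 1)))" for k x
 proof -
  have i1: "ip I01 ?f (tmode (%_. 0) (2*k)) = sqrt 2*(\<mu> (k + 1)*cos (0 - \<theta> (k + 1)))"
   unfolding coef[symmetric] ip_def tmode_def
   by (subst integral_mult_right_zero[symmetric]) (intro Bochner_Integration.integral_cong refl, simp)
  have i2: "ip I01 ?f (tmode (%_. 0) (2*k + 1)) = sqrt 2*(\<mu> (k + 1)*cos (pi/2 - \<theta> (k + 1)))"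
   unfolding coef[symmetric] ip_def tmode_def
   by (subst integral_mult_right_zero[symmetric]) (intro Bochner_Integration.integral_cong refl, simp)
  have t1: "tmode (%_. 0) (2*k) x = sqrt 2*cos (2*pi*real (k + 1)*x)"
   and t2: "tmode (%_. 0) (2*k + 1) x = sqrt 2 * sin (2*pi*real (k + 1)*x)"
   by (simp_all add: tmode_def cos_diff)
  have "ip I01 ?f (tmode (%_. 0) (2*k))*tmode (%_. 0) (2*k) x + ip I01 ?f (tmode (%_. 0) (2*k + 1))*tmode (%_. 0) (2*k + 1) x =
   (sqrt 2 * sqrt 2)*\<mu> (k + 1)*(cos (\<theta> (k + 1))*cos (2*pi*real (k + 1)*x) + sin (\<theta> (k + 1)) * sin (2*pi*real (k + 1)*x))"
  proof -
   have "cos (0 - \<theta> (k + 1)) = cos (\<theta> (k + 1))" "cos (pi/2 - \<theta> (k + 1)) = sin (\<theta> (k + 1))" by (simp_all add: cos_diff)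
   then show ?thesis unfolding i1 i2 t1 t2 by (simp only: distrib_left mult_ac)
  qed
  then show ?thesis by (simp add: cos_diff algebra_simps)
 qed
 have cont: "continuous_on {0<..<1} ?f" by (rule continuous_on_subset[OF psi_continuous[OF a]]) auto
 show ?thesis
 proof (rule exI[of _ \<theta>], intro allI impI)
  fix e :: real assume e: "e > 0"
  show "\<exists>n0. \<forall>n\<ge>n0. nm I01 (%x. ?f x - (\<mu> 0 + (\<Sum>k<n. \<mu> (k + 1)*(2*cos (2*pi*real (k + 1)*x - \<theta> (k + 1)))))) < e"
   using Fourier_L2[OF fs cont e] unfolding sum_pairs pair c0 .
 qed
qed

section \<open>Kernels on the unit square\<close>

abbreviation "P2 \<equiv> I01 \<Otimes>\<^sub>M I01"

lemma prob_space_P2: "prob_space P2"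
proof -
 interpret pair_prob_space I01 I01 ..
 show ?thesis by (rule P.prob_space_axioms)
qed

interpretation P2: prob_space P2 by (rule prob_space_P2)

lemma measurable_P2: "f : borel_measurable (borel \<Otimes>\<^sub>M borel) ==> f : borel_measurable P2"
proof -
 assume f: "f : borel_measurable (borel \<Otimes>\<^sub>M borel)"
 have id: "id : P2 \<rightarrow>\<^sub>M (borel \<Otimes>\<^sub>M borel)"
  unfolding id_def by (rule measurable_pair) (auto intro!: measurable_compose[OF measurable_fst] measurable_compose[OF measurable_snd] borel_measurable_I01 simp: comp_def)
 show ?thesis using measurable_comp[OF id f] by simp
qed

lemma pair_sqiI:
 assumes m: "(%(t, s). G t s) : borel_measurable P2"
  and inner: "AE t in I01. (\<integral>\<^sup>+s. ennreal ((G t s)^2) \<partial>I01) <= ennreal (B t)"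
  and outer: "(\<integral>\<^sup>+t. ennreal (B t) \<partial>I01) <= ennreal (c^2)" and c: "c >= 0"
 shows "(%(t, s). G t s) : sqi P2" "nm P2 (%(t, s). G t s) <= c"
proof -
 have "(\<integral>\<^sup>+z. ennreal ((case z of (t, s) => G t s)^2) \<partial>P2) = (\<integral>\<^sup>+t. \<integral>\<^sup>+s. ennreal ((G t s)^2) \<partial>I01 \<partial>I01)"
  using m by (subst I01.nn_integral_fst[symmetric]) (auto simp: case_prod_unfold)
 also have "... <= (\<integral>\<^sup>+t. ennreal (B t) \<partial>I01)" by (rule nn_integral_mono_AE[OF inner])
 finally have le: "(\<integral>\<^sup>+z. ennreal ((case z of (t, s) => G t s)^2) \<partial>P2) <= ennreal (c^2)" using outer by (rule order_trans)
 show s: "(%(t, s). G t s) : sqi P2"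
  using m le by (intro sqiI integrableI_bounded) (auto intro: order_le_less_trans simp: case_prod_unfold)
 have "ennreal ((nm P2 (%(t, s). G t s))^2) <= ennreal (c^2)"
  unfolding nm_sq using le s by (subst nn_integral_eq_integral[symmetric]) (auto simp: sqi_def)
 then have "(nm P2 (%(t, s). G t s))^2 <= c^2" by simp
 then show "nm P2 (%(t, s). G t s) <= c" using c by (rule power2_le_imp_le)
qed

lemma nn_integral_sqi: "f : sqi M ==> (\<integral>\<^sup>+x. ennreal ((f x)^2) \<partial>M) = ennreal ((nm M f)^2)"
 unfolding nm_sq by (rule nn_integral_eq_integral) (auto simp: sqi_def)

text \<open>For fixed t the argument t - s, taken modulo 1, runs once through the unit interval as s
  does, so the inner integral does not depend on t.\<close>

lemma periodic_kernel:
 assumes g: "g : borel_measurable borel" "g : sqi I01"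
 shows "(%(t, s). if s < t then g (t - s) else g (t - s + 1)) : sqi P2"
  "nm P2 (%(t, s). if s < t then g (t - s) else g (t - s + 1)) <= nm I01 g"
proof -
 have m: "(%(t, s). if s < t then g (t - s) else g (t - s + 1)) : borel_measurable P2"
 proof (rule measurable_P2)
  note g(1)[measurable]
  show "(%(t, s). if s < t then g (t - s) else g (t - s + 1)) : borel_measurable (borel \<Otimes>\<^sub>M borel)" by measurable
 qed
 have inner: "(\<integral>\<^sup>+s. ennreal ((if s < t then g (t - s) else g (t - s + 1))^2) \<partial>I01) <= ennreal ((nm I01 g)^2)" if t: "0 < t" "t < 1" for t
 proof -
  define h where "h x = ennreal ((g x)^2)" for x
  have hm [measurable]: "h : borel_measurable borel" unfolding h_def using g(1) by measurable
  define H1 H2 where "H1 x = indicator {0<..t} x*h x" and "H2 x = indicator {t..1} x*h x" for x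
  have [measurable]: "H1 : borel_measurable borel" "H2 : borel_measurable borel" unfolding H1_def H2_def by measurable
  have refl: "(\<integral>\<^sup>+s. f (c + -1 * s) \<partial>lborel) = (\<integral>\<^sup>+x. f x \<partial>lborel)" if "f : borel_measurable borel" for f and c :: real
   using nn_integral_real_affine[OF that, of "-1" c] by simp
  have "(\<integral>\<^sup>+s. ennreal ((if s < t then g (t - s) else g (t - s + 1))^2) \<partial>I01) =
    (\<integral>\<^sup>+s. ennreal ((if s < t then g (t - s) else g (t - s + 1))^2)*indicator {0..1} s \<partial>lborel)"
   unfolding I01_def by (subst nn_integral_restrict_space) auto
  also have "... = (\<integral>\<^sup>+s. H1 (t + -1 * s) + H2 ((t + 1) + -1 * s) \<partial>lborel)"
  proof (rule nn_integral_cong)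
   fix s :: real
   consider "s < 0" | "0 <= s" "s < t" | "t <= s" "s <= 1" | "1 < s" by linarith
   then show "ennreal ((if s < t then g (t - s) else g (t - s + 1))^2)*indicator {0..1} s = H1 (t + -1 * s) + H2 ((t + 1) + -1 * s)"
    by cases (use t in \<open>auto simp: H1_def H2_def h_def diff_add_eq\<close>)
  qed
  also have "... = (\<integral>\<^sup>+s. H1 (t + -1 * s) \<partial>lborel) + (\<integral>\<^sup>+s. H2 ((t + 1) + -1 * s) \<partial>lborel)"
   by (rule nn_integral_add) measurable
  also have "... = (\<integral>\<^sup>+x. H1 x + H2 x \<partial>lborel)"
   by (subst (1 2) refl) (auto intro!: nn_integral_add[symmetric])
  also have "... = (\<integral>\<^sup>+x. h x*indicator {0..1} x \<partial>lborel)"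
  proof (rule nn_integral_cong_AE)
   have "AE x in lborel. x ~= (0::real) & x ~= t"
    using AE_lborel_singleton[of "0::real"] AE_lborel_singleton[of t] by (auto elim!: eventually_elim2)
   then show "AE x in lborel. H1 x + H2 x = h x*indicator {0..1} x"
    by eventually_elim (use t in \<open>auto simp: H1_def H2_def indicator_def\<close>)
  qed
  also have "... = (\<integral>\<^sup>+x. h x \<partial>I01)" unfolding I01_def by (subst nn_integral_restrict_space) auto
  finally show ?thesis using nn_integral_sqi[OF g(2)] by (simp add: h_def)
 qed
 have "AE t in I01. (\<integral>\<^sup>+s. ennreal ((if s < t then g (t - s) else g (t - s + 1))^2) \<partial>I01) <= ennreal ((nm I01 g)^2)"
  using AE_I01_pos by eventually_elim (use inner in auto)
 from pair_sqiI[OF m this _ nm_nonneg]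
 show "(%(t, s). if s < t then g (t - s) else g (t - s + 1)) : sqi P2"
  "nm P2 (%(t, s). if s < t then g (t - s) else g (t - s + 1)) <= nm I01 g"
  by (auto simp: I01.emeasure_space_1)
qed

lemma fst_sqi:
 assumes "f : sqi I01"
 shows "(%(t, s). f t) : sqi P2" "nm P2 (%(t, s). f t) <= nm I01 f"
proof -
 have m: "(%(t, s). f t) : borel_measurable P2"
  using measurable_compose[OF measurable_fst sqi_measurable[OF assms], of I01] by (simp add: case_prod_unfold)
 have "AE t in I01. (\<integral>\<^sup>+s. ennreal ((f t)^2) \<partial>I01) <= ennreal ((f t)^2)" by (simp add: I01.emeasure_space_1)
 from pair_sqiI[OF m this _ nm_nonneg] nn_integral_sqi[OF assms]
 show "(%(t, s). f t) : sqi P2" "nm P2 (%(t, s). f t) <= nm I01 f" by auto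
qed

lemma AE_P2: "AE z in P2. 0 < fst z & fst z < 1 & 0 < snd z & snd z < 1 & fst z ~= snd z"
proof -
 have m: "Measurable.pred P2 (%z. 0 < fst z & fst z < 1 & 0 < snd z & snd z < 1 & fst z ~= snd z)"
 proof -
  have p: "Measurable.pred (borel \<Otimes>\<^sub>M borel) (%z :: real \<times> real. 0 < fst z & fst z < 1 & 0 < snd z & snd z < 1 & fst z ~= snd z)" by measurable
  have id: "id : P2 \<rightarrow>\<^sub>M (borel \<Otimes>\<^sub>M borel)"
   unfolding id_def by (rule measurable_pair) (auto intro!: measurable_compose[OF measurable_fst] measurable_compose[OF measurable_snd] borel_measurable_I01 simp: comp_def)
  show ?thesis using measurable_comp[OF id p] by simp
 qed
 have "AE t in I01. AE s in I01. 0 < fst (t, s) & fst (t, s) < 1 & 0 < snd (t, s) & snd (t, s) < 1 & fst (t, s) ~= snd (t, s)"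
  using AE_I01_pos
 proof eventually_elim
  case (elim t)
  have "AE s in I01. s ~= t" unfolding I01_def
   using AE_lborel_singleton[of t] by (subst AE_restrict_space_iff) auto
  with AE_I01_pos show ?case by eventually_elim (use elim in auto)
 qed
 note ae = this
 interpret pp: pair_sigma_finite I01 I01 ..
 show ?thesis using m ae by (intro pp.AE_pair_measure) (auto simp: pred_def)
qed

section \<open>Low-rank approximation at a corner\<close>

text \<open>The binomial series at 2/3, twice the bound 1/3 on the increments used later. This
  factor of 2 turns convergence into the rate 2^-K for the remainder of order K.\<close>

definition gbsum :: "real => real" where
 "gbsum \<gamma> = (\<Sum>p. \<bar>\<gamma> gchoose p\<bar>*(2/3)^p)"

lemma gbsum_summable: "summable (%p. \<bar>\<gamma> gchoose p\<bar>*(2/3 :: real)^p)"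
proof -
 have "summable (%p. norm ((\<gamma> gchoose p)*(2/3 :: real)^p))"
  by (rule abs_summable_in_conv_radius) (simp add: conv_radius_gchoose one_ereal_def[symmetric])
 then show ?thesis by (simp add: abs_mult)
qed

lemma gbsum_ge: "\<bar>\<gamma> gchoose p\<bar>*(2/3)^p <= gbsum \<gamma>"
 unfolding gbsum_def using sum_le_suminf[OF gbsum_summable, of "{p}"] by simp

lemma gbsum_ge_1: "1 <= gbsum \<gamma>"
 using gbsum_ge[of \<gamma> 0] by simp

lemma binomial_tail:
 fixes h :: real
 assumes h: "\<bar>h\<bar> <= 1/3"
 shows "\<bar>(1 + h) powr \<gamma> - (\<Sum>p<K. (\<gamma> gchoose p)*h^p)\<bar> <= gbsum \<gamma>/2^K"
proof -
 have s: "(%p. (\<gamma> gchoose p)*h^p) sums (1 + h) powr \<gamma>" using h by (intro gen_binomial_real) auto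
 have le: "norm ((\<gamma> gchoose (p + K))*h^(p + K)) <= \<bar>\<gamma> gchoose (p + K)\<bar>*(2/3)^(p + K)*(1/2^K)" for p
 proof -
  have "\<bar>h\<bar>^(p + K) <= (1/3)^(p + K)" using h by (intro power_mono) auto
  also have "(1/3 :: real)^(p + K) = (2/3)^(p + K)*(1/2)^(p + K)" by (simp add: power_mult_distrib[symmetric])
  also have "... <= (2/3)^(p + K)*(1/2)^K" by (intro mult_left_mono power_decreasing) auto
  finally have "\<bar>\<gamma> gchoose (p + K)\<bar>*\<bar>h\<bar>^(p + K) <= \<bar>\<gamma> gchoose (p + K)\<bar>*((2/3)^(p + K)*(1/2)^K)"
   by (intro mult_left_mono) auto
  then show ?thesis by (simp only: real_norm_def abs_mult power_abs power_one_over mult.assoc)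
 qed
 have sm: "summable (%p. \<bar>\<gamma> gchoose (p + K)\<bar>*(2/3 :: real)^(p + K))"
  using gbsum_summable by (rule summable_ignore_initial_segment)
 have "(1 + h) powr \<gamma> - (\<Sum>p<K. (\<gamma> gchoose p)*h^p) = (\<Sum>p. (\<gamma> gchoose (p + K))*h^(p + K))"
  using suminf_minus_initial_segment[OF sums_summable[OF s], of K] sums_unique[OF s] by simp
 also have "\<bar>...\<bar> <= (\<Sum>p. \<bar>\<gamma> gchoose (p + K)\<bar>*(2/3)^(p + K)*(1/2^K))"
  by (subst real_norm_def[symmetric], rule norm_suminf_le[OF le summable_mult2[OF sm]])
 also have "... = (\<Sum>p. \<bar>\<gamma> gchoose (p + K)\<bar>*(2/3)^(p + K))*(1/2^K)" by (rule suminf_mult2[OF sm, symmetric])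
 also have "... <= gbsum \<gamma>*(1/2^K)"
 proof (rule mult_right_mono)
  have "gbsum \<gamma> = (\<Sum>p. \<bar>\<gamma> gchoose (p + K)\<bar>*(2/3)^(p + K)) + (\<Sum>p<K. \<bar>\<gamma> gchoose p\<bar>*(2/3)^p)"
   unfolding gbsum_def by (rule suminf_split_initial_segment[OF gbsum_summable])
  moreover have "0 <= (\<Sum>p<K. \<bar>\<gamma> gchoose p\<bar>*(2/3 :: real)^p)" by (intro sum_nonneg) auto
  ultimately show "(\<Sum>p. \<bar>\<gamma> gchoose (p + K)\<bar>*(2/3)^(p + K)) <= gbsum \<gamma>" by linarith
 qed simp
 finally show ?thesis by simp
qed

text \<open>The p-th term of the expansion of \<open>psi \<gamma> a (t + u)\<close> about the centre
  c is \<open>cellb\<close> in t times \<open>cellv\<close> in u. The power c^p is moved from one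
  factor to the other so that neither grows with 1/c to the power p.\<close>

definition cellb :: "real => real => nat => real => real" where
 "cellb a c p t = ((t - c)/c)^p*exp (- a*(t - c))"

definition cellv :: "real => real => real => nat => real => real" where
 "cellv \<gamma> a c p u = (\<gamma> gchoose p)*c^p*psi (\<gamma> - p) a (c + u)"

text \<open>The bound on \<bar>t - c\<bar> holds relative to every base c + u + l, since these are
  at least c. One binomial expansion of order K thus serves all summands of the series at once and
  loses only a relative 2^-K.\<close>

lemma cell_approx:
 assumes c: "0 < c" "c <= 3/4" and t: "\<bar>t - c\<bar> <= c/3" and u: "0 <= u" "u <= 1" and a: "0 < a" "a <= 1"
 shows "\<bar>psi \<gamma> a (t + u) - (\<Sum>p<K. cellb a c p t*cellv \<gamma> a c p u)\<bar> <= 3*gbsum \<gamma>/2^K*psi \<gamma> a (c + u)"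
proof -
 have t0: "0 < t" "t <= 1" using c t by linarith+
 have cu: "0 < c + u" "c + u <= 2" "0 < t + u" "t + u <= 2" using c u t0 by auto
 define y where "y l = c + u + real l" for l
 define h where "h l = (t - c)/y l" for l
 have y: "y l >= c" "y l > 0" for l using c u by (auto simp: y_def)
 have h: "\<bar>h l\<bar> <= 1/3" for l
 proof -
  have "\<bar>t - c\<bar> <= 1/3*y l" using t y[of l] by linarith
  then show ?thesis using y[of l] by (simp add: h_def abs_divide divide_le_eq)
 qed
 define E where "E l = y l powr \<gamma>*exp (- a*y l)" for l
 have E0: "E l >= 0" for l by (simp add: E_def)
 have sE: "summable E" unfolding E_def y_def using psi_summable[OF cu(1,2) a, of \<gamma>] by simp
 have psiE: "psi \<gamma> a (c + u) = suminf E" unfolding psi_def E_def y_def ..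
 have term1: "(t + u + real l) powr \<gamma>*exp (- a*(t + u + real l)) = exp (- a*(t - c))*(E l*(1 + h l) powr \<gamma>)" for l
 proof -
  have yt: "t + u + real l = y l*(1 + h l)" using y[of l] by (simp add: h_def y_def field_simps)
  have e: "exp (- a*(t + u + real l)) = exp (- a*(t - c))*exp (- a*y l)"
   by (simp add: exp_add[symmetric] y_def algebra_simps)
  have "(t + u + real l) powr \<gamma> = y l powr \<gamma>*(1 + h l) powr \<gamma>"
   unfolding yt using y[of l] h[of l] by (intro powr_mult) 
  then show ?thesis unfolding e E_def by (simp add: mult_ac)
 qed
 have sp: "summable (%l. (c + u + real l) powr (\<gamma> - real p)*exp (- a*(c + u + real l)))" for p
  using psi_summable[OF cu(1,2) a, of "\<gamma> - real p"] by simp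
 have term2: "cellb a c p t*cellv \<gamma> a c p u = (\<Sum>l. exp (- a*(t - c))*(E l*((\<gamma> gchoose p)*h l^p)))" for p
 proof -
  have "cellb a c p t*cellv \<gamma> a c p u = (t - c)^p*exp (- a*(t - c))*(\<gamma> gchoose p)*psi (\<gamma> - p) a (c + u)"
   using c by (simp add: cellb_def cellv_def power_divide)
  also have "... = (\<Sum>l. (t - c)^p*exp (- a*(t - c))*(\<gamma> gchoose p)*((c + u + real l) powr (\<gamma> - real p)*exp (- a*(c + u + real l))))"
   unfolding psi_def by (rule suminf_mult[OF sp, symmetric])
  also have "... = (\<Sum>l. exp (- a*(t - c))*(E l*((\<gamma> gchoose p)*h l^p)))"
  proof (rule suminf_cong)
   fix l
   have "(c + u + real l) powr (\<gamma> - real p) = y l powr \<gamma>/y l^p"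
    using y[of l] by (simp add: y_def powr_diff powr_realpow)
   then show "(t - c)^p*exp (- a*(t - c))*(\<gamma> gchoose p)*((c + u + real l) powr (\<gamma> - real p)*exp (- a*(c + u + real l))) =
    exp (- a*(t - c))*(E l*((\<gamma> gchoose p)*h l^p))"
    by (simp add: E_def h_def power_divide y_def[symmetric])
  qed
  finally show ?thesis .
 qed
 have st2: "summable (%l. exp (- a*(t - c))*(E l*((\<gamma> gchoose p)*h l^p)))" for p
 proof (rule summable_comparison_test'[of "%l. exp (- a*(t - c))*\<bar>\<gamma> gchoose p\<bar>*E l" 0])
  show "summable (%l. exp (- a*(t - c))*\<bar>\<gamma> gchoose p\<bar>*E l)" using sE by (rule summable_mult)
  fix l :: nat
  have "\<bar>h l\<bar>^p <= 1" using h[of l] by (intro power_le_one) auto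
  then have "exp (- a*(t - c))*\<bar>\<gamma> gchoose p\<bar>*E l*\<bar>h l\<bar>^p <= exp (- a*(t - c))*\<bar>\<gamma> gchoose p\<bar>*E l*1"
   using E0[of l] by (intro mult_left_mono) auto
  then show "norm (exp (- a*(t - c))*(E l*((\<gamma> gchoose p)*h l^p))) <= exp (- a*(t - c))*\<bar>\<gamma> gchoose p\<bar>*E l"
   using E0[of l] by (simp add: abs_mult power_abs mult_ac)
 qed
 have s1: "summable (%l. exp (- a*(t - c))*(E l*(1 + h l) powr \<gamma>))"
  using psi_summable[OF cu(3,4) a, of \<gamma>] unfolding term1 .
 have sumK: "(\<Sum>p<K. cellb a c p t*cellv \<gamma> a c p u) = (\<Sum>l. \<Sum>p<K. exp (- a*(t - c))*(E l*((\<gamma> gchoose p)*h l^p)))"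
  unfolding term2 by (rule suminf_sum[symmetric]) (rule st2)
 have psi1: "psi \<gamma> a (t + u) = (\<Sum>l. exp (- a*(t - c))*(E l*(1 + h l) powr \<gamma>))"
  unfolding psi_def term1 ..
 have "psi \<gamma> a (t + u) - (\<Sum>p<K. cellb a c p t*cellv \<gamma> a c p u) =
   (\<Sum>l. exp (- a*(t - c))*(E l*(1 + h l) powr \<gamma>) - (\<Sum>p<K. exp (- a*(t - c))*(E l*((\<gamma> gchoose p)*h l^p))))"
  unfolding sumK psi1 by (rule suminf_diff[OF s1 summable_sum[OF st2]])
 also have "... = (\<Sum>l. exp (- a*(t - c))*E l*((1 + h l) powr \<gamma> - (\<Sum>p<K. (\<gamma> gchoose p)*h l^p)))"
  by (intro suminf_cong) (simp add: right_diff_distrib sum_distrib_left mult.assoc)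
 also have "\<bar>...\<bar> <= (\<Sum>l. 3*gbsum \<gamma>/2^K*E l)"
 proof -
  have le: "norm (exp (- a*(t - c))*E l*((1 + h l) powr \<gamma> - (\<Sum>p<K. (\<gamma> gchoose p)*h l^p))) <= 3*gbsum \<gamma>/2^K*E l" for l
  proof -
   have "- a*(t - c) <= 1"
   proof -
    have "\<bar>a*(t - c)\<bar> <= 1*1" unfolding abs_mult using a t c by (intro mult_mono) auto
    then show ?thesis by linarith
   qed
   then have "exp (- a*(t - c)) <= 3" using exp_le order_trans[of _ "exp 1"] by (metis exp_le_cancel_iff)
   then have "exp (- a*(t - c))*E l*\<bar>(1 + h l) powr \<gamma> - (\<Sum>p<K. (\<gamma> gchoose p)*h l^p)\<bar> <= 3*E l*(gbsum \<gamma>/2^K)"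
    using E0[of l] binomial_tail[OF h[of l], of \<gamma> K] by (intro mult_mono) auto
   then show ?thesis using E0[of l] by (simp add: abs_mult mult_ac)
  qed
  have sm: "summable (%l. 3*gbsum \<gamma>/2^K*E l)" using sE by (rule summable_mult)
  show ?thesis using norm_suminf_le[OF le sm] by simp
 qed
 also have "... = 3*gbsum \<gamma>/2^K*psi \<gamma> a (c + u)" unfolding psiE by (rule suminf_mult[OF sE])
 finally show ?thesis .
qed

lemma cellb_bound:
 assumes "0 < c" "c <= 3/4" "\<bar>t - c\<bar> <= c/3" "0 < a" "a <= 1"
 shows "\<bar>cellb a c p t\<bar> <= 3"
proof -
 have "\<bar>(t - c)/c\<bar> <= 1" using assms by (simp add: abs_divide divide_le_eq)
 then have 1: "\<bar>(t - c)/c\<bar>^p <= 1" by (intro power_le_one) auto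
 have "\<bar>a*(t - c)\<bar> <= 1*1" unfolding abs_mult using assms by (intro mult_mono) auto
 then have "- a*(t - c) <= 1" by linarith
 then have "exp (- a*(t - c)) <= 3" using exp_le order_trans[of _ "exp 1"] by (metis exp_le_cancel_iff)
 with 1 have "\<bar>(t - c)/c\<bar>^p*exp (- a*(t - c)) <= 1*3" by (intro mult_mono) auto
 then show ?thesis by (simp add: cellb_def abs_mult power_abs)
qed

lemma psi_bound_from:
 assumes c: "0 < c" "c <= x" "x <= 2" "c <= 1" and a: "0 < a" "a <= 1" and g: "- 1 <= \<gamma>" "\<gamma> <= real q"
 shows "psi \<gamma> a x <= 1/c + 2^q + psi_tail q a"
proof -
 have "psi \<gamma> a x <= x powr \<gamma> + psi_tail q a" using assms by (intro psi_upper) auto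
 moreover have "x powr \<gamma> <= 1/c + 2^q"
 proof (cases "x <= 1")
  case True
  have "x powr \<gamma> <= x powr (- 1)" using True c g by (intro powr_mono') auto
  also have "... = 1/x" using c by (simp add: powr_minus_divide)
  also have "... <= 1/c" using c by (intro divide_left_mono) auto
  finally show ?thesis by (simp add: add_increasing2)
 next
  case False
  have "x powr \<gamma> <= x powr real q" using False g by (intro powr_mono) auto
  also have "... = x^q" using False by (subst powr_realpow) auto
  also have "... <= 2^q" using False c by (intro power_mono) auto
  finally show ?thesis using c by (simp add: add_increasing)
 qed
 ultimately show ?thesis by linarith
qed

text \<open>c is at most every base c + u + l, so c^p makes up for the lowered exponent. What
  remains is the binomial coefficient, which grows at most like (3/2)^p.\<close>

lemma cellv_bound:
 assumes c: "0 < c" "c <= 3/4" and u: "0 <= u" "u <= 1" and a: "0 < a" "a <= 1" and g: "- 1 <= \<gamma>" "\<gamma> <= real q"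
 shows "\<bar>cellv \<gamma> a c p u\<bar> <= gbsum \<gamma>*2^p*(1/c + 2^q + psi_tail q a)"
proof -
 have cu: "0 < c + u" "c + u <= 2" using c u by auto
 have psi0: "0 <= psi (\<gamma> - p) a (c + u)"
  unfolding psi_def by (rule suminf_nonneg[OF psi_summable[OF cu a]]) auto
 have "c^p*psi (\<gamma> - p) a (c + u) <= psi \<gamma> a (c + u)"
  unfolding psi_def
 proof (subst suminf_mult[OF psi_summable[OF cu a], symmetric], rule suminf_le)
  fix l
  have y: "0 < c + u + real l" "c <= c + u + real l" using c u by auto
  have "c^p*(c + u + real l) powr (\<gamma> - real p) = (c/(c + u + real l))^p*(c + u + real l) powr \<gamma>"
   using y by (simp add: powr_diff powr_realpow power_divide)
  also have "... <= 1*(c + u + real l) powr \<gamma>"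
   using y c by (intro mult_right_mono power_le_one) auto
  finally have "c^p*(c + u + real l) powr (\<gamma> - real p)*exp (- a*(c + u + real l)) <= (c + u + real l) powr \<gamma>*exp (- a*(c + u + real l))"
   by (intro mult_right_mono) auto
  then show "c^p*((c + u + real l) powr (\<gamma> - real p)*exp (- a*(c + u + real l))) <= (c + u + real l) powr \<gamma>*exp (- a*(c + u + real l))"
   by (simp add: mult.assoc)
 qed (rule summable_mult[OF psi_summable[OF cu a]], rule psi_summable[OF cu a])
 also have "... <= 1/c + 2^q + psi_tail q a" using assms by (intro psi_bound_from) auto
 finally have 1: "c^p*psi (\<gamma> - p) a (c + u) <= 1/c + 2^q + psi_tail q a" .
 have "\<bar>\<gamma> gchoose p\<bar> <= gbsum \<gamma>*(3/2)^p"
  using gbsum_ge[of \<gamma> p] by (simp add: power_divide divide_simps mult.commute)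
 also have "... <= gbsum \<gamma>*2^p" using gbsum_ge_1[of \<gamma>] by (intro mult_left_mono power_mono) auto
 finally have "\<bar>\<gamma> gchoose p\<bar>*(c^p*psi (\<gamma> - p) a (c + u)) <= gbsum \<gamma>*2^p*(1/c + 2^q + psi_tail q a)"
  using 1 psi0 c gbsum_ge_1[of \<gamma>] by (intro mult_mono) auto
 then show ?thesis using psi0 c by (simp add: cellv_def abs_mult mult.assoc)
qed

section \<open>The Riemann-Liouville kernel and its corner correction\<close>

definition kern :: "real => real => real => real" where
 "kern \<beta> t s = (if s < t then (t - s) powr (\<beta> - 1) else 0)"

lemma kern_measurable [measurable]: "(%(t, s). kern \<beta> t s) : borel_measurable (borel \<Otimes>\<^sub>M borel)"
 unfolding kern_def by measurable

text \<open>Dominated by the periodic kernel with the same profile, whose norm is that of the power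
  over one period.\<close>

lemma kern_sqi:
 assumes b: "\<beta> > 1/2"
 shows "(%(t, s). kern \<beta> t s) : sqi P2" "nm P2 (%(t, s). kern \<beta> t s) <= sqrt (1/(2*\<beta> - 1))"
proof -
 let ?g = "%x::real. x powr (\<beta> - 1)"
 have g: "?g : borel_measurable borel" "?g : sqi I01" using b by (auto intro!: powr_sqi_I01)
 note per = periodic_kernel[OF g]
 have le: "AE z in P2. \<bar>case z of (t, s) => kern \<beta> t s\<bar> <= (case z of (t, s) => if s < t then ?g (t - s) else ?g (t - s + 1))"
  by (auto simp: kern_def)
 show "(%(t, s). kern \<beta> t s) : sqi P2"
  by (rule sqi_bound[OF per(1) measurable_P2[OF kern_measurable] le])
 have "nm P2 (%(t, s). kern \<beta> t s) <= nm I01 ?g" using nm_mono[OF per(1) le] per(2) by linarith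
 then show "nm P2 (%(t, s). kern \<beta> t s) <= sqrt (1/(2*\<beta> - 1))"
  using powr_sqi_I01(2)[of "\<beta> - 1"] b by (simp add: nm_def)
qed

text \<open>Centres of the dyadic cells; a cell is the interval around its centre of radius a third of it.\<close>

definition centre :: "nat => real" where "centre i = 3/2^(i + 2)"

lemma centre_bounds: "0 < centre i" "centre i <= 3/4"
 by (auto simp: centre_def divide_simps)

lemma dyadic_cell:
 fixes t :: real
 assumes "1/2^J <= t" "t < 1"
 shows "\<exists>i<J. 1/2^Suc i <= t & t < 1/2^i"
 using assms
proof (induction J)
 case (Suc J)
 show ?case
 proof (cases "1/2^J <= t")
  case True
  then show ?thesis using Suc by (meson less_Suc_eq)
 next
  case False
  then show ?thesis using Suc by (intro exI[of _ J]) auto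
 qed
qed simp

lemma dyadic_cell_unique:
 fixes t :: real
 assumes "1/2^Suc i <= t" "t < 1/2^i" "1/2^Suc j <= t" "t < 1/2^j"
 shows "i = j"
proof (rule ccontr)
 assume "i ~= j"
 then consider "Suc i <= j" | "Suc j <= i" by linarith
 then show False
 proof cases
  case 1
  then have "1/2^j <= (1/2^Suc i :: real)" by (intro divide_left_mono power_increasing) auto
  then show False using assms by linarith
 next
  case 2
  then have "1/2^i <= (1/2^Suc j :: real)" by (intro divide_left_mono power_increasing) auto
  then show False using assms by linarith
 qed
qed

lemma centre_cell:
 assumes "1/2^Suc i <= t" "t < 1/2^i"
 shows "\<bar>t - centre i\<bar> <= centre i/3"
proof -
 define h :: real where "h = 1/2^(i + 2)"
 have "(1/2^Suc i :: real) = 2*h" "(1/2^i :: real) = 4*h" "centre i = 3*h" by (simp_all add: h_def centre_def power_add)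
 note e = this
 have "2*h <= t" "t < 4*h" using assms unfolding e by simp_all
 then show ?thesis unfolding e by linarith
qed

definition dyb :: "real => nat => nat => real => real" where
 "dyb a i p t = indicator {1/2^Suc i..<1/2^i} t*cellb a (centre i) p t"

lemma dyb_measurable [measurable]: "dyb a i p : borel_measurable borel"
 unfolding dyb_def[abs_def] cellb_def by measurable

lemma dyb_bound: "0 < a ==> a <= 1 ==> \<bar>dyb a i p t\<bar> <= 3"
 using cellb_bound[OF centre_bounds[of i] centre_cell[of i t], of a p] by (auto simp: dyb_def indicator_def)

text \<open>On the closed square 1 + t - s vanishes only at t = 0, s = 1, and it is at least t. The
  J dyadic cells in t reach down to 1/2^J; on the strip below nothing is subtracted, and the kernel
  is small there in L2 because \<beta> > 1/2. The three summands are the expansion error, the power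
  on the strip and the bounded part on the strip.\<close>

lemma dyadic_rank_approx:
 assumes b: "\<beta> > 1/2" "\<beta> <= real q" and a: "0 < a" "a <= 1"
 shows "nm P2 (%(t, s). psi (\<beta> - 1) a (1 + t - s) - (\<Sum>i<J. \<Sum>p<K. dyb a i p t*cellv (\<beta> - 1) a (centre i) p (1 - s))) <=
   3*gbsum (\<beta> - 1)/2^K*(2^(J + 1) + 2^q + psi_tail q a) +
   sqrt ((1/2^J) powr (2*\<beta> - 1)/(2*\<beta> - 1)) + (2^q + psi_tail q a) * sqrt (1/2^J)" (is "_ <= ?e1 + ?e2 + ?W*?e3")
  and "(%(t, s). psi (\<beta> - 1) a (1 + t - s) - (\<Sum>i<J. \<Sum>p<K. dyb a i p t*cellv (\<beta> - 1) a (centre i) p (1 - s))) : sqi P2"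
proof -
 let ?\<gamma> = "\<beta> - 1"
 let ?R = "%t s. psi ?\<gamma> a (1 + t - s) - (\<Sum>i<J. \<Sum>p<K. dyb a i p t*cellv ?\<gamma> a (centre i) p (1 - s))"
 have W0: "0 <= psi_tail q a" unfolding psi_tail_def by (rule suminf_nonneg[OF psi_tail_bound(1)[OF a]]) auto
 have g: "- 1 <= ?\<gamma>" "?\<gamma> <= real q" using b by auto
 define d where "d = (1/2^J :: real)"
 have d: "0 < d" "d <= 1" by (auto simp: d_def)
 \<comment> \<open>A majorant that depends on t alone: \<open>?e1\<close> where t lies in a cell,
   the rest on the strip.\<close>
 define B where "B t = ?e1 + (indicator {0..d} t*t powr ?\<gamma> + ?W*indicator {0..d} t)" for t
 have e1: "0 <= ?e1" using W0 gbsum_ge_1[of ?\<gamma>] by auto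
 have pt: "\<bar>?R t s\<bar> <= B t" if t: "0 < t" "t < 1" and s: "0 < s" "s < 1" for t s
 proof (cases "d <= t")
  case True
  then obtain i where i: "i < J" "1/2^Suc i <= t" "t < 1/2^i" using dyadic_cell[of J t] t by (auto simp: d_def)
  have ind: "dyb a j p t = (if j = i then cellb a (centre i) p t else 0)" for j p
  proof -
   have "t : {1/2^Suc j..<1/2^j} \<longleftrightarrow> j = i"
    using dyadic_cell_unique[OF i(2,3), of j] i(2,3) unfolding atLeastLessThan_iff by blast
   then show ?thesis by (simp only: dyb_def indicator_def) simp
  qed
  have "(\<Sum>j<J. \<Sum>p<K. dyb a j p t*cellv ?\<gamma> a (centre j) p (1 - s)) =
   (\<Sum>j<J. if j = i then (\<Sum>p<K. cellb a (centre i) p t*cellv ?\<gamma> a (centre i) p (1 - s)) else 0)"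
   by (intro sum.cong refl) (auto simp: ind)
  also have "... = (\<Sum>p<K. cellb a (centre i) p t*cellv ?\<gamma> a (centre i) p (1 - s))" using i by simp
  finally have eq: "?R t s = psi ?\<gamma> a (t + (1 - s)) - (\<Sum>p<K. cellb a (centre i) p t*cellv ?\<gamma> a (centre i) p (1 - s))"
   by (simp add: algebra_simps)
  have "\<bar>?R t s\<bar> <= 3*gbsum ?\<gamma>/2^K*psi ?\<gamma> a (centre i + (1 - s))"
   unfolding eq by (rule cell_approx) (use centre_bounds[of i] centre_cell[OF i(2,3)] s a in auto)
  also have "... <= ?e1"
  proof (rule mult_left_mono)
   have "psi ?\<gamma> a (centre i + (1 - s)) <= 1/centre i + 2^q + psi_tail q a"
    using centre_bounds[of i] s a g by (intro psi_bound_from) auto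
   moreover have "1/centre i <= 2^(J + 1)"
   proof -
    have "1/centre i <= 2^(i + 2)" by (simp add: centre_def)
    also have "... <= (2^(J + 1) :: real)" using i by (intro power_increasing) auto
    finally show ?thesis .
   qed
   ultimately show "psi ?\<gamma> a (centre i + (1 - s)) <= 2^(J + 1) + 2^q + psi_tail q a" by linarith
  qed (use gbsum_ge_1[of ?\<gamma>] in auto)
  also have "... <= B t" using W0 by (simp add: B_def indicator_def)
  finally show ?thesis .
 next
  case False
  have ind: "dyb a j p t = 0" if "j < J" for j p
  proof -
   have "d <= 1/2^Suc j" unfolding d_def using that by (intro divide_left_mono power_increasing) auto
   then show ?thesis using False by (auto simp: dyb_def indicator_def)
  qed
  then have eq: "?R t s = psi ?\<gamma> a (1 + t - s)" by simp
  have x: "0 < 1 + t - s" "1 + t - s <= 2" using t s by auto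
  have "\<bar>psi ?\<gamma> a (1 + t - s)\<bar> <= (1 + t - s) powr ?\<gamma> + psi_tail q a" using psi_upper[OF x a g(2)] by simp
  moreover have "(1 + t - s) powr ?\<gamma> <= t powr ?\<gamma> + 2^q"
  proof (cases "?\<gamma> <= 0")
   case True
   then have "(1 + t - s) powr ?\<gamma> <= t powr ?\<gamma>" using t s by (intro powr_mono2') auto
   then show ?thesis by (simp add: add_increasing2)
  next
   case F: False
   have "(1 + t - s) powr ?\<gamma> <= 2 powr ?\<gamma>" using F x by (intro powr_mono2) auto
   also have "... <= 2 powr real q" using g by (intro powr_mono) auto
   finally show ?thesis by (simp add: powr_realpow add_increasing)
  qed
  ultimately show ?thesis using False t e1 unfolding eq by (simp add: B_def indicator_def)
 qed
 have Rm: "(%(t, s). ?R t s) : borel_measurable P2"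
  by (rule measurable_P2) (unfold cellv_def, measurable)
 have ind1: "(%t. indicator {0..d} t*t powr ?\<gamma>) : sqi I01"
  using powr_sqi_I01(1)[of ?\<gamma>] b
  by (rule_tac sqi_bound[where g = "%t. t powr ?\<gamma>"]) (auto intro!: borel_measurable_I01 AE_I2 simp: indicator_def)
 have ind2: "(%t. ?W*indicator {0..d} t) : sqi I01"
  by (intro sqi_cmult sqi_I01_bounded[where C = 1]) (auto simp: indicator_def)
 have cs: "(%t. ?e1) : sqi I01" by (rule sqi_I01_bounded[where C = "\<bar>?e1\<bar>"]) auto
 have Bs: "B : sqi I01" unfolding B_def by (intro sqi_add cs ind1 ind2)
 have "nm I01 B <= nm I01 (%t. ?e1) + (nm I01 (%t. indicator {0..d} t*t powr ?\<gamma>) + nm I01 (%t. ?W*indicator {0..d} t))"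
  unfolding B_def by (rule order_trans[OF nm_triangle[OF cs sqi_add[OF ind1 ind2]]]) (intro add_left_mono nm_triangle ind1 ind2)
 also have "nm I01 (%t. ?e1) = ?e1" unfolding nm_const[OF prob_space_I01] using e1 by (rule abs_of_nonneg)
 also have "nm I01 (%t. indicator {0..d} t*t powr ?\<gamma>) = ?e2"
  unfolding nm_def using powr_sqi_I01(3)[of ?\<gamma> d] b d by (simp add: d_def)
 also have "nm I01 (%t. ?W*indicator {0..d} t) = ?W*?e3"
 proof -
  have "(LINT t|I01. (indicator {0..d} t)^2) = (LINT t|lborel. (indicator {0..d} t :: real))"
   unfolding I01_def
  proof (subst integral_restrict_space)
   show "(LBINT x. indicator {0..1} x *\<^sub>R (indicator {0..d} x :: real)\<^sup>2) = (LBINT x. indicator {0..d} x)"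
    using d by (intro Bochner_Integration.integral_cong) (auto simp: indicator_def)
  qed simp
  also have "... = d" using d by simp
  finally have "nm I01 (indicator {0..d}) = sqrt d" by (simp add: nm_def)
  then show ?thesis using W0 unfolding nm_cmult by (simp add: d_def)
 qed
 finally have nB: "nm I01 B <= ?e1 + ?e2 + ?W*?e3" by simp
 have AE: "AE z in P2. \<bar>case z of (t, s) => ?R t s\<bar> <= (case z of (t, s) => B t)"
  using AE_P2 by eventually_elim (use pt in \<open>auto simp: case_prod_unfold\<close>)
 show "(%(t, s). ?R t s) : sqi P2" by (rule sqi_bound[OF fst_sqi(1)[OF Bs] Rm AE])
 show "nm P2 (%(t, s). ?R t s) <= ?e1 + ?e2 + ?W*?e3"
  using nm_mono[OF fst_sqi(1)[OF Bs] AE] fst_sqi(2)[OF Bs] nB by linarith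
qed

section \<open>Assembling the splitting of the kernel\<close>

lemma uniform_grid_modulus:
 fixes f :: "nat => real => real"
 assumes "\<And>j. j < m ==> continuous_on {0..1} (f j)" and e: "\<eta> > 0"
 shows "\<exists>N0>0. \<forall>N\<ge>N0. \<forall>j<m. \<forall>s\<in>{0..1}. \<forall>s'\<in>{0..1}. \<bar>s - s'\<bar> <= 1/real N --> \<bar>f j s - f j s'\<bar> <= \<eta>"
 using assms(1)
proof (induction m)
 case 0
 show ?case by (rule exI[of _ 1]) auto
next
 case (Suc m)
 then obtain N0 where N0: "N0 > 0" "\<And>N j s s'. N >= N0 ==> j < m ==> s : {0..1} ==> s' : {0..1} ==> \<bar>s - s'\<bar> <= 1/real N ==> \<bar>f j s - f j s'\<bar> <= \<eta>"
  by (metis less_SucI)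
 have "uniformly_continuous_on {0..1} (f m)" by (rule compact_uniformly_continuous) (use Suc.prems[of m] in auto)
 then obtain d where d: "d > 0" "\<And>s s'. s : {0..1} ==> s' : {0..1} ==> dist s' s < d ==> dist (f m s') (f m s) < \<eta>"
  using e unfolding uniformly_continuous_on_def by metis
 obtain N1 :: nat where N1: "1/d < real N1" using reals_Archimedean2 by blast
 have N1': "1/real N < d" if "N >= N1" for N
 proof -
  have "1/d < real N" using N1 that by linarith
  then show ?thesis using d(1) by (metis divide_less_eq mult.commute less_divide_eq_1_pos order.strict_trans zero_less_divide_1_iff)
 qed
 show ?case
 proof (rule exI[of _ "max N0 N1"], intro conjI allI impI ballI)
  show "0 < max N0 N1" using N0 by simp
  fix N j s s' assume N: "max N0 N1 <= N" and j: "j < Suc m" and s: "s : {0..1::real}" "s' : {0..1}" "\<bar>s - s'\<bar> <= 1/real N"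
  show "\<bar>f j s - f j s'\<bar> <= \<eta>"
  proof (cases "j = m")
   case True
   have "dist s s' < d" using s N1'[of N] N by (simp add: dist_real_def)
   then show ?thesis using d(2)[OF s(2,1)] True by (simp add: dist_real_def)
  next
   case False
   then show ?thesis using N0(2)[of N j s s'] N j s by auto
  qed
 qed
qed

lemma exists_power2: "\<exists>A::nat. x <= 2^A" for x :: real
 using real_arch_pow[of 2 x] by (auto intro: less_imp_le)

text \<open>The frequency k satisfies j + 1 <= 2k <= j + 2. Dropping a^2 gives the upper bound; for
  the lower one a <= 1 < pi lets one more unit of j absorb a^2, whence j + 3.\<close>

lemma mode_bounds:
 fixes j :: nat
 assumes b: "\<beta> > 0" and a: "0 < a" "a <= 1"
 defines "k \<equiv> j div 2 + 1"
 shows "Gamma \<beta>/pi powr \<beta>*real (j + 3) powr (- \<beta>) <= Gamma \<beta>*(a^2 + (2*pi*real k)^2) powr (- \<beta>/2)"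
  "Gamma \<beta>*(a^2 + (2*pi*real k)^2) powr (- \<beta>/2) <= Gamma \<beta>/pi powr \<beta>*real (j + 1) powr (- \<beta>)"
proof -
 have G: "Gamma \<beta> > 0" using b by (rule Gamma_real_pos)
 have "j + 1 <= 2*k" "2*k <= j + 2" unfolding k_def by presburger+
 then have "real (j + 1) <= real (2*k)" "real (2*k) <= real (j + 2)" by (simp_all only: of_nat_le_iff)
 then have k: "real (j + 1) <= 2*real k" "2*real k <= real (j + 2)" by simp_all
 have sq: "Gamma \<beta>/pi powr \<beta>*x powr (- \<beta>) = Gamma \<beta>*((pi*x)^2) powr (- \<beta>/2)" if "x > 0" for x
 proof -
  have "((pi*x)^2) powr (- \<beta>/2) = (pi*x) powr (- \<beta>)"
  proof -
   have e: "(pi*x)^2 = (pi*x) powr 2" using that by simp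
   show ?thesis unfolding e powr_powr by simp
  qed
  show ?thesis unfolding \<open>((pi * x)\<^sup>2) powr (- \<beta> / 2) = _\<close> by (simp add: powr_mult powr_minus divide_inverse)
 qed
 have pos: "0 < a^2 + (2*pi*real k)^2" using a by (simp add: add_pos_nonneg)
 have "(pi*real (j + 1))^2 <= (pi*(2*real k))^2" using k by (intro power_mono mult_left_mono) auto
 also have "... <= a^2 + (2*pi*real k)^2" by (simp add: mult_ac)
 finally have "(a^2 + (2*pi*real k)^2) powr (- \<beta>/2) <= ((pi*real (j + 1))^2) powr (- \<beta>/2)"
  using b by (intro powr_mono2') auto
 then show "Gamma \<beta>*(a^2 + (2*pi*real k)^2) powr (- \<beta>/2) <= Gamma \<beta>/pi powr \<beta>*real (j + 1) powr (- \<beta>)"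
  using G by (subst sq) auto
 have "a^2 + (2*pi*real k)^2 <= 1 + (pi*real (j + 2))^2"
  using a k by (intro add_mono power_le_one power_mono) (auto simp: mult.assoc intro!: mult_left_mono)
 also have "... <= (pi*real (j + 2) + 1)^2" by (simp add: power2_sum)
 also have "... <= (pi*real (j + 3))^2" using pi_gt3 by (intro power_mono) (auto simp: algebra_simps)
 finally have "((pi*real (j + 3))^2) powr (- \<beta>/2) <= (a^2 + (2*pi*real k)^2) powr (- \<beta>/2)"
  using b pos by (intro powr_mono2') auto
 then show "Gamma \<beta>/pi powr \<beta>*real (j + 3) powr (- \<beta>) <= Gamma \<beta>*(a^2 + (2*pi*real k)^2) powr (- \<beta>/2)"
  using G by (subst sq) auto
qed

lemma damping_error:
 assumes b: "\<beta> > 1/2" and a: "0 < a"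
 shows "(%(t, s). kern \<beta> t s*(1 - exp (- a*(t - s)))) : sqi P2"
  "nm P2 (%(t, s). kern \<beta> t s*(1 - exp (- a*(t - s)))) <= a * sqrt (1/(2*\<beta> - 1))"
proof -
 have m: "(%(t, s). kern \<beta> t s*(1 - exp (- a*(t - s)))) : borel_measurable P2"
  by (rule measurable_P2) (unfold kern_def, measurable)
 have s: "(%z. a*(case z of (t, s) => kern \<beta> t s)) : sqi P2" by (rule sqi_cmult[OF kern_sqi(1)[OF b]])
 have le: "AE z in P2. \<bar>case z of (t, s) => kern \<beta> t s*(1 - exp (- a*(t - s)))\<bar> <= a*(case z of (t, s) => kern \<beta> t s)"
  using AE_P2
 proof eventually_elim
  case (elim z)
  obtain t s where z: "z = (t, s)" by (cases z)
  show ?case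
  proof (cases "s < t")
   case True
   have "1 - exp (- a*(t - s)) <= a*(t - s)" using exp_ge_add_one_self[of "- a*(t - s)"] by simp
   also have "... <= a*1" using a elim z by (intro mult_left_mono) auto
   finally have "kern \<beta> t s*(1 - exp (- a*(t - s))) <= kern \<beta> t s*a" by (intro mult_left_mono) (auto simp: kern_def)
   moreover have "0 <= 1 - exp (- a*(t - s))" using a True by simp
   ultimately show ?thesis using True by (simp add: z abs_mult kern_def mult.commute)
  qed (simp add: z kern_def)
 qed
 show "(%(t, s). kern \<beta> t s*(1 - exp (- a*(t - s)))) : sqi P2" by (rule sqi_bound[OF s m le])
 have "nm P2 (%(t, s). kern \<beta> t s*(1 - exp (- a*(t - s)))) <= \<bar>a\<bar>*nm P2 (%(t, s). kern \<beta> t s)"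
  using nm_mono[OF s le] unfolding nm_cmult .
 also have "... <= a * sqrt (1/(2*\<beta> - 1))" using a kern_sqi(2)[OF b] by (simp add: mult_left_mono)
 finally show "nm P2 (%(t, s). kern \<beta> t s*(1 - exp (- a*(t - s)))) <= a * sqrt (1/(2*\<beta> - 1))" .
qed

lemma P2_bounded:
 assumes "(%(t, s). G t s) : borel_measurable P2" "\<And>t s. 0 < t ==> t < 1 ==> 0 < s ==> s < 1 ==> \<bar>G t s\<bar> <= c"
 shows "(%(t, s). G t s) : sqi P2" "0 <= c ==> nm P2 (%(t, s). G t s) <= c"
proof -
 have cs: "(%z. c) : sqi P2" by (rule sqi_bounded[OF P2.finite_measure_axioms, of _ "\<bar>c\<bar>"]) auto
 have le: "AE z in P2. \<bar>case z of (t, s) => G t s\<bar> <= c"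
  using AE_P2 by eventually_elim (use assms(2) in \<open>auto simp: case_prod_unfold\<close>)
 show "(%(t, s). G t s) : sqi P2" by (rule sqi_bound[OF cs assms(1) le])
 show "nm P2 (%(t, s). G t s) <= c" if "0 <= c"
  using nm_mono[OF cs le] that by (simp add: nm_const[OF prob_space_P2])
qed

text \<open>The kernel is split into a diagonal part with step functions in s, a part of rank r and a remainder
 of norm at most \<open>\<epsilon>\<close>.\<close>

locale rl_split =
 fixes \<beta> \<epsilon> L :: real and m N r :: nat and \<theta> \<mu> :: "nat => real" and b :: "nat => real => real" and v :: "nat => nat => real"
 assumes \<beta>: "\<beta> > 1/2" and mN: "m + 2 < N"
  and \<mu>: "\<And>j. j < m ==> Gamma \<beta>/pi powr \<beta>*real (j + 3) powr (- \<beta>) <= \<mu> j"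
   "\<And>j. j < m ==> \<mu> j <= Gamma \<beta>/pi powr \<beta>*real (j + 1) powr (- \<beta>)"
  and b: "\<And>i. i < r ==> b i : borel_measurable borel" "\<And>i t. i < r ==> \<bar>b i t\<bar> <= 3"
  and v: "\<And>i x. i < r ==> x < N ==> \<bar>v i x\<bar> <= L" and L0: "L >= 0"
  and res: "(%(t, s). kern \<beta> t s - ((\<Sum>j<m. \<mu> j*tmode \<theta> j t*tmode (%_. 0) j (real (nat \<lfloor>real N * s\<rfloor>)/N)) + (\<Sum>i<r. b i t * v i (nat \<lfloor>real N * s\<rfloor>)))) : sqi P2"
   "nm P2 (%(t, s). kern \<beta> t s - ((\<Sum>j<m. \<mu> j*tmode \<theta> j t*tmode (%_. 0) j (real (nat \<lfloor>real N * s\<rfloor>)/N)) + (\<Sum>i<r. b i t * v i (nat \<lfloor>real N * s\<rfloor>)))) <= \<epsilon>"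

text \<open>Four errors are added: damping \<open>E1\<close>, truncation of the Fourier series
  \<open>E2\<close>, the corner expansion \<open>E3\<close> and sampling in s \<open>E4\<close>.
  With \<open>\<epsilon> = 1/2^(n + 3)\<close> they are at most \<epsilon>, \<epsilon>, 3\<epsilon>
  and \<epsilon>. The number m of modes has no upper bound, since neither the size of the later
  codes nor their rounding error depends on it; it can be forced above any m0.\<close>

theorem kernel_decomposition:
 assumes b: "\<beta> > 1/2"
 shows "\<exists>C::nat. \<forall>n m0. \<exists>m N r \<theta> \<mu> b v. m0 <= m & r <= C*(n + 1)^2 & rl_split \<beta> (1/2^n) (2^(C*(n + 1))) m N r \<theta> \<mu> b v"
proof -
 let ?\<gamma> = "\<beta> - 1"
 obtain q :: nat where q: "\<beta> <= real q" using real_arch_simple by blast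
 obtain A1 where A1: "sqrt (1/(2*\<beta> - 1)) <= 2^A1" using exists_power2 by blast
 obtain A2 where A2: "2^q + 4*exp 1 * fact q*2^q <= (2^A2 :: real)" using exists_power2 by blast
 obtain A3 :: nat where A3: "1 <= real A3*(\<beta> - 1/2)" using b real_arch_simple[of "1/(\<beta> - 1/2)"] by (auto simp: field_simps)
 obtain A5 where A5: "3*gbsum ?\<gamma> <= 2^A5" using exists_power2 by blast
 obtain A8 where A8: "Gamma \<beta> <= 2^A8" using exists_power2 by blast
 define D where "D = 3 + A1"
 define cw where "cw = A2 + D*(q + 1)"
 define cJ where "cJ = A3*D + 2*(cw + 3)"
 define cK where "cK = A5 + cJ + 5"
 define C where "C = 1 + cJ*cK + (A5 + cK + cJ + 2) + (A8 + D*q)"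
 show ?thesis
 proof (rule exI[of _ C], intro allI)
  fix n m0 :: nat
  define \<epsilon> where "\<epsilon> = (1/2^(n + 3) :: real)"
  have \<epsilon>: "\<epsilon> > 0" by (simp add: \<epsilon>_def)
  define a where "a = (1/2^(n + D) :: real)"
  have a: "0 < a" "a <= 1" by (auto simp: a_def)
  have nD: "n + D <= D*(n + 1)" by (simp add: D_def)
  \<comment> \<open>\<open>2^w\<close> bounds the nonsingular part of \<open>psi\<close>. J must
    beat both strip terms, the power with rate 2 powr (- J (\<beta> - 1/2)) and the bounded part
    with rate 2 powr (- J/2); K must beat the size 2^J of \<open>psi\<close> near the corner. All
    three are linear in n, so the rank 1 + J*K is quadratic.\<close>
  define w where "w = A2 + (n + D)*(q + 1)"
  define J where "J = A3*(n + D) + 2*(w + n + 3)"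
  define K where "K = A5 + J + 2 + n + 3"
  have wle: "w <= cw*(n + 1)"
  proof -
   have "(n + D)*(q + 1) <= D*(n + 1)*(q + 1)" using nD by (rule mult_le_mono1)
   then show ?thesis by (simp add: w_def cw_def algebra_simps)
  qed
  have Jle: "J <= cJ*(n + 1)"
  proof -
   have "A3*(n + D) <= A3*(D*(n + 1))" using nD by (rule mult_le_mono2)
   moreover have "w + n + 3 <= cw*(n + 1) + 3*(n + 1)" using wle by simp
   ultimately have "J <= A3*(D*(n + 1)) + 2*(cw*(n + 1) + 3*(n + 1))"
    unfolding J_def by (rule add_mono[OF _ mult_le_mono2])
   also have "... = cJ*(n + 1)" by (simp add: cJ_def algebra_simps)
   finally show ?thesis .
  qed
  have Kle: "K <= cK*(n + 1)" using Jle by (simp add: K_def cK_def algebra_simps)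
  define W where "W = 2^q + psi_tail q a"
  have W: "W <= 2^w"
  proof -
   have "psi_tail q a <= 4*exp 1 * fact q*2^q/a^(q + 1)" by (rule psi_tail_bound(2)[OF a])
   also have "... = 4*exp 1 * fact q*2^q*2^((n + D)*(q + 1))" 
   proof -
    have e: "a^(q + 1) = 1/2^((n + D)*(q + 1))" unfolding a_def power_divide power_mult by simp
    show ?thesis unfolding e by simp
   qed
   finally have 1: "psi_tail q a <= 4*exp 1 * fact q*2^q*2^((n + D)*(q + 1))" .
   have "(1::real) <= 2^((n + D)*(q + 1))" by simp
   then have "2^q*1 <= 2^q*(2^((n + D)*(q + 1)) :: real)" by (intro mult_left_mono) auto
   then have "W <= (2^q + 4*exp 1 * fact q*2^q)*2^((n + D)*(q + 1))" using 1 unfolding W_def distrib_right by linarith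
   also have "... <= 2^A2*2^((n + D)*(q + 1))" using A2 by (intro mult_right_mono) auto
   finally show ?thesis by (simp add: w_def power_add)
  qed
  have WJ: "2^(J + 1) + W <= 2^(J + 2)"
  proof -
   have "(2::real)^w <= 2^(J + 1)" by (rule power_increasing) (auto simp: J_def)
   then show ?thesis using W by simp
  qed
  have e1: "3*gbsum ?\<gamma>/2^K*(2^(J + 1) + 2^q + psi_tail q a) <= \<epsilon>"
  proof -
   have "3*gbsum ?\<gamma>/2^K*(2^(J + 1) + W) <= 2^A5/2^K*2^(J + 2)"
    using A5 WJ gbsum_ge_1[of ?\<gamma>] psi_tail_bound(1)[OF a, of q]
    by (intro mult_mono divide_right_mono) (auto simp: W_def psi_tail_def intro!: add_nonneg_nonneg suminf_nonneg)
   also have "... = \<epsilon>" by (simp add: K_def \<epsilon>_def power_add)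
   finally show ?thesis by (simp add: W_def add.assoc)
  qed
  have e2: "sqrt ((1/2^J) powr (2*\<beta> - 1)/(2*\<beta> - 1)) <= \<epsilon>"
  proof -
   have "sqrt ((1/2^J) powr (2*\<beta> - 1)) = (1/2^J) powr (\<beta> - 1/2)"
    by (simp add: powr_half_sqrt[symmetric] powr_powr field_simps)
   also have "... = 2 powr (- (real J*(\<beta> - 1/2)))"
    by (simp add: powr_realpow[symmetric] powr_minus_divide[symmetric] powr_powr)
   also have "... <= 2 powr (- real (n + D))"
   proof -
    have "real (n + D)*1 <= real (n + D)*(real A3*(\<beta> - 1/2))" using A3 by (intro mult_left_mono) auto
    also have "... = real (A3*(n + D))*(\<beta> - 1/2)" by simp
    also have "... <= real J*(\<beta> - 1/2)" using b by (intro mult_right_mono) (auto simp: J_def simp del: of_nat_add of_nat_mult)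
    finally show ?thesis by simp
   qed
   also have "... = 1/2^(n + D)" by (simp only: powr_minus_divide powr_realpow zero_less_numeral)
   finally have "sqrt ((1/2^J) powr (2*\<beta> - 1)) * sqrt (1/(2*\<beta> - 1)) <= 1/2^(n + D)*2^A1"
    using A1 b by (intro mult_mono) auto
   also have "... = \<epsilon>" by (simp add: D_def \<epsilon>_def power_add)
   finally show ?thesis by (simp add: real_sqrt_mult[symmetric])
  qed
  have e3: "(2^q + psi_tail q a) * sqrt (1/2^J) <= \<epsilon>"
  proof -
   have "1/2^J <= (1/2^(w + n + 3) :: real)^2"
   proof -
    have "2^(2*(w + n + 3)) <= (2^J :: real)" by (rule power_increasing) (auto simp: J_def)
    then have "1/2^J <= (1/2^(2*(w + n + 3)) :: real)" by (intro divide_left_mono) auto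
    also have "... = (1/2^(w + n + 3) :: real)^2" by (simp add: power_divide power_mult[symmetric] mult.commute)
    finally show ?thesis .
   qed
   then have "sqrt (1/2^J) <= 1/2^(w + n + 3)" by (intro real_le_lsqrt) auto
   then have "W * sqrt (1/2^J) <= 2^w*(1/2^(w + n + 3))" using W by (intro mult_mono) auto
   also have "... = \<epsilon>" by (simp add: \<epsilon>_def power_add)
   finally show ?thesis by (simp add: W_def)
  qed
  have e4: "a * sqrt (1/(2*\<beta> - 1)) <= \<epsilon>"
  proof -
   have "a * sqrt (1/(2*\<beta> - 1)) <= a*2^A1" using A1 a by (intro mult_left_mono) auto
   also have "... = \<epsilon>" by (simp add: a_def D_def \<epsilon>_def power_add)
   finally show ?thesis .
  qed
  define \<nu> where "\<nu> k = Gamma \<beta>*(a^2 + (2*pi*real k)^2) powr (- \<beta>/2)" for k :: nat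
  obtain \<theta> where \<theta>: "\<And>e. e > 0 ==> \<exists>n0. \<forall>n\<ge>n0.
   nm I01 (%x. psi ?\<gamma> a x - (\<nu> 0 + (\<Sum>k<n. \<nu> (k + 1)*(2*cos (2*pi*real (k + 1)*x - \<theta> (k + 1)))))) < e"
   using psi_fourier_series[OF b a] unfolding \<nu>_def by blast
  obtain n0 where n0: "\<And>n. n >= n0 ==> nm I01 (%x. psi ?\<gamma> a x - (\<nu> 0 + (\<Sum>k<n. \<nu> (k + 1)*(2*cos (2*pi*real (k + 1)*x - \<theta> (k + 1)))))) < \<epsilon>"
   using \<theta>[OF \<epsilon>] by blast
  define M where "M = max n0 m0"
  define S where "S x = \<nu> 0 + (\<Sum>k<M. \<nu> (k + 1)*(2*cos (2*pi*real (k + 1)*x - \<theta> (k + 1))))" for x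
  have nS: "nm I01 (%x. psi ?\<gamma> a x - S x) <= \<epsilon>" using n0[of M] by (simp add: M_def S_def less_imp_le)
  define m where "m = 2*M"
  define \<mu> where "\<mu> j = \<nu> (j div 2 + 1)" for j
  have Sts: "S (t - s) = \<nu> 0 + (\<Sum>j<m. \<mu> j*tmode \<theta> j t*tmode (%_. 0) j s)" for t s
  proof -
   have "(\<Sum>j<m. \<mu> j*tmode \<theta> j t*tmode (%_. 0) j s) = (\<Sum>k<M. \<nu> (k + 1)*(tmode \<theta> (2*k) t*tmode (%_. 0) (2*k) s + tmode \<theta> (2*k + 1) t*tmode (%_. 0) (2*k + 1) s))"
    unfolding m_def sum_pairs by (intro sum.cong refl) (simp add: \<mu>_def distrib_left mult.assoc)
   then show ?thesis unfolding tmode_pair S_def by simp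
  qed
  have Sper: "S (x + 1) = S x" for x
  proof -
   have "cos (2*pi*real (k + 1)*(x + 1) - \<phi>) = cos (2*pi*real (k + 1)*x - \<phi>)" for k \<phi>
   proof -
    have "2*pi*real (k + 1)*(x + 1) - \<phi> = (2*pi*real (k + 1)*x - \<phi>) + 2*pi*real_of_int (int (k + 1))"
     by (simp add: algebra_simps)
    then show ?thesis using cos_int_2pin[of "int (k + 1)"] sin_int_2pin[of "int (k + 1)"] by (simp only: cos_add)
   qed
   then show ?thesis by (simp add: S_def)
  qed
  have Sm [measurable]: "S : borel_measurable borel" unfolding S_def[abs_def] by measurable
  have c0: "(%x. \<nu> 0) : sqi I01" by (rule sqi_I01_bounded[where C = "\<bar>\<nu> 0\<bar>"]) auto
  have Ss: "S : sqi I01"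
   unfolding S_def[abs_def] by (intro sqi_add sqi_sum sqi_cmult c0) (auto intro!: sqi_I01_bounded[where C = 1])
  have gs: "(%x. psi ?\<gamma> a x - S x) : sqi I01" using b by (intro sqi_diff psi_sqi a Ss) auto
  have gm: "(%x. psi ?\<gamma> a x - S x) : borel_measurable borel" by measurable
  define E2 where "E2 t s = (if s < t then psi ?\<gamma> a (t - s) - S (t - s) else psi ?\<gamma> a (t - s + 1) - S (t - s + 1))" for t s
  have E2: "(%(t, s). E2 t s) : sqi P2" "nm P2 (%(t, s). E2 t s) <= \<epsilon>"
   using periodic_kernel[OF gm gs] nS by (auto simp: E2_def)
  define E1 where "E1 t s = kern \<beta> t s*(1 - exp (- a*(t - s)))" for t s
  have E1: "(%(t, s). E1 t s) : sqi P2" "nm P2 (%(t, s). E1 t s) <= \<epsilon>"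
   using damping_error[OF b a(1)] e4 by (auto simp: E1_def)
  define E3 where "E3 t s = psi ?\<gamma> a (1 + t - s) - (\<Sum>i<J. \<Sum>p<K. dyb a i p t*cellv ?\<gamma> a (centre i) p (1 - s))" for t s
  have E3: "(%(t, s). E3 t s) : sqi P2" "nm P2 (%(t, s). E3 t s) <= 3*\<epsilon>"
   using dyadic_rank_approx[OF b q a, where J = J and K = K] e1 e2 e3 by (auto simp: E3_def)
  define r where "r = 1 + J*K"
  \<comment> \<open>Index 0 is the constant mode, whose coefficient \<open>\<nu> 0\<close> has the
    order a powr (- \<beta>) and is too large for the diagonal part. Index i >= 1 stands for the
    cell (i - 1) div K and the order (i - 1) mod K.\<close>
  define bb where "bb i t = (if i = 0 then 1 else dyb a ((i - 1) div K) ((i - 1) mod K) t)" for i t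
  define V where "V i s = (if i = 0 then \<nu> 0 else - cellv ?\<gamma> a (centre ((i - 1) div K)) ((i - 1) mod K) (1 - s))" for i s
  have K0: "K > 0" by (simp add: K_def)
  have sum_r: "(\<Sum>i<r. bb i t*V i s) = \<nu> 0 - (\<Sum>i<J. \<Sum>p<K. dyb a i p t*cellv ?\<gamma> a (centre i) p (1 - s))" for t s
  proof -
   have "(\<Sum>i<r. bb i t*V i s) = bb 0 t*V 0 s + (\<Sum>i<J*K. bb (Suc i) t*V (Suc i) s)"
    unfolding r_def by (simp only: plus_1_eq_Suc sum.lessThan_Suc_shift)
   also have "(\<Sum>i<J*K. bb (Suc i) t*V (Suc i) s) = (\<Sum>i<J. \<Sum>p<K. - (dyb a i p t*cellv ?\<gamma> a (centre i) p (1 - s)))"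
    unfolding sum_blocks using K0 by (intro sum.cong refl) (simp add: bb_def V_def)
   finally show ?thesis by (simp add: bb_def V_def sum_negf)
  qed
  \<comment> \<open>For s < t, subtracting the shift by one period recovers the damped power, by
    \<open>psi_split\<close>. For t < s the periodic extension and the subtracted \<open>psi\<close>
    cancel, and periodicity of \<open>S\<close> matches the two branches.\<close>
  have kern_eq: "kern \<beta> t s = S (t - s) + E2 t s - psi ?\<gamma> a (1 + t - s) + E1 t s"
   if ts: "0 < t" "t < 1" "0 < s" "s < 1" "t ~= s" for t s
  proof (cases "s < t")
   case True
   have "psi ?\<gamma> a (t - s) = (t - s) powr ?\<gamma>*exp (- a*(t - s)) + psi ?\<gamma> a (t - s + 1)"
    using True ts a by (intro psi_split) auto
   moreover have "t - s + 1 = 1 + t - s" by simp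
   ultimately show ?thesis using True by (simp add: E2_def E1_def kern_def algebra_simps)
  next
   case False
   have e: "t - s + 1 = 1 + t - s" by simp
   show ?thesis using False Sper[of "t - s"] unfolding E2_def E1_def kern_def e by simp
  qed
  \<comment> \<open>Bounds the total of the t-factors, 2 for a mode and 3 for a rank-one term, so
    that a modulus of continuity \<epsilon>/\<Lambda> of the s-factors keeps \<open>E4\<close> below
    \<epsilon>.\<close>
  define \<Lambda> where "\<Lambda> = (\<Sum>j<m. \<bar>\<mu> j\<bar>*2) + 3*real r"
  have L0: "\<Lambda> > 0" unfolding \<Lambda>_def r_def by (intro add_nonneg_pos sum_nonneg) (auto intro!: add_pos_nonneg)
  define \<eta> where "\<eta> = \<epsilon>/\<Lambda>"
  have \<eta>: "\<eta> > 0" using \<epsilon> L0 by (simp add: \<eta>_def)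
  have contV: "continuous_on {0..1} (V i)" for i
  proof (cases "i = 0")
   case False
   define c where "c = centre ((i - 1) div K)"
   define p where "p = (i - 1) mod K"
   have "continuous_on {0..1} (%s. psi (?\<gamma> - p) a (c + (1 - s)))"
    using centre_bounds[of "(i - 1) div K"]
    by (intro continuous_on_compose2[OF psi_continuous[OF a]] continuous_intros) (auto simp: c_def)
   then show ?thesis using False by (simp add: V_def[abs_def] cellv_def c_def p_def continuous_intros)
  qed (simp add: V_def[abs_def])
  have contt: "continuous_on {0..1} (tmode (%_. 0) j)" for j unfolding tmode_def[abs_def] by (intro continuous_intros)
  obtain N1 where N1: "N1 > 0" "\<And>N j s s'. N >= N1 ==> j < m ==> s : {0..1} ==> s' : {0..1} ==> \<bar>s - s'\<bar> <= 1/real N ==> \<bar>tmode (%_. 0) j s - tmode (%_. 0) j s'\<bar> <= \<eta>"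
   using uniform_grid_modulus[of m "tmode (%_. 0)" \<eta>] contt \<eta> by metis
  obtain N2 where N2: "N2 > 0" "\<And>N j s s'. N >= N2 ==> j < r ==> s : {0..1} ==> s' : {0..1} ==> \<bar>s - s'\<bar> <= 1/real N ==> \<bar>V j s - V j s'\<bar> <= \<eta>"
   using uniform_grid_modulus[of r V \<eta>] contV \<eta> by metis
  define N where "N = max (max N1 N2) (m + 3)"
  have N: "N >= N1" "N >= N2" "m + 2 < N" "N > 0" by (auto simp: N_def)
  define v where "v i x = V i (real x/N)" for i and x :: nat
  define \<phi> where "\<phi> s = real (nat \<lfloor>N * s\<rfloor>)/N" for s :: real
  have \<phi>m [measurable]: "\<phi> : borel_measurable borel" unfolding \<phi>_def[abs_def] by measurable
  have \<phi>: "\<phi> s : {0..1}" "\<bar>s - \<phi> s\<bar> <= 1/N" if "0 < s" "s < 1" for s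
  proof -
   have Ns: "0 <= N * s" "N * s < N" using that N(4) by auto
   define k where "k = nat \<lfloor>N * s\<rfloor>"
   have k: "real k <= N * s" "N * s <= real k + 1" using Ns unfolding k_def by linarith+
   have \<phi>k: "\<phi> s = real k/N" by (simp add: \<phi>_def k_def)
   have "real k <= N" using k Ns by linarith
   then show "\<phi> s : {0..1}" using N(4) unfolding \<phi>k by simp
   have "s - \<phi> s = (N * s - real k)/N" using N(4) unfolding \<phi>k by (simp add: field_simps)
   moreover have "\<bar>(N * s - real k)/N\<bar> <= 1/N" using k N(4) unfolding abs_divide by (intro frac_le) auto
   ultimately show "\<bar>s - \<phi> s\<bar> <= 1/N" by simp
  qed
  define E4 where "E4 t s = (\<Sum>j<m. \<mu> j*tmode \<theta> j t*(tmode (%_. 0) j s - tmode (%_. 0) j (\<phi> s))) + (\<Sum>i<r. bb i t*(V i s - V i (\<phi> s)))" for t s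
  have bbm: "bb i : borel_measurable borel" for i unfolding bb_def[abs_def] by (cases "i = 0") auto
  have bb3: "\<bar>bb i t\<bar> <= 3" for i t using dyb_bound[OF a] by (auto simp: bb_def)
  have Vm: "V i : borel_measurable borel" for i
   unfolding V_def[abs_def] cellv_def by (cases "i = 0") auto
  have E4m: "(%(t, s). E4 t s) : borel_measurable P2"
  proof (rule measurable_P2)
   note bbm[measurable] Vm[measurable]
   show "(%(t, s). E4 t s) : borel_measurable (borel \<Otimes>\<^sub>M borel)" unfolding E4_def by measurable
  qed
  have E4b: "\<bar>E4 t s\<bar> <= \<epsilon>" if ts: "0 < t" "t < 1" "0 < s" "s < 1" for t s
  proof -
   have s01: "s : {0..1}" using ts by simp
   have "\<bar>E4 t s\<bar> <= (\<Sum>j<m. \<bar>\<mu> j*tmode \<theta> j t*(tmode (%_. 0) j s - tmode (%_. 0) j (\<phi> s))\<bar>) + (\<Sum>i<r. \<bar>bb i t*(V i s - V i (\<phi> s))\<bar>)"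
    unfolding E4_def by (intro order_trans[OF abs_triangle_ineq] add_mono sum_abs)
   also have "... <= (\<Sum>j<m. \<bar>\<mu> j\<bar>*2*\<eta>) + (\<Sum>i<r. 3*\<eta>)"
   proof (intro add_mono sum_mono)
    fix j assume "j : {..<m}"
    then show "\<bar>\<mu> j*tmode \<theta> j t*(tmode (%_. 0) j s - tmode (%_. 0) j (\<phi> s))\<bar> <= \<bar>\<mu> j\<bar>*2*\<eta>"
     unfolding abs_mult using N1(2)[OF N(1) _ s01 \<phi>[OF ts(3,4)], of j] tmode_bound[of \<theta> j t] by (intro mult_mono) auto
   next
    fix i assume "i : {..<r}"
    then show "\<bar>bb i t*(V i s - V i (\<phi> s))\<bar> <= 3*\<eta>"
     unfolding abs_mult using N2(2)[OF N(2) _ s01 \<phi>[OF ts(3,4)], of i] bb3[of i t] by (intro mult_mono) auto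
   qed
   also have "... = \<Lambda>*\<eta>" unfolding \<Lambda>_def distrib_right sum_distrib_right by simp
   also have "... = \<epsilon>" using L0 by (simp add: \<eta>_def)
   finally show ?thesis .
  qed
  have E4: "(%(t, s). E4 t s) : sqi P2" "nm P2 (%(t, s). E4 t s) <= \<epsilon>"
   using P2_bounded[OF E4m E4b] \<epsilon> by auto
  define R where "R t s = kern \<beta> t s - ((\<Sum>j<m. \<mu> j*tmode \<theta> j t*tmode (%_. 0) j (\<phi> s)) + (\<Sum>i<r. bb i t*V i (\<phi> s)))" for t s
  have Req: "R t s = E1 t s + E2 t s - E3 t s + E4 t s" if ts: "0 < t" "t < 1" "0 < s" "s < 1" "t ~= s" for t s
  proof -
   have "E4 t s = ((\<Sum>j<m. \<mu> j*tmode \<theta> j t*tmode (%_. 0) j s) + (\<Sum>i<r. bb i t*V i s)) -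
     ((\<Sum>j<m. \<mu> j*tmode \<theta> j t*tmode (%_. 0) j (\<phi> s)) + (\<Sum>i<r. bb i t*V i (\<phi> s)))"
    by (simp add: E4_def right_diff_distrib sum_subtractf)
   then show ?thesis unfolding R_def kern_eq[OF ts] Sts sum_r E3_def by simp
  qed
  have Rm: "(%(t, s). R t s) : borel_measurable P2"
  proof (rule measurable_P2)
   note bbm[measurable] Vm[measurable]
   show "(%(t, s). R t s) : borel_measurable (borel \<Otimes>\<^sub>M borel)" unfolding R_def by measurable
  qed
  let ?T = "%z. ((case z of (t, s) => E1 t s) + (case z of (t, s) => E2 t s)) - (case z of (t, s) => E3 t s) + (case z of (t, s) => E4 t s)"
  have Ts: "?T : sqi P2" by (intro sqi_add sqi_diff E1 E2 E3 E4)
  have AE: "AE z in P2. (case z of (t, s) => R t s) = ?T z"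
   using AE_P2 by eventually_elim (use Req in \<open>auto simp: case_prod_unfold\<close>)
  have Rs: "(%(t, s). R t s) : sqi P2"
   using Ts Rm AE unfolding sqi_def by (auto intro!: integrable_cong_AE_imp[of _ "%z. (?T z)^2"] elim: eventually_mono)
  have "nm P2 (%(t, s). R t s) = nm P2 ?T" by (rule nm_cong_AE[OF Rm sqi_measurable[OF Ts] AE])
  also have "... <= nm P2 (%z. ((case z of (t, s) => E1 t s) + (case z of (t, s) => E2 t s)) - (case z of (t, s) => E3 t s)) + nm P2 (%(t, s). E4 t s)"
   by (rule nm_triangle) (intro sqi_add sqi_diff E1 E2 E3 E4)+
  also have "... <= (nm P2 (%z. (case z of (t, s) => E1 t s) + (case z of (t, s) => E2 t s)) + nm P2 (%(t, s). E3 t s)) + nm P2 (%(t, s). E4 t s)"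
   by (intro add_right_mono nm_triangle_diff sqi_add E1 E2 E3)
  also have "... <= ((nm P2 (%(t, s). E1 t s) + nm P2 (%(t, s). E2 t s)) + nm P2 (%(t, s). E3 t s)) + nm P2 (%(t, s). E4 t s)"
   by (intro add_right_mono nm_triangle E1 E2)
  also have "... <= 6*\<epsilon>" using E1 E2 E3 E4 by linarith
  also have "... <= 1/2^n" by (simp add: \<epsilon>_def power_add divide_simps)
  finally have nR: "nm P2 (%(t, s). R t s) <= 1/2^n" .
  have rle: "r <= C*(n + 1)^2"
  proof -
   have "J*K <= (cJ*(n + 1))*(cK*(n + 1))" using Jle Kle by (rule mult_le_mono)
   also have "... = cJ*cK*(n + 1)^2" by (simp only: power2_eq_square mult_ac)
   finally have "r <= 1*(n + 1)^2 + cJ*cK*(n + 1)^2" unfolding r_def by (intro add_mono) auto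
   also have "... <= C*(n + 1)^2" unfolding distrib_right[symmetric] by (rule mult_le_mono1) (simp add: C_def)
   finally show ?thesis .
  qed
  have vb: "\<bar>v i x\<bar> <= 2^(C*(n + 1))" if i: "i < r" and x: "x < N" for i x
  proof (cases "i = 0")
   case True
   have "\<nu> 0 = Gamma \<beta>*a powr (- \<beta>)"
   proof -
    have e: "a^2 = a powr 2" using a by simp
    show ?thesis unfolding \<nu>_def by (simp add: e powr_powr del: powr_numeral)
   qed
   also have "a powr (- \<beta>) = (2^(n + D)) powr \<beta>" by (simp add: a_def powr_minus_divide powr_divide)
   also have "... <= (2^(n + D)) powr real q" using q by (intro powr_mono) auto
   also have "... = 2^((n + D)*q)" by (simp add: powr_realpow power_mult)
   finally have "\<nu> 0 <= Gamma \<beta>*2^((n + D)*q)" using b Gamma_real_pos[of \<beta>] by simp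
   also have "... <= 2^A8*2^((n + D)*q)" using A8 by (intro mult_right_mono) auto
   also have "... = 2^(A8 + (n + D)*q)" by (simp add: power_add)
   also have "... <= 2^(C*(n + 1))"
   proof (rule power_increasing)
    have "(n + D)*q <= D*(n + 1)*q" using nD by (rule mult_le_mono1)
    then have "A8 + (n + D)*q <= A8*(n + 1) + D*(n + 1)*q" by (intro add_mono) auto
    also have "... = (A8 + D*q)*(n + 1)" by (simp add: algebra_simps)
    also have "... <= C*(n + 1)" by (rule mult_le_mono1) (simp add: C_def)
    finally show "A8 + (n + D)*q <= C*(n + 1)" .
   qed simp
   finally have "\<nu> 0 <= 2^(C*(n + 1))" .
   moreover have "0 <= \<nu> 0" using b Gamma_real_pos[of \<beta>] by (simp add: \<nu>_def)
   ultimately show ?thesis using True by (simp add: v_def V_def)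
  next
   case False
   define ii pp where "ii = (i - 1) div K" and "pp = (i - 1) mod K"
   have ii: "ii < J" using i False unfolding ii_def r_def by (simp add: less_mult_imp_div_less)
   have pp: "pp <= K" unfolding pp_def using K0 by (simp add: less_imp_le)
   have x1: "0 <= 1 - real x/N" "1 - real x/N <= 1" using x N(4) by auto
   have "\<bar>v i x\<bar> = \<bar>cellv ?\<gamma> a (centre ii) pp (1 - real x/N)\<bar>" using False by (simp add: v_def V_def ii_def pp_def)
   also have "... <= gbsum ?\<gamma>*2^pp*(1/centre ii + 2^q + psi_tail q a)"
    using centre_bounds[of ii] x1 a b q by (intro cellv_bound) auto
   also have "... <= 2^A5*2^K*2^(J + 2)"
   proof (intro mult_mono)
    show "gbsum ?\<gamma> <= 2^A5" using A5 gbsum_ge_1[of ?\<gamma>] by linarith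
    show "(2::real)^pp <= 2^K" using pp by (intro power_increasing) auto
    have "1/centre ii <= 2^(ii + 2)" by (simp add: centre_def)
    also have "... <= (2^(J + 1) :: real)" using ii by (intro power_increasing) auto
    finally show "1/centre ii + 2^q + psi_tail q a <= 2^(J + 2)" using WJ unfolding W_def by linarith
    show "0 <= 1/centre ii + 2^q + psi_tail q a"
     using centre_bounds[of ii] psi_tail_bound(1)[OF a, of q] by (auto simp: psi_tail_def intro!: add_nonneg_nonneg suminf_nonneg)
   qed (use gbsum_ge_1[of ?\<gamma>] in auto)
   also have "... = 2^(A5 + K + J + 2)" by (simp add: power_add)
   also have "... <= 2^(C*(n + 1))"
   proof (rule power_increasing)
    have "A5 + K + J + 2 <= (A5 + cK + cJ + 2)*(n + 1)" using Jle Kle by (simp add: algebra_simps)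
    also have "... <= C*(n + 1)" by (rule mult_le_mono1) (simp add: C_def)
    finally show "A5 + K + J + 2 <= C*(n + 1)" .
   qed simp
   finally show ?thesis .
  qed
  have mub: "Gamma \<beta>/pi powr \<beta>*real (j + 3) powr (- \<beta>) <= \<mu> j & \<mu> j <= Gamma \<beta>/pi powr \<beta>*real (j + 1) powr (- \<beta>)" for j
   unfolding \<mu>_def \<nu>_def using mode_bounds[of \<beta> a j] b a by simp
  have mm: "m0 <= m" by (simp add: m_def M_def)
  have "rl_split \<beta> (1/2^n) (2^(C*(n + 1))) m N r \<theta> \<mu> bb v"
   by (intro rl_split.intro b N(3) mub[THEN conjunct1] mub[THEN conjunct2] bbm bb3 vb zero_le_power zero_le_numeral
     Rs[unfolded R_def \<phi>_def v_def[symmetric]] nR[unfolded R_def \<phi>_def v_def[symmetric]])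
  then show "\<exists>m N r \<theta> \<mu> b v. m0 <= m & r <= C*(n + 1)^2 & rl_split \<beta> (1/2^n) (2^(C*(n + 1))) m N r \<theta> \<mu> b v"
   using mm rle by blast
 qed
qed

section \<open>Reduction to a diagonal problem\<close>

lemma grid_step_measurable: "(%s. f (nat \<lfloor>real N * s\<rfloor>)) : borel_measurable borel" for f :: "nat => real"
 by (rule measurable_compose[where N = "count_space UNIV" and g = f and f = "%s. nat \<lfloor>real N * s\<rfloor>"]) measurable

lemma grid_step_sqi: "(%s. f (nat \<lfloor>real N * s\<rfloor>)) : sqi I01" for f :: "nat => real"
proof (rule sqi_bounded[of _ _ "\<Sum>x\<le>N. \<bar>f x\<bar>"])
 fix s assume "s : space I01"
 then have "real N * s <= real N" by (simp add: space_I01 mult_left_le)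
 then have "\<lfloor>real N * s\<rfloor> <= int N" by linarith
 then have "nat \<lfloor>real N * s\<rfloor> : {..N}" by simp
 then show "\<bar>f (nat \<lfloor>real N * s\<rfloor>)\<bar> <= (\<Sum>x\<le>N. \<bar>f x\<bar>)" by (rule member_le_sum) auto
qed (auto intro: borel_measurable_I01 grid_step_measurable I01.finite_measure_axioms)

lemma grid_step_integral:
 fixes f :: "nat => real"
 assumes N: "N > 0"
 shows "(LINT s|I01. f (nat \<lfloor>real N * s\<rfloor>)) = (\<Sum>x<N. f x)/N"
proof -
 let ?I = "%x. {real x/N..<real (Suc x)/N}"
 have "(LINT s|I01. f (nat \<lfloor>real N * s\<rfloor>)) = (LINT s|I01. (\<Sum>x<N. f x*indicator (?I x) s))"
 proof (rule integral_cong_AE)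
  show "(%s. f (nat \<lfloor>real N * s\<rfloor>)) : borel_measurable I01" by (rule borel_measurable_I01[OF grid_step_measurable])
  show "(%s. \<Sum>x<N. f x*indicator (?I x) s) : borel_measurable I01" by (rule borel_measurable_I01) measurable
  show "AE s in I01. f (nat \<lfloor>real N * s\<rfloor>) = (\<Sum>x<N. f x*indicator (?I x) s)"
   using AE_I01_pos
  proof eventually_elim
   case (elim s)
   have Ns: "0 <= real N * s" "real N * s < real N" using elim N by auto
   define k where "k = nat \<lfloor>real N * s\<rfloor>"
   have k: "real k <= real N * s" "real N * s < real k + 1" using Ns unfolding k_def by linarith+
   have kN: "k < N" using k Ns by linarith
   have ind: "indicator (?I x) s = (if x = k then 1 else (0::real))" for x
   proof -
    have "s : ?I x \<longleftrightarrow> real x <= real N * s & real N * s < real x + 1"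
     using N by (simp add: divide_le_eq less_divide_eq mult.commute add.commute)
    also have "... \<longleftrightarrow> x = k" using k by auto
    finally show ?thesis by (simp add: indicator_def)
   qed
   have "(\<Sum>x<N. f x*indicator (?I x) s) = (\<Sum>x<N. if x = k then f x else 0)"
    by (rule sum.cong[OF refl]) (simp only: ind, simp)
   then show ?case using kN by (simp add: k_def[symmetric])
  qed
 qed
 also have "... = (\<Sum>x<N. \<integral>s. f x*indicator (?I x) s \<partial>I01)"
 proof (rule Bochner_Integration.integral_sum)
  fix x
  have "integrable I01 (indicator (?I x) :: real => real)"
   by (rule I01.integrable_const_bound[of _ 1]) (auto intro!: borel_measurable_I01 simp: indicator_def)
  then show "integrable I01 (%s. f x*indicator (?I x) s)" by (rule integrable_mult_right)
 qed
 also have "... = (\<Sum>x<N. f x*(LINT s|I01. indicator (?I x) s))" by (simp only: integral_mult_right_zero)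
 also have "... = (\<Sum>x<N. f x*(1/N))"
 proof (rule sum.cong[OF refl])
  fix x assume "x : {..<N}"
  define a b where "a = real x/N" and "b = real (Suc x)/N"
  have x: "0 <= a" "b <= 1" "a <= b" using \<open>x \<in> {..<N}\<close> by (auto simp: a_def b_def divide_simps)
  have "(LINT s|I01. indicator {a..<b} s) = (LINT s|lborel. (indicator {a..<b} s :: real))"
   unfolding I01_def
  proof (subst integral_restrict_space)
   show "(LINT s|lborel. indicator {0..1} s *\<^sub>R (indicator {a..<b} s :: real)) = (LINT s|lborel. indicator {a..<b} s)"
    using x by (intro Bochner_Integration.integral_cong refl) (auto simp: indicator_def)
  qed simp
  also have "... = b - a" using x by simp
  also have "... = 1/N" by (simp add: a_def b_def diff_divide_distrib[symmetric])
  finally have "(LINT s|I01. indicator (?I x) s) = 1/N" unfolding a_def b_def .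
  then show "f x*(LINT s|I01. indicator (?I x) s) = f x*(1/N)" by simp
 qed
 finally show ?thesis by (simp only: sum_divide_distrib mult_1_right times_divide_eq_right)
qed

lemma sqi_pair:
 fixes G :: "'a => 'b => real"
 assumes M: "prob_space M" and N: "prob_space N" and G: "(%(x, y). G x y) : sqi (M \<Otimes>\<^sub>M N)"
 shows "AE x in M. G x : sqi N" "(%x. nm N (G x)) : sqi M"
  "nm M (%x. nm N (G x)) = nm (M \<Otimes>\<^sub>M N) (%(x, y). G x y)"
proof -
 interpret M: prob_space M by fact
 interpret N: prob_space N by fact
 interpret pair_sigma_finite M N ..
 have i: "integrable (M \<Otimes>\<^sub>M N) (%z. (G (fst z) (snd z))^2)" using sqi_integrable[OF G] by (simp add: case_prod_unfold)
 have m: "(%z. G (fst z) (snd z)) : borel_measurable (M \<Otimes>\<^sub>M N)" using sqi_measurable[OF G] by (simp add: case_prod_unfold)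
 show "AE x in M. G x : sqi N"
  using AE_integrable_fst'[OF i] AE_space
 proof eventually_elim
  case (elim x)
  then show ?case using measurable_compose_Pair1[OF elim(2) m] by (intro sqiI) simp_all
 qed
 have nn: "(nm N (G x))^2 = (LINT y|N. (G x y)^2)" for x by (rule nm_sq)
 have i2: "integrable M (%x. (nm N (G x))^2)" unfolding nn using integrable_fst'[OF i] by simp
 have "(%x. nm N (G x)) : borel_measurable M"
  unfolding nm_def using borel_measurable_integrable[OF integrable_fst'[OF i]] by simp
 then show "(%x. nm N (G x)) : sqi M" using i2 by (rule sqiI)
 show "nm M (%x. nm N (G x)) = nm (M \<Otimes>\<^sub>M N) (%(x, y). G x y)"
  using integral_fst'[OF i] unfolding nm_def[of M] nn nm_def[of "M \<Otimes>\<^sub>M N"] by (simp add: case_prod_unfold)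
qed

text \<open>The first variable is integrated first: for the process the estimates hold at each fixed
  time, whereas distances are taken for each fixed outcome.\<close>

lemma sqi_pairI:
 fixes G :: "'a => 'b => real"
 assumes M: "prob_space M" and N: "prob_space N" and m: "(%(x, y). G x y) : borel_measurable (M \<Otimes>\<^sub>M N)"
  and inner: "AE y in N. (\<integral>\<^sup>+x. ennreal ((G x y)^2) \<partial>M) <= ennreal (B y)"
  and outer: "(\<integral>\<^sup>+y. ennreal (B y) \<partial>N) <= ennreal (c^2)" and c: "c >= 0"
 shows "(%(x, y). G x y) : sqi (M \<Otimes>\<^sub>M N)" "nm (M \<Otimes>\<^sub>M N) (%(x, y). G x y) <= c"
proof -
 interpret M: prob_space M by fact
 interpret N: prob_space N by fact
 interpret pair_sigma_finite M N ..
 have m2: "(%z. ennreal ((G (fst z) (snd z))^2)) : borel_measurable (M \<Otimes>\<^sub>M N)" using m by (simp add: case_prod_unfold)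
 have "(\<integral>\<^sup>+z. ennreal ((G (fst z) (snd z))^2) \<partial>(M \<Otimes>\<^sub>M N)) = (\<integral>\<^sup>+y. \<integral>\<^sup>+x. ennreal ((G x y)^2) \<partial>M \<partial>N)"
  using nn_integral_snd[OF m2] by simp
 also have "... <= (\<integral>\<^sup>+y. ennreal (B y) \<partial>N)" by (rule nn_integral_mono_AE[OF inner])
 finally have le: "(\<integral>\<^sup>+z. ennreal ((case z of (x, y) => G x y)^2) \<partial>(M \<Otimes>\<^sub>M N)) <= ennreal (c^2)"
  using outer by (simp add: case_prod_unfold)
 show s: "(%(x, y). G x y) : sqi (M \<Otimes>\<^sub>M N)"
  using m le by (intro sqiI integrableI_bounded) (auto intro: order_le_less_trans simp: case_prod_unfold)
 have "ennreal ((nm (M \<Otimes>\<^sub>M N) (%(x, y). G x y))^2) <= ennreal (c^2)" using le nn_integral_sqi[OF s] by simp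
 then have "(nm (M \<Otimes>\<^sub>M N) (%(x, y). G x y))^2 <= c^2" by simp
 then show "nm (M \<Otimes>\<^sub>M N) (%(x, y). G x y) <= c" using c by (rule power2_le_imp_le)
qed

text \<open>Cauchy-Schwarz in s for almost every t: the operator norm is at most the Hilbert-Schmidt
  norm.\<close>

lemma kernel_operator:
 assumes R: "(%(t, s). R t s) : sqi P2" and h: "h : sqi I01"
 shows "(%t. ip I01 (R t) h) : sqi I01"
  "nm I01 (%t. ip I01 (R t) h) <= nm P2 (%(t, s). R t s)*nm I01 h"
proof -
 note pr = sqi_pair[OF prob_space_I01 prob_space_I01 R]
 have hm: "(%z. h (snd z)) : borel_measurable P2"
  using measurable_compose[OF measurable_snd sqi_measurable[OF h]] .
 have Rm: "(%z. R (fst z) (snd z)) : borel_measurable P2" using sqi_measurable[OF R] by (simp add: case_prod_unfold)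
 have m: "(%t. ip I01 (R t) h) : borel_measurable I01"
  unfolding ip_def using hm Rm
  by (intro I01.borel_measurable_lebesgue_integral) (simp add: case_prod_unfold borel_measurable_times)
 have s: "(%t. nm I01 h*nm I01 (R t)) : sqi I01" by (rule sqi_cmult[OF pr(2)])
 have le: "AE t in I01. \<bar>ip I01 (R t) h\<bar> <= nm I01 h*nm I01 (R t)"
  using pr(1)
 proof eventually_elim
  case (elim t)
  show ?case using ip_le[OF elim h] by (simp only: mult.commute)
 qed
 show "(%t. ip I01 (R t) h) : sqi I01" by (rule sqi_bound[OF s m le])
 have "nm I01 (%t. ip I01 (R t) h) <= nm I01 (%t. nm I01 h*nm I01 (R t))" by (rule nm_mono[OF s le])
 then show "nm I01 (%t. ip I01 (R t) h) <= nm P2 (%(t, s). R t s)*nm I01 h"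
  unfolding nm_cmult pr(3) by (simp add: nm_nonneg mult.commute)
qed

section \<open>The fractional-integral set, its kernel form and distances to codebooks\<close>

lemma nm_I01_cong: "(\<And>t. t : {0..1} ==> f t = g t) ==> nm I01 f = nm I01 g"
 unfolding nm_def by (intro arg_cong[where f = sqrt] Bochner_Integration.integral_cong) (auto simp: space_I01)

lemma sqi_I01_cong: "(\<And>t. t : {0..1} ==> f t = g t) ==> f : sqi I01 \<longleftrightarrow> g : sqi I01"
proof -
 assume eq: "\<And>t. t : {0..1} ==> f t = g t"
 have "f : borel_measurable I01 \<longleftrightarrow> g : borel_measurable I01" by (rule measurable_cong) (use eq in \<open>auto simp: space_I01\<close>)
 moreover have "integrable I01 (%x. (f x)^2) \<longleftrightarrow> integrable I01 (%x. (g x)^2)"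
  by (rule Bochner_Integration.integrable_cong) (use eq in \<open>auto simp: space_I01\<close>)
 ultimately show ?thesis by (simp add: sqi_def)
qed

lemma ip_cmult: "ip M f (%x. c*g x) = c*ip M f g"
 by (simp add: ip_def mult.left_commute[of _ c])

lemma RL_op_kern:
 assumes t: "t : {0..1}"
 shows "RL_op \<beta> g t = ip I01 (kern \<beta> t) (%s. 1/Gamma \<beta>*g s)"
proof -
 have "(LBINT s:{0..t}. (t - s) powr (\<beta> - 1)*g s) = ip I01 (kern \<beta> t) g"
  unfolding set_lebesgue_integral_def ip_def I01_def
 proof (subst integral_restrict_space)
  show "(LINT s|lborel. indicator {0..t} s *\<^sub>R ((t - s) powr (\<beta> - 1)*g s)) = (LINT s|lborel. indicator {0..1} s *\<^sub>R (kern \<beta> t s*g s))"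
   using t by (intro Bochner_Integration.integral_cong refl) (auto simp: indicator_def kern_def)
 qed simp
 then show ?thesis unfolding RL_op_def ip_cmult by simp
qed

text \<open>The radius \<open>Gamma (\<rho> + 1/2)\<close> cancels the normalization in
  \<open>RL_op\<close>, so the set is the image of the unit ball under the bare kernel.\<close>

lemma U_rho_kern:
 assumes r: "\<rho> > 0" and x: "x : U_rho \<rho>"
 shows "\<exists>h. h : L2_01 & nm I01 h <= 1 & (\<forall>t\<in>{0..1}. x t = ip I01 (kern (\<rho> + 1/2) t) h)"
proof -
 obtain g where g: "g : L2_01" "(LBINT t:{0..1}. (g t)^2) <= (Gamma (\<rho> + 1/2))^2" "x = RL_op (\<rho> + 1/2) g"
  using x by (auto simp: U_rho_def)
 have G: "Gamma (\<rho> + 1/2) > 0" using r by (intro Gamma_real_pos) auto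
 have "nm I01 g <= Gamma (\<rho> + 1/2)"
  using g(2) G unfolding L2norm_eq_nm[symmetric] L2norm_def by (intro real_le_lsqrt) auto
 then have "nm I01 (%s. 1/Gamma (\<rho> + 1/2)*g s) <= 1" using G unfolding nm_cmult by (simp add: divide_le_eq)
 moreover have "(%s. 1/Gamma (\<rho> + 1/2)*g s) : L2_01" using g(1) unfolding L2_01_iff by (intro conjI sqi_cmult) auto
 moreover have "x t = ip I01 (kern (\<rho> + 1/2) t) (%s. 1/Gamma (\<rho> + 1/2)*g s)" if "t : {0..1}" for t
  unfolding g(3) by (rule RL_op_kern[OF that])
 ultimately show ?thesis by blast
qed

lemma U_rho_kern_conv:
 assumes r: "\<rho> > 0" and h: "h : L2_01" "nm I01 h <= 1"
 shows "\<exists>x\<in>U_rho \<rho>. \<forall>t\<in>{0..1}. x t = ip I01 (kern (\<rho> + 1/2) t) h"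
proof -
 let ?G = "Gamma (\<rho> + 1/2)"
 have G: "?G > 0" using r by (intro Gamma_real_pos) auto
 define g where "g s = ?G*h s" for s
 have gL: "g : L2_01" using h(1) unfolding L2_01_iff g_def by (auto intro: sqi_cmult)
 have "nm I01 g = ?G*nm I01 h" unfolding g_def nm_cmult using G by simp
 also have "... <= ?G*1" using G h(2) by (intro mult_left_mono) auto
 finally have "(L2norm g)^2 <= ?G^2" unfolding L2norm_eq_nm by (intro power_mono nm_nonneg) simp
 then have le: "(LBINT t:{0..1}. (g t)^2) <= ?G^2"
  unfolding L2norm_def by (simp add: set_lebesgue_integral_def)
 have "RL_op (\<rho> + 1/2) g : U_rho \<rho>" unfolding U_rho_def using gL le by blast
 moreover have "RL_op (\<rho> + 1/2) g t = ip I01 (kern (\<rho> + 1/2) t) h" if "t : {0..1}" for t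
  unfolding RL_op_kern[OF that] using G by (simp add: g_def)
 ultimately show ?thesis by blast
qed

lemma U_rho_bounded:
 assumes r: "\<rho> > 0" and x: "x : U_rho \<rho>"
 shows "x : sqi I01" "nm I01 x <= sqrt (1/(2*\<rho>))"
proof -
 obtain h where h: "h : L2_01" "nm I01 h <= 1" "\<And>t. t : {0..1} ==> x t = ip I01 (kern (\<rho> + 1/2) t) h"
  using U_rho_kern[OF assms] by blast
 have b: "\<rho> + 1/2 > 1/2" using r by simp
 have hs: "h : sqi I01" using h(1) by (simp add: L2_01_iff)
 note op = kernel_operator[OF kern_sqi(1)[OF b] hs]
 show "x : sqi I01" using op(1) sqi_I01_cong[OF h(3)] by simp
 have "nm I01 x = nm I01 (%t. ip I01 (kern (\<rho> + 1/2) t) h)" by (rule nm_I01_cong[OF h(3)])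
 also have "... <= nm P2 (%(t, s). kern (\<rho> + 1/2) t s)*nm I01 h" by (rule op(2))
 also have "... <= sqrt (1/(2*\<rho>))*1" using kern_sqi(2)[OF b] h(2) r by (intro mult_mono) (auto simp: nm_nonneg)
 finally show "nm I01 x <= sqrt (1/(2*\<rho>))" by simp
qed

lemma dist_to_le: "finite \<alpha> ==> a : \<alpha> ==> dist_to \<alpha> x <= nm I01 (%t. x t - a t)"
 unfolding dist_to_def L2norm_eq_nm by (rule Min_le) auto

lemma dist_to_attained: "finite \<alpha> ==> \<alpha> ~= {} ==> \<exists>a\<in>\<alpha>. dist_to \<alpha> x = nm I01 (%t. x t - a t)"
 unfolding dist_to_def L2norm_eq_nm using Min_in[of "(%a. nm I01 (%t. x t - a t)) ` \<alpha>"] by fastforce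

lemma dist_to_nonneg: "finite \<alpha> ==> \<alpha> ~= {} ==> 0 <= dist_to \<alpha> x"
 using dist_to_attained[of \<alpha> x] nm_nonneg by metis

lemma U_rho_nonempty: "\<rho> > 0 ==> U_rho \<rho> ~= {}"
 using U_rho_kern_conv[of \<rho> "%_. 0"] by (auto simp: L2_01_iff sqi_zero nm_def)

lemma dist_to_U_rho_bdd:
 assumes r: "\<rho> > 0" and a: "\<alpha> : codebooks n"
 shows "bdd_above (dist_to \<alpha> ` U_rho \<rho>)"
proof -
 obtain a where "finite \<alpha>" "a : \<alpha>" "\<alpha> \<subseteq> L2_01" using a by (auto simp: codebooks_def)
 then have a: "finite \<alpha>" "a : \<alpha>" "a : sqi I01" using L2_01_iff[of a] by auto
 show ?thesis
 proof (rule bdd_aboveI2)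
  fix x assume x: "x : U_rho \<rho>"
  have "dist_to \<alpha> x <= nm I01 (%t. x t - a t)" using a by (intro dist_to_le)
  also have "... <= nm I01 x + nm I01 a" by (intro nm_triangle_diff U_rho_bounded[OF r x] a)
  finally show "dist_to \<alpha> x <= sqrt (1/(2*\<rho>)) + nm I01 a" using U_rho_bounded(2)[OF r x] by linarith
 qed
qed

lemma entropy_number_le:
 assumes r: "\<rho> > 0" and a: "\<alpha> : codebooks n" and e: "\<And>x. x : U_rho \<rho> ==> dist_to \<alpha> x <= e"
 shows "entropy_number (U_rho \<rho>) n <= e"
proof -
 obtain x0 where x0: "x0 : U_rho \<rho>" using U_rho_nonempty[OF r] by blast
 have "bdd_below ((%\<alpha>. SUP x\<in>U_rho \<rho>. dist_to \<alpha> x) ` codebooks n)"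
 proof (rule bdd_belowI2)
  fix \<gamma> assume g: "\<gamma> : codebooks n"
  have "0 <= dist_to \<gamma> x0" using g by (intro dist_to_nonneg) (auto simp: codebooks_def)
  also have "... <= (SUP x\<in>U_rho \<rho>. dist_to \<gamma> x)" by (rule cSUP_upper[OF x0 dist_to_U_rho_bdd[OF r g]])
  finally show "0 <= (SUP x\<in>U_rho \<rho>. dist_to \<gamma> x)" .
 qed
 then have "entropy_number (U_rho \<rho>) n <= (SUP x\<in>U_rho \<rho>. dist_to \<alpha> x)"
  unfolding entropy_number_def using a by (rule cINF_lower)
 also have "... <= e" by (rule cSUP_least[OF U_rho_nonempty[OF r] e])
 finally show ?thesis .
qed

lemma codebooks_nonempty: "n >= 1 ==> codebooks n ~= {}"
proof -
 assume "n >= 1"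
 then have "{%_. 0} : codebooks n" by (auto simp: codebooks_def L2_01_iff sqi_zero)
 then show ?thesis by blast
qed

lemma le_entropy_number:
 assumes r: "\<rho> > 0" and n: "n >= 1"
  and e: "\<And>\<alpha> s. \<alpha> : codebooks n ==> 0 <= s ==> (\<And>x. x : U_rho \<rho> ==> dist_to \<alpha> x <= s) ==> e <= s"
 shows "e <= entropy_number (U_rho \<rho>) n"
 unfolding entropy_number_def
proof (rule cINF_greatest[OF codebooks_nonempty[OF n]])
 fix \<alpha> assume a: "\<alpha> : codebooks n"
 obtain x0 where x0: "x0 : U_rho \<rho>" using U_rho_nonempty[OF r] by blast
 note up = cSUP_upper[OF _ dist_to_U_rho_bdd[OF r a]]
 have "0 <= dist_to \<alpha> x0" using a by (intro dist_to_nonneg) (auto simp: codebooks_def)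
 then have "0 <= (SUP x\<in>U_rho \<rho>. dist_to \<alpha> x)" using up[OF x0] by linarith
 from e[OF a this up] show "e <= (SUP x\<in>U_rho \<rho>. dist_to \<alpha> x)" .
qed

lemma quant_error_le:
 assumes "\<alpha> : codebooks n" "nm M (%\<omega>. dist_to \<alpha> (X \<omega>)) <= e"
 shows "quant_error M X n <= e"
proof -
 have "bdd_below ((%\<alpha>. nm M (%\<omega>. dist_to \<alpha> (X \<omega>))) ` codebooks n)" by (rule bdd_belowI2[of _ 0]) (rule nm_nonneg)
 then have "quant_error M X n <= nm M (%\<omega>. dist_to \<alpha> (X \<omega>))"
  unfolding quant_error_def nm_def using assms(1) by (rule cINF_lower)
 then show ?thesis using assms(2) by linarith
qed

lemma le_quant_error:
 assumes "n >= 1" "\<And>\<alpha>. \<alpha> : codebooks n ==> e <= nm M (%\<omega>. dist_to \<alpha> (X \<omega>))"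
 shows "e <= quant_error M X n"
 unfolding quant_error_def using assms(2) unfolding nm_def by (rule cINF_greatest[OF codebooks_nonempty[OF assms(1)]])

context rl_split
begin

text \<open>Sampling at the left grid points makes the s-modes step functions, for which Wiener
  integrals are finite sums. Discrete orthogonality keeps them orthonormal in L2.\<close>

definition \<psi> :: "nat => real => real" where
 "\<psi> j s = tmode (%_. 0) j (real (nat \<lfloor>real N * s\<rfloor>)/N)"

definition vst :: "nat => real => real" where
 "vst i s = v i (nat \<lfloor>real N * s\<rfloor>)"

definition combi :: "(nat => real) => (nat => real) => real => real" where
 "combi y z t = (\<Sum>j<m. \<mu> j*y j*tmode \<theta> j t) + (\<Sum>i<r. z i*b i t)"

definition Res :: "real => real => real" where
 "Res t s = kern \<beta> t s - ((\<Sum>j<m. \<mu> j*tmode \<theta> j t*\<psi> j s) + (\<Sum>i<r. b i t * vst i s))"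

lemma Res: "(%(t, s). Res t s) : sqi P2" "nm P2 (%(t, s). Res t s) <= \<epsilon>"
 using res by (simp_all add: Res_def \<psi>_def vst_def)

lemma eps_nonneg: "\<epsilon> >= 0" using Res(2) nm_nonneg[of P2] order_trans by blast

lemma N_pos: "N > 0" using mN by simp

lemma \<psi>_sqi: "\<psi> j : sqi I01"
 unfolding \<psi>_def[abs_def] by (rule grid_step_sqi[of "%x. tmode (%_. 0) j (real x/N)"])

lemma \<psi>_measurable: "\<psi> j : borel_measurable borel"
 unfolding \<psi>_def[abs_def] by (rule grid_step_measurable[of "%x. tmode (%_. 0) j (real x/N)"])

lemma vst_sqi: "vst i : sqi I01"
 unfolding vst_def[abs_def] by (rule grid_step_sqi)

lemma \<psi>_orthonormal: "orthonormal I01 {..<m} \<psi>"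
 unfolding orthonormal_def
proof (intro conjI ballI)
 fix i j assume "i : {..<m}" "j : {..<m}"
 then show "ip I01 (\<psi> i) (\<psi> j) = (if i = j then 1 else 0)"
  unfolding ip_def \<psi>_def
  using grid_step_integral[OF N_pos, of "%x. tmode (%_. 0) i (real x/N)*tmode (%_. 0) j (real x/N)"]
   tmode_grid_orthonormal[of i m j N "%_. 0"] mN N_pos by simp
qed (rule \<psi>_sqi)

lemma vst_norm: "i < r ==> nm I01 (vst i) <= L"
proof -
 assume i: "i < r"
 have "(LINT s|I01. (vst i s)^2) = (\<Sum>x<N. (v i x)^2)/N"
  unfolding vst_def using grid_step_integral[OF N_pos, of "%x. (v i x)^2"] by simp
 also have "... <= L^2"
 proof -
  have "(\<Sum>x<N. (v i x)^2) <= (\<Sum>x<N. L^2)" using v[OF i] by (intro sum_mono) (metis abs_ge_zero lessThan_iff power2_abs power_mono)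
  then show ?thesis using N_pos by (simp add: divide_le_eq mult.commute)
 qed
 finally show ?thesis unfolding nm_def using L0 by (intro real_le_lsqrt) auto
qed

lemma b_sqi: "i < r ==> b i : sqi I01"
 using b by (intro sqi_I01_bounded[where C = 3]) auto

lemma b_norm: "i < r ==> nm I01 (b i) <= 3"
 using nm_mono[OF sqi_I01_bounded[of "%_. 3" 3], of "b i"] b by (auto simp: nm_const[OF prob_space_I01])

lemma combi_sqi: "combi y z : sqi I01"
 unfolding combi_def[abs_def] by (intro sqi_add sqi_sum sqi_cmult tmode_sqi b_sqi) auto

lemma operator_approx:
 assumes h: "h : sqi I01"
 shows "nm I01 (%t. ip I01 (kern \<beta> t) h - combi (%j. ip I01 h (\<psi> j)) (%i. ip I01 h (vst i)) t) <= \<epsilon>*nm I01 h"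
proof -
 note Ro = kernel_operator[OF Res(1) h]
 have ko: "(%t. ip I01 (kern \<beta> t) h) : sqi I01" by (rule kernel_operator(1)[OF kern_sqi(1)[OF \<beta>] h])
 have "AE t in I01. ip I01 (kern \<beta> t) h - combi (%j. ip I01 h (\<psi> j)) (%i. ip I01 h (vst i)) t = ip I01 (Res t) h"
  using sqi_pair(1)[OF prob_space_I01 prob_space_I01 Res(1)]
   sqi_pair(1)[OF prob_space_I01 prob_space_I01 kern_sqi(1)[OF \<beta>]]
 proof eventually_elim
  case (elim t)
  let ?A = "%s. \<Sum>j<m. (\<mu> j*tmode \<theta> j t)*\<psi> j s" and ?B = "%s. \<Sum>i<r. b i t * vst i s"
  have A: "?A : sqi I01" and B: "?B : sqi I01" by (intro sqi_sum sqi_cmult \<psi>_sqi vst_sqi)+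
  have ipA: "ip I01 ?A h = (\<Sum>j<m. (\<mu> j*tmode \<theta> j t)*ip I01 (\<psi> j) h)" by (rule ip_sum_left[OF \<psi>_sqi h])
  have ipB: "ip I01 ?B h = (\<Sum>i<r. b i t*ip I01 (vst i) h)" by (rule ip_sum_left[OF vst_sqi h])
  have "ip I01 (Res t) h = (LINT s|I01. kern \<beta> t s*h s - (?A s*h s + ?B s*h s))"
   by (simp add: ip_def Res_def algebra_simps)
  also have "... = ip I01 (kern \<beta> t) h - (ip I01 ?A h + ip I01 ?B h)"
   using sqi_mult_integrable[OF elim(2) h] sqi_mult_integrable[OF A h] sqi_mult_integrable[OF B h]
   by (simp add: ip_def)
  finally show ?case unfolding ipA ipB combi_def by (simp add: ip_commute[of I01 h] mult_ac)
 qed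
 then have "nm I01 (%t. ip I01 (kern \<beta> t) h - combi (%j. ip I01 h (\<psi> j)) (%i. ip I01 h (vst i)) t) = nm I01 (%t. ip I01 (Res t) h)"
  by (intro nm_cong_AE sqi_measurable sqi_diff ko combi_sqi Ro(1))
 also have "... <= \<epsilon>*nm I01 h" using Ro(2) Res(2) mult_right_mono[OF Res(2) nm_nonneg[of I01 h]] by linarith
 finally show ?thesis .
qed

lemma U_approx:
 assumes "\<beta> = \<rho> + 1/2" "x : U_rho \<rho>"
 shows "\<exists>y z. (\<Sum>j<m. (y j)^2) <= 1 & (\<forall>i<r. \<bar>z i\<bar> <= L) & nm I01 (%t. x t - combi y z t) <= \<epsilon>"
proof -
 have r: "\<rho> > 0" using \<beta> assms(1) by simp
 obtain h where h: "h : L2_01" "nm I01 h <= 1" "\<And>t. t : {0..1} ==> x t = ip I01 (kern \<beta> t) h"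
  using U_rho_kern[OF r assms(2)] unfolding assms(1)[symmetric] by blast
 have hs: "h : sqi I01" using h(1) by (simp add: L2_01_iff)
 have "(\<Sum>j<m. (ip I01 h (\<psi> j))^2) <= (nm I01 h)^2" by (rule Bessel[OF \<psi>_orthonormal _ hs]) simp
 also have "... <= 1" using h(2) nm_nonneg[of I01 h] by (intro power_le_one)
 finally have 1: "(\<Sum>j<m. (ip I01 h (\<psi> j))^2) <= 1" .
 have 2: "\<bar>ip I01 h (vst i)\<bar> <= L" if "i < r" for i
 proof -
  have "\<bar>ip I01 h (vst i)\<bar> <= nm I01 h*nm I01 (vst i)" by (rule ip_le[OF hs vst_sqi])
  also have "... <= 1*L" using h(2) vst_norm[OF that] by (intro mult_mono nm_nonneg) auto
  finally show ?thesis by simp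
 qed
 have "nm I01 (%t. x t - combi (%j. ip I01 h (\<psi> j)) (%i. ip I01 h (vst i)) t) =
   nm I01 (%t. ip I01 (kern \<beta> t) h - combi (%j. ip I01 h (\<psi> j)) (%i. ip I01 h (vst i)) t)"
  by (rule nm_I01_cong) (simp add: h(3))
 also have "... <= \<epsilon>*nm I01 h" by (rule operator_approx[OF hs])
 also have "... <= \<epsilon>*1" using h(2) eps_nonneg by (rule mult_left_mono)
 finally show ?thesis using 1 2 by (intro exI[of _ "%j. ip I01 h (\<psi> j)"] exI[of _ "%i. ip I01 h (vst i)"]) simp
qed

text \<open>The diagonal coordinates can be prescribed, by taking h in the span of the
  \<open>\<psi> j\<close>. The low-rank coefficients then follow from h and are only known to be
  bounded by \<open>L\<close>, so lower bounds have to code them separately.\<close>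

lemma U_realize:
 assumes "\<beta> = \<rho> + 1/2" and d: "d <= m" and y: "(\<Sum>j<d. (y j)^2) <= 1"
 shows "\<exists>x\<in>U_rho \<rho>. \<exists>z. (\<forall>i<r. \<bar>z i\<bar> <= L) & x : sqi I01 & nm I01 (%t. x t - combi (%j. if j < d then y j else 0) z t) <= \<epsilon>"
proof -
 have r: "\<rho> > 0" using \<beta> assms(1) by simp
 define y' where "y' j = (if j < d then y j else 0)" for j
 define h where "h s = (\<Sum>j<m. y' j*\<psi> j s)" for s
 have hs: "h : sqi I01" unfolding h_def[abs_def] by (intro sqi_sum sqi_cmult \<psi>_sqi)
 have hm: "h : borel_measurable borel" unfolding h_def[abs_def] using \<psi>_measurable by measurable
 have "(\<Sum>j<m. (y' j)^2) = (\<Sum>j<d. (y j)^2)"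
  using d by (intro sum.mono_neutral_cong_right) (auto simp: y'_def)
 moreover have "(nm I01 h)^2 = (\<Sum>j<m. (y' j)^2)"
  unfolding h_def[abs_def] by (rule nm_orthonormal_sum[OF \<psi>_orthonormal]) simp
 ultimately have "(nm I01 h)^2 <= 1^2" using y by simp
 then have h1: "nm I01 h <= 1" by (rule power2_le_imp_le) simp
 have ipy: "ip I01 h (\<psi> k) = y' k" if "k < m" for k
 proof -
  have "ip I01 h (\<psi> k) = (\<Sum>j<m. y' j*ip I01 (\<psi> j) (\<psi> k))" unfolding h_def[abs_def] by (rule ip_sum_left[OF \<psi>_sqi \<psi>_sqi])
  also have "... = (\<Sum>j<m. if j = k then y' k else 0)"
   using \<psi>_orthonormal that by (intro sum.cong refl) (auto simp: orthonormal_def)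
  finally show ?thesis using that by simp
 qed
 obtain x where x: "x : U_rho \<rho>" "\<And>t. t : {0..1} ==> x t = ip I01 (kern \<beta> t) h"
  using U_rho_kern_conv[OF r _ h1] hs hm unfolding L2_01_iff assms(1)[symmetric] by blast
 define z where "z i = ip I01 h (vst i)" for i
 have z: "\<bar>z i\<bar> <= L" if "i < r" for i
 proof -
  have "\<bar>ip I01 h (vst i)\<bar> <= nm I01 h*nm I01 (vst i)" by (rule ip_le[OF hs vst_sqi])
  also have "... <= 1*L" using h1 vst_norm[OF that] by (intro mult_mono nm_nonneg) auto
  finally show ?thesis by (simp add: z_def)
 qed
 have c: "combi y' z t = combi (%j. ip I01 h (\<psi> j)) (%i. ip I01 h (vst i)) t" for t
  unfolding combi_def z_def by (simp add: ipy)
 have "nm I01 (%t. x t - combi y' z t) = nm I01 (%t. ip I01 (kern \<beta> t) h - combi (%j. ip I01 h (\<psi> j)) (%i. ip I01 h (vst i)) t)"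
  by (rule nm_I01_cong) (simp add: x(2) c)
 also have "... <= \<epsilon>*nm I01 h" by (rule operator_approx[OF hs])
 also have "... <= \<epsilon>*1" using h1 eps_nonneg by (rule mult_left_mono)
 finally show ?thesis using x(1) z U_rho_bounded(1)[OF r x(1)] unfolding y'_def by (intro bexI[of _ x] exI[of _ z]) auto
qed

end

lemma grid_product_code:
 fixes H :: real
 assumes H: "H >= 1"
 shows "\<exists>Q::(nat => real) set. finite Q & Q ~= {} & real (card Q) <= (5*H^2)^r &
  (\<forall>z. \<exists>q\<in>Q. \<forall>i<r. \<bar>z i - q i\<bar> <= 1/H + (z i)^2/H)"
proof -
 obtain G where G: "finite G" "G ~= {}" "real (card G) <= 5*H^2" "\<And>z. \<exists>g\<in>G. \<bar>z - g\<bar> <= 1/H + z^2/H"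
  using grid_code[OF H] by blast
 define Q where "Q = PiE {..<r} (%_. G)"
 have "finite Q" "Q ~= {}" "card Q = card G^r"
  using G by (auto simp: Q_def card_PiE PiE_eq_empty_iff intro: finite_PiE)
 moreover have "real (card G)^r <= (5*H^2)^r" using G(3) by (intro power_mono) auto
 moreover have "\<exists>q\<in>Q. \<forall>i<r. \<bar>z i - q i\<bar> <= 1/H + (z i)^2/H" for z
 proof -
  have "\<forall>i. \<exists>g. g : G & \<bar>z i - g\<bar> <= 1/H + (z i)^2/H" using G(4) by blast
  from choice[OF this] obtain g where "\<forall>i. g i : G & \<bar>z i - g i\<bar> <= 1/H + (z i)^2/H" by blast
  then show ?thesis by (intro bexI[of _ "restrict g {..<r}"]) (auto simp: Q_def)
 qed
 ultimately show ?thesis by (intro exI[of _ Q]) auto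
qed

section \<open>The process in Gaussian coordinates\<close>

lemma measurable_process:
 assumes "(%(\<omega>, t). X \<omega> t) : borel_measurable (M \<Otimes>\<^sub>M lborel)"
 shows "(%(\<omega>, t). X \<omega> t) : borel_measurable (M \<Otimes>\<^sub>M I01)"
proof -
 have "(%t. t) : I01 \<rightarrow>\<^sub>M lborel" unfolding I01_def by (rule measurable_restrict_space1) simp
 then have "(%z. (fst z, snd z)) : (M \<Otimes>\<^sub>M I01) \<rightarrow>\<^sub>M (M \<Otimes>\<^sub>M lborel)"
  by (intro measurable_Pair measurable_fst measurable_compose[OF measurable_snd])
 from measurable_compose[OF this assms] show ?thesis by simp
qed

context rl_split
begin

text \<open>The sampled modes integrated against W; they take the place that the inner products with
  h have in the deterministic problem.\<close>

definition gaus :: "(real => 'w => real) => nat => 'w => real" where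
 "gaus W j = wint W N (%x. tmode (%_. 0) j (real x/real N))"

definition zeta :: "(real => 'w => real) => nat => 'w => real" where
 "zeta W i = wint W N (v i)"

lemma gaus_system:
 assumes "std_BM M W" "d <= m"
 shows "gauss_system M d (gaus W)"
 unfolding gaus_def[abs_def]
 by (rule gauss_system_wint[OF assms(1) N_pos], rule tmode_grid_orthonormal[of _ m]) (use assms(2) mN in auto)

lemma gaus_moments:
 assumes BM: "std_BM M W" and j: "j < m"
 shows "gaus W j : sqi M" "(%\<omega>. (gaus W j \<omega>)^2) : sqi M" "(LINT \<omega>|M. (gaus W j \<omega>)^2) = 1"
  "nm M (%\<omega>. (gaus W j \<omega>)^2) = sqrt 3"
proof -
 have "(\<Sum>x<N. (tmode (%_. 0) j (real x/real N))^2)/N = 1"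
  using tmode_grid_orthonormal[OF j j mN, of "%_. 0"] N_pos by (simp add: power2_eq_square)
 then show "gaus W j : sqi M" "(%\<omega>. (gaus W j \<omega>)^2) : sqi M" "(LINT \<omega>|M. (gaus W j \<omega>)^2) = 1"
  "nm M (%\<omega>. (gaus W j \<omega>)^2) = sqrt 3"
  unfolding gaus_def using wint_moments[OF BM N_pos, of "%x. tmode (%_. 0) j (real x/real N)"] by auto
qed

lemma zeta_moments:
 assumes BM: "std_BM M W" and i: "i < r"
 shows "zeta W i : sqi M" "(%\<omega>. (zeta W i \<omega>)^2) : sqi M" "nm M (%\<omega>. (zeta W i \<omega>)^2) <= sqrt 3*L^2"
proof -
 note w = wint_moments[OF BM N_pos, of "v i"]
 show "zeta W i : sqi M" "(%\<omega>. (zeta W i \<omega>)^2) : sqi M" using w by (auto simp: zeta_def)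
 have "(\<Sum>x<N. (v i x)^2) <= (\<Sum>x<N. L^2)" using v[OF i] by (intro sum_mono) (metis abs_ge_zero lessThan_iff power2_abs power_mono)
 then have "(\<Sum>x<N. (v i x)^2)/N <= L^2" using N_pos by (simp add: divide_le_eq mult.commute)
 then have "sqrt 3*((\<Sum>x<N. (v i x)^2)/N) <= sqrt 3*L^2" by (rule mult_left_mono) simp
 then show "nm M (%\<omega>. (zeta W i \<omega>)^2) <= sqrt 3*L^2" using w(4) by (simp add: zeta_def)
qed

text \<open>At a fixed time t, \<open>combi\<close> is the Wiener integral of the step function in s
  that approximates \<open>kern \<beta> t\<close>, so the isometry bounds the mean-square error by
  the norm of \<open>Res t\<close>. Integrating over t gives the norm of the residual
  kernel.\<close>

lemma process_approx:
 assumes BM: "std_BM M W" and X: "RL_process \<rho> M W X" and \<beta>\<rho>: "\<beta> = \<rho> + 1/2"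
 shows "(%(\<omega>, t). X \<omega> t - combi (%j. gaus W j \<omega>) (%i. zeta W i \<omega>) t) : sqi (M \<Otimes>\<^sub>M I01)"
  "nm (M \<Otimes>\<^sub>M I01) (%(\<omega>, t). X \<omega> t - combi (%j. gaus W j \<omega>) (%i. zeta W i \<omega>) t) <= \<epsilon>"
proof -
 let ?Y = "%\<omega>. combi (%j. gaus W j \<omega>) (%i. zeta W i \<omega>)"
 have M: "prob_space M" using BM by (simp add: std_BM_def)
 have Xm: "(%(\<omega>, t). X \<omega> t) : borel_measurable (M \<Otimes>\<^sub>M I01)"
  using X by (intro measurable_process) (simp add: RL_process_def)
 have gm: "(%z. gaus W j (fst z)) : borel_measurable (M \<Otimes>\<^sub>M I01)" if "j < m" for j
  by (rule measurable_compose[OF measurable_fst sqi_measurable[OF gaus_moments(1)[OF BM that]]])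
 have zm: "(%z. zeta W i (fst z)) : borel_measurable (M \<Otimes>\<^sub>M I01)" if "i < r" for i
  by (rule measurable_compose[OF measurable_fst sqi_measurable[OF zeta_moments(1)[OF BM that]]])
 have tm: "(%z. tmode \<theta> j (snd z)) : borel_measurable (M \<Otimes>\<^sub>M I01)" for j
  by (rule measurable_compose[OF measurable_snd borel_measurable_I01[OF tmode_measurable]])
 have bm: "(%z. b i (snd z)) : borel_measurable (M \<Otimes>\<^sub>M I01)" if "i < r" for i
  by (rule measurable_compose[OF measurable_snd borel_measurable_I01[OF b(1)[OF that]]])
 have Ym: "(%z. ?Y (fst z) (snd z)) : borel_measurable (M \<Otimes>\<^sub>M I01)"
  unfolding combi_def
  by (intro borel_measurable_add borel_measurable_sum borel_measurable_times borel_measurable_const gm zm tm bm) auto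
 have m: "(%(\<omega>, t). X \<omega> t - ?Y \<omega> t) : borel_measurable (M \<Otimes>\<^sub>M I01)"
  using borel_measurable_diff[OF Xm Ym] by (simp add: case_prod_unfold)
 have inner: "AE t in I01. (\<integral>\<^sup>+\<omega>. ennreal ((X \<omega> t - ?Y \<omega> t)^2) \<partial>M) <= ennreal ((nm I01 (Res t))^2)"
  using sqi_pair(1)[OF prob_space_I01 prob_space_I01 kern_sqi(1)[OF \<beta>]] AE_space
 proof eventually_elim
  case (elim t)
  then have t: "0 <= t" "t <= 1" by (auto simp: space_I01)
  define vt where "vt x = (\<Sum>j<m. \<mu> j*tmode \<theta> j t*tmode (%_. 0) j (real x/real N)) + (\<Sum>i<r. b i t * v i x)" for x
  have wi: "wiener_integral M W (%s. (t - s) powr (\<rho> - 1/2)) t (%\<omega>. X \<omega> t)"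
   using X t by (simp add: RL_process_def)
  have k: "(%s. if s < t then (t - s) powr (\<rho> - 1/2) else 0) = kern \<beta> t"
   by (simp add: fun_eq_iff kern_def \<beta>\<rho>)
  note ap = wiener_integral_approx[OF BM wi t N_pos, unfolded k, OF elim(1)]
  have "wint W N vt \<omega> = ?Y \<omega> t" for \<omega>
  proof -
   let ?I = "%x. incr W N x \<omega>"
   have "wint W N vt \<omega> = (\<Sum>x<N. \<Sum>j<m. \<mu> j*tmode \<theta> j t*(tmode (%_. 0) j (real x/real N)*?I x)) +
     (\<Sum>x<N. \<Sum>i<r. b i t*(v i x*?I x))"
    by (simp add: wint_def[OF BM] vt_def distrib_right sum_distrib_right sum.distrib mult.assoc)
   also have "(\<Sum>x<N. \<Sum>j<m. \<mu> j*tmode \<theta> j t*(tmode (%_. 0) j (real x/real N)*?I x)) =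
     (\<Sum>j<m. \<mu> j*gaus W j \<omega>*tmode \<theta> j t)"
    by (subst sum.swap) (simp add: gaus_def wint_def[OF BM] sum_distrib_left sum_distrib_right mult_ac)
   also have "(\<Sum>x<N. \<Sum>i<r. b i t*(v i x*?I x)) = (\<Sum>i<r. zeta W i \<omega>*b i t)"
    by (subst sum.swap) (simp add: zeta_def wint_def[OF BM] sum_distrib_left sum_distrib_right mult_ac)
   finally show ?thesis by (simp add: combi_def)
  qed
  note wY = this
  have R: "(%s. (if s < t then (t - s) powr (\<rho> - 1/2) else 0) - vt (nat \<lfloor>real N * s\<rfloor>)) = Res t"
  proof -
   have e: "\<rho> - 1/2 = \<beta> - 1" using \<beta>\<rho> by simp
   show ?thesis unfolding e by (simp add: fun_eq_iff Res_def vt_def \<psi>_def vst_def kern_def)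
  qed
  have s: "(%\<omega>. X \<omega> t - ?Y \<omega> t) : sqi M"
   using sqi_diff[OF ap(1) wint_moments(1)[OF BM N_pos, of vt]] unfolding wY .
  have "nm M (%\<omega>. X \<omega> t - ?Y \<omega> t) <= nm I01 (Res t)" using ap(2)[of vt] unfolding wY R .
  then have "(nm M (%\<omega>. X \<omega> t - ?Y \<omega> t))^2 <= (nm I01 (Res t))^2" by (intro power_mono nm_nonneg)
  then show ?case unfolding nn_integral_sqi[OF s] by (rule ennreal_leI)
 qed
 have outer: "(\<integral>\<^sup>+t. ennreal ((nm I01 (Res t))^2) \<partial>I01) <= ennreal (\<epsilon>^2)"
 proof -
  note pr = sqi_pair[OF prob_space_I01 prob_space_I01 Res(1)]
  have "(nm P2 (%(t, s). Res t s))^2 <= \<epsilon>^2" using Res(2) by (intro power_mono nm_nonneg)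
  then show ?thesis unfolding nn_integral_sqi[OF pr(2)] pr(3) by (rule ennreal_leI)
 qed
 from sqi_pairI[OF M prob_space_I01 m inner outer eps_nonneg]
 show "(%(\<omega>, t). X \<omega> t - ?Y \<omega> t) : sqi (M \<Otimes>\<^sub>M I01)" "nm (M \<Otimes>\<^sub>M I01) (%(\<omega>, t). X \<omega> t - ?Y \<omega> t) <= \<epsilon>" by auto
qed

lemma process_distance:
 assumes BM: "std_BM M W" and X: "RL_process \<rho> M W X" and \<beta>\<rho>: "\<beta> = \<rho> + 1/2"
 defines "\<Delta> \<equiv> %\<omega>. nm I01 (%t. X \<omega> t - combi (%j. gaus W j \<omega>) (%i. zeta W i \<omega>) t)"
 shows "AE \<omega> in M. X \<omega> : sqi I01" "\<Delta> : sqi M" "nm M \<Delta> <= \<epsilon>"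
proof -
 have M: "prob_space M" using BM by (simp add: std_BM_def)
 note pa = process_approx[OF BM X \<beta>\<rho>]
 note pr = sqi_pair[OF M prob_space_I01 pa(1)]
 show "AE \<omega> in M. X \<omega> : sqi I01"
  using pr(1)
 proof eventually_elim
  case (elim \<omega>)
  show ?case using sqi_add[OF elim combi_sqi[of "%j. gaus W j \<omega>" "%i. zeta W i \<omega>"]] by simp
 qed
 show "\<Delta> : sqi M" unfolding \<Delta>_def by (rule pr(2))
 show "nm M \<Delta> <= \<epsilon>" unfolding \<Delta>_def pr(3) by (rule pa(2))
qed

section \<open>Upper bounds for fixed parameters\<close>

lemma \<mu>_pos: "j < m ==> 0 < \<mu> j"
proof -
 assume "j < m"
 have "0 < Gamma \<beta>" using \<beta> by (intro Gamma_real_pos) auto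
 then have "0 < Gamma \<beta>/pi powr \<beta>*real (j + 3) powr (- \<beta>)" by simp
 then show ?thesis using \<mu>(1)[OF \<open>j < m\<close>] by linarith
qed

text \<open>The codebook bound holds for each outcome. In L2 of the outcomes the square root becomes
  exact, because the Gaussian coordinates have unit variance; the quadratic rounding term is bounded
  through fourth moments, whence the factors \<open>sqrt 3\<close>.\<close>

lemma quant_upper:
 assumes BM: "std_BM M W" and X: "RL_process \<rho> M W X" and \<beta>\<rho>: "\<beta> = \<rho> + 1/2"
  and \<alpha>: "\<alpha> : codebooks n" and n1: "n1 <= m" and \<kappa>: "\<kappa> >= 0"
  and code: "\<And>y z. \<exists>a\<in>\<alpha>. nm I01 (%t. combi y z t - a t) <=
   sqrt (E^2*(\<Sum>j<n1. (y j)^2) + (\<Sum>j\<in>{n1..<m}. (\<mu> j*y j)^2)) + \<kappa>*(1 + (\<Sum>j<n1. (y j)^2) + (\<Sum>i<r. (z i)^2))"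
 shows "quant_error M X n <= \<epsilon> + sqrt (E^2*n1 + (\<Sum>j\<in>{n1..<m}. (\<mu> j)^2)) + \<kappa>*(1 + sqrt 3*n1 + sqrt 3*r*L^2)"
proof (rule quant_error_le[OF \<alpha>])
 have M: "prob_space M" using BM by (simp add: std_BM_def)
 define \<Delta> where "\<Delta> \<omega> = nm I01 (%t. X \<omega> t - combi (%j. gaus W j \<omega>) (%i. zeta W i \<omega>) t)" for \<omega>
 note pd = process_distance[OF BM X \<beta>\<rho>, folded \<Delta>_def]
 define T where "T \<omega> = E^2*(\<Sum>j<n1. (gaus W j \<omega>)^2) + (\<Sum>j\<in>{n1..<m}. (\<mu> j)^2*(gaus W j \<omega>)^2)" for \<omega>
 define Q where "Q \<omega> = 1 + (\<Sum>j<n1. (gaus W j \<omega>)^2) + (\<Sum>i<r. (zeta W i \<omega>)^2)" for \<omega>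
 have gi: "integrable M (%\<omega>. (gaus W j \<omega>)^2)" if "j < m" for j using sqi_integrable[OF gaus_moments(1)[OF BM that]] .
 have Ti: "integrable M T" unfolding T_def using gi n1
  by (intro Bochner_Integration.integrable_add integrable_mult_right Bochner_Integration.integrable_sum) auto
 have T0: "T \<omega> >= 0" for \<omega> unfolding T_def by (intro add_nonneg_nonneg mult_nonneg_nonneg sum_nonneg) auto
 have TI: "(LINT \<omega>|M. T \<omega>) = E^2*n1 + (\<Sum>j\<in>{n1..<m}. (\<mu> j)^2)"
 proof -
  have "(LINT \<omega>|M. T \<omega>) = E^2*(\<Sum>j<n1. \<integral>\<omega>. (gaus W j \<omega>)^2 \<partial>M) + (\<Sum>j\<in>{n1..<m}. (\<mu> j)^2*(LINT \<omega>|M. (gaus W j \<omega>)^2))"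
  proof -
   have i1: "integrable M (%\<omega>. E^2*(\<Sum>j<n1. (gaus W j \<omega>)^2))" and i2: "integrable M (%\<omega>. \<Sum>j\<in>{n1..<m}. (\<mu> j)^2*(gaus W j \<omega>)^2)"
    using gi n1 by (auto intro!: integrable_mult_right Bochner_Integration.integrable_sum)
   have "(LINT \<omega>|M. T \<omega>) = (LINT \<omega>|M. E^2*(\<Sum>j<n1. (gaus W j \<omega>)^2)) + (LINT \<omega>|M. (\<Sum>j\<in>{n1..<m}. (\<mu> j)^2*(gaus W j \<omega>)^2))"
    unfolding T_def by (rule Bochner_Integration.integral_add[OF i1 i2])
   also have "(LINT \<omega>|M. E^2*(\<Sum>j<n1. (gaus W j \<omega>)^2)) = E^2*(LINT \<omega>|M. (\<Sum>j<n1. (gaus W j \<omega>)^2))" by (rule integral_mult_right_zero)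
   also have "(LINT \<omega>|M. (\<Sum>j<n1. (gaus W j \<omega>)^2)) = (\<Sum>j<n1. \<integral>\<omega>. (gaus W j \<omega>)^2 \<partial>M)"
    using gi n1 by (intro Bochner_Integration.integral_sum) auto
   also have "(LINT \<omega>|M. (\<Sum>j\<in>{n1..<m}. (\<mu> j)^2*(gaus W j \<omega>)^2)) = (\<Sum>j\<in>{n1..<m}. \<integral>\<omega>. (\<mu> j)^2*(gaus W j \<omega>)^2 \<partial>M)"
    using gi by (intro Bochner_Integration.integral_sum integrable_mult_right) auto
   finally show ?thesis unfolding integral_mult_right_zero .
  qed
  also have "(\<Sum>j<n1. \<integral>\<omega>. (gaus W j \<omega>)^2 \<partial>M) = n1" using n1 by (simp add: gaus_moments(3)[OF BM])
  also have "(\<Sum>j\<in>{n1..<m}. (\<mu> j)^2*(LINT \<omega>|M. (gaus W j \<omega>)^2)) = (\<Sum>j\<in>{n1..<m}. (\<mu> j)^2)"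
   by (rule sum.cong[OF refl]) (simp add: gaus_moments(3)[OF BM])
  finally show ?thesis .
 qed
 have Ss: "(%\<omega>. sqrt (T \<omega>)) : sqi M" using Ti T0 by (intro sqiI) (auto intro: borel_measurable_integrable)
 have nS: "nm M (%\<omega>. sqrt (T \<omega>)) = sqrt (E^2*n1 + (\<Sum>j\<in>{n1..<m}. (\<mu> j)^2))"
  unfolding nm_def using T0 TI by simp
 have one: "(%\<omega>. 1) : sqi M" using M by (intro sqi_bounded[of _ _ 1]) (auto intro: prob_space.finite_measure)
 have gs: "(%\<omega>. \<Sum>j<n1. (gaus W j \<omega>)^2) : sqi M" using n1 by (intro sqi_sum gaus_moments(2)[OF BM]) auto
 have zs: "(%\<omega>. \<Sum>i<r. (zeta W i \<omega>)^2) : sqi M" by (intro sqi_sum zeta_moments(2)[OF BM]) auto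
 have Qs: "Q : sqi M" unfolding Q_def by (intro sqi_add one gs zs)
 have "nm M Q <= nm M (%\<omega>. 1 + (\<Sum>j<n1. (gaus W j \<omega>)^2)) + nm M (%\<omega>. \<Sum>i<r. (zeta W i \<omega>)^2)"
  unfolding Q_def by (intro nm_triangle sqi_add one gs zs)
 also have "nm M (%\<omega>. 1 + (\<Sum>j<n1. (gaus W j \<omega>)^2)) <= nm M (%\<omega>. 1) + nm M (%\<omega>. \<Sum>j<n1. (gaus W j \<omega>)^2)"
  by (intro nm_triangle one gs)
 also have "nm M (%\<omega>. 1) = 1" using nm_const[OF M, of 1] by simp
 also have "nm M (%\<omega>. \<Sum>j<n1. (gaus W j \<omega>)^2) <= (\<Sum>j<n1. nm M (%\<omega>. (gaus W j \<omega>)^2))"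
  using n1 by (intro nm_sum_le gaus_moments(2)[OF BM]) auto
 also have "... = sqrt 3*n1" using n1 by (simp add: gaus_moments(4)[OF BM] mult.commute)
 also have "nm M (%\<omega>. \<Sum>i<r. (zeta W i \<omega>)^2) <= (\<Sum>i<r. nm M (%\<omega>. (zeta W i \<omega>)^2))"
  by (intro nm_sum_le zeta_moments(2)[OF BM]) auto
 also have "... <= (\<Sum>i<r. sqrt 3*L^2)" by (intro sum_mono zeta_moments(3)[OF BM]) auto
 finally have nQ: "nm M Q <= 1 + sqrt 3*n1 + sqrt 3*r*L^2" by (simp add: mult_ac)
 have Bs: "(%\<omega>. \<Delta> \<omega> + sqrt (T \<omega>) + \<kappa>*Q \<omega>) : sqi M" by (intro sqi_add sqi_cmult pd(2) Ss Qs)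
 have "AE \<omega> in M. \<bar>dist_to \<alpha> (X \<omega>)\<bar> <= \<Delta> \<omega> + sqrt (T \<omega>) + \<kappa>*Q \<omega>"
  using pd(1)
 proof eventually_elim
  case (elim \<omega>)
  obtain a where a: "a : \<alpha>" "nm I01 (%t. combi (%j. gaus W j \<omega>) (%i. zeta W i \<omega>) t - a t) <= sqrt (T \<omega>) + \<kappa>*Q \<omega>"
   using code[of "%j. gaus W j \<omega>" "%i. zeta W i \<omega>"] unfolding T_def Q_def power_mult_distrib by blast
  have fin: "finite \<alpha>" "\<alpha> ~= {}" and as: "a : sqi I01" using \<alpha> a(1) L2_01_iff[of a] by (auto simp: codebooks_def)
  have "dist_to \<alpha> (X \<omega>) <= nm I01 (%t. X \<omega> t - a t)" by (rule dist_to_le[OF fin(1) a(1)])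
  also have "(%t. X \<omega> t - a t) = (%t. (X \<omega> t - combi (%j. gaus W j \<omega>) (%i. zeta W i \<omega>) t) + (combi (%j. gaus W j \<omega>) (%i. zeta W i \<omega>) t - a t))" by simp
  also have "nm I01 ... <= \<Delta> \<omega> + nm I01 (%t. combi (%j. gaus W j \<omega>) (%i. zeta W i \<omega>) t - a t)"
   unfolding \<Delta>_def by (intro nm_triangle sqi_diff elim combi_sqi as)
  finally show ?case using a(2) dist_to_nonneg[OF fin, of "X \<omega>"] by linarith
 qed
 from nm_mono[OF Bs this]
 have "nm M (%\<omega>. dist_to \<alpha> (X \<omega>)) <= nm M (%\<omega>. \<Delta> \<omega> + sqrt (T \<omega>) + \<kappa>*Q \<omega>)" .
 also have "... <= nm M (%\<omega>. \<Delta> \<omega> + sqrt (T \<omega>)) + nm M (%\<omega>. \<kappa>*Q \<omega>)" by (intro nm_triangle sqi_add sqi_cmult pd(2) Ss Qs)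
 also have "nm M (%\<omega>. \<Delta> \<omega> + sqrt (T \<omega>)) <= nm M \<Delta> + nm M (%\<omega>. sqrt (T \<omega>))" by (intro nm_triangle pd(2) Ss)
 also have "nm M (%\<omega>. \<kappa>*Q \<omega>) = \<kappa>*nm M Q" unfolding nm_cmult using \<kappa> by simp
 finally show "nm M (%\<omega>. dist_to \<alpha> (X \<omega>)) <= \<epsilon> + sqrt (E^2*n1 + (\<Sum>j\<in>{n1..<m}. (\<mu> j)^2)) + \<kappa>*(1 + sqrt 3*n1 + sqrt 3*r*L^2)"
  using pd(3) mult_left_mono[OF nQ \<kappa>] unfolding nS by linarith
qed

text \<open>The coordinates from \<open>n1\<close> on are not coded, but there
  \<open>\<mu> j <= E\<close>, so they lose no more per unit of squared length than the coded ones.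
  On the unit ball both kinds together give E.\<close>

lemma entropy_upper:
 assumes \<beta>\<rho>: "\<beta> = \<rho> + 1/2"
  and \<alpha>: "\<alpha> : codebooks n" and n1: "n1 <= m" and \<kappa>: "\<kappa> >= 0" and E: "E >= 0" "\<And>j. n1 <= j ==> j < m ==> \<mu> j <= E"
  and code: "\<And>y z. \<exists>a\<in>\<alpha>. nm I01 (%t. combi y z t - a t) <=
   sqrt (E^2*(\<Sum>j<n1. (y j)^2) + (\<Sum>j\<in>{n1..<m}. (\<mu> j*y j)^2)) + \<kappa>*(1 + (\<Sum>j<n1. (y j)^2) + (\<Sum>i<r. (z i)^2))"
 shows "entropy_number (U_rho \<rho>) n <= \<epsilon> + E + \<kappa>*(2 + r*L^2)"
proof -
 have r: "\<rho> > 0" using \<beta> \<beta>\<rho> by simp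
 have fin: "finite \<alpha>" using \<alpha> by (auto simp: codebooks_def)
 show ?thesis
 proof (rule entropy_number_le[OF r \<alpha>])
  fix x assume x: "x : U_rho \<rho>"
  obtain y z where yz: "(\<Sum>j<m. (y j)^2) <= 1" "\<And>i. i < r ==> \<bar>z i\<bar> <= L" "nm I01 (%t. x t - combi y z t) <= \<epsilon>"
   using U_approx[OF \<beta>\<rho> x] by blast
  obtain a where a: "a : \<alpha>" "nm I01 (%t. combi y z t - a t) <=
   sqrt (E^2*(\<Sum>j<n1. (y j)^2) + (\<Sum>j\<in>{n1..<m}. (\<mu> j*y j)^2)) + \<kappa>*(1 + (\<Sum>j<n1. (y j)^2) + (\<Sum>i<r. (z i)^2))"
   using code by blast
  have as: "a : sqi I01" using \<alpha> a(1) L2_01_iff[of a] by (auto simp: codebooks_def)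
  have split: "(\<Sum>j<m. (y j)^2) = (\<Sum>j<n1. (y j)^2) + (\<Sum>j\<in>{n1..<m}. (y j)^2)"
   using n1 by (metis (lifting) lessThan_atLeast0 sum.atLeastLessThan_concat zero_le)
  have "(\<Sum>j\<in>{n1..<m}. (\<mu> j*y j)^2) <= (\<Sum>j\<in>{n1..<m}. E^2*(y j)^2)"
   unfolding power_mult_distrib using E \<mu>_pos by (intro sum_mono mult_right_mono power_mono) (auto intro: less_imp_le)
  also have "... = E^2*(\<Sum>j\<in>{n1..<m}. (y j)^2)" by (simp only: sum_distrib_left)
  finally have "E^2*(\<Sum>j<n1. (y j)^2) + (\<Sum>j\<in>{n1..<m}. (\<mu> j*y j)^2) <= E^2*(\<Sum>j<m. (y j)^2)"
   unfolding split distrib_left by linarith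
  also have "... <= E^2*1" using yz(1) by (intro mult_left_mono) auto
  finally have 1: "sqrt (E^2*(\<Sum>j<n1. (y j)^2) + (\<Sum>j\<in>{n1..<m}. (\<mu> j*y j)^2)) <= E"
   using E(1) by (intro real_le_lsqrt) auto
  have "0 <= (\<Sum>j\<in>{n1..<m}. (y j)^2)" by (intro sum_nonneg) auto
  then have y1: "(\<Sum>j<n1. (y j)^2) <= 1" using yz(1) split by linarith
  have "(\<Sum>i<r. (z i)^2) <= (\<Sum>i<r. L^2)" using yz(2) by (intro sum_mono) (metis abs_ge_zero lessThan_iff power2_abs power_mono)
  then have "1 + (\<Sum>j<n1. (y j)^2) + (\<Sum>i<r. (z i)^2) <= 2 + r*L^2" using y1 by simp
  from mult_left_mono[OF this \<kappa>] have 2: "\<kappa>*(1 + (\<Sum>j<n1. (y j)^2) + (\<Sum>i<r. (z i)^2)) <= \<kappa>*(2 + r*L^2)" .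
  have "dist_to \<alpha> x <= nm I01 (%t. x t - a t)" by (rule dist_to_le[OF fin a(1)])
  also have "(%t. x t - a t) = (%t. (x t - combi y z t) + (combi y z t - a t))" by simp
  also have "nm I01 ... <= nm I01 (%t. x t - combi y z t) + nm I01 (%t. combi y z t - a t)"
   by (intro nm_triangle sqi_diff U_rho_bounded(1)[OF r x] combi_sqi as)
  finally show "dist_to \<alpha> x <= \<epsilon> + E + \<kappa>*(2 + r*L^2)" using yz(3) a(2) 1 2 by linarith
 qed
qed

section \<open>Lower bounds for fixed parameters\<close>

definition coords :: "(real => real) => (nat => real) => nat => real" where
 "coords a q j = ip I01 (%t. a t - (\<Sum>i<r. q i*b i t)) (tmode \<theta> j)"

text \<open>After the low-rank part has been coded separately by q, only the orthonormal expansion matters.\<close>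

lemma coords_bound:
 assumes x: "x : sqi I01" and a: "a : sqi I01" and q: "\<And>i. i < r ==> \<bar>z i - q i\<bar> <= 1/H + (z i)^2/H" and H: "H >= 1"
 shows "(\<Sum>j<m. (\<mu> j*y j - coords a q j)^2) <=
  (nm I01 (%t. x t - a t) + nm I01 (%t. x t - combi y z t) + 3/H*(real r + (\<Sum>i<r. (z i)^2)))\<^sup>2"
proof -
 let ?S = "%t. \<Sum>j<m. (\<mu> j*y j)*tmode \<theta> j t" and ?c = "%t. a t - (\<Sum>i<r. q i*b i t)"
 let ?z = "%t. \<Sum>i<r. (z i - q i)*b i t"
 have S: "?S : sqi I01" by (intro sqi_sum sqi_cmult tmode_sqi)
 have c: "?c : sqi I01" by (intro sqi_diff sqi_sum sqi_cmult a b_sqi) auto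
 have zs: "?z : sqi I01" by (intro sqi_sum sqi_cmult b_sqi) auto
 have on: "orthonormal I01 {..<m} (tmode \<theta>)" by (rule tmode_orthonormal)
 have "\<mu> k*y k - coords a q k = ip I01 (%t. ?S t - ?c t) (tmode \<theta> k)" if k: "k < m" for k
 proof -
  have "ip I01 ?S (tmode \<theta> k) = (\<Sum>j<m. (\<mu> j*y j)*ip I01 (tmode \<theta> j) (tmode \<theta> k))" by (rule ip_sum_left[OF tmode_sqi tmode_sqi])
  also have "... = (\<Sum>j<m. if j = k then \<mu> k*y k else 0)"
   using on k by (intro sum.cong refl) (auto simp: orthonormal_def)
  finally have "ip I01 ?S (tmode \<theta> k) = \<mu> k*y k" using k by simp
  moreover have "ip I01 (%t. ?S t - ?c t) (tmode \<theta> k) = ip I01 ?S (tmode \<theta> k) - ip I01 ?c (tmode \<theta> k)"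
   unfolding ip_def left_diff_distrib[of "?S _" "?c _"]
   by (rule Bochner_Integration.integral_diff[OF sqi_mult_integrable[OF S tmode_sqi] sqi_mult_integrable[OF c tmode_sqi]])
  ultimately show ?thesis by (simp add: coords_def)
 qed
 then have "(\<Sum>j<m. (\<mu> j*y j - coords a q j)^2) = (\<Sum>j<m. (ip I01 (%t. ?S t - ?c t) (tmode \<theta> j))^2)" by simp
 also have "... <= (nm I01 (%t. ?S t - ?c t))^2" by (rule Bessel[OF on _ sqi_diff[OF S c]]) simp
 also have "... <= (nm I01 (%t. x t - a t) + nm I01 (%t. x t - combi y z t) + 3/H*(real r + (\<Sum>i<r. (z i)^2)))^2"
 proof (intro power_mono nm_nonneg)
  have "(%t. ?S t - ?c t) = (%t. ((x t - a t) - (x t - combi y z t)) - ?z t)"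
   by (simp add: fun_eq_iff combi_def left_diff_distrib sum_subtractf)
  then have "nm I01 (%t. ?S t - ?c t) <= nm I01 (%t. (x t - a t) - (x t - combi y z t)) + nm I01 ?z"
   using nm_triangle_diff[OF sqi_diff[OF sqi_diff[OF x a] sqi_diff[OF x combi_sqi]] zs] by simp
  also have "nm I01 (%t. (x t - a t) - (x t - combi y z t)) <= nm I01 (%t. x t - a t) + nm I01 (%t. x t - combi y z t)"
   by (intro nm_triangle_diff sqi_diff x a combi_sqi)
  also have "nm I01 ?z <= (\<Sum>i<r. nm I01 (%t. (z i - q i)*b i t))" by (intro nm_sum_le sqi_cmult b_sqi) auto
  also have "... <= (\<Sum>i<r. (1/H + (z i)^2/H)*3)"
   unfolding nm_cmult using q b_norm H by (intro sum_mono mult_mono) (auto simp: nm_nonneg)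
  also have "... = 3/H*(real r + (\<Sum>i<r. (z i)^2))"
   by (simp add: sum_distrib_left sum.distrib algebra_simps sum_divide_distrib)
  finally show "nm I01 (%t. ?S t - ?c t) <= nm I01 (%t. x t - a t) + nm I01 (%t. x t - combi y z t) + 3/H*(real r + (\<Sum>i<r. (z i)^2))" by simp
 qed
 finally show ?thesis .
qed

text \<open>Turns any codebook of functions into a finite set of coordinate vectors. A grid value is
  subtracted for every possible low-rank contribution, which enlarges the logarithm of the size by
  \<open>r*ln (5*H^2)\<close>.\<close>

lemma coords_code:
 assumes \<alpha>: "\<alpha> : codebooks n" and H: "H >= 1"
 shows "\<exists>A. finite A & A ~= {} & ln (real (card A)) <= ln (real n) + r*ln (5*H^2) &
  (\<forall>x y z. x : sqi I01 --> (\<exists>a\<in>A. (\<Sum>j<m. (\<mu> j*y j - a j)^2) <=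
   (dist_to \<alpha> x + nm I01 (%t. x t - combi y z t) + 3/H*(real r + (\<Sum>i<r. (z i)^2)))\<^sup>2))"
proof -
 obtain Q where Q: "finite Q" "Q ~= {}" "real (card Q) <= (5*H^2)^r"
  "\<And>z. \<exists>q\<in>Q. \<forall>i<r. \<bar>z i - q i\<bar> <= 1/H + (z i)^2/H"
  using grid_product_code[OF H, of r] by blast
 have \<alpha>': "finite \<alpha>" "\<alpha> ~= {}" "card \<alpha> <= n" "\<And>a. a : \<alpha> ==> a : sqi I01"
  using \<alpha> L2_01_iff by (auto simp: codebooks_def)
 define A where "A = (%(a, q). coords a q) ` (\<alpha> \<times> Q)"
 have A: "finite A" "A ~= {}" using \<alpha>' Q by (auto simp: A_def)
 have n0: "n > 0" using \<alpha>' by (metis card_gt_0_iff less_le_trans)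
 have "card A <= card (\<alpha> \<times> Q)" unfolding A_def using \<alpha>' Q by (intro card_image_le) auto
 then have "real (card A) <= real (card \<alpha>)*real (card Q)" by (metis card_cartesian_product of_nat_le_iff of_nat_mult)
 also have "... <= real n*(5*H^2)^r" using \<alpha>'(3) Q(3) by (intro mult_mono) auto
 finally have le: "real (card A) <= real n*(5*H^2)^r" .
 have cp: "0 < real (card A)" using A by (simp add: card_gt_0_iff)
 have "ln (real (card A)) <= ln (real n*(5*H^2)^r)"
  by (rule iffD2[OF ln_le_cancel_iff[OF cp less_le_trans[OF cp le]] le])
 also have "... = ln (real n) + r*ln (5*H^2)" using n0 H by (simp add: ln_mult ln_realpow distrib_left)
 finally have "ln (real (card A)) <= ln (real n) + r*ln (5*H^2)" .
 moreover have "\<exists>a\<in>A. (\<Sum>j<m. (\<mu> j*y j - a j)^2) <=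
   (dist_to \<alpha> x + nm I01 (%t. x t - combi y z t) + 3/H*(real r + (\<Sum>i<r. (z i)^2)))\<^sup>2" if x: "x : sqi I01" for x y z
 proof -
  obtain a where a: "a : \<alpha>" "dist_to \<alpha> x = nm I01 (%t. x t - a t)" using dist_to_attained[OF \<alpha>'(1,2)] by blast
  obtain q where q: "q : Q" "\<And>i. i < r ==> \<bar>z i - q i\<bar> <= 1/H + (z i)^2/H" using Q(4) by blast
  show ?thesis using coords_bound[OF x \<alpha>'(4)[OF a(1)] q(2) H, where y = y] a q(1) unfolding A_def
   by (intro bexI[of _ "coords a q"]) auto
 qed
 ultimately show ?thesis using A by blast
qed

text \<open>Shannon's bound for the coordinate code of \<open>coords_code\<close>, with the distance
  to \<alpha>, the splitting error and the rounding error together as the distortion. \<Lambda> and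
  w stay free here; \<open>lower_bounds\<close> chooses them.\<close>

lemma quant_lower:
 assumes BM: "std_BM M W" and X: "RL_process \<rho> M W X" and \<beta>\<rho>: "\<beta> = \<rho> + 1/2"
  and \<alpha>: "\<alpha> : codebooks n" and H: "H >= 1" and \<Lambda>: "\<Lambda> > 0"
  and w: "\<And>j. j < m ==> w j <= 1/2" "\<And>j. j < m ==> w j < \<Lambda>*(\<mu> j)^2"
 shows "(\<Sum>j<m. w j) - (ln (real n) + r*ln (5*H^2)) + (\<Sum>j<m. ln (1 + 2*\<Lambda>*(\<mu> j)^2 - 2*w j))/2
  <= \<Lambda>*(nm M (%\<omega>. dist_to \<alpha> (X \<omega>)) + \<epsilon> + 3/H*(real r + sqrt 3*r*L^2))^2"
proof -
 have M: "prob_space M" using BM by (simp add: std_BM_def)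
 define \<Delta> where "\<Delta> \<omega> = nm I01 (%t. X \<omega> t - combi (%j. gaus W j \<omega>) (%i. zeta W i \<omega>) t)" for \<omega>
 note pd = process_distance[OF BM X \<beta>\<rho>, folded \<Delta>_def]
 have \<alpha>': "finite \<alpha>" "\<alpha> ~= {}" "\<And>a. a : \<alpha> ==> a : sqi I01" "\<And>a. a : \<alpha> ==> a : borel_measurable borel"
  using \<alpha> L2_01_iff by (auto simp: codebooks_def)
 have Xm: "(%(\<omega>, t). X \<omega> t) : borel_measurable (M \<Otimes>\<^sub>M I01)"
  using X by (intro measurable_process) (simp add: RL_process_def)
 have nmm: "(%\<omega>. nm I01 (%t. X \<omega> t - a t)) : borel_measurable M" if a: "a : \<alpha>" for a
 proof -
  have "(%z. a (snd z)) : borel_measurable (M \<Otimes>\<^sub>M I01)"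
   by (rule measurable_compose[OF measurable_snd borel_measurable_I01[OF \<alpha>'(4)[OF a]]])
  then have "(%(\<omega>, t). (X \<omega> t - a t)^2) : borel_measurable (M \<Otimes>\<^sub>M I01)"
   using borel_measurable_power[OF borel_measurable_diff[OF Xm], of _ 2] by (simp add: case_prod_unfold)
  then have "(%\<omega>. \<integral>t. (X \<omega> t - a t)^2 \<partial>I01) : borel_measurable M"
   by (rule I01.borel_measurable_lebesgue_integral)
  then show ?thesis unfolding nm_def by measurable
 qed
 have dm: "(%\<omega>. dist_to \<alpha> (X \<omega>)) : borel_measurable M"
  unfolding dist_to_def L2norm_eq_nm using nmm \<alpha>'(1) by (intro borel_measurable_Min) auto
 obtain a0 where a0: "a0 : \<alpha>" using \<alpha>'(2) by blast
 have gs: "(%\<omega>. \<Sum>i<r. (zeta W i \<omega>)^2) : sqi M" by (intro sqi_sum zeta_moments(2)[OF BM]) auto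
 have cs: "(%\<omega>. c) : sqi M" for c using M by (intro sqi_bounded[of _ _ "\<bar>c\<bar>"]) (auto intro: prob_space.finite_measure)
 \<comment> \<open>Square integrability of the distance to \<alpha> comes from comparison with the
   single code word \<open>a0\<close>.\<close>
 have ds: "(%\<omega>. dist_to \<alpha> (X \<omega>)) : sqi M"
 proof -
  define B where "B \<omega> = nm I01 (combi (%j. gaus W j \<omega>) (%i. zeta W i \<omega>))" for \<omega>
  define C where "C \<omega> = (\<Sum>j<m. \<bar>\<mu> j\<bar>*\<bar>gaus W j \<omega>\<bar>) + (\<Sum>i<r. 3*\<bar>zeta W i \<omega>\<bar>)" for \<omega>
  have abs_sqi: "(%\<omega>. \<bar>f \<omega>\<bar>) : sqi M" if "f : sqi M" for f using that by (auto simp: sqi_def)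
  have Cs: "C : sqi M" unfolding C_def
   by (intro sqi_add sqi_sum sqi_cmult abs_sqi gaus_moments(1)[OF BM] zeta_moments(1)[OF BM]) auto
  have "AE \<omega> in M. \<bar>dist_to \<alpha> (X \<omega>)\<bar> <= \<Delta> \<omega> + C \<omega> + nm I01 a0"
   using pd(1)
  proof eventually_elim
   case (elim \<omega>)
   let ?y = "%j. gaus W j \<omega>" and ?z = "%i. zeta W i \<omega>"
   have t1: "nm I01 (tmode \<theta> j) = 1" if "j < m" for j
   proof -
    have "(nm I01 (tmode \<theta> j))^2 = 1" unfolding ip_self[symmetric] using tmode_orthonormal[of "{j}" \<theta>] by (simp add: orthonormal_def)
    then show ?thesis using nm_nonneg[of I01 "tmode \<theta> j"] by (simp add: power2_eq_1_iff)
   qed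
   have "nm I01 (combi ?y ?z) <= nm I01 (%t. \<Sum>j<m. \<mu> j*?y j*tmode \<theta> j t) + nm I01 (%t. \<Sum>i<r. ?z i*b i t)"
    unfolding combi_def[abs_def] by (intro nm_triangle sqi_sum sqi_cmult tmode_sqi b_sqi) auto
   also have "nm I01 (%t. \<Sum>j<m. \<mu> j*?y j*tmode \<theta> j t) <= (\<Sum>j<m. nm I01 (%t. \<mu> j*?y j*tmode \<theta> j t))"
    by (intro nm_sum_le sqi_cmult tmode_sqi) auto
   also have "... = (\<Sum>j<m. \<bar>\<mu> j\<bar>*\<bar>?y j\<bar>)" unfolding nm_cmult by (simp add: t1 abs_mult)
   also have "nm I01 (%t. \<Sum>i<r. ?z i*b i t) <= (\<Sum>i<r. nm I01 (%t. ?z i*b i t))"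
    by (intro nm_sum_le sqi_cmult b_sqi) auto
   also have "... <= (\<Sum>i<r. 3*\<bar>?z i\<bar>)" unfolding nm_cmult using b_norm by (intro sum_mono) (simp add: mult.commute mult_right_mono)
   finally have c: "nm I01 (combi ?y ?z) <= C \<omega>" by (simp add: C_def)
   have "dist_to \<alpha> (X \<omega>) <= nm I01 (%t. X \<omega> t - a0 t)" by (rule dist_to_le[OF \<alpha>'(1) a0])
   also have "(%t. X \<omega> t - a0 t) = (%t. (X \<omega> t - combi ?y ?z t) + combi ?y ?z t - a0 t)" by simp
   also have "nm I01 ... <= nm I01 (%t. (X \<omega> t - combi ?y ?z t) + combi ?y ?z t) + nm I01 a0"
    by (intro nm_triangle_diff sqi_add sqi_diff elim combi_sqi \<alpha>'(3)[OF a0])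
   also have "nm I01 (%t. (X \<omega> t - combi ?y ?z t) + combi ?y ?z t) <= \<Delta> \<omega> + nm I01 (combi ?y ?z)"
    unfolding \<Delta>_def by (intro nm_triangle sqi_diff elim combi_sqi)
   finally show ?case using c dist_to_nonneg[OF \<alpha>'(1,2), of "X \<omega>"] by linarith
  qed
  then show ?thesis by (rule sqi_bound[OF sqi_add[OF sqi_add[OF pd(2) Cs] cs] dm])
 qed
 define D where "D \<omega> = dist_to \<alpha> (X \<omega>) + \<Delta> \<omega> + 3/H*(real r + (\<Sum>i<r. (zeta W i \<omega>)^2))" for \<omega>
 have Gs: "(%\<omega>. 3/H*(real r + (\<Sum>i<r. (zeta W i \<omega>)^2))) : sqi M" by (intro sqi_cmult sqi_add cs gs)
 have Ds: "D : sqi M" unfolding D_def by (intro sqi_add ds pd(2) Gs)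
 obtain A where A: "finite A" "A ~= {}" "ln (real (card A)) <= ln (real n) + r*ln (5*H^2)"
  "\<And>x y z. x : sqi I01 ==> \<exists>a\<in>A. (\<Sum>j<m. (\<mu> j*y j - a j)^2) <=
   (dist_to \<alpha> x + nm I01 (%t. x t - combi y z t) + 3/H*(real r + (\<Sum>i<r. (z i)^2)))\<^sup>2"
  using coords_code[OF \<alpha> H] by blast
 have ae: "AE \<omega> in M. \<exists>a\<in>A. (\<Sum>j<m. (\<mu> j*gaus W j \<omega> - a j)^2) <= (D \<omega>)^2"
  using pd(1)
 proof eventually_elim
  case (elim \<omega>)
  show ?case using A(4)[OF elim, of "%j. gaus W j \<omega>" "%i. zeta W i \<omega>"] unfolding D_def \<Delta>_def .
 qed
 have "(\<Sum>j<m. w j) - ln (real (card A)) + (\<Sum>j<m. ln (1 + 2*\<Lambda>*(\<mu> j)^2 - 2*w j))/2 <= \<Lambda>*(LINT \<omega>|M. (D \<omega>)^2)"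
  by (rule gauss_quantization_lower[OF gaus_system[OF BM order_refl] \<Lambda> w sqi_integrable[OF Ds] ae A(1,2)])
 also have "(LINT \<omega>|M. (D \<omega>)^2) = (nm M D)^2" by (rule nm_sq[symmetric])
 also have "\<Lambda>*(nm M D)^2 <= \<Lambda>*(nm M (%\<omega>. dist_to \<alpha> (X \<omega>)) + \<epsilon> + 3/H*(real r + sqrt 3*r*L^2))^2"
 proof (intro mult_left_mono power_mono nm_nonneg)
  have "nm M D <= nm M (%\<omega>. dist_to \<alpha> (X \<omega>) + \<Delta> \<omega>) + nm M (%\<omega>. 3/H*(real r + (\<Sum>i<r. (zeta W i \<omega>)^2)))"
   unfolding D_def by (intro nm_triangle sqi_add ds pd(2) Gs)
  also have "nm M (%\<omega>. dist_to \<alpha> (X \<omega>) + \<Delta> \<omega>) <= nm M (%\<omega>. dist_to \<alpha> (X \<omega>)) + nm M \<Delta>" by (intro nm_triangle ds pd(2))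
  also have "nm M (%\<omega>. 3/H*(real r + (\<Sum>i<r. (zeta W i \<omega>)^2))) = 3/H*nm M (%\<omega>. real r + (\<Sum>i<r. (zeta W i \<omega>)^2))"
   unfolding nm_cmult using H by simp
  also have "... <= 3/H*(real r + sqrt 3*r*L^2)"
  proof (rule mult_left_mono)
   have "nm M (%\<omega>. real r + (\<Sum>i<r. (zeta W i \<omega>)^2)) <= nm M (%\<omega>. real r) + nm M (%\<omega>. \<Sum>i<r. (zeta W i \<omega>)^2)"
    by (intro nm_triangle cs gs)
   also have "nm M (%\<omega>. real r) = r" using nm_const[OF M, of "real r"] by simp
   also have "nm M (%\<omega>. \<Sum>i<r. (zeta W i \<omega>)^2) <= (\<Sum>i<r. nm M (%\<omega>. (zeta W i \<omega>)^2))"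
    by (intro nm_sum_le zeta_moments(2)[OF BM]) auto
   also have "... <= (\<Sum>i<r. sqrt 3*L^2)" by (intro sum_mono zeta_moments(3)[OF BM]) auto
   finally show "nm M (%\<omega>. real r + (\<Sum>i<r. (zeta W i \<omega>)^2)) <= r + sqrt 3*r*L^2" by (simp add: mult_ac)
  qed (use H in simp)
  finally show "nm M D <= nm M (%\<omega>. dist_to \<alpha> (X \<omega>)) + \<epsilon> + 3/H*(real r + sqrt 3*r*L^2)" using pd(3) by linarith
 qed (use \<Lambda> in simp)
 finally show ?thesis using A(3) by linarith
qed

text \<open>The assertion is deterministic; W only supplies the Gaussian vector of the averaging
  argument in \<open>gauss_covering_lower\<close>.\<close>

lemma entropy_lower:
 assumes BM: "std_BM M W" and \<beta>\<rho>: "\<beta> = \<rho> + 1/2" and d: "0 < d" "d <= m" and \<delta>: "0 < \<delta>" "\<delta> <= 1"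
  and conc: "measure M {\<omega> : space M. (1 - \<delta>)*d <= (\<Sum>j<d. (gaus W j \<omega>)^2) & (\<Sum>j<d. (gaus W j \<omega>)^2) <= (1 + \<delta>)*d} >= 1/2"
  and \<alpha>: "\<alpha> : codebooks n" and H: "H >= 1" and s: "\<And>x. x : U_rho \<rho> ==> dist_to \<alpha> x <= s"
  and e: "e > 0" "s + \<epsilon> + 3/H*(real r + real r*L^2) <= e" and \<mu>e: "\<And>j. j < d ==> \<mu> j > e * sqrt (1 + \<delta>)"
 shows "(\<Sum>j<d. ln (\<mu> j/e)) - ln 2 - \<delta>*d <= ln (real n) + r*ln (5*H^2)"
proof -
 have fin: "finite \<alpha>" "\<alpha> ~= {}" using \<alpha> by (auto simp: codebooks_def)
 obtain A where A: "finite A" "A ~= {}" "ln (real (card A)) <= ln (real n) + r*ln (5*H^2)"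
  "\<And>x y z. x : sqi I01 ==> \<exists>a\<in>A. (\<Sum>j<m. (\<mu> j*y j - a j)^2) <=
   (dist_to \<alpha> x + nm I01 (%t. x t - combi y z t) + 3/H*(real r + (\<Sum>i<r. (z i)^2)))\<^sup>2"
  using coords_code[OF \<alpha> H] by blast
 have cov: "\<exists>a\<in>A. (\<Sum>j<d. (\<mu> j*y j - a j)^2) <= e^2" if y: "(\<Sum>j<d. (y j)^2) <= 1" for y
 proof -
  let ?y = "%j. if j < d then y j else 0"
  obtain x z where x: "x : U_rho \<rho>" "\<And>i. i < r ==> \<bar>z i\<bar> <= L" "x : sqi I01" "nm I01 (%t. x t - combi ?y z t) <= \<epsilon>"
   using U_realize[OF \<beta>\<rho> d(2) y] by blast
  obtain a where a: "a : A" "(\<Sum>j<m. (\<mu> j*?y j - a j)^2) <=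
   (dist_to \<alpha> x + nm I01 (%t. x t - combi ?y z t) + 3/H*(real r + (\<Sum>i<r. (z i)^2)))\<^sup>2"
   using A(4)[OF x(3), of ?y z] by blast
  have "(\<Sum>j<d. (\<mu> j*y j - a j)^2) = (\<Sum>j<d. (\<mu> j*?y j - a j)^2)" by simp
  also have "... <= (\<Sum>j<m. (\<mu> j*?y j - a j)^2)" using d by (intro sum_mono2) auto
  also note a(2)
  also have "(dist_to \<alpha> x + nm I01 (%t. x t - combi ?y z t) + 3/H*(real r + (\<Sum>i<r. (z i)^2)))^2 <= e^2"
  proof (rule power_mono)
   have "(\<Sum>i<r. (z i)^2) <= (\<Sum>i<r. L^2)" using x(2) by (intro sum_mono) (metis abs_ge_zero lessThan_iff power2_abs power_mono)
   then have "3/H*(real r + (\<Sum>i<r. (z i)^2)) <= 3/H*(real r + real r*L^2)" using H by (intro mult_left_mono) auto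
   then show "dist_to \<alpha> x + nm I01 (%t. x t - combi ?y z t) + 3/H*(real r + (\<Sum>i<r. (z i)^2)) <= e"
    using s[OF x(1)] x(4) e(2) by linarith
   have "0 <= 3/H*(real r + (\<Sum>i<r. (z i)^2))" using H by (intro mult_nonneg_nonneg add_nonneg_nonneg sum_nonneg) auto
   then show "0 <= dist_to \<alpha> x + nm I01 (%t. x t - combi ?y z t) + 3/H*(real r + (\<Sum>i<r. (z i)^2))"
    using dist_to_nonneg[OF fin, of x] nm_nonneg[of I01 "%t. x t - combi ?y z t"] by linarith
  qed
  finally show ?thesis using a(1) by blast
 qed
 have "(\<Sum>j<d. ln (\<mu> j/e)) - ln 2 - \<delta>*d <= ln (real (card A))"
  by (rule gauss_covering_lower[OF gaus_system[OF BM d(2)] d(1) \<delta> conc cov A(1) e(1) \<mu>e])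
 then show ?thesis using A(3) by linarith
qed

end

section \<open>Asymptotics\<close>

text \<open>The sum is ln (B^B/B!), so this is a bound of Stirling type; the step from B to B + 1
  adds B ln (1 + 1/B) <= 1. It is the source of the leading term \<beta> D in the size of the
  codebook.\<close>

lemma ln_block_sum: "(\<Sum>k\<in>{1..<B}. ln (real B/real k)) <= real B"
proof (induction B)
 case (Suc B)
 show ?case
 proof (cases "B = 0")
  case False
  have "(\<Sum>k\<in>{1..<Suc B}. ln (real (Suc B)/real k)) = (\<Sum>k\<in>{1..<Suc B}. ln (real B/real k) + ln (real (Suc B)/real B))"
   using False by (intro sum.cong refl) (simp add: ln_div)
  also have "... = (\<Sum>k\<in>{1..<Suc B}. ln (real B/real k)) + B*ln (real (Suc B)/real B)" by (simp add: sum.distrib)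
  also have "(\<Sum>k\<in>{1..<Suc B}. ln (real B/real k)) = (\<Sum>k\<in>{1..<B}. ln (real B/real k))"
   using False by simp
  also have "ln (real (Suc B)/real B) <= 1/B"
  proof -
   have "real (Suc B)/real B = 1 + 1/B" using False by (simp add: field_simps)
   then show ?thesis using ln_add_one_self_le_self[of "1/real B"] by simp
  qed
  finally show ?thesis using Suc.IH False by (simp add: mult_left_mono)
 qed simp
qed simp

section \<open>The codebook and its size\<close>

context rl_split
begin

abbreviation cc :: real where "cc \<equiv> Gamma \<beta>/pi powr \<beta>"

lemma cc_pos: "cc > 0"
 using \<beta> by (simp add: Gamma_real_pos)

lemma \<mu>_le: "j < m ==> 0 < x ==> x <= real (j + 1) ==> \<mu> j <= cc*x powr (- \<beta>)"
proof -
 assume j: "j < m" and x: "0 < x" "x <= real (j + 1)"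
 have "real (j + 1) powr (- \<beta>) <= x powr (- \<beta>)" using \<beta> x by (intro powr_mono2') auto
 then show ?thesis using \<mu>(2)[OF j] mult_left_mono[OF _ less_imp_le[OF cc_pos]] by fastforce
qed

text \<open>The modes of block k are at most \<open>cc*real (k*l) powr (- \<beta>)\<close>, and the
  relative accuracy \<open>(k/B) powr \<beta>\<close> brings every block to the same level
  \<open>cc*real (B*l) powr (- \<beta>)\<close>, that of the first uncoded mode. This is reverse
  water-filling in steps. Block k costs about \<beta> l ln (B/k), which \<open>ln_block_sum\<close>
  adds up to \<beta> B l.\<close>

lemma upper_codebook:
 fixes \<delta> H K :: real and B l :: nat
 assumes \<delta>: "0 < \<delta>" "\<delta> <= 1" and H: "H >= 1" and B: "0 < B" "B*l <= m" and l: "l*\<delta>^2 >= 6" and K: "K >= 3" "K >= cc"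
 defines "E \<equiv> (1 + 3*\<delta>)*(cc*real (B*l) powr (- \<beta>))"
 shows "\<exists>\<alpha>. \<alpha> \<subseteq> L2_01 & finite \<alpha> & \<alpha> ~= {} &
  ln (real (card \<alpha>)) <= B*(ln (H^2 + 1) + ln (20*(real l)^2/\<delta>)) + 2*\<delta>*(B*l) + \<beta>*(B*(l + 1)) + (r + l)*ln (5*H^2) &
  (\<forall>y z. \<exists>a\<in>\<alpha>. nm I01 (%t. combi y z t - a t) <=
   sqrt (E^2*(\<Sum>j<B*l. (y j)^2) + (\<Sum>j\<in>{B*l..<m}. (\<mu> j*y j)^2)) +
   6*K*(B + r + l)/H*(1 + (\<Sum>j<B*l. (y j)^2) + (\<Sum>i<r. (z i)^2)))"
proof -
 define \<epsilon>k where "\<epsilon>k k = (real k/real B) powr \<beta>" for k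
 have l0: "l > 0" using l by (cases l) auto
 have ek: "0 < \<epsilon>k k" "\<epsilon>k k < 1" if "1 <= k" "k < B" for k
 proof -
  have q: "0 < real k/real B" "real k/real B < 1" using that by auto
  show "0 < \<epsilon>k k" using that by (simp add: \<epsilon>k_def)
  have "(real k/real B) powr \<beta> < 1 powr \<beta>" using q \<beta> by (intro powr_less_mono2) auto
  then show "\<epsilon>k k < 1" by (simp add: \<epsilon>k_def)
 qed
 define P where "P k V \<longleftrightarrow> finite V & V ~= {} & real (card V) <= (H^2 + 1)*(20*(real l)^2/(\<delta>*\<epsilon>k k)*exp (2*\<delta>*l)/\<epsilon>k k^l) &
  (\<forall>y. \<exists>v\<in>V. L2_set (%i. y i - v i) {..<l} <= \<epsilon>k k*(1 + 3*\<delta>)*L2_set y {..<l} + 5/H + (L2_set y {..<l})^2/H)" for k V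
 have "\<forall>k\<in>{1..<B}. \<exists>V. P k V" using ball_code[OF ek \<delta> l H] unfolding P_def by auto
 from bchoice[OF this] obtain V where V1: "\<forall>k\<in>{1..<B}. P k (V k)" by blast
 have VP: "P k (V k)" if "1 <= k" "k < B" for k using V1 that by simp
 have V: "finite (V k)" "V k ~= {}" "real (card (V k)) <= (H^2 + 1)*(20*(real l)^2/(\<delta>*\<epsilon>k k)*exp (2*\<delta>*l)/\<epsilon>k k^l)"
  "\<exists>v\<in>V k. L2_set (%i. y i - v i) {..<l} <= \<epsilon>k k*(1 + 3*\<delta>)*L2_set y {..<l} + 5/H + (L2_set y {..<l})^2/H"
  if "1 <= k" "k < B" for k y
  using VP[OF that] unfolding P_def by blast+
 have muK: "\<mu> j <= K" if "j < m" for j using \<mu>_le[OF that, of 1] K by simp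
 have Dk: "cc*real (k*l) powr (- \<beta>) <= K" if "1 <= k" "k < B" for k
 proof -
  have "real (k*l) powr (- \<beta>) <= 1 powr (- \<beta>)" using that l0 \<beta> by (intro powr_mono2') (auto simp: Suc_le_eq simp del: of_nat_mult)
  then have "cc*real (k*l) powr (- \<beta>) <= cc*1" using cc_pos by (intro mult_left_mono) auto
  then show ?thesis using K by linarith
 qed
 have DE: "cc*real (k*l) powr (- \<beta>)*(\<epsilon>k k*(1 + 3*\<delta>)) <= E" if k: "1 <= k" "k < B" for k
 proof -
  have "real (k*l) powr (- \<beta>)*\<epsilon>k k = real (B*l) powr (- \<beta>)"
  proof -
   have "real (k*l) powr (- \<beta>)*\<epsilon>k k = (real k*real l*(real B/real k)) powr (- \<beta>)"
    using k l0 by (simp add: \<epsilon>k_def powr_mult powr_minus powr_divide field_simps)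
   also have "real k*real l*(real B/real k) = real (B*l)" using k by simp
   finally show ?thesis .
  qed
  then have "cc*real (k*l) powr (- \<beta>)*(\<epsilon>k k*(1 + 3*\<delta>)) = E"
   unfolding E_def by (simp only: mult.assoc mult.left_commute mult.commute) (metis mult.assoc mult.commute)
  then show ?thesis by simp
 qed
 have E0: "E >= 0" unfolding E_def using \<delta> cc_pos by (intro mult_nonneg_nonneg) auto
 have K0: "K >= 0" using K by linarith
 have bK: "nm I01 (b i) <= K" if "i < r" for i using b_norm[OF that] K by linarith
 have D1: "\<mu> j <= cc*real (k*l) powr (- \<beta>)" if "1 <= k" "k < B" "k*l <= j" "j < k*l + l" for k j
 proof (rule \<mu>_le)
  have "k*l + l <= B*l" using that(2) mult_le_mono1[of "Suc k" B l] by simp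
  then show "j < m" using that(4) B(2) by linarith
  show "0 < real (k*l)" using that(1) l0 by simp
  show "real (k*l) <= real (j + 1)" using that(3) by (simp del: of_nat_mult)
 qed
 have D2: "0 <= cc*real (k*l) powr (- \<beta>)" for k using cc_pos by (intro mult_nonneg_nonneg) auto
 have "\<exists>\<alpha>. finite \<alpha> & \<alpha> ~= {} & (\<forall>a\<in>\<alpha>. \<exists>p q. a = (%t. (\<Sum>j<m. p j*tmode \<theta> j t) + (\<Sum>i<r. q i*b i t))) &
   real (card \<alpha>) <= (\<Prod>k\<in>{1..<B}. real (card (V k)))*(5*H^2)^(r + l) &
   (\<forall>y z. \<exists>a\<in>\<alpha>. nm I01 (%t. (\<Sum>j<m. \<mu> j*y j*tmode \<theta> j t) + (\<Sum>i<r. z i*b i t) - a t) <=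
    sqrt (E^2*(\<Sum>j<B*l. (y j)^2) + (\<Sum>j\<in>{B*l..<m}. (\<mu> j*y j)^2)) +
    6*K*(B + r + l)/H*(1 + (\<Sum>j<B*l. (y j)^2) + (\<Sum>i<r. (z i)^2)))"
  by (intro block_codebook[where \<epsilon> = "%k. \<epsilon>k k*(1 + 3*\<delta>)" and D = "%k. cc*real (k*l) powr (- \<beta>)"]
    tmode_orthonormal b_sqi bK less_imp_le[OF \<mu>_pos] muK B(1) l0 B(2) V(1,2,4) D1 D2 Dk DE H K0 E0)
 then obtain \<alpha> where \<alpha>: "finite \<alpha>" "\<alpha> ~= {}"
   "\<forall>a\<in>\<alpha>. \<exists>p q. a = (%t. (\<Sum>j<m. p j*tmode \<theta> j t) + (\<Sum>i<r. q i*b i t))"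
   "real (card \<alpha>) <= (\<Prod>k\<in>{1..<B}. real (card (V k)))*(5*H^2)^(r + l)"
   "\<forall>y z. \<exists>a\<in>\<alpha>. nm I01 (%t. (\<Sum>j<m. \<mu> j*y j*tmode \<theta> j t) + (\<Sum>i<r. z i*b i t) - a t) <=
    sqrt (E^2*(\<Sum>j<B*l. (y j)^2) + (\<Sum>j\<in>{B*l..<m}. (\<mu> j*y j)^2)) +
    6*K*(B + r + l)/H*(1 + (\<Sum>j<B*l. (y j)^2) + (\<Sum>i<r. (z i)^2))"
  by (elim exE conjE, intro that)
 have L2: "\<alpha> \<subseteq> L2_01"
 proof
  fix a assume "a : \<alpha>"
  then obtain p q where a: "a = (%t. (\<Sum>j<m. p j*tmode \<theta> j t) + (\<Sum>i<r. q i*b i t))" using \<alpha>(3) by blast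
  have "a : sqi I01" unfolding a by (intro sqi_add sqi_sum sqi_cmult tmode_sqi b_sqi) auto
  moreover have "a : borel_measurable borel" unfolding a using b(1)
   by (intro borel_measurable_add borel_measurable_sum borel_measurable_times borel_measurable_const tmode_measurable) auto
  ultimately show "a : L2_01" by (simp add: L2_01_iff)
 qed
 define X where "X = ln (H^2 + 1) + ln (20*(real l)^2/\<delta>)"
 have X0: "X >= 0"
 proof -
  have "1 <= 20*(real l)^2/\<delta>"
  proof -
   have "1 <= (real l)^2" using l0 by simp
   then show ?thesis using \<delta> by (simp add: le_divide_eq)
  qed
  then show ?thesis unfolding X_def by (intro add_nonneg_nonneg ln_ge_zero) auto
 qed
 have lnV: "ln (real (card (V k))) <= X + 2*\<delta>*l + (real l + 1)*\<beta>*ln (real B/real k)" if k: "1 <= k" "k < B" for k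
 proof -
  have cp: "0 < real (card (V k))" using V(1,2)[OF k] by (simp add: card_gt_0_iff)
  have ep: "\<epsilon>k k > 0" by (rule ek(1)[OF k])
  have l2: "0 < 20*(real l)^2/\<delta>" using l0 \<delta> by simp
  have eq: "(H^2 + 1)*(20*(real l)^2/(\<delta>*\<epsilon>k k)*exp (2*\<delta>*l)/\<epsilon>k k^l) = (H^2 + 1)*((20*(real l)^2/\<delta>)*(exp (2*\<delta>*l)/\<epsilon>k k^(l + 1)))"
   using ep \<delta> by (simp add: field_simps)
  have "ln (real (card (V k))) <= ln ((H^2 + 1)*((20*(real l)^2/\<delta>)*(exp (2*\<delta>*l)/\<epsilon>k k^(l + 1))))"
   using V(3)[OF k, unfolded eq] cp by (intro iffD2[OF ln_le_cancel_iff]) auto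
  also have "... = ln (H^2 + 1) + (ln (20*(real l)^2/\<delta>) + (2*\<delta>*l - ln (\<epsilon>k k^(l + 1))))"
  proof -
   have 1: "0 < H^2 + 1" by (simp add: add_nonneg_pos)
   have 2: "0 < exp (2*\<delta>*l)/\<epsilon>k k^(l + 1)" using ep by simp
   have 3: "ln (exp (2*\<delta>*l)/\<epsilon>k k^(l + 1)) = 2*\<delta>*l - ln (\<epsilon>k k^(l + 1))" using ep by (subst ln_div) auto
   show ?thesis unfolding 3[symmetric] ln_mult_pos[OF 1 mult_pos_pos[OF l2 2]] ln_mult_pos[OF l2 2] ..
  qed
  also have "ln (\<epsilon>k k^(l + 1)) = - ((real l + 1)*\<beta>*ln (real B/real k))"
  proof -
   have "ln (\<epsilon>k k^(l + 1)) = real (l + 1)*ln (\<epsilon>k k)" by (simp only: ln_realpow)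
   also have "ln (\<epsilon>k k) = \<beta>*ln (real k/real B)" unfolding \<epsilon>k_def by (rule ln_powr)
   also have "ln (real k/real B) = - ln (real B/real k)" using k by (simp add: ln_div)
   finally show ?thesis by simp
  qed
  finally show ?thesis unfolding X_def by simp
 qed
 have Vp: "0 < (\<Prod>k\<in>{1..<B}. real (card (V k)))" using V(1,2) by (intro prod_pos) (auto simp: card_gt_0_iff)
 have Hp: "0 < (5*H^2)^(r + l)" using H by simp
 have cp: "0 < real (card \<alpha>)" using \<alpha>(1,2) by (simp add: card_gt_0_iff)
 have "ln (real (card \<alpha>)) <= ln ((\<Prod>k\<in>{1..<B}. real (card (V k)))*(5*H^2)^(r + l))"
  by (rule iffD2[OF ln_le_cancel_iff[OF cp less_le_trans[OF cp \<alpha>(4)]] \<alpha>(4)])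
 also have "... = ln (\<Prod>k\<in>{1..<B}. real (card (V k))) + ln ((5*H^2)^(r + l))" using Vp Hp by (rule ln_mult_pos)
 also have "ln (\<Prod>k\<in>{1..<B}. real (card (V k))) = (\<Sum>k\<in>{1..<B}. ln (real (card (V k))))"
  using V(1,2) by (intro ln_prod) (auto simp: card_gt_0_iff)
 also have "ln ((5*H^2)^(r + l)) = (r + l)*ln (5*H^2)" using H by (subst ln_realpow) auto
 also have "(\<Sum>k\<in>{1..<B}. ln (real (card (V k)))) <= (\<Sum>k\<in>{1..<B}. (X + 2*\<delta>*l) + (real l + 1)*\<beta>*ln (real B/real k))"
  using lnV by (intro sum_mono) auto
 also have "... = (real B - 1)*(X + 2*\<delta>*l) + (real l + 1)*\<beta>*(\<Sum>k\<in>{1..<B}. ln (real B/real k))"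
  using B by (simp add: sum.distrib sum_distrib_left of_nat_diff)
 also have "... <= B*(X + 2*\<delta>*l) + (real l + 1)*\<beta>*B"
 proof (intro add_mono mult_right_mono mult_left_mono ln_block_sum)
  show "0 <= X + 2*\<delta>*l" using X0 \<delta> by simp
  show "0 <= (real l + 1)*\<beta>" using \<beta> by (intro mult_nonneg_nonneg) auto
 qed simp
 finally have "ln (real (card \<alpha>)) <= B*(ln (H^2 + 1) + ln (20*(real l)^2/\<delta>)) + 2*\<delta>*(B*l) + \<beta>*(B*(l + 1)) + (r + l)*ln (5*H^2)"
  unfolding X_def by (simp add: algebra_simps)
 then show ?thesis using L2 \<alpha>(1,2,5) unfolding combi_def by (intro exI[of _ \<alpha>] conjI)
qed

end

section \<open>Sums of powers and logarithms\<close>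

lemma powr_step:
 fixes x s :: real
 assumes x: "x > 0" and s: "s > 1"
 shows "(x + 1) powr (- s) <= (x powr (1 - s) - (x + 1) powr (1 - s))/(s - 1)"
  "(x powr (1 - s) - (x + 1) powr (1 - s))/(s - 1) <= x powr (- s)"
proof -
 have "\<exists>z>x. z < x + 1 & (x + 1) powr (1 - s) - x powr (1 - s) = (x + 1 - x)*((1 - s)*z powr (- s))"
 proof (rule MVT2)
  fix y assume "x <= y" "y <= x + 1"
  then have "((%x. x powr (1 - s)) has_real_derivative (1 - s)*y powr (1 - s - 1)) (at y)"
   using x by (intro has_real_derivative_powr) auto
  then show "((%x. x powr (1 - s)) has_real_derivative (1 - s)*y powr (- s)) (at y)" by simp
 qed simp
 then obtain z where z: "x < z" "z < x + 1" "(x + 1) powr (1 - s) - x powr (1 - s) = (1 - s)*z powr (- s)" by auto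
 have "x powr (1 - s) - (x + 1) powr (1 - s) = (s - 1)*z powr (- s)" using z(3) by (simp add: algebra_simps)
 then have e: "(x powr (1 - s) - (x + 1) powr (1 - s))/(s - 1) = z powr (- s)" using s by simp
 show "(x + 1) powr (- s) <= (x powr (1 - s) - (x + 1) powr (1 - s))/(s - 1)"
  unfolding e using x z s by (intro powr_mono2') auto
 show "(x powr (1 - s) - (x + 1) powr (1 - s))/(s - 1) <= x powr (- s)"
  unfolding e using x z s by (intro powr_mono2') auto
qed

lemma powr_sum_upper:
 fixes s :: real
 assumes s: "s > 1" and a: "0 < a"
 shows "(\<Sum>j\<in>{a..<m}. real (j + 1) powr (- s)) <= real a powr (1 - s)/(s - 1)"
proof (cases "a <= m")
 case True
 have "(\<Sum>j\<in>{a..<m}. real (j + 1) powr (- s)) <= (\<Sum>j\<in>{a..<m}. real j powr (1 - s)/(s - 1) - real (Suc j) powr (1 - s)/(s - 1))"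
 proof (rule sum_mono)
  fix j assume "j : {a..<m}"
  then show "real (j + 1) powr (- s) <= real j powr (1 - s)/(s - 1) - real (Suc j) powr (1 - s)/(s - 1)"
   using powr_step(1)[of "real j" s] a s by (simp add: diff_divide_distrib add.commute)
 qed
 also have "... = real a powr (1 - s)/(s - 1) - real m powr (1 - s)/(s - 1)"
  using sum_Suc_diff'[OF True, of "%j. - (real j powr (1 - s)/(s - 1))"] by simp
 also have "... <= real a powr (1 - s)/(s - 1)" using s by simp
 finally show ?thesis .
qed (use s in auto)

lemma powr_sum_lower:
 fixes s :: real
 assumes s: "s > 1" and a: "a <= m"
 shows "(real (a + 3) powr (1 - s) - real (m + 3) powr (1 - s))/(s - 1) <= (\<Sum>j\<in>{a..<m}. real (j + 3) powr (- s))"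
proof -
 have "(real (a + 3) powr (1 - s) - real (m + 3) powr (1 - s))/(s - 1) =
   (\<Sum>j\<in>{a..<m}. real (j + 3) powr (1 - s)/(s - 1) - real (Suc j + 3) powr (1 - s)/(s - 1))"
  using sum_Suc_diff'[OF a, of "%j. - (real (j + 3) powr (1 - s)/(s - 1))"] by (simp add: diff_divide_distrib)
 also have "... <= (\<Sum>j\<in>{a..<m}. real (j + 3) powr (- s))"
 proof (rule sum_mono)
  fix j
  have e: "real (j + 3) + 1 = real (Suc j + 3)" by simp
  show "real (j + 3) powr (1 - s)/(s - 1) - real (Suc j + 3) powr (1 - s)/(s - 1) <= real (j + 3) powr (- s)"
   using powr_step(2)[of "real (j + 3)" s] s unfolding e diff_divide_distrib by simp
 qed
 finally show ?thesis .
qed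

text \<open>The counterpart of \<open>ln_block_sum\<close> for the lower bounds; the offset 3 is
  that of the lower bound on the modes, and it costs only a logarithm.\<close>

lemma ln_sum_lower: "real d - 3*ln (real (d + 3)) <= (\<Sum>j<d. ln (real (d + 3)/real (j + 3)))"
proof -
 have "(\<Sum>j<d. ln (real (j + 3))) <= real (d + 3)*ln (real (d + 3)) - real d"
 proof (induction d)
  case (Suc d)
  define x where "x = real (d + 3)"
  have x: "x > 0" by (simp add: x_def)
  have "ln (x/(x + 1)) <= x/(x + 1) - 1" using x by (intro ln_le_minus_one) auto
  also have "... = - (1/(x + 1))" using x by (simp add: field_simps)
  finally have "1/(x + 1) <= ln (x + 1) - ln x" using x by (simp add: ln_div)
  then have "(x + 1)*(1/(x + 1)) <= (x + 1)*(ln (x + 1) - ln x)" using x by (intro mult_left_mono) auto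
  then have "1 + x*ln x + ln x <= (x + 1)*ln (x + 1)" using x by (simp add: algebra_simps)
  moreover have "real (Suc d + 3) = x + 1" "real (Suc d) = real d + 1" by (simp_all add: x_def)
  ultimately show ?case using Suc.IH unfolding sum.lessThan_Suc x_def[symmetric] by (simp only:)
 qed simp
 moreover have "(\<Sum>j<d. ln (real (d + 3)/real (j + 3))) = real d*ln (real (d + 3)) - (\<Sum>j<d. ln (real (j + 3)))"
  by (simp add: ln_div sum_subtractf)
 moreover have "real (d + 3)*ln (real (d + 3)) = real d*ln (real (d + 3)) + 3*ln (real (d + 3))" by (simp add: distrib_right)
 ultimately show ?thesis by linarith
qed

text \<open>With \<open>u = ln D\<close>, the number of coded coordinates is about D and the parameters are: accuracy \<open>2\<^sup>-\<^sup>p\<close> of the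
 splitting with \<open>p \<approx> u\<^sup>2\<close>, grid width \<open>1/H\<close> with \<open>H = exp (u\<^sup>3)\<close>, and \<open>B \<approx> u\<^sup>4\<close> blocks. Here \<open>smallf\<close> bounds the sum of all
 negligible errors and \<open>costf\<close> the logarithm of the size of the codebook.\<close>

definition smallf :: "real => real => real => real" where
 "smallf K C D = 2 powr (- (ln D)\<^sup>2) + 6*K*((ln D)^4 + 1 + C*((ln D)^2 + 2)^2 + D)/exp ((ln D)^3) *
   (2 + 2*D + 2*(C*((ln D)^2 + 2)^2 + 1)*exp (2*C*((ln D)^2 + 2)))"

definition costf :: "real => real => real => real => real" where
 "costf \<delta> \<beta> C D = ((ln D)^4 + 1)*(ln 5 + 2*(ln D)^3 + ln (20*D^2/\<delta>)) + 2*\<delta>*D + \<beta>*(D + (ln D)^4 + 1) +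
   (C*((ln D)^2 + 2)^2 + D/(ln D)^4)*(ln 5 + 2*(ln D)^3)"

lemma smallf_eventually:
 fixes K C \<beta> \<eta> :: real
 assumes "K > 0" "C > 0" "\<beta> > 0" "\<eta> > 0"
 shows "\<forall>\<^sub>F D in at_top. smallf K C D <= \<eta>*D powr (- \<beta>)"
proof -
 have "((%D. smallf K C D/D powr (- \<beta>)) \<longlongrightarrow> 0) at_top"
  unfolding smallf_def using assms by real_asymp
 then have "\<forall>\<^sub>F D in at_top. smallf K C D/D powr (- \<beta>) < \<eta>" using assms(4) by (rule order_tendstoD)
 then show ?thesis using eventually_gt_at_top[of 0]
  by eventually_elim (simp add: divide_less_eq less_imp_le mult.commute)
qed

lemma costf_eventually:
 fixes C \<beta> \<delta> :: real
 assumes "C > 0" "\<beta> > 0" "\<delta> > 0"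
 shows "\<forall>\<^sub>F D in at_top. costf \<delta> \<beta> C D <= (\<beta> + 3*\<delta>)*D"
proof -
 have "((%D. costf \<delta> \<beta> C D/D) \<longlongrightarrow> \<beta> + 2*\<delta>) at_top"
  unfolding costf_def using assms by real_asymp
 then have "\<forall>\<^sub>F D in at_top. costf \<delta> \<beta> C D/D < \<beta> + 3*\<delta>" using assms(3) by (intro order_tendstoD) auto
 then show ?thesis using eventually_gt_at_top[of 0]
  by eventually_elim (simp add: divide_less_eq less_imp_le)
qed

lemma rank_cost_eventually:
 fixes C \<beta> \<delta> :: real
 assumes "C > 0" "\<beta> > 0" "\<delta> > 0"
 shows "\<forall>\<^sub>F D in at_top. C*((ln D)^2 + 2)^2*(ln 5 + 2*(ln D)^3) + 3*\<beta>*ln (D + 3) + ln 2 < \<delta>*D"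
 using assms by real_asymp

lemma shifted_powr_eventually:
 fixes \<gamma> \<delta> :: real
 assumes "\<gamma> > 0" "\<delta> > 0"
 shows "\<forall>\<^sub>F D in at_top. 0 < D - (ln D)^4 - 1 & (D - (ln D)^4 - 1) powr (- \<gamma>) <= (1 + \<delta>)*D powr (- \<gamma>)"
  "\<forall>\<^sub>F D in at_top. (1 - \<delta>)*D powr (- \<gamma>) <= (D + 3) powr (- \<gamma>)"
proof -
 have "((%D. (D - (ln D)^4 - 1) powr (- \<gamma>)/D powr (- \<gamma>)) \<longlongrightarrow> 1) at_top" using assms by real_asymp
 then have "\<forall>\<^sub>F D in at_top. (D - (ln D)^4 - 1) powr (- \<gamma>)/D powr (- \<gamma>) < 1 + \<delta>" using assms by (intro order_tendstoD) auto
 moreover have "\<forall>\<^sub>F D in at_top. 0 < D - (ln D)^4 - (1::real)" by real_asymp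
 ultimately show "\<forall>\<^sub>F D in at_top. 0 < D - (ln D)^4 - 1 & (D - (ln D)^4 - 1) powr (- \<gamma>) <= (1 + \<delta>)*D powr (- \<gamma>)"
  using eventually_gt_at_top[of 0] by eventually_elim (simp add: divide_less_eq less_imp_le)
 have "((%D. (D + 3) powr (- \<gamma>)/D powr (- \<gamma>)) \<longlongrightarrow> 1) at_top" using assms by real_asymp
 then have "\<forall>\<^sub>F D in at_top. 1 - \<delta> < (D + 3) powr (- \<gamma>)/D powr (- \<gamma>)" using assms by (intro order_tendstoD) auto
 then show "\<forall>\<^sub>F D in at_top. (1 - \<delta>)*D powr (- \<gamma>) <= (D + 3) powr (- \<gamma>)"
  using eventually_gt_at_top[of 0] by eventually_elim (simp add: less_divide_eq less_imp_le)
qed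

text \<open>The rank is polynomial in u = ln D and the coefficient bound at most exp (O(u^2)). Hence
  H = exp (u^3) outgrows both, while ln H remains polynomial in u; and 2^-p with p >= u^2 is below
  every power of D.\<close>

lemma parameter_bounds:
 fixes D :: real and C p r :: nat
 assumes p: "p = nat \<lceil>(ln D)^2\<rceil>" and r: "r <= C*(p + 1)^2"
 shows "real r <= (real C + 1)*((ln D)^2 + 2)^2" "(2^(C*(p + 1)))^2 <= exp (2*(real C + 1)*((ln D)^2 + 2))"
  "1/2^p <= 2 powr (- (ln D)\<^sup>2)"
proof -
 have p1: "(ln D)^2 <= real p" "real p <= (ln D)^2 + 1" unfolding p using zero_le_power2[of "ln D"] by linarith+
 have "real r <= real (C*(p + 1)^2)" using r by (simp only: of_nat_le_iff)
 also have "... = real C*(real p + 1)^2" by simp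
 also have "... <= (real C + 1)*((ln D)^2 + 2)^2" using p1 by (intro mult_mono power_mono) auto
 finally show "real r <= (real C + 1)*((ln D)^2 + 2)^2" .
 have "(2^(C*(p + 1)))^2 = (2::real)^(2*C*(p + 1))" by (simp only: power_mult[symmetric] mult_ac)
 also have "... <= exp 1^(2*C*(p + 1))" using exp_ge_add_one_self[of 1] by (intro power_mono) auto
 also have "... = exp (real (2*C*(p + 1)))" by (simp only: exp_of_nat_mult[symmetric] mult_1_right)
 also have "... <= exp (2*(real C + 1)*((ln D)^2 + 2))"
 proof -
  have "real (2*C*(p + 1)) = 2*real C*(real p + 1)" by (simp only: of_nat_mult of_nat_add of_nat_1 of_nat_numeral)
  also have "... <= 2*(real C + 1)*((ln D)^2 + 2)" using p1 by (intro mult_mono) auto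
  finally show ?thesis by simp
 qed
 finally show "(2^(C*(p + 1)))^2 <= exp (2*(real C + 1)*((ln D)^2 + 2))" .
 have "1/2^p = 2 powr (- real p)" by (simp add: powr_minus_divide powr_realpow)
 also have "... <= 2 powr (- (ln D)\<^sup>2)" using p1 by (intro powr_mono) auto
 finally show "1/2^p <= 2 powr (- (ln D)\<^sup>2)" .
qed

lemma powr_neg_half_square:
 fixes x :: real
 assumes "x > 0" shows "(x powr (- (\<beta> - 1/2)))^2 = x powr (1 - 2*\<beta>)"
proof -
 have "(x powr (- (\<beta> - 1/2)))^2 = x powr (- (\<beta> - 1/2))*x powr (- (\<beta> - 1/2))" by (rule power2_eq_square)
 also have "... = x powr (1 - 2*\<beta>)" by (simp add: powr_add[symmetric])
 finally show ?thesis .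
qed

text \<open>The form in which \<beta>/\<rho> arises: 1 from the coded coordinates at the common
  level, 1/(2\<beta> - 1) from the tail sum of squares.\<close>

lemma sqrt_ratio:
 assumes "\<rho> > 0" "\<beta> = \<rho> + 1/2"
 shows "1 <= sqrt (\<beta>/\<rho>)" "(sqrt (\<beta>/\<rho>))^2 = 1 + 1/(2*\<beta> - 1)"
 using assms by (auto simp: field_simps)

text \<open>One codebook gives both bounds. \<open>costf\<close> controls the logarithm of its size,
  and \<open>smallf\<close> all errors apart from the leading one.\<close>

lemma upper_bounds:
 fixes M :: "'a measure"
 assumes r0: "\<rho> > 0" and \<beta>\<rho>: "\<beta> = \<rho> + 1/2" and BM: "std_BM M W" and X: "RL_process \<rho> M W X" and \<delta>: "0 < \<delta>" "\<delta> <= 1"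
 defines "c \<equiv> Gamma \<beta>/pi powr \<beta>"
 shows "\<forall>\<^sub>F D in at_top. \<forall>n. (\<beta> + 3*\<delta>)*D <= ln (real n) -->
  entropy_number (U_rho \<rho>) n <= ((1 + 3*\<delta>)*(1 + \<delta>) + \<delta>)*c*D powr (- \<beta>) &
  quant_error M X n <= ((1 + 3*\<delta>)*(1 + \<delta>) + \<delta>)*(c * sqrt (\<beta>/\<rho>))*D powr (- (\<beta> - 1/2))"
proof -
 have b: "\<beta> > 1/2" using r0 \<beta>\<rho> by simp
 have c0: "c > 0" unfolding c_def using b by (simp add: Gamma_real_pos)
 obtain C :: nat where C: "\<And>n m0. \<exists>m N r \<theta> \<mu> b v. m0 <= m & r <= C*(n + 1)^2 & rl_split \<beta> (1/2^n) (2^(C*(n + 1))) m N r \<theta> \<mu> b v"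
  using kernel_decomposition[OF b] by blast
 define K where "K = c + 3"
 define C' where "C' = real C + 1"
 have K: "K > 0" "K >= 3" "K >= c" using c0 by (auto simp: K_def)
 have C'0: "C' > 0" by (simp add: C'_def)
 have ev2: "\<forall>\<^sub>F D in at_top. (D/((ln D)^4 + 1) - 1)*\<delta>^2 >= 6" using \<delta> by real_asymp
 have ev3: "\<forall>\<^sub>F D in at_top. costf \<delta> \<beta> C' D <= (\<beta> + 3*\<delta>)*D" using C'0 b \<delta> by (intro costf_eventually) auto
 have ev4: "\<forall>\<^sub>F D in at_top. smallf K C' D <= (\<delta>*c)*D powr (- \<beta>)" using K C'0 b \<delta> c0 by (intro smallf_eventually) auto
 have ev5: "\<forall>\<^sub>F D in at_top. 0 < D - (ln D)^4 - 1 & (D - (ln D)^4 - 1) powr (- \<beta>) <= (1 + \<delta>)*D powr (- \<beta>)"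
  using b \<delta> by (intro shifted_powr_eventually) auto
 have ev6: "\<forall>\<^sub>F D in at_top. 0 < D - (ln D)^4 - 1 & (D - (ln D)^4 - 1) powr (- (\<beta> - 1/2)) <= (1 + \<delta>)*D powr (- (\<beta> - 1/2))"
  using b \<delta> by (intro shifted_powr_eventually) auto
 show ?thesis
  using eventually_ge_at_top[of "exp 1"] ev2 ev3 ev4 ev5 ev6
 proof eventually_elim
  case (elim D)
  note D = elim
  define u where "u = ln D"
  have D0: "D > 0" using D(1) exp_gt_zero[of 1] by linarith
  have D1: "D >= 1" using D(1) exp_ge_add_one_self[of 1] by linarith
  have u1: "u >= 1" unfolding u_def using D(1) D0 by (simp add: ln_ge_iff)
  define p where "p = nat \<lceil>(ln D)^2\<rceil>"
  define H where "H = exp (u^3)"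
  have H1: "H >= 1" unfolding H_def using u1 by simp
  \<comment> \<open>B and l are rounded so that B*l lies between D - u^4 - 1 and D. The blocks must
    be long for the random coding, and numerous so that block 0, coded on the grid, stays
    cheap.\<close>
  define B where "B = nat \<lceil>u^4\<rceil>"
  have u4: "u^4 >= 1" using u1 by simp
  have B: "u^4 <= real B" "real B <= u^4 + 1" unfolding B_def using u4 by linarith+
  have B0: "B > 0" "real B > 0" using B u4 by (auto intro: gr0I)
  define l where "l = nat \<lfloor>D/B\<rfloor>"
  have DB: "0 <= D/B" using D0 by simp
  have l: "real l <= D/B" "D/B - 1 <= real l" unfolding l_def using DB by linarith+
  have Bl: "real (B*l) <= D" "D - u^4 - 1 <= real (B*l)"
  proof -
   have "real B*real l <= real B*(D/B)" using l by (intro mult_left_mono) auto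
   then show "real (B*l) <= D" using B0 by simp
   have "real B*(D/B - 1) <= real B*real l" using l by (intro mult_left_mono) auto
   then show "D - u^4 - 1 <= real (B*l)" using B0 B(2) by (simp add: right_diff_distrib)
  qed
  have "0 < D - u^4 - 1" using D(5) by (simp only: u_def)
  then have Blp: "0 < real (B*l)" "0 < D - u^4 - 1" using Bl(2) by linarith+
  have Bln: "0 < B*l" using Blp(1) by (simp only: of_nat_0_less_iff)
  have l6: "real l*\<delta>^2 >= 6"
  proof -
   have "D/(u^4 + 1) <= D/B" using B B0 D0 by (intro divide_left_mono) auto
   then have "(D/(u^4 + 1) - 1)*\<delta>^2 <= real l*\<delta>^2" using l by (intro mult_right_mono) auto
   then show ?thesis using D(2) by (simp add: u_def)
  qed
  have lu: "real l <= D/u^4" using l(1) divide_left_mono[OF B(1), of D] D0 u4 B0 by (meson less_imp_le order_trans zero_less_mult_iff less_le_trans zero_less_one)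
  have "D/u^4 <= D/1" using D0 u4 by (intro divide_left_mono) auto
  then have lD: "real l <= D" using lu by simp
  obtain m N r \<theta> \<mu> b v where S: "B*l <= m" "r <= C*(p + 1)^2" "rl_split \<beta> (1/2^p) (2^(C*(p + 1))) m N r \<theta> \<mu> b v"
   using C[of "B*l" p] by blast
  interpret S: rl_split \<beta> "1/2^p" "2^(C*(p + 1))" m N r \<theta> \<mu> b v by (rule S(3))
  note pb = parameter_bounds[OF p_def S(2), folded C'_def u_def]
  define R where "R = C'*(u^2 + 2)^2"
  define Xe where "Xe = exp (2*C'*(u^2 + 2))"
  define Z where "Z = 2 + 2*D + 2*(R + 1)*Xe"
  have R: "real r <= R" "R >= 0" using pb(1) C'0 by (auto simp: R_def)
  have Xe: "(2^(C*(p + 1)))^2 <= Xe" "Xe > 0" using pb(2) by (auto simp: Xe_def)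
  have rX: "real r*(2^(C*(p + 1)))^2 <= (R + 1)*Xe" using R Xe by (intro mult_mono) auto
  have RX0: "0 <= (R + 1)*Xe" using R Xe by simp
  define E where "E = (1 + 3*\<delta>)*(c*real (B*l) powr (- \<beta>))"
  have E0: "E >= 0" unfolding E_def using \<delta> c0 by simp
  define \<kappa> where "\<kappa> = 6*K*real (B + r + l)/H"
  have \<kappa>0: "\<kappa> >= 0" unfolding \<kappa>_def using K H1 by simp
  have \<kappa>: "\<kappa> <= 6*K*(u^4 + 1 + R + D)/H"
   unfolding \<kappa>_def using K H1 B(2) R(1) lD by (intro divide_right_mono mult_left_mono) auto
  \<comment> \<open>\<open>Z\<close> dominates the factor of \<kappa> in both applications, the
    deterministic and the random one, so the two share this estimate.\<close>
  have small: "1/2^p + \<kappa>*Y <= (\<delta>*c)*D powr (- \<beta>)" if "0 <= Y" "Y <= Z" for Y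
  proof -
   have "\<kappa>*Y <= 6*K*(u^4 + 1 + R + D)/H*Z" using \<kappa> \<kappa>0 that by (intro mult_mono) auto
   then have "1/2^p + \<kappa>*Y <= smallf K C' D"
    using pb(3) unfolding smallf_def Z_def R_def Xe_def H_def u_def by linarith
   then show ?thesis using D(4) by linarith
  qed
  obtain \<alpha> where \<alpha>: "\<alpha> \<subseteq> L2_01" "finite \<alpha>" "\<alpha> ~= {}"
   "ln (real (card \<alpha>)) <= real B*(ln (H^2 + 1) + ln (20*(real l)^2/\<delta>)) + 2*\<delta>*real (B*l) + \<beta>*real (B*(l + 1)) + real (r + l)*ln (5*H^2)"
   "\<forall>y z. \<exists>a\<in>\<alpha>. nm I01 (%t. S.combi y z t - a t) <=
    sqrt (E^2*(\<Sum>j<B*l. (y j)^2) + (\<Sum>j\<in>{B*l..<m}. (\<mu> j*y j)^2)) + \<kappa>*(1 + (\<Sum>j<B*l. (y j)^2) + (\<Sum>i<r. (z i)^2))"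
   using S.upper_codebook[OF \<delta> H1 B0(1) S(1) l6 K(2) K(3)[unfolded c_def], folded c_def, folded E_def \<kappa>_def]
   by (elim exE conjE, intro that)
  have l1: "real l > 0" using l6 \<delta> by (metis mult_zero_left not_numeral_le_zero of_nat_0_less_iff gr0I of_nat_0)
  have lnH: "ln (5*H^2) = ln 5 + 2*u^3" using H1 by (simp add: ln_mult ln_realpow H_def)
  have lnH1: "ln (H^2 + 1) <= ln 5 + 2*u^3"
  proof -
   have "1 <= H^2" using H1 by simp
   then have "ln (H^2 + 1) <= ln (5*H^2)" by (intro iffD2[OF ln_le_cancel_iff]) auto
   then show ?thesis unfolding lnH .
  qed
  have lnl: "ln (20*(real l)^2/\<delta>) <= ln (20*D^2/\<delta>)"
   using l1 lD D0 \<delta> by (intro iffD2[OF ln_le_cancel_iff]) (auto intro!: divide_right_mono power_mono)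
  have ln0: "0 <= ln 5 + 2*u^3 + ln (20*D^2/\<delta>)"
  proof -
   have "1 <= D^2" using D1 by simp
   then have "1 <= 20*D^2/\<delta>" using \<delta> by (simp add: le_divide_eq)
   then show ?thesis using u1 by (intro add_nonneg_nonneg ln_ge_zero) auto
  qed
  have "ln (real (card \<alpha>)) <= costf \<delta> \<beta> C' D"
  proof -
   have 1: "real B*(ln (H^2 + 1) + ln (20*(real l)^2/\<delta>)) <= (u^4 + 1)*(ln 5 + 2*u^3 + ln (20*D^2/\<delta>))"
   proof -
    have "real B*(ln (H^2 + 1) + ln (20*(real l)^2/\<delta>)) <= real B*(ln 5 + 2*u^3 + ln (20*D^2/\<delta>))"
     using lnH1 lnl by (intro mult_left_mono) auto
    also have "... <= (u^4 + 1)*(ln 5 + 2*u^3 + ln (20*D^2/\<delta>))" using B(2) ln0 by (intro mult_right_mono)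
    finally show ?thesis .
   qed
   have 2: "2*\<delta>*real (B*l) <= 2*\<delta>*D" using Bl(1) \<delta> by (intro mult_left_mono) auto
   have 3: "\<beta>*real (B*(l + 1)) <= \<beta>*(D + u^4 + 1)"
   proof (rule mult_left_mono)
    have "real (B*(l + 1)) = real (B*l) + real B" by (simp add: distrib_left)
    then show "real (B*(l + 1)) <= D + u^4 + 1" using Bl(1) B(2) by linarith
   qed (use b in simp)
   have 4: "real (r + l)*ln (5*H^2) <= (R + D/u^4)*(ln 5 + 2*u^3)"
    unfolding lnH using R(1) lu u1 by (intro mult_right_mono) auto
   show ?thesis using \<alpha>(4) 1 2 3 4 unfolding costf_def u_def[symmetric] R_def by linarith
  qed
  then have card: "ln (real (card \<alpha>)) <= (\<beta> + 3*\<delta>)*D" using D(3) by linarith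
  show ?case
  proof (intro allI impI)
   fix n assume n: "(\<beta> + 3*\<delta>)*D <= ln (real n)"
   have "0 < (\<beta> + 3*\<delta>)*D" using b \<delta> D0 by (intro mult_pos_pos) auto
   then have n0: "0 < real n" using n by (cases "n = 0") auto
   have cp: "0 < real (card \<alpha>)" using \<alpha>(2,3) by (simp add: card_gt_0_iff)
   have "real (card \<alpha>) <= real n" using card n ln_le_cancel_iff[OF cp n0] by linarith
   then have \<alpha>n: "\<alpha> : codebooks n" using \<alpha>(1,2,3) by (simp add: codebooks_def)
   have muE: "\<mu> j <= E" if "B*l <= j" "j < m" for j
   proof -
    have "\<mu> j <= c*real (B*l) powr (- \<beta>)" unfolding c_def using that Blp by (intro S.\<mu>_le) (auto simp del: of_nat_mult)
    also have "... <= E" unfolding E_def using \<delta> c0 by (simp add: mult_left_le_one_le mult_right_mono distrib_right)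
    finally show ?thesis .
   qed
   note code = \<alpha>(5)[rule_format]
   have "(real (B*l)) powr (- \<beta>) <= (D - u^4 - 1) powr (- \<beta>)" using Bl Blp b by (intro powr_mono2') auto
   also have "... <= (1 + \<delta>)*D powr (- \<beta>)" using D(5) by (simp add: u_def)
   finally have pB: "(real (B*l)) powr (- \<beta>) <= (1 + \<delta>)*D powr (- \<beta>)" .
   have Ele: "E <= (1 + 3*\<delta>)*(c*((1 + \<delta>)*D powr (- \<beta>)))" unfolding E_def using \<delta> c0 pB by (intro mult_left_mono) auto
   have "entropy_number (U_rho \<rho>) n <= 1/2^p + E + \<kappa>*(2 + real r*(2^(C*(p + 1)))^2)"
    by (rule S.entropy_upper[OF \<beta>\<rho> \<alpha>n S(1) \<kappa>0 E0 muE code])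
   moreover have "1/2^p + \<kappa>*(2 + real r*(2^(C*(p + 1)))^2) <= (\<delta>*c)*D powr (- \<beta>)"
   proof (rule small)
    show "2 + real r*(2^(C*(p + 1)))^2 <= Z" using rX RX0 D0 unfolding Z_def mult.assoc by linarith
   qed simp
   ultimately have "entropy_number (U_rho \<rho>) n <= (1 + 3*\<delta>)*(c*((1 + \<delta>)*D powr (- \<beta>))) + (\<delta>*c)*D powr (- \<beta>)"
    using Ele by linarith
   then have ent: "entropy_number (U_rho \<rho>) n <= ((1 + 3*\<delta>)*(1 + \<delta>) + \<delta>)*c*D powr (- \<beta>)" by (simp add: algebra_simps)
   define g where "g = sqrt (\<beta>/\<rho>)"
   have g: "1 <= g" "g^2 = 1 + 1/(2*\<beta> - 1)" unfolding g_def using sqrt_ratio[OF r0 \<beta>\<rho>] by auto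
   define P where "P = real (B*l) powr (- (\<beta> - 1/2))"
   have P2: "P^2 = real (B*l) powr (1 - 2*\<beta>)" unfolding P_def by (rule powr_neg_half_square[OF Blp(1)])
   have P0: "P >= 0" by (simp add: P_def)
   have EB: "E^2*real (B*l) = (1 + 3*\<delta>)^2*c^2*P^2"
   proof -
    have "(real (B*l) powr (- \<beta>))^2*real (B*l) = P^2"
    proof -
     have "(real (B*l) powr (- \<beta>))^2*real (B*l) = real (B*l) powr (- \<beta>)*real (B*l) powr (- \<beta>)*real (B*l) powr 1"
      using Blp by (simp add: power2_eq_square del: of_nat_mult)
     also have "... = real (B*l) powr (1 - 2*\<beta>)"
     proof -
      have e: "- \<beta> + - \<beta> + 1 = 1 - 2*\<beta>" by simp
      show ?thesis by (simp only: powr_add[symmetric] e)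
     qed
     finally show ?thesis unfolding P2 .
    qed
    then show ?thesis unfolding E_def power_mult_distrib by (simp only: mult.assoc)
   qed
   have mus: "(\<Sum>j\<in>{B*l..<m}. (\<mu> j)^2) <= c^2*(P^2/(2*\<beta> - 1))"
   proof -
    have "(\<Sum>j\<in>{B*l..<m}. (\<mu> j)^2) <= (\<Sum>j\<in>{B*l..<m}. c^2*real (j + 1) powr (- (2*\<beta>)))"
    proof (rule sum_mono)
     fix j assume "j : {B*l..<m}"
     then have j: "j < m" by simp
     have "(\<mu> j)^2 <= (c*real (j + 1) powr (- \<beta>))^2"
      using S.\<mu>(2)[OF j] S.\<mu>_pos[OF j] unfolding c_def by (intro power_mono) auto
     also have "... = c^2*real (j + 1) powr (- (2*\<beta>))"
      by (simp add: power_mult_distrib power2_eq_square powr_add[symmetric])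
     finally show "(\<mu> j)^2 <= c^2*real (j + 1) powr (- (2*\<beta>))" .
    qed
    also have "... = c^2*(\<Sum>j\<in>{B*l..<m}. real (j + 1) powr (- (2*\<beta>)))" by (simp only: sum_distrib_left)
    also have "... <= c^2*(P^2/(2*\<beta> - 1))"
     unfolding P2 using b Bln by (intro mult_left_mono powr_sum_upper) auto
    finally show ?thesis .
   qed
   \<comment> \<open>Coded part P^2 and tail P^2/(2\<beta> - 1) combine to g^2 P^2. Only the first
     carries (1 + 3\<delta>)^2, and giving it to the tail as well costs nothing in the
     limit.\<close>
   have "E^2*real (B*l) + (\<Sum>j\<in>{B*l..<m}. (\<mu> j)^2) <= ((1 + 3*\<delta>)*(c*g)*P)^2"
   proof -
    have "1 <= (1 + 3*\<delta>)^2" using \<delta> by (intro one_le_power) auto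
    then have "1*(c^2*(P^2/(2*\<beta> - 1))) <= (1 + 3*\<delta>)^2*(c^2*(P^2/(2*\<beta> - 1)))" using b by (intro mult_right_mono) auto
    then have "E^2*real (B*l) + (\<Sum>j\<in>{B*l..<m}. (\<mu> j)^2) <= (1 + 3*\<delta>)^2*c^2*P^2 + (1 + 3*\<delta>)^2*(c^2*(P^2/(2*\<beta> - 1)))"
     using mus unfolding EB by linarith
    also have "... = (1 + 3*\<delta>)^2*(c^2*g^2)*P^2" unfolding g(2) by (simp add: algebra_simps)
    finally show ?thesis by (simp only: power_mult_distrib)
   qed
   then have "sqrt (E^2*real (B*l) + (\<Sum>j\<in>{B*l..<m}. (\<mu> j)^2)) <= sqrt (((1 + 3*\<delta>)*(c*g)*P)^2)" by (rule real_sqrt_le_mono)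
   also have "... = (1 + 3*\<delta>)*(c*g)*P" using \<delta> c0 g P0 by simp
   also have "... <= (1 + 3*\<delta>)*(c*g)*((1 + \<delta>)*D powr (- (\<beta> - 1/2)))"
   proof (rule mult_left_mono)
    have "P <= (D - u^4 - 1) powr (- (\<beta> - 1/2))" unfolding P_def using Bl Blp b by (intro powr_mono2') auto
    also have "... <= (1 + \<delta>)*D powr (- (\<beta> - 1/2))" using D(6) by (simp add: u_def)
    finally show "P <= (1 + \<delta>)*D powr (- (\<beta> - 1/2))" .
   qed (use \<delta> c0 g in simp)
   finally have q1: "sqrt (E^2*real (B*l) + (\<Sum>j\<in>{B*l..<m}. (\<mu> j)^2)) <= (1 + 3*\<delta>)*(c*g)*((1 + \<delta>)*D powr (- (\<beta> - 1/2)))" .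
   have s3: "sqrt 3 <= 2" by (rule real_le_lsqrt) auto
   have "sqrt 3*real (B*l) <= 2*D" using s3 Bl(1) D0 by (intro mult_mono) auto
   moreover have "sqrt 3*(real r*(2^(C*(p + 1)))^2) <= 2*((R + 1)*Xe)" by (rule mult_mono[OF s3 rX]) auto
   ultimately have "1 + sqrt 3*real (B*l) + sqrt 3*real r*(2^(C*(p + 1)))^2 <= Z"
    unfolding Z_def mult.assoc by linarith
   then have q2: "1/2^p + \<kappa>*(1 + sqrt 3*real (B*l) + sqrt 3*real r*(2^(C*(p + 1)))^2) <= (\<delta>*c)*D powr (- \<beta>)"
    by (intro small) auto
   have q3: "(\<delta>*c)*D powr (- \<beta>) <= \<delta>*(c*g)*D powr (- (\<beta> - 1/2))"
   proof -
    have "(\<delta>*c)*1 <= (\<delta>*c)*g" using g(1) \<delta> c0 by (intro mult_left_mono) auto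
    then have g1: "\<delta>*c <= \<delta>*c*g" by simp
    have "D powr (- \<beta>) <= D powr (- (\<beta> - 1/2))" using D1 by (intro powr_mono) auto
    from mult_mono[OF g1 this] have "(\<delta>*c)*D powr (- \<beta>) <= ((\<delta>*c)*g)*D powr (- (\<beta> - 1/2))" using \<delta> c0 g by simp
    then show ?thesis by (simp only: mult.assoc)
   qed
   have "quant_error M X n <= 1/2^p + sqrt (E^2*real (B*l) + (\<Sum>j\<in>{B*l..<m}. (\<mu> j)^2)) + \<kappa>*(1 + sqrt 3*real (B*l) + sqrt 3*real r*(2^(C*(p + 1)))^2)"
    by (rule S.quant_upper[OF BM X \<beta>\<rho> \<alpha>n S(1) \<kappa>0 code])
   then have "quant_error M X n <= (1 + 3*\<delta>)*(c*g)*((1 + \<delta>)*D powr (- (\<beta> - 1/2))) + \<delta>*(c*g)*D powr (- (\<beta> - 1/2))"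
    using q1 q2 q3 by linarith
   then have "quant_error M X n <= ((1 + 3*\<delta>)*(1 + \<delta>) + \<delta>)*(c*g)*D powr (- (\<beta> - 1/2))" by (simp add: algebra_simps)
   then show "entropy_number (U_rho \<rho>) n <= ((1 + 3*\<delta>)*(1 + \<delta>) + \<delta>)*c*D powr (- \<beta>) &
    quant_error M X n <= ((1 + 3*\<delta>)*(1 + \<delta>) + \<delta>)*(c * sqrt (\<beta>/\<rho>))*D powr (- (\<beta> - 1/2))"
    using ent unfolding g_def by blast
  qed
 qed
qed

text \<open>\<open>d\<close> counts coordinates. About \<beta> d is the entropy of d modes relative
  to the level of the d-th one, so a code with ln n <= (\<beta> - 2\<delta>) d is too small; the
  margin 2\<delta>d covers the shell, the low-rank grid and the logarithmic terms.\<close>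

lemma lower_bounds:
 fixes M :: "'a measure"
 assumes r0: "\<rho> > 0" and \<beta>\<rho>: "\<beta> = \<rho> + 1/2" and BM: "std_BM M W" and X: "RL_process \<rho> M W X" and \<delta>: "0 < \<delta>" "\<delta> < 1"
 defines "c \<equiv> Gamma \<beta>/pi powr \<beta>"
 shows "\<forall>\<^sub>F d in sequentially. \<forall>n\<ge>1. ln (real n) <= (\<beta> - 2*\<delta>)*real d -->
  ((1 - \<delta>)/sqrt (1 + \<delta>) - \<delta>)*c*real d powr (- \<beta>) <= entropy_number (U_rho \<rho>) n &
  ((1 - \<delta>)^2 - \<delta>)*(c * sqrt (\<beta>/\<rho>))*real d powr (- (\<beta> - 1/2)) <= quant_error M X n"
proof -
 have b: "\<beta> > 1/2" using r0 \<beta>\<rho> by simp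
 have c0: "c > 0" unfolding c_def using b by (simp add: Gamma_real_pos)
 obtain C :: nat where C: "\<And>n m0. \<exists>m N r \<theta> \<mu> b v. m0 <= m & r <= C*(n + 1)^2 & rl_split \<beta> (1/2^n) (2^(C*(n + 1))) m N r \<theta> \<mu> b v"
  using kernel_decomposition[OF b] by blast
 define K where "K = c + 3"
 define C' where "C' = real C + 1"
 have K: "K > 0" "K >= 3" "K >= c" using c0 by (auto simp: K_def)
 have C'0: "C' > 0" by (simp add: C'_def)
 obtain d0 where d0: "d0 > 0" "\<forall>d\<ge>d0. \<forall>(M :: 'a measure) \<eta>. gauss_system M d \<eta> -->
  measure M {\<omega> : space M. (1 - \<delta>)*d <= (\<Sum>j<d. (\<eta> j \<omega>)^2) & (\<Sum>j<d. (\<eta> j \<omega>)^2) <= (1 + \<delta>)*d} >= 1/2"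
  using gauss_norm_concentration[OF \<delta>(1)] by (elim exE conjE, intro that)
 note seq = eventually_compose_filterlim[OF _ filterlim_real_sequentially]
 have ev1: "\<forall>\<^sub>F d in sequentially. real d >= exp 1" by (rule seq) (rule eventually_ge_at_top)
 have ev2: "\<forall>\<^sub>F d in sequentially. smallf K C' (real d) <= (\<delta>*c)*real d powr (- \<beta>)"
  by (rule seq) (use K C'0 b \<delta> c0 in \<open>auto intro!: smallf_eventually\<close>)
 have ev3: "\<forall>\<^sub>F d in sequentially. C'*((ln (real d))^2 + 2)^2*(ln 5 + 2*(ln (real d))^3) + 3*\<beta>*ln (real d + 3) + ln 2 < \<delta>*real d"
  by (rule seq) (use C'0 b \<delta> in \<open>auto intro!: rank_cost_eventually\<close>)
 have ev4: "\<forall>\<^sub>F d in sequentially. (1 - \<delta>)*real d powr (- \<beta>) <= (real d + 3) powr (- \<beta>)"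
  by (rule seq) (use b \<delta> in \<open>auto intro!: shifted_powr_eventually\<close>)
 have ev5: "\<forall>\<^sub>F d in sequentially. (1 - \<delta>)*real d powr (- (\<beta> - 1/2)) <= (real d + 3) powr (- (\<beta> - 1/2))"
  by (rule seq, rule shifted_powr_eventually) (use b \<delta> in auto)
 have ev6: "\<forall>\<^sub>F d in sequentially. (1 - \<delta>)^2*(real d + 3) <= real d"
 proof -
  have "(1 - \<delta>)^2 < 1" using \<delta> by (simp add: power_less_one_iff)
  then have "\<forall>\<^sub>F d in sequentially. a*(real d + 3) <= real d" if "a = (1 - \<delta>)^2" for a
   unfolding that[symmetric] using that by real_asymp
  then show ?thesis by blast
 qed
 show ?thesis
  using ev1 ev2 ev3 ev4 ev5 ev6 eventually_ge_at_top[of d0]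
 proof eventually_elim
  case (elim d)
  note D = elim
  define x where "x = real d"
  define u where "u = ln x"
  have x0: "x > 0" using D(1) exp_gt_zero[of 1] unfolding x_def by linarith
  have x1: "x >= 1" using D(1) exp_ge_add_one_self[of 1] unfolding x_def by linarith
  have d0': "0 < d" using x0 by (simp add: x_def)
  have u1: "u >= 1" unfolding u_def using D(1) x0 by (simp add: ln_ge_iff x_def)
  define p where "p = nat \<lceil>(ln x)^2\<rceil>"
  define H where "H = exp (u^3)"
  have H1: "H >= 1" unfolding H_def using u1 by simp
  \<comment> \<open>The tail of variances is cut off at m; m is taken so large that the missing part
    is less than the fraction \<delta>.\<close>
  have lim: "((%m. real (m + 3) powr (1 - 2*\<beta>)) \<longlongrightarrow> 0) sequentially" using b by real_asymp
  have "0 < \<delta>*(x + 3) powr (1 - 2*\<beta>)" using \<delta> x0 by simp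
  from order_tendstoD(2)[OF lim this] obtain m1 where m1: "\<And>m. m >= m1 ==> real (m + 3) powr (1 - 2*\<beta>) < \<delta>*(x + 3) powr (1 - 2*\<beta>)"
   unfolding eventually_sequentially by blast
  obtain m N r \<theta> \<mu> b v where S: "max d m1 <= m" "r <= C*(p + 1)^2" "rl_split \<beta> (1/2^p) (2^(C*(p + 1))) m N r \<theta> \<mu> b v"
   using C[of "max d m1" p] by blast
  interpret S: rl_split \<beta> "1/2^p" "2^(C*(p + 1))" m N r \<theta> \<mu> b v by (rule S(3))
  have dm: "d <= m" "m1 <= m" using S(1) by auto
  note pb = parameter_bounds[OF p_def S(2), folded C'_def u_def]
  define R where "R = C'*(u^2 + 2)^2"
  define Xe where "Xe = exp (2*C'*(u^2 + 2))"
  define Z where "Z = 2 + 2*x + 2*(R + 1)*Xe"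
  have R: "real r <= R" "R >= 0" using pb(1) C'0 by (auto simp: R_def)
  have Xe: "(2^(C*(p + 1)))^2 <= Xe" "Xe >= 1" using pb(2) C'0 by (auto simp: Xe_def)
  have rX: "real r*(2^(C*(p + 1)))^2 <= R*Xe" using R Xe by (intro mult_mono) auto
  have RX: "R <= R*Xe" using mult_left_mono[OF Xe(2) R(2)] by simp
  have small: "1/2^p + 3/H*Y <= (\<delta>*c)*x powr (- \<beta>)" if Y: "Y <= 3*(R*Xe)" for Y
  proof -
   have RX0: "0 <= R*Xe" using R Xe by simp
   have Z: "2*(R*Xe) <= Z" unfolding Z_def using x0 Xe by (simp add: algebra_simps)
   have "3*Y <= 18*(1*(2*(R*Xe)))" using Y RX0 by linarith
   also have "... <= (6*K)*((u^4 + 1 + R + x)*Z)"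
    using K Z RX0 R x0 u1 by (intro mult_mono) auto
   finally have "3*Y/H <= (6*K)*((u^4 + 1 + R + x)*Z)/H" using H1 by (intro divide_right_mono) auto
   then have "3/H*Y <= 6*K*(u^4 + 1 + R + x)/H*Z" by (simp add: mult_ac)
   then have "1/2^p + 3/H*Y <= smallf K C' x"
    using pb(3) unfolding smallf_def Z_def R_def Xe_def H_def u_def by linarith
   then show ?thesis using D(2) unfolding x_def by linarith
  qed
  have lnH: "ln (5*H^2) = ln 5 + 2*u^3" using H1 by (simp add: ln_mult ln_realpow H_def)
  have rl: "real r*ln (5*H^2) <= R*(ln 5 + 2*u^3)" unfolding lnH using R(1) u1 by (intro mult_right_mono) auto
  have e3: "R*(ln 5 + 2*u^3) + 3*\<beta>*ln (x + 3) + ln 2 < \<delta>*x" using D(3) unfolding R_def u_def x_def .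
  have xd: "real (d + 3) = x + 3" by (simp add: x_def)
  define LS where "LS = (\<Sum>j<d. ln (real (d + 3)/real (j + 3)))"
  have LS: "\<beta>*(x - 3*ln (x + 3)) <= \<beta>*LS" unfolding LS_def using ln_sum_lower[of d] b by (intro mult_left_mono) (auto simp: x_def)
  have LS': "\<beta>*x - 3*\<beta>*ln (x + 3) <= \<beta>*LS" using LS by (simp add: algebra_simps)
  have mulo: "c*real (j + 3) powr (- \<beta>) <= \<mu> j" if "j < m" for j using S.\<mu>(1)[OF that] by (simp only: c_def)
  show ?case
  proof (intro allI impI)
   fix n :: nat assume n1: "n >= 1" and n: "ln (real n) <= (\<beta> - 2*\<delta>)*real d"
   have n': "ln (real n) <= \<beta>*x - 2*(\<delta>*x)" using n by (simp add: x_def algebra_simps)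
   have ent: "((1 - \<delta>)/sqrt (1 + \<delta>) - \<delta>)*c*real d powr (- \<beta>) <= entropy_number (U_rho \<rho>) n"
   proof (rule le_entropy_number[OF r0 n1])
    fix \<alpha> s assume \<alpha>: "\<alpha> : codebooks n" and s0: "0 <= s" and s: "\<And>x. x : U_rho \<rho> ==> dist_to \<alpha> x <= s"
    show "((1 - \<delta>)/sqrt (1 + \<delta>) - \<delta>)*c*real d powr (- \<beta>) <= s"
    proof (rule ccontr)
     assume "\<not> ?thesis"
     then have s1: "s < ((1 - \<delta>)/sqrt (1 + \<delta>) - \<delta>)*c*x powr (- \<beta>)" by (simp add: x_def)
     define q where "q = sqrt (1 + \<delta>)"
     have q: "q >= 1" using \<delta> by (simp add: q_def)
     \<comment> \<open>Large enough to exceed \<open>s\<close> plus all small errors, and small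
       enough that \<open>e * sqrt (1 + \<delta>)\<close> stays below each of the first d modes, as
       the covering bound requires.\<close>
     define e where "e = c*(x + 3) powr (- \<beta>)/q"
     have e0: "e > 0" unfolding e_def using c0 q x0 by simp
     have "(1 - \<delta>)*x powr (- \<beta>) <= (x + 3) powr (- \<beta>)" using D(4) by (simp add: x_def)
     then have "c*((1 - \<delta>)*x powr (- \<beta>))/q <= e" unfolding e_def using c0 q by (intro divide_right_mono mult_left_mono) auto
     moreover have "((1 - \<delta>)/q - \<delta>)*c*x powr (- \<beta>) = c*((1 - \<delta>)*x powr (- \<beta>))/q - (\<delta>*c)*x powr (- \<beta>)"
      by (simp add: algebra_simps diff_divide_distrib)
     moreover have "1/2^p + 3/H*(real r + real r*(2^(C*(p + 1)))^2) <= (\<delta>*c)*x powr (- \<beta>)"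
     proof (rule small)
      show "real r + real r*(2^(C*(p + 1)))^2 <= 3*(R*Xe)" using R rX RX by linarith
     qed
     ultimately have se: "s + 1/2^p + 3/H*(real r + real r*(2^(C*(p + 1)))^2) <= e"
      using s1 unfolding q_def[symmetric] by linarith
     have mue: "\<mu> j > e * sqrt (1 + \<delta>)" if j: "j < d" for j
     proof -
      have "e*q = c*(x + 3) powr (- \<beta>)" unfolding e_def using q by simp
      also have "... < c*real (j + 3) powr (- \<beta>)" using c0 j b unfolding x_def by (intro mult_strict_left_mono powr_less_mono2_neg) auto
      also have "... <= \<mu> j" using j dm by (intro mulo) auto
      finally show ?thesis by (simp only: q_def)
     qed
     have conc: "measure M {\<omega> : space M. (1 - \<delta>)*real d <= (\<Sum>j<d. (S.gaus W j \<omega>)^2) & (\<Sum>j<d. (S.gaus W j \<omega>)^2) <= (1 + \<delta>)*real d} >= 1/2"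
      by (rule d0(2)[rule_format, OF D(7) S.gaus_system[OF BM dm(1)]])
     have "(\<Sum>j<d. ln (\<mu> j/e)) - ln 2 - \<delta>*real d <= ln (real n) + real r*ln (5*H^2)"
      by (rule S.entropy_lower[OF BM \<beta>\<rho> d0' dm(1) \<delta>(1) less_imp_le[OF \<delta>(2)] conc \<alpha> H1 s e0 se mue])
     moreover have "\<beta>*LS <= (\<Sum>j<d. ln (\<mu> j/e))"
      unfolding LS_def sum_distrib_left
     proof (rule sum_mono)
      fix j assume "j : {..<d}"
      then have j: "j < d" by simp
      have "(real (d + 3)/real (j + 3)) powr \<beta> <= \<mu> j/e"
      proof -
       have "(real (d + 3)/real (j + 3)) powr \<beta> = real (j + 3) powr (- \<beta>)/(x + 3) powr (- \<beta>)"
        by (simp add: powr_divide powr_minus field_simps x_def)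
       also have "... <= \<mu> j/e"
       proof -
        have "c*real (j + 3) powr (- \<beta>)/(c*(x + 3) powr (- \<beta>)) <= \<mu> j/e"
        proof (rule frac_le)
         show "c*real (j + 3) powr (- \<beta>) <= \<mu> j" using j dm by (intro mulo) auto
         show "e <= c*(x + 3) powr (- \<beta>)" 
         proof -
          have "c*(x + 3) powr (- \<beta>)/q <= c*(x + 3) powr (- \<beta>)/1" using c0 q by (intro divide_left_mono) auto
          then show ?thesis by (simp add: e_def)
         qed
        qed (use e0 S.\<mu>_pos[of j] j dm in auto)
        then show ?thesis using c0 by simp
       qed
       finally show ?thesis .
      qed
      then have "ln ((real (d + 3)/real (j + 3)) powr \<beta>) <= ln (\<mu> j/e)" using e0 S.\<mu>_pos[of j] j dm by (intro iffD2[OF ln_le_cancel_iff]) auto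
      then show "\<beta>*ln (real (d + 3)/real (j + 3)) <= ln (\<mu> j/e)" by (simp only: ln_powr)
     qed
     ultimately show False using n' rl e3 LS' unfolding x_def[symmetric] by linarith
    qed
   qed
   define g where "g = sqrt (\<beta>/\<rho>)"
   have g: "1 <= g" "g^2 = 1 + 1/(2*\<beta> - 1)" unfolding g_def using sqrt_ratio[OF r0 \<beta>\<rho>] by auto
   have qu: "((1 - \<delta>)^2 - \<delta>)*(c*g)*x powr (- (\<beta> - 1/2)) <= quant_error M X n"
   proof (rule le_quant_error[OF n1])
    fix \<alpha> assume \<alpha>: "\<alpha> : codebooks n"
    define q where "q = nm M (%\<omega>. dist_to \<alpha> (X \<omega>))"
    define sm where "sm = 1/2^p + 3/H*(real r + sqrt 3*real r*(2^(C*(p + 1)))^2)"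
    \<comment> \<open>Explicit lower bounds for the squared modes. They decrease in j, which
      separates the indices below d from the others.\<close>
    define gg where "gg j = c^2*real (j + 3) powr (- (2*\<beta>))" for j :: nat
    have gg0: "gg j > 0" for j unfolding gg_def using c0 by simp
    have ggmono: "gg i < gg j" if "j < i" for i j unfolding gg_def using c0 b that by (intro mult_strict_left_mono powr_less_mono2_neg) auto
    have ggmu: "gg j <= (\<mu> j)^2" if "j < m" for j
    proof -
     have "(c*real (j + 3) powr (- \<beta>))^2 <= (\<mu> j)^2" using mulo[OF that] c0 by (intro power_mono) auto
     moreover have "(real (j + 3) powr (- \<beta>))^2 = real (j + 3) powr (- (2*\<beta>))" by (simp add: power2_eq_square powr_add[symmetric])
     ultimately show ?thesis unfolding gg_def by (simp only: power_mult_distrib)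
    qed
    \<comment> \<open>\<open>gg d\<close> acts as the water level: 2\<Lambda> \<open>gg j\<close>
      exceeds 1 for j < d and is at most 1 from d on.\<close>
    define \<Lambda> where "\<Lambda> = 1/(2*gg d)"
    have L0: "\<Lambda> > 0" unfolding \<Lambda>_def using gg0[of d] by simp
    have Lg: "2*(\<Lambda>*gg d) = 1" unfolding \<Lambda>_def using gg0[of d] by simp
    define w where "w j = (if j < d then 1/2 else (1 - \<delta>)*(\<Lambda>*gg j))" for j
    have Lgm: "\<Lambda>*gg j <= \<Lambda>*(\<mu> j)^2" if "j < m" for j using ggmu[OF that] L0 by (intro mult_left_mono) auto
    have Lgd: "\<Lambda>*gg d < \<Lambda>*gg j" if "j < d" for j using ggmono[OF that] L0 by (intro mult_strict_left_mono) auto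
    have Lgd': "\<Lambda>*gg j <= \<Lambda>*gg d" if "d <= j" for j
     using ggmono[of d j] that L0 by (cases "d = j") (auto intro!: mult_left_mono)
    have Lg0: "0 < \<Lambda>*gg j" for j using L0 gg0 by simp
    have dl: "(1 - \<delta>)*(\<Lambda>*gg j) < \<Lambda>*gg j" for j
    proof -
     have "0 < \<delta>*(\<Lambda>*gg j)" using \<delta> Lg0 by simp
     then show ?thesis by (simp add: left_diff_distrib)
    qed
    have w1: "w j <= 1/2" if "j < m" for j using dl[of j] Lgd'[of j] Lg by (cases "j < d") (auto simp: w_def)
    have w2: "w j < \<Lambda>*(\<mu> j)^2" if "j < m" for j
     using dl[of j] Lgm[OF that] Lgd[of j] Lg by (cases "j < d") (auto simp: w_def)
    have main: "(\<Sum>j<m. w j) - (ln (real n) + real r*ln (5*H^2)) + (\<Sum>j<m. ln (1 + 2*\<Lambda>*(\<mu> j)^2 - 2*w j))/2 <= \<Lambda>*(q + sm)^2"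
     using S.quant_lower[OF BM X \<beta>\<rho> \<alpha> H1 L0 w1 w2] unfolding q_def sm_def by (simp only: add.assoc)
    have split: "(\<Sum>j<m. f j) = (\<Sum>j<d. f j) + (\<Sum>j\<in>{d..<m}. f j)" for f :: "nat => real"
     using dm(1) by (metis (lifting) lessThan_atLeast0 sum.atLeastLessThan_concat zero_le)
    have sw: "(\<Sum>j<m. w j) = x/2 + (1 - \<delta>)*(\<Lambda>*(\<Sum>j\<in>{d..<m}. gg j))"
     unfolding split by (simp add: w_def x_def sum_distrib_left)
    have sl: "2*(\<beta>*LS) <= (\<Sum>j<m. ln (1 + 2*\<Lambda>*(\<mu> j)^2 - 2*w j))"
    proof -
     have "2*(\<beta>*LS) <= (\<Sum>j<d. ln (1 + 2*\<Lambda>*(\<mu> j)^2 - 2*w j))"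
      unfolding LS_def sum_distrib_left
     proof (rule sum_mono)
      fix j assume "j : {..<d}"
      then have j: "j < d" "j < m" using dm by auto
      have "(real (d + 3)/real (j + 3)) powr (2*\<beta>) = 2*(\<Lambda>*gg j)"
       unfolding \<Lambda>_def gg_def using c0 by (simp add: powr_divide powr_minus field_simps)
      also have "... <= 1 + 2*\<Lambda>*(\<mu> j)^2 - 2*w j" using Lgm[OF j(2)] j by (simp add: w_def)
      finally have le: "(real (d + 3)/real (j + 3)) powr (2*\<beta>) <= 1 + 2*\<Lambda>*(\<mu> j)^2 - 2*w j" .
      have "0 < (real (d + 3)/real (j + 3)) powr (2*\<beta>)" by simp
      then have "ln ((real (d + 3)/real (j + 3)) powr (2*\<beta>)) <= ln (1 + 2*\<Lambda>*(\<mu> j)^2 - 2*w j)"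
       using le by (intro iffD2[OF ln_le_cancel_iff]) (linarith+)
      then show "2*(\<beta>*ln (real (d + 3)/real (j + 3))) <= ln (1 + 2*\<Lambda>*(\<mu> j)^2 - 2*w j)" by (simp only: ln_powr mult.assoc)
     qed
     moreover have "0 <= (\<Sum>j\<in>{d..<m}. ln (1 + 2*\<Lambda>*(\<mu> j)^2 - 2*w j))"
     proof (intro sum_nonneg ln_ge_zero)
      fix j assume "j : {d..<m}"
      then have "w j < \<Lambda>*(\<mu> j)^2" by (intro w2) auto
      then show "1 <= 1 + 2*\<Lambda>*(\<mu> j)^2 - 2*w j" by simp
     qed
     ultimately show ?thesis unfolding split by linarith
    qed
    have "x/2 + (1 - \<delta>)*(\<Lambda>*(\<Sum>j\<in>{d..<m}. gg j)) <= \<Lambda>*(q + sm)^2"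
    proof -
     have "0 < ln (2::real)" "0 < \<delta>*x" using \<delta> x0 by auto
     then show ?thesis using main sl n' rl e3 LS' unfolding sw by linarith
    qed
    then have "2*gg d*(x/2 + (1 - \<delta>)*(\<Lambda>*(\<Sum>j\<in>{d..<m}. gg j))) <= 2*gg d*(\<Lambda>*(q + sm)^2)"
     using gg0[of d] by (intro mult_left_mono) auto
    moreover have "2*gg d*(\<Lambda>*Y) = Y" for Y unfolding \<Lambda>_def using gg0[of d] by simp
    moreover have "2*gg d*(x/2 + (1 - \<delta>)*(\<Lambda>*Y)) = gg d*x + (1 - \<delta>)*(2*gg d*(\<Lambda>*Y))" for Y by (simp add: algebra_simps)
    ultimately have low: "gg d*x + (1 - \<delta>)*(\<Sum>j\<in>{d..<m}. gg j) <= (q + sm)^2" by simp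
    define Q where "Q = (x + 3) powr (1 - 2*\<beta>)"
    have Q0: "Q >= 0" by (simp add: Q_def)
    have l1: "(1 - \<delta>)^2*(c^2*Q) <= gg d*x"
    proof -
     have "(x + 3) powr (1 - 2*\<beta>) = (x + 3) powr (- (2*\<beta>))*(x + 3) powr 1" unfolding powr_add[symmetric] by simp
     then have "c^2*Q = gg d*(x + 3)" unfolding Q_def gg_def xd using x0 by simp
     then have "(1 - \<delta>)^2*(c^2*Q) = gg d*((1 - \<delta>)^2*(x + 3))" by (simp only: mult_ac)
     also have "... <= gg d*x" using D(6) gg0[of d] unfolding x_def by (intro mult_left_mono) auto
     finally show ?thesis .
    qed
    have l2: "(1 - \<delta>)*(c^2*Q/(2*\<beta> - 1)) <= (\<Sum>j\<in>{d..<m}. gg j)"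
    proof -
     have "(1 - \<delta>)*Q <= real (d + 3) powr (1 - 2*\<beta>) - real (m + 3) powr (1 - 2*\<beta>)"
      using m1[OF dm(2)] unfolding Q_def xd by (simp add: algebra_simps)
     then have "(1 - \<delta>)*Q/(2*\<beta> - 1) <= (real (d + 3) powr (1 - 2*\<beta>) - real (m + 3) powr (1 - 2*\<beta>))/(2*\<beta> - 1)"
      using b by (intro divide_right_mono) auto
     also have "... <= (\<Sum>j\<in>{d..<m}. real (j + 3) powr (- (2*\<beta>)))" using b dm by (intro powr_sum_lower) auto
     finally have "c^2*((1 - \<delta>)*Q/(2*\<beta> - 1)) <= c^2*(\<Sum>j\<in>{d..<m}. real (j + 3) powr (- (2*\<beta>)))" by (intro mult_left_mono) auto
     then show ?thesis unfolding gg_def sum_distrib_left by (simp add: mult_ac)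
    qed
    define P where "P = (x + 3) powr (- (\<beta> - 1/2))"
    have P2: "P^2 = Q" unfolding P_def Q_def using x0 by (intro powr_neg_half_square) auto
    have "((1 - \<delta>)*(c*g)*P)^2 <= (q + sm)^2"
    proof -
     have "((1 - \<delta>)*(c*g)*P)^2 = (1 - \<delta>)^2*(c^2*Q) + (1 - \<delta>)*((1 - \<delta>)*(c^2*Q/(2*\<beta> - 1)))"
      unfolding power_mult_distrib P2 g(2) by (simp add: algebra_simps power2_eq_square add_divide_distrib diff_divide_distrib)
     moreover have "(1 - \<delta>)*((1 - \<delta>)*(c^2*Q/(2*\<beta> - 1))) <= (1 - \<delta>)*(\<Sum>j\<in>{d..<m}. gg j)"
      using l2 \<delta> by (intro mult_left_mono) auto
     ultimately show ?thesis using low l1 by linarith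
    qed
    moreover have qs0: "0 <= q + sm" unfolding q_def sm_def using H1 nm_nonneg[of M] by (intro add_nonneg_nonneg mult_nonneg_nonneg) auto
    ultimately have "(1 - \<delta>)*(c*g)*P <= q + sm" by (rule power2_le_imp_le)
    moreover have "(1 - \<delta>)*(c*g)*((1 - \<delta>)*x powr (- (\<beta> - 1/2))) <= (1 - \<delta>)*(c*g)*P"
     using D(5) \<delta> c0 g unfolding P_def x_def by (intro mult_left_mono) auto
    moreover have "sm <= \<delta>*(c*g)*x powr (- (\<beta> - 1/2))"
    proof -
     have s3: "sqrt 3 <= 2" by (rule real_le_lsqrt) auto
     have "sqrt 3*(real r*(2^(C*(p + 1)))^2) <= 2*(R*Xe)" by (rule mult_mono[OF s3 rX]) auto
     then have "real r + sqrt 3*real r*(2^(C*(p + 1)))^2 <= 3*(R*Xe)" using R RX unfolding mult.assoc by linarith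
     then have "sm <= (\<delta>*c)*x powr (- \<beta>)" unfolding sm_def by (rule small)
     also have "... <= ((\<delta>*c)*g)*x powr (- (\<beta> - 1/2))"
     proof (rule mult_mono)
      have "(\<delta>*c)*1 <= (\<delta>*c)*g" using g(1) \<delta> c0 by (intro mult_left_mono) auto
      then show "\<delta>*c <= \<delta>*c*g" by simp
      show "x powr (- \<beta>) <= x powr (- (\<beta> - 1/2))" using x1 by (intro powr_mono) auto
     qed (use \<delta> c0 g in auto)
     finally show ?thesis by (simp only: mult.assoc)
    qed
    moreover have "((1 - \<delta>)^2 - \<delta>)*(c*g)*x powr (- (\<beta> - 1/2)) =
      (1 - \<delta>)*(c*g)*((1 - \<delta>)*x powr (- (\<beta> - 1/2))) - \<delta>*(c*g)*x powr (- (\<beta> - 1/2))"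
     by (simp add: algebra_simps power2_eq_square)
    ultimately show "((1 - \<delta>)^2 - \<delta>)*(c*g)*x powr (- (\<beta> - 1/2)) <= nm M (%\<omega>. dist_to \<alpha> (X \<omega>))"
     unfolding q_def[symmetric] by linarith
   qed
   show "((1 - \<delta>)/sqrt (1 + \<delta>) - \<delta>)*c*real d powr (- \<beta>) <= entropy_number (U_rho \<rho>) n &
    ((1 - \<delta>)^2 - \<delta>)*(c * sqrt (\<beta>/\<rho>))*real d powr (- (\<beta> - 1/2)) <= quant_error M X n"
    using ent qu unfolding g_def x_def by blast
  qed
 qed
qed

section \<open>Passage to the limit\<close>

lemma ratio_limit:
 fixes f :: "nat => real" and lo hi :: "real => real" and k \<beta> \<gamma> :: real
 assumes k: "k > 0" and b: "\<beta> > 0" and g: "\<gamma> > 0"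
  and lo: "(lo \<longlongrightarrow> 1) (at_right 0)" and hi: "(hi \<longlongrightarrow> 1) (at_right 0)"
  and up: "\<And>\<delta>. 0 < \<delta> ==> \<delta> < 1 ==> \<forall>\<^sub>F D in at_top. \<forall>n. (\<beta> + 3*\<delta>)*D <= ln (real n) --> f n <= hi \<delta>*k*D powr (- \<gamma>)"
  and low: "\<And>\<delta>. 0 < \<delta> ==> \<delta> < 1 ==> \<forall>\<^sub>F d in sequentially. \<forall>n\<ge>1. ln (real n) <= (\<beta> - 2*\<delta>)*real d --> lo \<delta>*k*real d powr (- \<gamma>) <= f n"
 shows "((%n. f n/(k*\<beta> powr \<gamma>*ln (real n) powr (- \<gamma>))) \<longlongrightarrow> 1) sequentially"
proof (rule order_tendstoI)
 have small: "\<forall>\<^sub>F \<delta> in at_right 0. 0 < \<delta> & \<delta> < min 1 (\<beta>/2)"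
  unfolding eventually_at_right_field using b by (intro exI[of _ "min 1 (\<beta>/2)"]) auto
 have lnn: "filterlim (%n. ln (real n)) at_top sequentially" by real_asymp
 fix a :: real
 show "\<forall>\<^sub>F n in sequentially. f n/(k*\<beta> powr \<gamma>*ln (real n) powr (- \<gamma>)) < a" if a: "1 < a"
 proof -
  have "((%\<delta>. ((\<beta> + 3*\<delta>)/\<beta>) powr \<gamma>) \<longlongrightarrow> 1) (at_right 0)" using b by real_asymp
  from tendsto_mult[OF hi this] have "((%\<delta>. hi \<delta>*((\<beta> + 3*\<delta>)/\<beta>) powr \<gamma>) \<longlongrightarrow> 1) (at_right 0)" by simp
  from eventually_happens'[OF trivial_limit_at_right_real eventually_conj[OF order_tendstoD(2)[OF this a] small]]
  obtain \<delta> where d: "hi \<delta>*((\<beta> + 3*\<delta>)/\<beta>) powr \<gamma> < a" "0 < \<delta>" "\<delta> < 1"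
   by auto
  have bd: "\<beta> + 3*\<delta> > 0" using b d by simp
  \<comment> \<open>The bound is used at the largest D that the size n permits.\<close>
  have "filterlim (%n. ln (real n)/(\<beta> + 3*\<delta>)) at_top sequentially" using bd by real_asymp
  from eventually_compose_filterlim[OF up[OF d(2,3)] this] show ?thesis using eventually_gt_at_top[of 1]
  proof eventually_elim
   case (elim n)
   define T where "T = ln (real n)"
   have T: "T > 0" using elim(2) by (simp add: T_def)
   have "f n <= hi \<delta>*k*(T/(\<beta> + 3*\<delta>)) powr (- \<gamma>)" using elim(1) bd by (simp add: T_def)
   also have "(T/(\<beta> + 3*\<delta>)) powr (- \<gamma>) = (\<beta> + 3*\<delta>) powr \<gamma>*T powr (- \<gamma>)"
    using T bd by (simp add: powr_divide powr_minus field_simps)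
   also have "(\<beta> + 3*\<delta>) powr \<gamma> = ((\<beta> + 3*\<delta>)/\<beta>) powr \<gamma>*\<beta> powr \<gamma>" using b bd by (simp add: powr_divide)
   finally have "f n <= (hi \<delta>*((\<beta> + 3*\<delta>)/\<beta>) powr \<gamma>)*(k*\<beta> powr \<gamma>*T powr (- \<gamma>))" by (simp only: mult_ac)
   also have "... < a*(k*\<beta> powr \<gamma>*T powr (- \<gamma>))" using d(1) k b T by (intro mult_strict_right_mono) auto
   finally show ?case using k b T unfolding T_def[symmetric] by (subst divide_less_eq) auto
  qed
 qed
 show "\<forall>\<^sub>F n in sequentially. a < f n/(k*\<beta> powr \<gamma>*ln (real n) powr (- \<gamma>))" if a: "a < 1"
 proof -
  have "((%\<delta>. (1 - \<delta>)*((\<beta> - 2*\<delta>)/\<beta>) powr \<gamma>) \<longlongrightarrow> 1) (at_right 0)" using b by real_asymp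
  from tendsto_mult[OF lo this] have "((%\<delta>. lo \<delta>*((1 - \<delta>)*((\<beta> - 2*\<delta>)/\<beta>) powr \<gamma>)) \<longlongrightarrow> 1) (at_right 0)" by simp
  from eventually_happens'[OF trivial_limit_at_right_real
    eventually_conj[OF order_tendstoD(1)[OF this a] eventually_conj[OF order_tendstoD(1)[OF lo zero_less_one] small]]]
  obtain \<delta> where d: "a < lo \<delta>*((1 - \<delta>)*((\<beta> - 2*\<delta>)/\<beta>) powr \<gamma>)" "0 < lo \<delta>" "0 < \<delta>" "\<delta> < 1" "\<delta> < \<beta>/2"
   by auto
  define A where "A = \<beta> - 2*\<delta>"
  have A: "A > 0" using d by (simp add: A_def)
  \<comment> \<open>The least integer d that n permits. Rounding up shifts ln n / A by at most 1,
    which the factor 1 - \<delta> pays for.\<close>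
  have "filterlim (%n. nat \<lceil>ln (real n)/A\<rceil>) at_top sequentially"
  proof -
   have "filterlim (%n. ln (real n)/A) at_top sequentially" using A by real_asymp
   then have "\<forall>\<^sub>F n in sequentially. real z <= ln (real n)/A" for z by (simp add: filterlim_at_top)
   then have "\<forall>\<^sub>F n in sequentially. z <= nat \<lceil>ln (real n)/A\<rceil>" for z
   proof (rule eventually_mono)
    fix n assume "real z <= ln (real n)/A"
    then have "real z <= real (nat \<lceil>ln (real n)/A\<rceil>)" using real_nat_ceiling_ge[of "ln (real n)/A"] by linarith
    then show "z <= nat \<lceil>ln (real n)/A\<rceil>" by (simp only: of_nat_le_iff)
   qed
   then show ?thesis by (simp add: filterlim_at_top)
  qed
  note e1 = eventually_compose_filterlim[OF low[OF d(3,4), folded A_def] this]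
  have "((%n. (ln (real n)/A + 1) powr (- \<gamma>)/(ln (real n)/A) powr (- \<gamma>)) \<longlongrightarrow> 1) sequentially" using A g by real_asymp
  then have e2: "\<forall>\<^sub>F n in sequentially. 1 - \<delta> < (ln (real n)/A + 1) powr (- \<gamma>)/(ln (real n)/A) powr (- \<gamma>)" using d by (intro order_tendstoD) auto
  show ?thesis using e1 e2 eventually_gt_at_top[of 1]
  proof eventually_elim
   case (elim n)
   define T where "T = ln (real n)"
   have T: "T > 0" using elim(3) by (simp add: T_def)
   define m where "m = nat \<lceil>T/A\<rceil>"
   have TA: "T/A > 0" using T A by simp
   have m: "T/A <= real m" "real m <= T/A + 1" unfolding m_def using TA by linarith+
   have "T <= A*real m" using m(1) A by (simp add: divide_le_eq mult.commute)
   then have f: "lo \<delta>*k*real m powr (- \<gamma>) <= f n" using elim(1,3) unfolding T_def m_def by simp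
   have pw: "0 < (T/A) powr (- \<gamma>)" using T A by simp
   have "(1 - \<delta>)*(T/A) powr (- \<gamma>) <= (T/A + 1) powr (- \<gamma>)"
    using elim(2) unfolding T_def[symmetric] pos_less_divide_eq[OF pw] by linarith
   also have "... <= real m powr (- \<gamma>)" using m TA g by (intro powr_mono2') auto
   finally have h: "(1 - \<delta>)*(T/A) powr (- \<gamma>) <= real m powr (- \<gamma>)" .
   have lk: "0 <= lo \<delta>*k" using d(2) k by simp
   have "lo \<delta>*k*((1 - \<delta>)*(T/A) powr (- \<gamma>)) <= f n" by (rule order_trans[OF mult_left_mono[OF h lk] f])
   moreover have "(T/A) powr (- \<gamma>) = (A/\<beta>) powr \<gamma>*\<beta> powr \<gamma>*T powr (- \<gamma>)"
    using T A b by (simp add: powr_divide powr_minus field_simps)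
   ultimately have "(lo \<delta>*((1 - \<delta>)*(A/\<beta>) powr \<gamma>))*(k*\<beta> powr \<gamma>*T powr (- \<gamma>)) <= f n" by (simp add: mult_ac)
   moreover have "a*(k*\<beta> powr \<gamma>*T powr (- \<gamma>)) < (lo \<delta>*((1 - \<delta>)*(A/\<beta>) powr \<gamma>))*(k*\<beta> powr \<gamma>*T powr (- \<gamma>))"
    using d(1) k b T unfolding A_def by (intro mult_strict_right_mono) auto
   moreover have "0 < k*\<beta> powr \<gamma>*T powr (- \<gamma>)" using k b T by simp
   ultimately show ?case unfolding T_def[symmetric] by (subst pos_less_divide_eq) (linarith+)
  qed
 qed
qed

theorem theorem4:
  fixes \<rho> :: real and M :: "'a measure" and W :: "real \<Rightarrow> 'a \<Rightarrow> real" and X :: "'a \<Rightarrow> real \<Rightarrow> real"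
  assumes "\<rho> > 0" and "std_BM M W" and "RL_process \<rho> M W X"
  shows "((\<lambda>n. entropy_number (U_rho \<rho>) n) \<sim>[at_top]
           (\<lambda>n. ((\<rho> + 1/2) / pi) powr (\<rho> + 1/2) * Gamma (\<rho> + 1/2) * ln (real n) powr (-(\<rho> + 1/2)))) \<and>
         ((\<lambda>n. ((\<rho> + 1/2) / pi) powr (\<rho> + 1/2) * Gamma (\<rho> + 1/2) * ln (real n) powr (-(\<rho> + 1/2)))
           \<sim>[at_top] (\<lambda>n. sqrt (\<rho> / ln (real n)) * quant_error M X n))"
proof -
 define \<beta> where "\<beta> = \<rho> + 1/2"
 define c where "c = Gamma \<beta>/pi powr \<beta>"
 have b: "\<beta> > 1/2" using assms(1) by (simp add: \<beta>_def)
 have c0: "c > 0" unfolding c_def using b by (simp add: Gamma_real_pos)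
 note up = upper_bounds[OF assms(1) \<beta>_def assms(2,3), folded c_def]
 note low = lower_bounds[OF assms(1) \<beta>_def assms(2,3), folded c_def]
 have lo1: "((%\<delta>::real. (1 - \<delta>)/sqrt (1 + \<delta>) - \<delta>) \<longlongrightarrow> 1) (at_right 0)" by real_asymp
 have lo2: "((%\<delta>::real. (1 - \<delta>)^2 - \<delta>) \<longlongrightarrow> 1) (at_right 0)" by real_asymp
 have hi: "((%\<delta>::real. (1 + 3*\<delta>)*(1 + \<delta>) + \<delta>) \<longlongrightarrow> 1) (at_right 0)" by real_asymp
 define k where "k = c * sqrt (\<beta>/\<rho>)"
 have k0: "k > 0" using c0 b assms(1) by (simp add: k_def)
 have lim1: "((%n. entropy_number (U_rho \<rho>) n/(c*\<beta> powr \<beta>*ln (real n) powr (- \<beta>))) \<longlongrightarrow> 1) sequentially"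
 proof (rule ratio_limit[OF c0 _ _ lo1 hi])
  fix \<delta> :: real assume d: "0 < \<delta>" "\<delta> < 1"
  show "\<forall>\<^sub>F D in at_top. \<forall>n. (\<beta> + 3*\<delta>)*D <= ln (real n) --> entropy_number (U_rho \<rho>) n <= ((1 + 3*\<delta>)*(1 + \<delta>) + \<delta>)*c*D powr (- \<beta>)"
   using up[OF d(1) less_imp_le[OF d(2)]] by eventually_elim (blast)
  show "\<forall>\<^sub>F d in sequentially. \<forall>n\<ge>1. ln (real n) <= (\<beta> - 2*\<delta>)*real d --> ((1 - \<delta>)/sqrt (1 + \<delta>) - \<delta>)*c*real d powr (- \<beta>) <= entropy_number (U_rho \<rho>) n"
   using low[OF d] by eventually_elim (blast)
 qed (use b in auto)
 have lim2: "((%n. quant_error M X n/(k*\<beta> powr (\<beta> - 1/2)*ln (real n) powr (- (\<beta> - 1/2)))) \<longlongrightarrow> 1) sequentially"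
 proof (rule ratio_limit[OF k0 _ _ lo2 hi])
  fix \<delta> :: real assume d: "0 < \<delta>" "\<delta> < 1"
  show "\<forall>\<^sub>F D in at_top. \<forall>n. (\<beta> + 3*\<delta>)*D <= ln (real n) --> quant_error M X n <= ((1 + 3*\<delta>)*(1 + \<delta>) + \<delta>)*k*D powr (- (\<beta> - 1/2))"
   using up[OF d(1) less_imp_le[OF d(2)]] unfolding k_def by eventually_elim (blast)
  show "\<forall>\<^sub>F d in sequentially. \<forall>n\<ge>1. ln (real n) <= (\<beta> - 2*\<delta>)*real d --> ((1 - \<delta>)^2 - \<delta>)*k*real d powr (- (\<beta> - 1/2)) <= quant_error M X n"
   using low[OF d] unfolding k_def by eventually_elim (blast)
 qed (use b in auto)
 let ?T = "%n. (\<beta>/pi) powr \<beta>*Gamma \<beta>*ln (real n) powr (- \<beta>)"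
 have T: "?T n = c*\<beta> powr \<beta>*ln (real n) powr (- \<beta>)" for n
  using b by (simp add: c_def powr_divide)
 \<comment> \<open>\<open>sqrt (\<rho>/ln (real n))\<close> supplies the missing half power of the
   logarithm, and its \<rho> cancels the one in \<open>k = c * sqrt (\<beta>/\<rho>)\<close>; the
   remaining \<open>sqrt \<beta>\<close> completes \<open>\<beta> powr \<beta>\<close>.\<close>
 have T2: "\<forall>\<^sub>F n in sequentially. sqrt (\<rho>/ln (real n))*quant_error M X n/?T n = quant_error M X n/(k*\<beta> powr (\<beta> - 1/2)*ln (real n) powr (- (\<beta> - 1/2)))"
  using eventually_gt_at_top[of 1]
 proof eventually_elim
  case (elim n)
  define t where "t = ln (real n)"
  have t: "t > 0" using elim by (simp add: t_def)
  have b0: "\<beta> > 0" using b by simp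
  have e1: "\<beta> powr \<beta> = \<beta> powr (\<beta> - 1/2) * sqrt \<beta>" using b0 by (simp add: powr_half_sqrt[symmetric] powr_add[symmetric])
  have e2: "t powr (- \<beta>) * sqrt t = t powr (- (\<beta> - 1/2))" using t by (simp add: powr_half_sqrt[symmetric] powr_add[symmetric])
  have e3: "sqrt (\<beta>/\<rho>) * sqrt (\<rho>/t) = sqrt \<beta>/sqrt t" using b0 t assms(1) by (simp add: real_sqrt_mult[symmetric] real_sqrt_divide[symmetric])
  have "sqrt (\<rho>/t)*(k*\<beta> powr (\<beta> - 1/2)*t powr (- (\<beta> - 1/2))) =
    c*(sqrt (\<beta>/\<rho>) * sqrt (\<rho>/t))*\<beta> powr (\<beta> - 1/2)*(t powr (- \<beta>) * sqrt t)"
   unfolding e2 k_def by (simp only: mult_ac)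
  also have "... = c*(\<beta> powr (\<beta> - 1/2) * sqrt \<beta>)*t powr (- \<beta>)" unfolding e3 using t by simp
  finally have e: "c*\<beta> powr \<beta>*t powr (- \<beta>) = sqrt (\<rho>/t)*(k*\<beta> powr (\<beta> - 1/2)*t powr (- (\<beta> - 1/2)))"
   unfolding e1[symmetric] by (rule sym)
  have "sqrt (\<rho>/t) ~= 0" using assms(1) t by simp
  then show ?case unfolding T unfolding t_def[symmetric] e by (rule mult_divide_mult_cancel_left)
 qed
 have "(%n. entropy_number (U_rho \<rho>) n) \<sim>[at_top] ?T"
  by (rule asymp_equivI') (use lim1 in \<open>simp only: T\<close>)
 moreover have "(%n. sqrt (\<rho>/ln (real n))*quant_error M X n) \<sim>[at_top] ?T"
  by (rule asymp_equivI') (use lim2 T2 in \<open>simp add: tendsto_cong\<close>)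
 ultimately show ?thesis unfolding \<beta>_def by (blast intro: asymp_equiv_symI)
qed

end
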